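(* Suppose $\text{E-HA}^{\omega*}_{\mathrm{st}\lor} + \mathsf{OS}^*_\lor + \mathsf{US}^*_\lor + \mathsf{NU} + \mathsf{AC}^{\mathrm{st}} + \mathsf{IP}_{\forall \, \lor}^{\mathrm{st}} + \Delta_\lor \vdash \Phi(\underline{a})$, where $\Delta_\lor$ is a set of internal, $\lor$-free sentences. Let $\Phi(\underline{a})^U = \exists^{\mathrm{st}} \underline{x}\,\forall^{\mathrm{st}} \underline{y} \, \varphi_U(\underline{x},\underline{y},\underline{a})$. Then from the proof one can extract a tuple of closed terms $\underline{t}$ such that $\text{E-HA}^{\omega*}_\lor + \Delta_\lor \vdash \forall \underline{y} \, \varphi_U(\underline{t}, \underline{y}, \underline{a})$.
   Context: $\text{E-HA}^{\omega*}$ is extensional Heyting arithmetic in all finite types over the types generated by $0$, $\sigma\to\tau$ and $\sigma^*$ (finite sequences), with constants for the empty sequence $\langle\rangle$, prepending $C$, a list recursor, and the axiom that every sequence is empty or a prepend; $\langle x\rangle$ is the one-element sequence, $a\in s :\equiv \exists i<|s|\,(a=s_i)$, $s'\subseteq s :\equiv\forall x(x\in s'\to x\in s)$. $\text{E-HA}^{\omega*}_{\mathrm{st}}$ adds predicates $\mathrm{st}_\sigma$ and external quantifiers $\forall^{\mathrm{st}}x\,\Phi :\leftrightarrow \forall x(\mathrm{st}(x)\to\Phi)$, $\exists^{\mathrm{st}}x\,\Phi :\leftrightarrow \exists x(\mathrm{st}(x)\land\Phi)$; internal formulae (lowercase Greek) are those not containing $\mathrm{st}$. Axioms: those of $\text{E-HA}^{\omega*}$,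 $\mathrm{st}(x)\land x=y\to\mathrm{st}(y)$, $\mathrm{st}(a)$ for closed terms $a$, $\mathrm{st}(f)\land\mathrm{st}(x)\to\mathrm{st}(fx)$, and external induction for all formulae. $\text{E-HA}^{\omega*}_\lor$ and $\text{E-HA}^{\omega*}_{\mathrm{st}\lor}$ are $\text{E-HA}^{\omega*}$ and $\text{E-HA}^{\omega*}_{\mathrm{st}}$ with the internal induction schema restricted to internal $\lor$-free formulae. $\mathrm{hyper}(s):=\forall^{\mathrm{st}}x\,(x\in s)$. Principles (all types; $\varphi$ internal and $\lor$-free; $\Phi,\Psi$ arbitrary): $\mathsf{OS}^*_\lor$: $\forall^{\mathrm{st}}s:\sigma^*\,\varphi(s)\to\exists s:\sigma^*(\mathrm{hyper}(s)\land\varphi(s))$; $\mathsf{US}^*_\lor$: $\forall s:\sigma^*(\mathrm{hyper}(s)\to\varphi(s))\to\exists^{\mathrm{st}}s\,\varphi(s)$; $\mathsf{NU}$: $\forall y\,\exists^{\mathrm{st}}x\,\Phi(x,y)\to\exists^{\mathrm{st}}x\,\forall y\,\Phi(x,y)$; $\mathsf{AC}^{\mathrm{st}}$: $\forall^{\mathrm{st}}x:\sigma\,\exists^{\mathrm{st}}y:\tau\,\Phi(x,y)\to\exists^{\mathrm{st}}f:\sigma\to\tau\,\forall^{\mathrm{st}}x\,\Phi(x,fx)$; $\mathsf{IP}^{\mathrm{st}}_{\forall\lor}$: $(\forall^{\mathrm{st}}x\,\varphi(x)\to\exists^{\mathrm{st}}y\,\Psi(y))\to\exists^{\mathrm{st}}y(\forall^{\mathrm{st}}x\,\varphi(x)\to\Psi(y))$.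 The uniform Diller-Nahm translation assigns to each formula $\Phi(\underline{a})$ a formula $\exists^{\mathrm{st}}\underline{x}\,\forall^{\mathrm{st}}\underline{y}\,\varphi_U(\underline{x},\underline{y},\underline{a})$ with $\varphi_U$ internal and $\lor$-free (tuples of variables underlined), inductively: $\varphi^U:=\varphi$ for internal atomic $\varphi$; $\mathrm{st}_\sigma(x)^U:=\exists^{\mathrm{st}}y:\sigma\,(y=x)$; and if $\Phi^U=\exists^{\mathrm{st}}\underline{x}\forall^{\mathrm{st}}\underline{y}\,\varphi_U(\underline{x},\underline{y},\underline{a})$, $\Psi^U=\exists^{\mathrm{st}}\underline{u}\forall^{\mathrm{st}}\underline{v}\,\psi_U(\underline{u},\underline{v},\underline{b})$: $(\Phi\land\Psi)^U:=\exists^{\mathrm{st}}\underline{x},\underline{u}\,\forall^{\mathrm{st}}\underline{y},\underline{v}(\varphi_U\land\psi_U)$; $(\Phi\lor\Psi)^U:=\exists^{\mathrm{st}}z{:}0,\underline{x},\underline{u}\,\forall^{\mathrm{st}}\underline{y},\underline{v}\,\big((z=0\to\varphi_U(\underline{x},\underline{y},\underline{a}))\land(\neg z=0\to\psi_U(\underline{u},\underline{v},\underline{b}))\big)$; $(\Phi\to\Psi)^U:=\exists^{\mathrm{st}}\underline{U},\underline{Y}\,\forall^{\mathrm{st}}\underline{x},\underline{v}\,\big(\forall\underline{y}\in\underline{Y}\underline{x}\underline{v}\,\varphi_U(\underline{x},\underline{y},\underline{a})\to\psi_U(\underline{U}\underline{x},\underline{v},\underline{b})\big)$ (the $\underline{Y}\underline{x}\underline{v}$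 are finite sequences); $(\exists z\,\Phi(z))^U:=\exists^{\mathrm{st}}\underline{x}\,\forall^{\mathrm{st}}\underline{y}\,\exists z\,\forall\underline{y}'\in\underline{y}\,\varphi_U(\underline{x},\underline{y}',z,\underline{a})$ (here $\underline{y}$ ranges over sequences); $(\forall z\,\Phi(z))^U:=\exists^{\mathrm{st}}\underline{x}\,\forall^{\mathrm{st}}\underline{y}\,\forall z\,\varphi_U(\underline{x},\underline{y},z,\underline{a})$; $(\exists^{\mathrm{st}}z\,\Phi(z))^U:=\exists^{\mathrm{st}}z,\underline{x}\,\forall^{\mathrm{st}}\underline{y}\,\varphi_U(\underline{x},\underline{y},z,\underline{a})$; $(\forall^{\mathrm{st}}z\,\Phi(z))^U:=\exists^{\mathrm{st}}\underline{X}\,\forall^{\mathrm{st}}\underline{y},z\,\varphi_U(\underline{X}z,\underline{y},z,\underline{a})$.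
   Formalization: The axiom that every sequence is empty or a prepend is taken in the ∨-free form ∃n((n=0→s=⟨⟩)∧(¬n=0→∃a,s' s=C a s')), since with a literal ∨ it is inconsistent with NU; "one can extract" is stated as existence of the closed terms. *)

theory Defs
  imports Main
begin

section \<open>Types and terms\<close>

datatype ty =
    N
  | Fn ty ty  (infixr "\<^bold>\<rightarrow>" 65)
  | Seq ty

text \<open>\<open>Rec \<sigma>s i\<close> is the \<open>i\<close>-th component of the simultaneous recursor for the tuple of types
  \<open>\<sigma>s\<close>, the usual primitive when there are no product types; \<open>Rec [\<sigma>] 0\<close> is the ordinary
  recursor.\<close>

datatype cst =
    Zero
  | Succ
  | CombK ty ty
  | CombS ty ty ty
  | Rec "ty list" nat
  | Empty ty
  | Prep ty
  | LRec ty ty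

text \<open>Variables are de Bruijn indices, typed by a context \<open>\<Gamma>\<close> in which index \<open>i\<close> has type \<open>\<Gamma> ! i\<close>.\<close>

datatype tm =
    Var nat
  | Cst cst
  | App tm tm  (infixl "\<^bold>\<cdot>" 75)

definition arrs :: "ty list \<Rightarrow> ty \<Rightarrow> ty" where
  "arrs \<sigma>s \<tau> = foldr Fn \<sigma>s \<tau>"

definition apps :: "tm \<Rightarrow> tm list \<Rightarrow> tm" where
  "apps t ts = foldl App t ts"

inductive cst_ty :: "cst \<Rightarrow> ty \<Rightarrow> bool" where
  "cst_ty Zero N"
| "cst_ty Succ (N \<^bold>\<rightarrow> N)"
| "cst_ty (CombK \<sigma> \<tau>) (\<sigma> \<^bold>\<rightarrow> \<tau> \<^bold>\<rightarrow> \<sigma>)"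
| "cst_ty (CombS \<rho> \<sigma> \<tau>) ((\<rho> \<^bold>\<rightarrow> \<sigma> \<^bold>\<rightarrow> \<tau>) \<^bold>\<rightarrow> (\<rho> \<^bold>\<rightarrow> \<sigma>) \<^bold>\<rightarrow> \<rho> \<^bold>\<rightarrow> \<tau>)"
| "i < length \<sigma>s \<Longrightarrow>
   cst_ty (Rec \<sigma>s i) (arrs (\<sigma>s @ map (\<lambda>\<tau>. N \<^bold>\<rightarrow> arrs \<sigma>s \<tau>) \<sigma>s) (N \<^bold>\<rightarrow> \<sigma>s ! i))"
| "cst_ty (Empty \<sigma>) (Seq \<sigma>)"
| "cst_ty (Prep \<sigma>) (\<sigma> \<^bold>\<rightarrow> Seq \<sigma> \<^bold>\<rightarrow> Seq \<sigma>)"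
| "cst_ty (LRec \<sigma> \<rho>) (\<rho> \<^bold>\<rightarrow> (\<sigma> \<^bold>\<rightarrow> Seq \<sigma> \<^bold>\<rightarrow> \<rho> \<^bold>\<rightarrow> \<rho>) \<^bold>\<rightarrow> Seq \<sigma> \<^bold>\<rightarrow> \<rho>)"

inductive has_ty :: "ty list \<Rightarrow> tm \<Rightarrow> ty \<Rightarrow> bool" where
  "i < length \<Gamma> \<Longrightarrow> has_ty \<Gamma> (Var i) (\<Gamma> ! i)"
| "cst_ty c \<sigma> \<Longrightarrow> has_ty \<Gamma> (Cst c) \<sigma>"
| "has_ty \<Gamma> f (\<sigma> \<^bold>\<rightarrow> \<tau>) \<Longrightarrow> has_ty \<Gamma> t \<sigma> \<Longrightarrow> has_ty \<Gamma> (f \<^bold>\<cdot> t) \<tau>"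

primrec tsubst :: "(nat \<Rightarrow> tm) \<Rightarrow> tm \<Rightarrow> tm" where
  "tsubst \<theta> (Var i) = \<theta> i"
| "tsubst \<theta> (Cst c) = Cst c"
| "tsubst \<theta> (f \<^bold>\<cdot> t) = tsubst \<theta> f \<^bold>\<cdot> tsubst \<theta> t"

definition tlift :: "nat \<Rightarrow> tm \<Rightarrow> tm" where
  "tlift n = tsubst (\<lambda>i. Var (i + n))"

definition up :: "(nat \<Rightarrow> tm) \<Rightarrow> nat \<Rightarrow> tm" where
  "up \<theta> = case_nat (Var 0) (\<lambda>i. tlift 1 (\<theta> i))"

text \<open>The variables bound by a block of \<open>n\<close> quantifiers, outermost first.\<close>

definition vars :: "nat \<Rightarrow> tm list" where
  "vars n = map Var (rev [0..<n])"

abbreviation zero :: tm where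
  "zero \<equiv> Cst Zero"

abbreviation suc :: "tm \<Rightarrow> tm" where
  "suc t \<equiv> Cst Succ \<^bold>\<cdot> t"

definition plus_tm :: "tm \<Rightarrow> tm \<Rightarrow> tm" where
  "plus_tm m n = Cst (Rec [N] 0) \<^bold>\<cdot> m \<^bold>\<cdot> (Cst (CombK (N \<^bold>\<rightarrow> N) N) \<^bold>\<cdot> Cst Succ) \<^bold>\<cdot> n"

primrec null_tm :: "ty \<Rightarrow> tm" where
  "null_tm N = zero"
| "null_tm (\<sigma> \<^bold>\<rightarrow> \<tau>) = Cst (CombK \<tau> \<sigma>) \<^bold>\<cdot> null_tm \<tau>"
| "null_tm (Seq \<sigma>) = Cst (Empty \<sigma>)"

text \<open>\<open>|s|\<close> is recursion with step \<open>\<lambda>a s' n. S n\<close>; the head and the tail are recursions with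
  steps \<open>\<lambda>a s' r. a\<close> and \<open>\<lambda>a s' r. s'\<close>; and \<open>s\<^sub>i\<close> is the head of the \<open>i\<close>-th iterated tail
  (so it is \<open>null_tm \<sigma>\<close> for \<open>i \<ge> |s|\<close>).\<close>

definition len_tm :: "ty \<Rightarrow> tm \<Rightarrow> tm" where
  "len_tm \<sigma> s =
    Cst (LRec \<sigma> N) \<^bold>\<cdot> zero \<^bold>\<cdot>
      (Cst (CombK (Seq \<sigma> \<^bold>\<rightarrow> N \<^bold>\<rightarrow> N) \<sigma>) \<^bold>\<cdot> (Cst (CombK (N \<^bold>\<rightarrow> N) (Seq \<sigma>)) \<^bold>\<cdot> Cst Succ)) \<^bold>\<cdot> s"

definition head_tm :: "ty \<Rightarrow> tm \<Rightarrow> tm" where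
  "head_tm \<sigma> s =
    Cst (LRec \<sigma> \<sigma>) \<^bold>\<cdot> null_tm \<sigma> \<^bold>\<cdot>
      (Cst (CombS \<sigma> (\<sigma> \<^bold>\<rightarrow> \<sigma>) (Seq \<sigma> \<^bold>\<rightarrow> \<sigma> \<^bold>\<rightarrow> \<sigma>)) \<^bold>\<cdot>
        (Cst (CombK ((\<sigma> \<^bold>\<rightarrow> \<sigma>) \<^bold>\<rightarrow> Seq \<sigma> \<^bold>\<rightarrow> \<sigma> \<^bold>\<rightarrow> \<sigma>) \<sigma>) \<^bold>\<cdot> Cst (CombK (\<sigma> \<^bold>\<rightarrow> \<sigma>) (Seq \<sigma>))) \<^bold>\<cdot>
        Cst (CombK \<sigma> \<sigma>)) \<^bold>\<cdot> s"

definition tail_fn :: "ty \<Rightarrow> tm" where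
  "tail_fn \<sigma> =
    Cst (LRec \<sigma> (Seq \<sigma>)) \<^bold>\<cdot> Cst (Empty \<sigma>) \<^bold>\<cdot>
      (Cst (CombK (Seq \<sigma> \<^bold>\<rightarrow> Seq \<sigma> \<^bold>\<rightarrow> Seq \<sigma>) \<sigma>) \<^bold>\<cdot> Cst (CombK (Seq \<sigma>) (Seq \<sigma>)))"

definition nth_tm :: "ty \<Rightarrow> tm \<Rightarrow> tm \<Rightarrow> tm" where
  "nth_tm \<sigma> s i =
    head_tm \<sigma> (Cst (Rec [Seq \<sigma>] 0) \<^bold>\<cdot> s \<^bold>\<cdot> (Cst (CombK (Seq \<sigma> \<^bold>\<rightarrow> Seq \<sigma>) N) \<^bold>\<cdot> tail_fn \<sigma>) \<^bold>\<cdot> i)"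

section \<open>Formulae\<close>

datatype fm =
    Bot
  | Eq ty tm tm
  | St ty tm
  | And fm fm
  | Or fm fm
  | Imp fm fm
  | All ty fm
  | Ex ty fm
  | AllSt ty fm
  | ExSt ty fm

abbreviation Neg :: "fm \<Rightarrow> fm" where
  "Neg \<phi> \<equiv> Imp \<phi> Bot"

primrec wff :: "ty list \<Rightarrow> fm \<Rightarrow> bool" where
  "wff \<Gamma> Bot = True"
| "wff \<Gamma> (Eq \<sigma> t u) = (has_ty \<Gamma> t \<sigma> \<and> has_ty \<Gamma> u \<sigma>)"
| "wff \<Gamma> (St \<sigma> t) = has_ty \<Gamma> t \<sigma>"
| "wff \<Gamma> (And \<phi> \<psi>) = (wff \<Gamma> \<phi> \<and> wff \<Gamma> \<psi>)"
| "wff \<Gamma> (Or \<phi> \<psi>) = (wff \<Gamma> \<phi> \<and> wff \<Gamma> \<psi>)"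
| "wff \<Gamma> (Imp \<phi> \<psi>) = (wff \<Gamma> \<phi> \<and> wff \<Gamma> \<psi>)"
| "wff \<Gamma> (All \<sigma> \<phi>) = wff (\<sigma> # \<Gamma>) \<phi>"
| "wff \<Gamma> (Ex \<sigma> \<phi>) = wff (\<sigma> # \<Gamma>) \<phi>"
| "wff \<Gamma> (AllSt \<sigma> \<phi>) = wff (\<sigma> # \<Gamma>) \<phi>"
| "wff \<Gamma> (ExSt \<sigma> \<phi>) = wff (\<sigma> # \<Gamma>) \<phi>"

abbreviation sentence :: "fm \<Rightarrow> bool" where
  "sentence \<equiv> wff []"

primrec internal :: "fm \<Rightarrow> bool" where
  "internal Bot = True"
| "internal (Eq \<sigma> t u) = True"
| "internal (St \<sigma> t) = False"
| "internal (And \<phi> \<psi>) = (internal \<phi> \<and> internal \<psi>)"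
| "internal (Or \<phi> \<psi>) = (internal \<phi> \<and> internal \<psi>)"
| "internal (Imp \<phi> \<psi>) = (internal \<phi> \<and> internal \<psi>)"
| "internal (All \<sigma> \<phi>) = internal \<phi>"
| "internal (Ex \<sigma> \<phi>) = internal \<phi>"
| "internal (AllSt \<sigma> \<phi>) = False"
| "internal (ExSt \<sigma> \<phi>) = False"

primrec or_free :: "fm \<Rightarrow> bool" where
  "or_free Bot = True"
| "or_free (Eq \<sigma> t u) = True"
| "or_free (St \<sigma> t) = True"
| "or_free (And \<phi> \<psi>) = (or_free \<phi> \<and> or_free \<psi>)"
| "or_free (Or \<phi> \<psi>) = False"
| "or_free (Imp \<phi> \<psi>) = (or_free \<phi> \<and> or_free \<psi>)"
| "or_free (All \<sigma> \<phi>) = or_free \<phi>"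
| "or_free (Ex \<sigma> \<phi>) = or_free \<phi>"
| "or_free (AllSt \<sigma> \<phi>) = or_free \<phi>"
| "or_free (ExSt \<sigma> \<phi>) = or_free \<phi>"

primrec fsubst :: "(nat \<Rightarrow> tm) \<Rightarrow> fm \<Rightarrow> fm" where
  "fsubst \<theta> Bot = Bot"
| "fsubst \<theta> (Eq \<sigma> t u) = Eq \<sigma> (tsubst \<theta> t) (tsubst \<theta> u)"
| "fsubst \<theta> (St \<sigma> t) = St \<sigma> (tsubst \<theta> t)"
| "fsubst \<theta> (And \<phi> \<psi>) = And (fsubst \<theta> \<phi>) (fsubst \<theta> \<psi>)"
| "fsubst \<theta> (Or \<phi> \<psi>) = Or (fsubst \<theta> \<phi>) (fsubst \<theta> \<psi>)"
| "fsubst \<theta> (Imp \<phi> \<psi>) = Imp (fsubst \<theta> \<phi>) (fsubst \<theta> \<psi>)"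
| "fsubst \<theta> (All \<sigma> \<phi>) = All \<sigma> (fsubst (up \<theta>) \<phi>)"
| "fsubst \<theta> (Ex \<sigma> \<phi>) = Ex \<sigma> (fsubst (up \<theta>) \<phi>)"
| "fsubst \<theta> (AllSt \<sigma> \<phi>) = AllSt \<sigma> (fsubst (up \<theta>) \<phi>)"
| "fsubst \<theta> (ExSt \<sigma> \<phi>) = ExSt \<sigma> (fsubst (up \<theta>) \<phi>)"

definition flift :: "fm \<Rightarrow> fm" where
  "flift = fsubst (\<lambda>i. Var (Suc i))"

definition finst :: "tm \<Rightarrow> fm \<Rightarrow> fm" where
  "finst t = fsubst (case_nat t Var)"

text \<open>\<open>\<phi>(S n)\<close>, where \<open>n\<close> is variable 0 and stays free.\<close>

definition fsucc :: "fm \<Rightarrow> fm" where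
  "fsucc = fsubst (case_nat (suc (Var 0)) (\<lambda>i. Var (Suc i)))"

definition Alls :: "ty list \<Rightarrow> fm \<Rightarrow> fm" where
  "Alls \<sigma>s \<phi> = foldr All \<sigma>s \<phi>"

definition Less :: "tm \<Rightarrow> tm \<Rightarrow> fm" where
  "Less m n = Ex N (Eq N (plus_tm (tlift 1 m) (suc (Var 0))) (tlift 1 n))"

definition Mem :: "ty \<Rightarrow> tm \<Rightarrow> tm \<Rightarrow> fm" where
  "Mem \<sigma> a s = Ex N (And (Less (Var 0) (len_tm \<sigma> (tlift 1 s)))
                         (Eq \<sigma> (tlift 1 a) (nth_tm \<sigma> (tlift 1 s) (Var 0))))"

text \<open>\<open>\<forall>y\<^sub>1\<in>s\<^sub>1 \<dots> \<forall>y\<^sub>n\<in>s\<^sub>n \<phi>\<close>; the matrix \<open>\<phi>\<close> lives under the \<open>n\<close> binders, the \<open>s\<^sub>i\<close> do not.\<close>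

fun BAlls :: "ty list \<Rightarrow> tm list \<Rightarrow> fm \<Rightarrow> fm" where
  "BAlls (\<tau> # \<tau>s) (s # ss) \<phi> =
     All \<tau> (Imp (Mem \<tau> (Var 0) (tlift 1 s)) (BAlls \<tau>s (map (tlift 1) ss) \<phi>))"
| "BAlls _ _ \<phi> = \<phi>"

definition hyper :: "ty \<Rightarrow> tm \<Rightarrow> fm" where
  "hyper \<sigma> s = AllSt \<sigma> (Mem \<sigma> (Var 0) (tlift 1 s))"

section \<open>Intuitionistic predicate logic\<close>

text \<open>\<open>prv L Ax \<Gamma> H \<phi>\<close>: natural deduction over the language \<open>L\<close> with axioms \<open>Ax\<close>, free variables
  declared in \<open>\<Gamma>\<close> and open assumptions \<open>H\<close>. Since \<open>Ax\<close> collects instances of schemata for all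
  contexts, well-formedness in \<open>\<Gamma>\<close> is checked when an axiom is used.\<close>

inductive prv :: "fm set \<Rightarrow> fm set \<Rightarrow> ty list \<Rightarrow> fm list \<Rightarrow> fm \<Rightarrow> bool"
  for L :: "fm set" and Ax :: "fm set" where
  ax: "\<phi> \<in> Ax \<Longrightarrow> \<phi> \<in> L \<Longrightarrow> wff \<Gamma> \<phi> \<Longrightarrow> prv L Ax \<Gamma> H \<phi>"
| hyp: "\<phi> \<in> set H \<Longrightarrow> prv L Ax \<Gamma> H \<phi>"
| botE: "prv L Ax \<Gamma> H Bot \<Longrightarrow> \<phi> \<in> L \<Longrightarrow> wff \<Gamma> \<phi> \<Longrightarrow> prv L Ax \<Gamma> H \<phi>"
| andI: "prv L Ax \<Gamma> H \<phi> \<Longrightarrow> prv L Ax \<Gamma> H \<psi> \<Longrightarrow> prv L Ax \<Gamma> H (And \<phi> \<psi>)"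
| andE1: "prv L Ax \<Gamma> H (And \<phi> \<psi>) \<Longrightarrow> prv L Ax \<Gamma> H \<phi>"
| andE2: "prv L Ax \<Gamma> H (And \<phi> \<psi>) \<Longrightarrow> prv L Ax \<Gamma> H \<psi>"
| orI1: "prv L Ax \<Gamma> H \<phi> \<Longrightarrow> \<psi> \<in> L \<Longrightarrow> wff \<Gamma> \<psi> \<Longrightarrow> prv L Ax \<Gamma> H (Or \<phi> \<psi>)"
| orI2: "prv L Ax \<Gamma> H \<psi> \<Longrightarrow> \<phi> \<in> L \<Longrightarrow> wff \<Gamma> \<phi> \<Longrightarrow> prv L Ax \<Gamma> H (Or \<phi> \<psi>)"
| orE: "prv L Ax \<Gamma> H (Or \<phi> \<psi>) \<Longrightarrow> prv L Ax \<Gamma> (\<phi> # H) \<chi> \<Longrightarrow> prv L Ax \<Gamma> (\<psi> # H) \<chi> \<Longrightarrow>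
    prv L Ax \<Gamma> H \<chi>"
| impI: "\<phi> \<in> L \<Longrightarrow> wff \<Gamma> \<phi> \<Longrightarrow> prv L Ax \<Gamma> (\<phi> # H) \<psi> \<Longrightarrow> prv L Ax \<Gamma> H (Imp \<phi> \<psi>)"
| impE: "prv L Ax \<Gamma> H (Imp \<phi> \<psi>) \<Longrightarrow> prv L Ax \<Gamma> H \<phi> \<Longrightarrow> prv L Ax \<Gamma> H \<psi>"
| allI: "prv L Ax (\<sigma> # \<Gamma>) (map flift H) \<phi> \<Longrightarrow> prv L Ax \<Gamma> H (All \<sigma> \<phi>)"
| allE: "prv L Ax \<Gamma> H (All \<sigma> \<phi>) \<Longrightarrow> has_ty \<Gamma> t \<sigma> \<Longrightarrow> prv L Ax \<Gamma> H (finst t \<phi>)"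
| exI: "Ex \<sigma> \<phi> \<in> L \<Longrightarrow> wff \<Gamma> (Ex \<sigma> \<phi>) \<Longrightarrow> has_ty \<Gamma> t \<sigma> \<Longrightarrow> prv L Ax \<Gamma> H (finst t \<phi>) \<Longrightarrow>
    prv L Ax \<Gamma> H (Ex \<sigma> \<phi>)"
| exE: "prv L Ax \<Gamma> H (Ex \<sigma> \<phi>) \<Longrightarrow> prv L Ax (\<sigma> # \<Gamma>) (\<phi> # map flift H) (flift \<chi>) \<Longrightarrow>
    prv L Ax \<Gamma> H \<chi>"

section \<open>The theories\<close>

text \<open>Axioms of E-HA\<omega>*\<or>. In \<open>seq_cases\<close>, ``empty or a prepend'' is stated
  with the \<open>\<or>\<close>-free arithmetical rendering
  \<open>\<exists>n ((n = 0 \<longrightarrow> A) \<and> (\<not> n = 0 \<longrightarrow> B))\<close> of disjunction, as is appropriate for the \<open>\<or>\<close>-free setting: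
  with a literal internal \<open>\<or>\<close>, the principle NU would yield a single standard \<open>n\<close>
  deciding emptiness for all sequences at once, a contradiction.\<close>

inductive_set EHA_or_ax :: "fm set" where
  eq_refl: "Eq \<sigma> t t \<in> EHA_or_ax"
| eq_sym: "Imp (Eq \<sigma> t u) (Eq \<sigma> u t) \<in> EHA_or_ax"
| eq_trans: "Imp (And (Eq \<sigma> t u) (Eq \<sigma> u v)) (Eq \<sigma> t v) \<in> EHA_or_ax"
| eq_app: "Imp (And (Eq (\<sigma> \<^bold>\<rightarrow> \<tau>) f g) (Eq \<sigma> t u)) (Eq \<tau> (f \<^bold>\<cdot> t) (g \<^bold>\<cdot> u)) \<in> EHA_or_ax"
| extensionality:
    "Imp (All \<sigma> (Eq \<tau> (tlift 1 f \<^bold>\<cdot> Var 0) (tlift 1 g \<^bold>\<cdot> Var 0))) (Eq (\<sigma> \<^bold>\<rightarrow> \<tau>) f g) \<in> EHA_or_ax"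
| suc_not_zero: "Neg (Eq N (suc t) zero) \<in> EHA_or_ax"
| suc_inject: "Imp (Eq N (suc t) (suc u)) (Eq N t u) \<in> EHA_or_ax"
| comb_k: "Eq \<sigma> (Cst (CombK \<sigma> \<tau>) \<^bold>\<cdot> t \<^bold>\<cdot> u) t \<in> EHA_or_ax"
| comb_s: "Eq \<tau> (Cst (CombS \<rho> \<sigma> \<tau>) \<^bold>\<cdot> t \<^bold>\<cdot> u \<^bold>\<cdot> v) (t \<^bold>\<cdot> v \<^bold>\<cdot> (u \<^bold>\<cdot> v)) \<in> EHA_or_ax"
| rec_zero: "length ts = length \<sigma>s \<Longrightarrow> length us = length \<sigma>s \<Longrightarrow> i < length \<sigma>s \<Longrightarrow>
    Eq (\<sigma>s ! i) (apps (Cst (Rec \<sigma>s i)) (ts @ us) \<^bold>\<cdot> zero) (ts ! i) \<in> EHA_or_ax"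
| rec_suc: "length ts = length \<sigma>s \<Longrightarrow> length us = length \<sigma>s \<Longrightarrow> i < length \<sigma>s \<Longrightarrow>
    Eq (\<sigma>s ! i) (apps (Cst (Rec \<sigma>s i)) (ts @ us) \<^bold>\<cdot> suc v)
       (apps (us ! i \<^bold>\<cdot> v)
          (map (\<lambda>j. apps (Cst (Rec \<sigma>s j)) (ts @ us) \<^bold>\<cdot> v) [0..<length \<sigma>s])) \<in> EHA_or_ax"
| lrec_empty: "Eq \<rho> (Cst (LRec \<sigma> \<rho>) \<^bold>\<cdot> t \<^bold>\<cdot> u \<^bold>\<cdot> Cst (Empty \<sigma>)) t \<in> EHA_or_ax"
| lrec_prep:
    "Eq \<rho> (Cst (LRec \<sigma> \<rho>) \<^bold>\<cdot> t \<^bold>\<cdot> u \<^bold>\<cdot> (Cst (Prep \<sigma>) \<^bold>\<cdot> a \<^bold>\<cdot> s))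
          (u \<^bold>\<cdot> a \<^bold>\<cdot> s \<^bold>\<cdot> (Cst (LRec \<sigma> \<rho>) \<^bold>\<cdot> t \<^bold>\<cdot> u \<^bold>\<cdot> s)) \<in> EHA_or_ax"
| seq_cases:
    "Ex N (And
       (Imp (Eq N (Var 0) zero) (Eq (Seq \<sigma>) (tlift 1 s) (Cst (Empty \<sigma>))))
       (Imp (Neg (Eq N (Var 0) zero))
         (Ex \<sigma> (Ex (Seq \<sigma>) (Eq (Seq \<sigma>) (tlift 3 s) (Cst (Prep \<sigma>) \<^bold>\<cdot> Var 1 \<^bold>\<cdot> Var 0))))))
     \<in> EHA_or_ax"
| induction: "internal \<phi> \<Longrightarrow> or_free \<phi> \<Longrightarrow>
    Imp (And (finst zero \<phi>) (All N (Imp \<phi> (fsucc \<phi>)))) (All N \<phi>) \<in> EHA_or_ax"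

text \<open>The external quantifiers are primitive, as the translation below has separate clauses for
  them; their defining equivalences are axioms.\<close>

inductive_set st_ax :: "fm set" where
  allst1: "Imp (AllSt \<sigma> \<Phi>) (All \<sigma> (Imp (St \<sigma> (Var 0)) \<Phi>)) \<in> st_ax"
| allst2: "Imp (All \<sigma> (Imp (St \<sigma> (Var 0)) \<Phi>)) (AllSt \<sigma> \<Phi>) \<in> st_ax"
| exst1: "Imp (ExSt \<sigma> \<Phi>) (Ex \<sigma> (And (St \<sigma> (Var 0)) \<Phi>)) \<in> st_ax"
| exst2: "Imp (Ex \<sigma> (And (St \<sigma> (Var 0)) \<Phi>)) (ExSt \<sigma> \<Phi>) \<in> st_ax"
| st_eq: "Imp (And (St \<sigma> t) (Eq \<sigma> t u)) (St \<sigma> u) \<in> st_ax"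
| st_closed: "has_ty [] t \<sigma> \<Longrightarrow> St \<sigma> t \<in> st_ax"
| st_app: "Imp (And (St (\<sigma> \<^bold>\<rightarrow> \<tau>) f) (St \<sigma> t)) (St \<tau> (f \<^bold>\<cdot> t)) \<in> st_ax"
| ext_induction:
    "Imp (And (finst zero \<Phi>) (AllSt N (Imp \<Phi> (fsucc \<Phi>)))) (AllSt N \<Phi>) \<in> st_ax"

inductive_set OS_or :: "fm set" where
  "internal \<phi> \<Longrightarrow> or_free \<phi> \<Longrightarrow>
   Imp (AllSt (Seq \<sigma>) \<phi>) (Ex (Seq \<sigma>) (And (hyper \<sigma> (Var 0)) \<phi>)) \<in> OS_or"

inductive_set US_or :: "fm set" where
  "internal \<phi> \<Longrightarrow> or_free \<phi> \<Longrightarrow>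
   Imp (All (Seq \<sigma>) (Imp (hyper \<sigma> (Var 0)) \<phi>)) (ExSt (Seq \<sigma>) \<phi>) \<in> US_or"

text \<open>In \<open>\<forall>y \<exists>\<^sup>s\<^sup>tx \<Phi>\<close> variable 0 of \<open>\<Phi>\<close> is \<open>x\<close> and variable 1 is \<open>y\<close>; exchanging the
  quantifiers exchanges these indices.\<close>

inductive_set NU :: "fm set" where
  "Imp (All \<tau> (ExSt \<sigma> \<Phi>))
       (ExSt \<sigma> (All \<tau> (fsubst (case_nat (Var 1) (case_nat (Var 0) (\<lambda>i. Var (i + 2)))) \<Phi>))) \<in> NU"

text \<open>In \<open>\<forall>\<^sup>s\<^sup>tx \<exists>\<^sup>s\<^sup>ty \<Phi>\<close> variable 0 of \<open>\<Phi>\<close> is \<open>y\<close> and variable 1 is \<open>x\<close>; under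
  \<open>\<exists>\<^sup>s\<^sup>tf \<forall>\<^sup>s\<^sup>tx\<close> variable 0 is \<open>x\<close> and variable 1 is \<open>f\<close>.\<close>

inductive_set AC_st :: "fm set" where
  "Imp (AllSt \<sigma> (ExSt \<tau> \<Phi>))
       (ExSt (\<sigma> \<^bold>\<rightarrow> \<tau>) (AllSt \<sigma>
         (fsubst (case_nat (Var 1 \<^bold>\<cdot> Var 0) (case_nat (Var 0) (\<lambda>i. Var (i + 2)))) \<Phi>))) \<in> AC_st"

inductive_set IP_or :: "fm set" where
  "internal \<phi> \<Longrightarrow> or_free \<phi> \<Longrightarrow>
   Imp (Imp (AllSt \<sigma> \<phi>) (ExSt \<tau> \<Psi>))
       (ExSt \<tau> (Imp (flift (AllSt \<sigma> \<phi>)) \<Psi>)) \<in> IP_or"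

text \<open>\<open>EHA_or \<Delta> \<Gamma> \<phi>\<close> and \<open>EHA_st_or P \<Gamma> \<Phi>\<close>: provability, with free variables in \<open>\<Gamma>\<close>, in
  E-HA\<omega>*\<or> \<open>+ \<Delta>\<close> and in E-HA\<omega>*st\<or> \<open>+ P\<close>.\<close>

definition EHA_or :: "fm set \<Rightarrow> ty list \<Rightarrow> fm \<Rightarrow> bool" where
  "EHA_or \<Delta> \<Gamma> \<phi> = prv {\<psi>. internal \<psi>} (EHA_or_ax \<union> \<Delta>) \<Gamma> [] \<phi>"

definition EHA_st_or :: "fm set \<Rightarrow> ty list \<Rightarrow> fm \<Rightarrow> bool" where
  "EHA_st_or P \<Gamma> \<Phi> = prv UNIV (EHA_or_ax \<union> st_ax \<union> P) \<Gamma> [] \<Phi>"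

section \<open>The uniform Diller-Nahm translation\<close>

text \<open>The translation \<open>\<exists>\<^sup>s\<^sup>tx \<forall>\<^sup>s\<^sup>ty \<phi>\<^sub>U(x,y,a)\<close> of \<open>\<Phi>(a)\<close> is given by the types of the tuples
  \<open>x\<close> (first component of \<open>Uty\<close>) and \<open>y\<close> (second component), and by its matrix.\<close>

primrec Uty :: "fm \<Rightarrow> ty list \<times> ty list" where
  "Uty Bot = ([], [])"
| "Uty (Eq \<sigma> t u) = ([], [])"
| "Uty (St \<sigma> t) = ([\<sigma>], [])"
| "Uty (And \<Phi> \<Psi>) = (fst (Uty \<Phi>) @ fst (Uty \<Psi>), snd (Uty \<Phi>) @ snd (Uty \<Psi>))"
| "Uty (Or \<Phi> \<Psi>) = (N # fst (Uty \<Phi>) @ fst (Uty \<Psi>), snd (Uty \<Phi>) @ snd (Uty \<Psi>))"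
| "Uty (Imp \<Phi> \<Psi>) =
    (map (arrs (fst (Uty \<Phi>))) (fst (Uty \<Psi>)) @
       map (\<lambda>\<tau>. arrs (fst (Uty \<Phi>) @ snd (Uty \<Psi>)) (Seq \<tau>)) (snd (Uty \<Phi>)),
     fst (Uty \<Phi>) @ snd (Uty \<Psi>))"
| "Uty (Ex \<sigma> \<Phi>) = (fst (Uty \<Phi>), map Seq (snd (Uty \<Phi>)))"
| "Uty (All \<sigma> \<Phi>) = Uty \<Phi>"
| "Uty (ExSt \<sigma> \<Phi>) = (\<sigma> # fst (Uty \<Phi>), snd (Uty \<Phi>))"
| "Uty (AllSt \<sigma> \<Phi>) = (map (Fn \<sigma>) (fst (Uty \<Phi>)), snd (Uty \<Phi>) @ [\<sigma>])"

abbreviation Uex :: "fm \<Rightarrow> ty list" where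
  "Uex \<Phi> \<equiv> fst (Uty \<Phi>)"

abbreviation Uall :: "fm \<Rightarrow> ty list" where
  "Uall \<Phi> \<equiv> snd (Uty \<Phi>)"

text \<open>\<open>Umat \<Phi> as xs ys\<close> is \<open>\<phi>\<^sub>U(xs, ys, as)\<close> for terms \<open>xs\<close>, \<open>ys\<close> of types \<open>Uex \<Phi>\<close>, \<open>Uall \<Phi>\<close>,
  where \<open>as i\<close> is the term put for the free variable \<open>i\<close> of \<open>\<Phi>\<close>. Passing these terms down makes the
  substitutions of the clauses part of the recursion; under a binder they are lifted. Tuples of
  concatenated form are split by \<open>take\<close> and \<open>drop\<close>.\<close>

primrec Umat :: "fm \<Rightarrow> (nat \<Rightarrow> tm) \<Rightarrow> tm list \<Rightarrow> tm list \<Rightarrow> fm" where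
  "Umat Bot as xs ys = Bot"
| "Umat (Eq \<sigma> t u) as xs ys = Eq \<sigma> (tsubst as t) (tsubst as u)"
| "Umat (St \<sigma> t) as xs ys = Eq \<sigma> (hd xs) (tsubst as t)"
| "Umat (And \<Phi> \<Psi>) as xus yvs =
    (let m = length (Uex \<Phi>); n = length (Uall \<Phi>) in
      And (Umat \<Phi> as (take m xus) (take n yvs)) (Umat \<Psi> as (drop m xus) (drop n yvs)))"
| "Umat (Or \<Phi> \<Psi>) as zxus yvs =
    (let m = length (Uex \<Phi>); n = length (Uall \<Phi>); z = hd zxus; xus = tl zxus in
      And (Imp (Eq N z zero) (Umat \<Phi> as (take m xus) (take n yvs)))
          (Imp (Neg (Eq N z zero)) (Umat \<Psi> as (drop m xus) (drop n yvs))))"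
| "Umat (Imp \<Phi> \<Psi>) as UYs xvs =
    (let Us = take (length (Uex \<Psi>)) UYs; Ys = drop (length (Uex \<Psi>)) UYs;
         xs = take (length (Uex \<Phi>)) xvs; vs = drop (length (Uex \<Phi>)) xvs;
         n = length (Uall \<Phi>) in
      Imp (BAlls (Uall \<Phi>) (map (\<lambda>Y. apps Y (xs @ vs)) Ys)
             (Umat \<Phi> (tlift n \<circ> as) (map (tlift n) xs) (vars n)))
          (Umat \<Psi> as (map (\<lambda>U. apps U xs) Us) vs))"
| "Umat (Ex \<sigma> \<Phi>) as xs ys =
    (let n = length (Uall \<Phi>) in
      Ex \<sigma> (BAlls (Uall \<Phi>) (map (tlift 1) ys)
             (Umat \<Phi> (tlift n \<circ> up as) (map (tlift (n + 1)) xs) (vars n))))"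
| "Umat (All \<sigma> \<Phi>) as xs ys = All \<sigma> (Umat \<Phi> (up as) (map (tlift 1) xs) (map (tlift 1) ys))"
| "Umat (ExSt \<sigma> \<Phi>) as zxs ys = Umat \<Phi> (case_nat (hd zxs) as) (tl zxs) ys"
| "Umat (AllSt \<sigma> \<Phi>) as Xs yzs =
    (let z = last yzs in Umat \<Phi> (case_nat z as) (map (\<lambda>X. X \<^bold>\<cdot> z) Xs) (butlast yzs))"

definition Utrans :: "fm \<Rightarrow> fm" where
  "Utrans \<Phi> =
    (let m = length (Uex \<Phi>); n = length (Uall \<Phi>) in
      foldr ExSt (Uex \<Phi>) (foldr AllSt (Uall \<Phi>)
        (Umat \<Phi> (\<lambda>i. Var (i + m + n)) (map (tlift n) (vars m)) (vars n))))"

end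

theory Submission
  imports Defs
begin

text \<open>A sequent \<open>\<Phi> \<turnstile> \<Psi>\<close> is interpreted by open terms: \<open>f\<close> computes realizers of \<open>\<Psi>\<close> from realizers of
  \<open>\<Phi>\<close>, and \<open>g\<close> computes, from a realizer of \<open>\<Phi>\<close> and a challenge to \<open>\<Psi>\<close>, finite sequences of challenges
  to \<open>\<Phi>\<close> such that the matrix of \<open>\<Psi>\<close> follows if that of \<open>\<Phi>\<close> holds for all members of these
  sequences. Contraction appends the sequences, composition takes unions over the members of a
  sequence, so the matrix need not be decidable; the internal quantifiers leave the realizers
  unchanged. The characteristic principles and the standardness axioms have premises and
  conclusions with nearly identical interpretations.

  To verify the realizers, provability in the internal theory is treated as forcing over worlds
  that consist of a context and a list of hypotheses: \<open>\<longrightarrow>\<close> and \<open>\<forall>\<close> are then characterised by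
  quantification over larger worlds, and \<open>\<exists>\<close> by an elimination rule. This replaces derivations by
  semantic arguments about the matrix of the translation.\<close>

section \<open>Substitution and typing\<close>

text \<open>The internal theory is used without any reasoning by disjunction: its induction is
  restricted to \<or>-free formulae, and forcing has no clause for \<or>. This is enough because
  every matrix is \<or>-free, a disjunction being replaced by a test of a numerical flag; the case
  distinctions that such a test calls for are derived from induction. Composing realizers is a
  syntactic matter, but abstraction and recursion return the intended values only up to provable
  equality, so the matrix must be shown to respect equality of realizers, challenges and parameters
  alike. A second obstacle is that a bounded block over a tuple of sequences says nothing as soon as
  one sequence is empty. Wherever such a block for a conjunction or a disjunction has to be split,
  the sequences are padded with default elements. The theorem itself is the sequent whose premise
  has neither realizers nor challenges, so that the realizers of its conclusion are closed
  terms.\<close>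

lemma tsubst_Var [simp]: "tsubst Var t = t"
  by (induction t) auto

lemma tsubst_tsubst: "tsubst \<theta> (tsubst \<eta> t) = tsubst (\<lambda>i. tsubst \<theta> (\<eta> i)) t"
  by (induction t) auto

lemma up_0 [simp]: "up \<theta> 0 = Var 0"
  by (simp add: up_def)

lemma up_Suc [simp]: "up \<theta> (Suc i) = tlift 1 (\<theta> i)"
  by (simp add: up_def)

lemma tlift_simps [simp]:
  "tlift n (Var i) = Var (i + n)" "tlift n (Cst c) = Cst c" "tlift n (f \<^bold>\<cdot> t) = tlift n f \<^bold>\<cdot> tlift n t"
  by (simp_all add: tlift_def)

lemma tlift_0 [simp]: "tlift 0 t = t"
  by (simp add: tlift_def)

lemma tlift_tlift [simp]: "tlift m (tlift n t) = tlift (n + m) t"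
  by (simp add: tlift_def tsubst_tsubst add.assoc)

lemma tsubst_tlift: "tsubst \<theta> (tlift n t) = tsubst (\<lambda>i. \<theta> (i + n)) t"
  by (simp add: tlift_def tsubst_tsubst)

lemma tlift_tsubst: "tlift n (tsubst \<theta> t) = tsubst (\<lambda>i. tlift n (\<theta> i)) t"
  by (simp add: tlift_def tsubst_tsubst)

lemma up_Var [simp]: "up Var = Var"
  by (rule ext) (simp add: up_def split: nat.split)

lemma tsubst_up_up: "tsubst (up \<theta>) (up \<eta> i) = up (\<lambda>i. tsubst \<theta> (\<eta> i)) i"
  by (cases i) (simp_all add: tsubst_tlift tlift_tsubst)

lemma fsubst_Var [simp]: "fsubst Var \<phi> = \<phi>"
  by (induction \<phi>) auto

lemma fsubst_fsubst: "fsubst \<theta> (fsubst \<eta> \<phi>) = fsubst (\<lambda>i. tsubst \<theta> (\<eta> i)) \<phi>"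
  by (induction \<phi> arbitrary: \<theta> \<eta>) (simp_all add: tsubst_tsubst tsubst_up_up)

lemma case_nat_eq: "case_nat a f = g \<longleftrightarrow> a = g 0 \<and> (\<forall>i. f i = g (Suc i))"
  by (auto simp: fun_eq_iff split: nat.split)

lemma tsubst_case_nat_up: "tsubst (case_nat t Var) (up \<theta> i) = case_nat t \<theta> i"
  by (cases i) (simp_all add: tsubst_tlift)

text \<open>Quantifier instances in worlds have this shape. Merging both substitutions into
  \<open>case_nat t \<theta>\<close> removes the binder, so later arguments extend an assignment of
  terms instead of renaming bound variables.\<close>

lemma finst_fsubst_up [simp]: "finst t (fsubst (up \<theta>) \<phi>) = fsubst (case_nat t \<theta>) \<phi>"
  by (simp add: finst_def fsubst_fsubst tsubst_case_nat_up)

lemma tsubst_case_nat: "tsubst \<theta> (case_nat t \<eta> i) = case_nat (tsubst \<theta> t) (\<lambda>i. tsubst \<theta> (\<eta> i)) i"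
  by (cases i) simp_all

lemma tsubst_case_nat_Var: "(\<lambda>i. tsubst \<theta> (case_nat t Var i)) = case_nat (tsubst \<theta> t) \<theta>"
  by (auto simp: fun_eq_iff split: nat.split)

lemma fsubst_finst: "fsubst \<theta> (finst t \<phi>) = fsubst (case_nat (tsubst \<theta> t) \<theta>) \<phi>"
  by (simp add: finst_def fsubst_fsubst tsubst_case_nat_Var)

lemma fsubst_flift: "fsubst \<theta> (flift \<phi>) = fsubst (\<lambda>i. \<theta> (Suc i)) \<phi>"
  by (simp add: flift_def fsubst_fsubst)

lemma fsubst_up_flift: "fsubst (up \<theta>) (flift \<phi>) = flift (fsubst \<theta> \<phi>)"
  by (simp add: fsubst_flift) (simp add: flift_def fsubst_fsubst tlift_def)

lemma finst_flift [simp]: "finst t (flift \<phi>) = \<phi>"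
  by (simp add: finst_def fsubst_flift)

lemma fsubst_up_fsucc: "fsubst (up \<theta>) (fsucc \<phi>) = fsucc (fsubst (up \<theta>) \<phi>)"
proof -
  have "tsubst (up \<theta>) (case_nat (suc (Var 0)) (\<lambda>i. Var (Suc i)) i) =
      tsubst (case_nat (suc (Var 0)) (\<lambda>i. Var (Suc i))) (up \<theta> i)" for i
    by (cases i) (simp_all add: tsubst_tlift, simp add: tlift_def)
  then show ?thesis
    by (simp add: fsucc_def fsubst_fsubst)
qed

lemma internal_fsubst [simp]: "internal (fsubst \<theta> \<phi>) = internal \<phi>"
  by (induction \<phi> arbitrary: \<theta>) auto

lemma or_free_fsubst [simp]: "or_free (fsubst \<theta> \<phi>) = or_free \<phi>"
  by (induction \<phi> arbitrary: \<theta>) auto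

lemma internal_finst [simp]: "internal (finst t \<phi>) = internal \<phi>"
  by (simp add: finst_def)

lemma or_free_finst [simp]: "or_free (finst t \<phi>) = or_free \<phi>"
  by (simp add: finst_def)

lemma internal_flift [simp]: "internal (flift \<phi>) = internal \<phi>"
  by (simp add: flift_def)

lemma or_free_flift [simp]: "or_free (flift \<phi>) = or_free \<phi>"
  by (simp add: flift_def)

lemma internal_fsucc [simp]: "internal (fsucc \<phi>) = internal \<phi>"
  by (simp add: fsucc_def)

lemma or_free_fsucc [simp]: "or_free (fsucc \<phi>) = or_free \<phi>"
  by (simp add: fsucc_def)

lemma tsubst_apps: "tsubst \<theta> (apps t ts) = apps (tsubst \<theta> t) (map (tsubst \<theta>) ts)"
  by (induction ts arbitrary: t) (simp_all add: apps_def)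

lemma apps_simps [simp]: "apps t [] = t" "apps t (u # us) = apps (t \<^bold>\<cdot> u) us"
  by (simp_all add: apps_def)

lemma apps_append: "apps t (us @ vs) = apps (apps t us) vs"
  by (simp add: apps_def)

lemma arrs_simps [simp]: "arrs [] \<tau> = \<tau>" "arrs (\<sigma> # \<sigma>s) \<tau> = \<sigma> \<^bold>\<rightarrow> arrs \<sigma>s \<tau>"
  by (simp_all add: arrs_def)

lemma arrs_append [simp]: "arrs (\<sigma>s @ \<rho>s) \<tau> = arrs \<sigma>s (arrs \<rho>s \<tau>)"
  by (simp add: arrs_def)

section \<open>Typing and well-formedness under substitution\<close>

definition subst_ty :: "ty list \<Rightarrow> (nat \<Rightarrow> tm) \<Rightarrow> ty list \<Rightarrow> bool" where
  "subst_ty \<Gamma>' \<theta> \<Gamma> \<longleftrightarrow> (\<forall>i<length \<Gamma>. has_ty \<Gamma>' (\<theta> i) (\<Gamma> ! i))"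

inductive_cases has_ty_VarE: "has_ty \<Gamma> (Var i) \<tau>"
inductive_cases has_ty_CstE: "has_ty \<Gamma> (Cst c) \<tau>"
inductive_cases has_ty_AppE: "has_ty \<Gamma> (f \<^bold>\<cdot> t) \<tau>"

lemma has_ty_VarI: "i < length \<Gamma> \<Longrightarrow> \<Gamma> ! i = \<tau> \<Longrightarrow> has_ty \<Gamma> (Var i) \<tau>"
  using has_ty.intros(1) by blast

lemma has_ty_tsubst: "has_ty \<Gamma> t \<tau> \<Longrightarrow> subst_ty \<Gamma>' \<theta> \<Gamma> \<Longrightarrow> has_ty \<Gamma>' (tsubst \<theta> t) \<tau>"
  by (induction rule: has_ty.induct) (auto simp: subst_ty_def intro: has_ty.intros)

lemma subst_ty_mono: "subst_ty (\<Gamma> @ \<Delta>) Var \<Gamma>"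
  by (auto simp: subst_ty_def nth_append intro!: has_ty_VarI)

lemma has_ty_mono: "has_ty \<Gamma> t \<tau> \<Longrightarrow> has_ty (\<Gamma> @ \<Delta>) t \<tau>"
  using has_ty_tsubst[OF _ subst_ty_mono] by fastforce

lemma has_ty_closed: "has_ty [] t \<tau> \<Longrightarrow> has_ty \<Gamma> t \<tau>"
  using has_ty_mono[of "[]"] by simp

lemma has_ty_tlift: "has_ty \<Gamma> t \<tau> \<Longrightarrow> length \<Delta> = n \<Longrightarrow> has_ty (\<Delta> @ \<Gamma>) (tlift n t) \<tau>"
  unfolding tlift_def
  by (erule has_ty_tsubst) (auto simp: subst_ty_def nth_append intro!: has_ty_VarI)

lemma has_ty_tlift1: "has_ty \<Gamma> t \<tau> \<Longrightarrow> has_ty (\<sigma> # \<Gamma>) (tlift 1 t) \<tau>"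
  using has_ty_tlift[of \<Gamma> t \<tau> "[\<sigma>]" 1] by simp

lemma subst_ty_case_nat: "has_ty \<Gamma>' t \<sigma> \<Longrightarrow> subst_ty \<Gamma>' \<theta> \<Gamma> \<Longrightarrow> subst_ty \<Gamma>' (case_nat t \<theta>) (\<sigma> # \<Gamma>)"
  by (auto simp: subst_ty_def less_Suc_eq_0_disj)

lemma subst_ty_up: "subst_ty \<Gamma>' \<theta> \<Gamma> \<Longrightarrow> subst_ty (\<sigma> # \<Gamma>') (up \<theta>) (\<sigma> # \<Gamma>)"
  using has_ty_tlift1 by (fastforce simp: subst_ty_def less_Suc_eq_0_disj intro: has_ty_VarI)

lemma subst_ty_Var [simp]: "subst_ty \<Gamma> Var \<Gamma>"
  by (auto simp: subst_ty_def intro!: has_ty_VarI)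

lemma subst_ty_lift: "subst_ty \<Gamma>' \<theta> \<Gamma> \<Longrightarrow> length \<Delta> = n \<Longrightarrow> subst_ty (\<Delta> @ \<Gamma>') (tlift n \<circ> \<theta>) \<Gamma>"
  by (auto simp: subst_ty_def has_ty_tlift)

lemma subst_ty_ext: "subst_ty \<Gamma>' \<theta> \<Gamma> \<Longrightarrow> subst_ty (\<Gamma>' @ \<Delta>) \<theta> \<Gamma>"
  by (auto simp: subst_ty_def has_ty_mono)

lemma wff_fsubst: "wff \<Gamma> \<phi> \<Longrightarrow> subst_ty \<Gamma>' \<theta> \<Gamma> \<Longrightarrow> wff \<Gamma>' (fsubst \<theta> \<phi>)"
  by (induction \<phi> arbitrary: \<Gamma> \<Gamma>' \<theta>) (auto intro: has_ty_tsubst subst_ty_up)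

lemma wff_mono: "wff \<Gamma> \<phi> \<Longrightarrow> wff (\<Gamma> @ \<Delta>) \<phi>"
  using wff_fsubst[OF _ subst_ty_mono] by fastforce

lemma wff_finst: "wff (\<sigma> # \<Gamma>) \<phi> \<Longrightarrow> has_ty \<Gamma> t \<sigma> \<Longrightarrow> wff \<Gamma> (finst t \<phi>)"
  unfolding finst_def by (erule wff_fsubst) (simp add: subst_ty_case_nat)

lemma wff_flift: "wff \<Gamma> \<phi> \<Longrightarrow> wff (\<sigma> # \<Gamma>) (flift \<phi>)"
  unfolding flift_def by (erule wff_fsubst) (auto simp: subst_ty_def intro!: has_ty_VarI)

lemma tsubst_cong: "has_ty \<Gamma> t \<tau> \<Longrightarrow> (\<And>i. i < length \<Gamma> \<Longrightarrow> \<theta> i = \<theta>' i) \<Longrightarrow> tsubst \<theta> t = tsubst \<theta>' t"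
  by (induction rule: has_ty.induct) auto

text \<open>A formula well formed in \<Gamma> reads only the first \<open>length \<Gamma>\<close>
  values of a substitution. Hence sentences are fixed by every substitution, and renamings that
  differ only beyond the context act alike.\<close>

lemma fsubst_cong:
  "wff \<Gamma> \<phi> \<Longrightarrow> (\<And>i. i < length \<Gamma> \<Longrightarrow> \<theta> i = \<theta>' i) \<Longrightarrow> fsubst \<theta> \<phi> = fsubst \<theta>' \<phi>"
proof (induction \<phi> arbitrary: \<Gamma> \<theta> \<theta>')
  case (Eq \<sigma> t u)
  then show ?case by (auto intro!: tsubst_cong)
next
  case (St \<sigma> t)
  then show ?case by (auto intro!: tsubst_cong)
next
  case (All \<sigma> \<phi>)
  have "up \<theta> i = up \<theta>' i" if "i < length (\<sigma> # \<Gamma>)" for i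
    using All.prems(2) that by (cases i) auto
  then have "fsubst (up \<theta>) \<phi> = fsubst (up \<theta>') \<phi>"
    using All.IH[of "\<sigma> # \<Gamma>" "up \<theta>" "up \<theta>'"] All.prems(1) by simp
  then show ?case by simp
next
  case (Ex \<sigma> \<phi>)
  have "up \<theta> i = up \<theta>' i" if "i < length (\<sigma> # \<Gamma>)" for i
    using Ex.prems(2) that by (cases i) auto
  then have "fsubst (up \<theta>) \<phi> = fsubst (up \<theta>') \<phi>"
    using Ex.IH[of "\<sigma> # \<Gamma>" "up \<theta>" "up \<theta>'"] Ex.prems(1) by simp
  then show ?case by simp
next
  case (AllSt \<sigma> \<phi>)
  have "up \<theta> i = up \<theta>' i" if "i < length (\<sigma> # \<Gamma>)" for i
    using AllSt.prems(2) that by (cases i) auto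
  then have "fsubst (up \<theta>) \<phi> = fsubst (up \<theta>') \<phi>"
    using AllSt.IH[of "\<sigma> # \<Gamma>" "up \<theta>" "up \<theta>'"] AllSt.prems(1) by simp
  then show ?case by simp
next
  case (ExSt \<sigma> \<phi>)
  have "up \<theta> i = up \<theta>' i" if "i < length (\<sigma> # \<Gamma>)" for i
    using ExSt.prems(2) that by (cases i) auto
  then have "fsubst (up \<theta>) \<phi> = fsubst (up \<theta>') \<phi>"
    using ExSt.IH[of "\<sigma> # \<Gamma>" "up \<theta>" "up \<theta>'"] ExSt.prems(1) by simp
  then show ?case by simp
next
  case (And \<phi> \<psi>)
  then show ?case by simp blast
next
  case (Or \<phi> \<psi>)
  then show ?case by simp blast
next
  case (Imp \<phi> \<psi>)
  then show ?case by simp blast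
qed simp

lemma tsubst_closed: "has_ty [] t \<tau> \<Longrightarrow> tsubst \<theta> t = t"
  using tsubst_cong[of "[]" t \<tau> \<theta> Var] by simp

lemma fsubst_sentence: "sentence \<phi> \<Longrightarrow> fsubst \<theta> \<phi> = \<phi>"
  using fsubst_cong[of "[]" \<phi> \<theta> Var] by simp

text \<open>Every type has a closed inhabitant. These terms serve as dummy challenges and dummy
  realizers, and as the value put for a variable that is to be discarded.\<close>

lemma has_ty_null: "has_ty [] (null_tm \<sigma>) \<sigma>"
  by (induction \<sigma>) (auto intro!: has_ty.intros cst_ty.intros)

text \<open>Lifting is undone by substituting a closed term for variable 0.\<close>

lemma wff_fliftD: "wff (\<sigma> # \<Gamma>) (flift \<phi>) \<Longrightarrow> wff \<Gamma> \<phi>"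
  using wff_finst[of \<sigma> \<Gamma> "flift \<phi>" "null_tm \<sigma>"] has_ty_closed[OF has_ty_null] by simp

text \<open>The axioms are schemata over arbitrary terms, so a substitution turns an instance into
  an instance. Stability of derivations under substitution, and with it monotonicity of forcing,
  rests on this.\<close>

lemma EHA_or_ax_fsubst: "\<phi> \<in> EHA_or_ax \<Longrightarrow> fsubst \<theta> \<phi> \<in> EHA_or_ax"
proof (induction rule: EHA_or_ax.induct)
  case (extensionality \<sigma> \<tau> f g)
  then show ?case
    using EHA_or_ax.extensionality[of \<sigma> \<tau> "tsubst \<theta> f" "tsubst \<theta> g"]
    by (simp add: tsubst_tlift tlift_tsubst)
next
  case (rec_zero ts \<sigma>s us i)
  then show ?case
    using EHA_or_ax.rec_zero[of "map (tsubst \<theta>) ts" \<sigma>s "map (tsubst \<theta>) us" i]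
    by (simp add: tsubst_apps)
next
  case (rec_suc ts \<sigma>s us i v)
  then show ?case
    using EHA_or_ax.rec_suc[of "map (tsubst \<theta>) ts" \<sigma>s "map (tsubst \<theta>) us" i "tsubst \<theta> v"]
    by (simp add: tsubst_apps o_def)
next
  case (seq_cases \<sigma> s)
  \<comment> \<open>Below the three binders of the axiom the lifted term \<open>tlift 3 s\<close>
    meets the threefold \<open>up\<close> from index 3 on, where it is \<theta> lifted by 3.\<close>
  have "up (up (up \<theta>)) (i + 3) = tlift 3 (\<theta> i)" for i
    using tlift_tlift[of 1 2 "\<theta> i"] by (simp add: numeral_3_eq_3 numeral_2_eq_2)
  then show ?case
    using EHA_or_ax.seq_cases[of \<sigma> "tsubst \<theta> s"]
    by (simp add: tsubst_tlift tlift_tsubst)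
next
  case (induction \<phi>)
  then show ?case
    using EHA_or_ax.induction[of "fsubst (up \<theta>) \<phi>"]
    by (simp add: fsubst_finst fsubst_up_fsucc)
qed (auto intro: EHA_or_ax.intros)

section \<open>Structural properties of derivations\<close>

lemma prv_weaken: "prv L Ax \<Gamma> H \<phi> \<Longrightarrow> set H \<subseteq> set H' \<Longrightarrow> prv L Ax \<Gamma> H' \<phi>"
proof (induction arbitrary: H' rule: prv.induct)
  case (orE \<Gamma> H \<phi> \<psi> \<chi>)
  show ?case
    by (rule prv.orE[OF orE.IH(1,2,3)]) (use orE.prems in auto)
next
  case (impI \<phi> \<Gamma> H \<psi>)
  show ?case by (rule prv.impI) (use impI in \<open>auto intro!: impI.IH\<close>)
next
  case (allI \<sigma> \<Gamma> H \<phi>)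
  show ?case by (rule prv.allI[OF allI.IH]) (use allI.prems in auto)
next
  case (exE \<Gamma> H \<sigma> \<phi> \<chi>)
  show ?case
    by (rule prv.exE[OF exE.IH(1,2)]) (use exE.prems in auto)
qed (auto intro: prv.intros)

text \<open>The rules check well-formedness only where a formula enters that the premises do not
  determine. For all other formulae it is recovered here, because the semantic rules ask for
  it.\<close>

lemma prv_wff: "prv L Ax \<Gamma> H \<phi> \<Longrightarrow> (\<And>h. h \<in> set H \<Longrightarrow> wff \<Gamma> h) \<Longrightarrow> wff \<Gamma> \<phi>"
proof (induction rule: prv.induct)
  case (orE \<Gamma> H \<phi> \<psi> \<chi>)
  then show ?case by (auto simp: ball_simps)
next
  case (allE \<Gamma> H \<sigma> \<phi> t)
  then show ?case by (auto intro: wff_finst)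
next
  case (exE \<Gamma> H \<sigma> \<phi> \<chi>)
  \<comment> \<open>The premise only concerns the lifted conclusion; the eigenvariable is removed
    again by instantiating it with a closed term.\<close>
  then have "wff (\<sigma> # \<Gamma>) (flift \<chi>)" by (auto intro: wff_flift)
  then show ?case by (rule wff_fliftD)
qed (auto intro: wff_flift)

section \<open>Kripke-style provability\<close>

text \<open>\<open>\<Gamma>'\<close> and \<theta> are generalised in the induction because the
  premises of \<forall>-introduction and \<exists>-elimination live over one more variable and are
  used with \<open>up \<theta>\<close>. The closure conditions on \<open>L\<close> and
  \<open>Ax\<close> take care of side formulae and axioms.\<close>

lemma prv_fsubst:
  assumes "prv L Ax \<Gamma> H \<phi>" and "subst_ty \<Gamma>' \<theta> \<Gamma>"
    and L: "\<And>\<phi> \<theta>. \<phi> \<in> L \<Longrightarrow> fsubst \<theta> \<phi> \<in> L" and Ax: "\<And>\<phi> \<theta>. \<phi> \<in> Ax \<Longrightarrow> fsubst \<theta> \<phi> \<in> Ax"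
  shows "prv L Ax \<Gamma>' (map (fsubst \<theta>) H) (fsubst \<theta> \<phi>)"
  using assms(1,2)
proof (induction arbitrary: \<Gamma>' \<theta> rule: prv.induct)
  case (ax \<phi> \<Gamma> H)
  then show ?case by (auto intro!: prv.ax L Ax wff_fsubst)
next
  case (hyp \<phi> H \<Gamma>)
  then show ?case by (auto intro!: prv.hyp)
next
  case (botE \<Gamma> H \<phi>)
  have "prv L Ax \<Gamma>' (map (fsubst \<theta>) H) Bot" using botE.IH[OF botE.prems] by simp
  then show ?case using botE by (auto intro: prv.botE L wff_fsubst)
next
  case (orI1 \<Gamma> H \<phi> \<psi>)
  then show ?case by (auto intro!: prv.orI1 L wff_fsubst)
next
  case (orI2 \<Gamma> H \<phi> \<psi>)
  then show ?case by (auto intro!: prv.orI2 L wff_fsubst)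
next
  case (impI \<phi> \<Gamma> H \<psi>)
  then show ?case by (auto intro!: prv.impI L wff_fsubst)
next
  case (allI \<sigma> \<Gamma> H \<phi>)
  have "prv L Ax (\<sigma> # \<Gamma>') (map (fsubst (up \<theta>)) (map flift H)) (fsubst (up \<theta>) \<phi>)"
    by (rule allI.IH) (rule subst_ty_up[OF allI.prems])
  then show ?case by (auto simp: fsubst_up_flift o_def intro!: prv.allI)
next
  case (allE \<Gamma> H \<sigma> \<phi> t)
  have "prv L Ax \<Gamma>' (map (fsubst \<theta>) H) (finst (tsubst \<theta> t) (fsubst (up \<theta>) \<phi>))"
    by (rule prv.allE) (use allE in \<open>auto intro!: has_ty_tsubst\<close>)
  then show ?case by (simp add: fsubst_finst)
next
  case (exI \<sigma> \<phi> \<Gamma> t H)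
  show ?case unfolding fsubst.simps
  proof (rule prv.exI)
    show "Ex \<sigma> (fsubst (up \<theta>) \<phi>) \<in> L" using L[OF exI.hyps(1), of \<theta>] by simp
    show "wff \<Gamma>' (Ex \<sigma> (fsubst (up \<theta>) \<phi>))" using wff_fsubst[OF exI.hyps(2) exI.prems] by simp
    show "has_ty \<Gamma>' (tsubst \<theta> t) \<sigma>" using exI.hyps(3) exI.prems by (rule has_ty_tsubst)
    show "prv L Ax \<Gamma>' (map (fsubst \<theta>) H) (finst (tsubst \<theta> t) (fsubst (up \<theta>) \<phi>))"
      using exI.IH[OF exI.prems] by (simp add: fsubst_finst)
  qed
next
  case (exE \<Gamma> H \<sigma> \<phi> \<chi>)
  have "prv L Ax (\<sigma> # \<Gamma>') (map (fsubst (up \<theta>)) (\<phi> # map flift H)) (fsubst (up \<theta>) (flift \<chi>))"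
    by (rule exE.IH) (rule subst_ty_up[OF exE.prems])
  then have "prv L Ax (\<sigma> # \<Gamma>') (fsubst (up \<theta>) \<phi> # map flift (map (fsubst \<theta>) H)) (flift (fsubst \<theta> \<chi>))"
    by (simp add: fsubst_up_flift o_def)
  moreover have "prv L Ax \<Gamma>' (map (fsubst \<theta>) H) (Ex \<sigma> (fsubst (up \<theta>) \<phi>))"
    using exE.IH(1)[OF exE.prems] by simp
  ultimately show ?case by (rule prv.exE[rotated])
next
  case (orE \<Gamma> H \<phi> \<psi> \<chi>)
  then show ?case using prv.orE[of L Ax \<Gamma>' "map (fsubst \<theta>) H" "fsubst \<theta> \<phi>" "fsubst \<theta> \<psi>"] by simp
next
  case (impE \<Gamma> H \<phi> \<psi>)
  then show ?case using prv.impE[of L Ax \<Gamma>' "map (fsubst \<theta>) H" "fsubst \<theta> \<phi>"] by simp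
qed (auto intro: prv.intros)

section \<open>Worlds and their extension\<close>

type_synonym world = "ty list \<times> fm list"

text \<open>Well-formed hypotheses make every forced formula well formed, and they let the renaming
  used for a fresh variable act on the hypotheses as plain lifting.\<close>

definition world :: "world \<Rightarrow> bool" where
  "world W \<longleftrightarrow> (\<forall>h\<in>set (snd W). wff (fst W) h \<and> internal h)"

definition ext :: "world \<Rightarrow> world \<Rightarrow> bool" (infix "\<sqsubseteq>" 50) where
  "W \<sqsubseteq> W' \<longleftrightarrow> world W' \<and> (\<exists>\<Gamma>. fst W' = fst W @ \<Gamma>) \<and> set (snd W) \<subseteq> set (snd W')"

abbreviation hty :: "world \<Rightarrow> tm \<Rightarrow> ty \<Rightarrow> bool" where
  "hty W \<equiv> has_ty (fst W)"

abbreviation htys :: "world \<Rightarrow> tm list \<Rightarrow> ty list \<Rightarrow> bool" where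
  "htys W \<equiv> list_all2 (hty W)"

lemma ext_refl: "world W \<Longrightarrow> W \<sqsubseteq> W"
  by (simp add: ext_def)

lemma ext_trans: "W \<sqsubseteq> W' \<Longrightarrow> W' \<sqsubseteq> W'' \<Longrightarrow> W \<sqsubseteq> W''"
  by (fastforce simp: ext_def)

lemma ext_world: "W \<sqsubseteq> W' \<Longrightarrow> world W'"
  by (simp add: ext_def)

lemma hty_ext: "W \<sqsubseteq> W' \<Longrightarrow> hty W t \<sigma> \<Longrightarrow> hty W' t \<sigma>"
  by (auto simp: ext_def has_ty_mono)

lemma htys_ext: "W \<sqsubseteq> W' \<Longrightarrow> htys W ts \<sigma>s \<Longrightarrow> htys W' ts \<sigma>s"
  by (auto intro: hty_ext elim: list_all2_mono)

lemma wff_ext: "W \<sqsubseteq> W' \<Longrightarrow> wff (fst W) \<phi> \<Longrightarrow> wff (fst W') \<phi>"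
  by (auto simp: ext_def wff_mono)

lemma wff_ext1: "W \<sqsubseteq> W' \<Longrightarrow> wff (\<sigma> # fst W) \<phi> \<Longrightarrow> wff (\<sigma> # fst W') \<phi>"
  using wff_mono[of "\<sigma> # fst W" \<phi>] by (auto simp: ext_def)

lemma subst_ty_world: "W \<sqsubseteq> W' \<Longrightarrow> subst_ty (fst W) \<theta> \<Gamma> \<Longrightarrow> subst_ty (fst W') \<theta> \<Gamma>"
  by (auto simp: ext_def subst_ty_ext)

text \<open>The three conditions have separate uses: sentences are invariant under substitution,
  internal ones belong to the language of the target theory, and \<or>-free ones are their own
  translation.\<close>

locale ha_theory =
  fixes \<Delta> :: "fm set"
  assumes Delta: "\<delta> \<in> \<Delta> \<Longrightarrow> sentence \<delta> \<and> internal \<delta> \<and> or_free \<delta>"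
begin

section \<open>Forcing rules for the connectives and quantifiers\<close>

definition forces :: "world \<Rightarrow> fm \<Rightarrow> bool" (infix "\<tturnstile>" 50) where
  "W \<tturnstile> \<phi> \<longleftrightarrow> prv {\<psi>. internal \<psi>} (EHA_or_ax \<union> \<Delta>) (fst W) (snd W) \<phi>"

lemma ax_fsubst: "\<phi> \<in> EHA_or_ax \<union> \<Delta> \<Longrightarrow> fsubst \<theta> \<phi> \<in> EHA_or_ax \<union> \<Delta>"
  using EHA_or_ax_fsubst Delta fsubst_sentence by auto

lemma forces_subst:
  "(\<Gamma>, H) \<tturnstile> \<phi> \<Longrightarrow> subst_ty \<Gamma>' \<theta> \<Gamma> \<Longrightarrow> (\<Gamma>', map (fsubst \<theta>) H) \<tturnstile> fsubst \<theta> \<phi>"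
  unfolding forces_def fst_conv snd_conv by (erule (1) prv_fsubst) (simp, rule ax_fsubst)

text \<open>The identity substitution retypes a derivation over the longer context, and weakening
  adds the new hypotheses; nothing is renamed.\<close>

lemma forces_mono:
  assumes "W \<sqsubseteq> W'" and "W \<tturnstile> \<phi>"
  shows "W' \<tturnstile> \<phi>"
proof -
  obtain \<Gamma> H where W: "W = (\<Gamma>, H)" by (cases W)
  obtain \<Gamma>' H' where W': "W' = (\<Gamma> @ \<Gamma>', H')" using assms(1) W by (cases W') (auto simp: ext_def)
  have "(\<Gamma> @ \<Gamma>', map (fsubst Var) H) \<tturnstile> fsubst Var \<phi>"
    using assms(2) unfolding W by (rule forces_subst) (rule subst_ty_mono)
  then have "prv {\<psi>. internal \<psi>} (EHA_or_ax \<union> \<Delta>) (\<Gamma> @ \<Gamma>') H \<phi>"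
    by (simp add: forces_def map_idI)
  then show ?thesis
    using assms(1) unfolding W W' forces_def by (auto simp: ext_def intro: prv_weaken)
qed

lemma forces_wff: "world W \<Longrightarrow> W \<tturnstile> \<phi> \<Longrightarrow> wff (fst W) \<phi>"
  unfolding forces_def by (erule prv_wff) (auto simp: world_def)

lemma forces_ax: "\<phi> \<in> EHA_or_ax \<union> \<Delta> \<Longrightarrow> internal \<phi> \<Longrightarrow> wff (fst W) \<phi> \<Longrightarrow> W \<tturnstile> \<phi>"
  by (auto simp: forces_def intro!: prv.ax)

lemma forces_botE: "W \<tturnstile> Bot \<Longrightarrow> internal \<phi> \<Longrightarrow> wff (fst W) \<phi> \<Longrightarrow> W \<tturnstile> \<phi>"
  by (auto simp: forces_def intro: prv.botE)

lemma forces_And: "W \<tturnstile> And \<phi> \<psi> \<longleftrightarrow> W \<tturnstile> \<phi> \<and> W \<tturnstile> \<psi>"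
  unfolding forces_def by (auto intro: prv.intros)

lemma forces_mp: "W \<tturnstile> Imp \<phi> \<psi> \<Longrightarrow> W \<tturnstile> \<phi> \<Longrightarrow> W \<tturnstile> \<psi>"
  unfolding forces_def by (rule prv.impE)

text \<open>Among the larger worlds there is a generic one, the world with \<phi> added to its
  hypotheses; a proof of \<psi> there is the premise of \<longrightarrow>-introduction.\<close>

lemma forces_impI:
  assumes "world W" "internal \<phi>" "wff (fst W) \<phi>"
    and "\<And>W'. W \<sqsubseteq> W' \<Longrightarrow> W' \<tturnstile> \<phi> \<Longrightarrow> W' \<tturnstile> \<psi>"
  shows "W \<tturnstile> Imp \<phi> \<psi>"
proof -
  have "(fst W, \<phi> # snd W) \<tturnstile> \<psi>"
    by (rule assms(4)) (use assms(1-3) in \<open>auto simp: ext_def world_def forces_def intro: prv.hyp\<close>)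
  then show ?thesis using assms by (auto simp: forces_def intro: prv.impI)
qed

lemma forces_allE: "W \<tturnstile> All \<sigma> \<phi> \<Longrightarrow> hty W t \<sigma> \<Longrightarrow> W \<tturnstile> finst t \<phi>"
  unfolding forces_def by (rule prv.allE)

lemma forces_exI:
  "W \<tturnstile> finst t \<phi> \<Longrightarrow> hty W t \<sigma> \<Longrightarrow> internal \<phi> \<Longrightarrow> wff (\<sigma> # fst W) \<phi> \<Longrightarrow> W \<tturnstile> Ex \<sigma> \<phi>"
  unfolding forces_def by (rule prv.exI) auto

text \<open>Extensions of a context append the new variable at the end, so that terms and formulae of a
  world need not be lifted when they are used in a larger one; this renaming moves the new variable
  to the position 0 demanded by the rules.\<close>

definition rot :: "nat \<Rightarrow> nat \<Rightarrow> tm" where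
  "rot n i = (if i = n then Var 0 else Var (Suc i))"

lemma subst_ty_rot: "subst_ty (\<sigma> # \<Gamma>) (rot (length \<Gamma>)) (\<Gamma> @ [\<sigma>])"
  by (auto simp: subst_ty_def rot_def nth_append intro!: has_ty_VarI)

lemma fsubst_rot: "wff \<Gamma> \<phi> \<Longrightarrow> fsubst (rot (length \<Gamma>)) \<phi> = flift \<phi>"
  unfolding flift_def by (erule fsubst_cong) (simp add: rot_def)

lemma fsubst_rot_finst:
  assumes "wff (\<sigma> # \<Gamma>) \<phi>"
  shows "fsubst (rot (length \<Gamma>)) (finst (Var (length \<Gamma>)) \<phi>) = \<phi>"
proof -
  have "fsubst (rot (length \<Gamma>)) (finst (Var (length \<Gamma>)) \<phi>) = fsubst Var \<phi>"
    unfolding fsubst_finst using assms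
    by (rule fsubst_cong) (auto simp: rot_def split: nat.split)
  then show ?thesis by simp
qed

lemma map_fsubst_rot: "world (\<Gamma>, H) \<Longrightarrow> map (fsubst (rot (length \<Gamma>))) H = map flift H"
  by (auto simp: world_def fsubst_rot)

lemma forces_allI:
  assumes "world W" "wff (\<sigma> # fst W) \<phi>"
    and "\<And>W' t. W \<sqsubseteq> W' \<Longrightarrow> hty W' t \<sigma> \<Longrightarrow> W' \<tturnstile> finst t \<phi>"
  shows "W \<tturnstile> All \<sigma> \<phi>"
proof -
  obtain \<Gamma> H where W: "W = (\<Gamma>, H)" by (cases W)
  \<comment> \<open>The generic instance: the world with one more variable at the end, and that
    variable as the term.\<close>
  have "(\<Gamma> @ [\<sigma>], H) \<tturnstile> finst (Var (length \<Gamma>)) \<phi>"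
    by (rule assms(3)) (use assms(1) in \<open>auto simp: W ext_def world_def wff_mono intro!: has_ty_VarI\<close>)
  from forces_subst[OF this subst_ty_rot] show ?thesis
    using assms by (simp add: W fsubst_rot_finst map_fsubst_rot forces_def prv.allI)
qed

lemma forces_exE:
  assumes "W \<tturnstile> Ex \<sigma> \<phi>" "world W" "wff (fst W) \<chi>" "internal \<phi>"
    and "\<And>W' t. W \<sqsubseteq> W' \<Longrightarrow> hty W' t \<sigma> \<Longrightarrow> W' \<tturnstile> finst t \<phi> \<Longrightarrow> W' \<tturnstile> \<chi>"
  shows "W \<tturnstile> \<chi>"
proof -
  obtain \<Gamma> H where W: "W = (\<Gamma>, H)" by (cases W)
  let ?v = "Var (length \<Gamma>)"
  have v: "has_ty (\<Gamma> @ [\<sigma>]) ?v \<sigma>" by (rule has_ty_VarI) auto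
  have wf: "wff (\<sigma> # \<Gamma>) \<phi>" using forces_wff[OF assms(2,1)] W by simp
  then have wfv: "wff (\<Gamma> @ [\<sigma>]) (finst ?v \<phi>)"
    using wff_finst[of \<sigma> "\<Gamma> @ [\<sigma>]" \<phi> ?v] wff_mono[of "\<sigma> # \<Gamma>" \<phi> "[\<sigma>]"] v by simp
  \<comment> \<open>Witness and its property are adjoined together. After the renaming this is the
    premise of \<exists>-elimination: \<chi>, being well formed in the old context, turns into
    \<open>flift \<chi>\<close>.\<close>
  have "(\<Gamma> @ [\<sigma>], finst ?v \<phi> # H) \<tturnstile> \<chi>"
    by (rule assms(5))
      (use assms(2,4) v wfv in \<open>auto simp: W ext_def world_def wff_mono forces_def intro!: prv.hyp\<close>)
  from forces_subst[OF this subst_ty_rot]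
  have "(\<sigma> # \<Gamma>, \<phi> # map flift H) \<tturnstile> flift \<chi>"
    using assms(2,3) wf by (simp add: W fsubst_rot_finst map_fsubst_rot fsubst_rot)
  then show ?thesis using assms(1) unfolding forces_def W by (auto intro: prv.exE)
qed

section \<open>Provable equality and replacement\<close>

lemma eq_reflI: "hty W t \<sigma> \<Longrightarrow> W \<tturnstile> Eq \<sigma> t t"
  by (rule forces_ax) (auto intro: EHA_or_ax.intros)

lemma eq_symI:
  assumes "world W" "W \<tturnstile> Eq \<sigma> t u"
  shows "W \<tturnstile> Eq \<sigma> u t"
proof -
  have "W \<tturnstile> Imp (Eq \<sigma> t u) (Eq \<sigma> u t)"
    using forces_wff[OF assms] by (auto intro!: forces_ax EHA_or_ax.intros)
  then show ?thesis using assms(2) by (rule forces_mp)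
qed

lemma eq_transI:
  assumes "world W" "W \<tturnstile> Eq \<sigma> t u" "W \<tturnstile> Eq \<sigma> u v"
  shows "W \<tturnstile> Eq \<sigma> t v"
proof -
  have "W \<tturnstile> Imp (And (Eq \<sigma> t u) (Eq \<sigma> u v)) (Eq \<sigma> t v)"
    using forces_wff[OF assms(1,2)] forces_wff[OF assms(1,3)]
    by (auto intro!: forces_ax EHA_or_ax.intros)
  then show ?thesis using assms by (auto intro: forces_mp simp: forces_And)
qed

lemma eq_appI:
  assumes "world W" "W \<tturnstile> Eq (\<sigma> \<^bold>\<rightarrow> \<tau>) f g" "W \<tturnstile> Eq \<sigma> t u"
  shows "W \<tturnstile> Eq \<tau> (f \<^bold>\<cdot> t) (g \<^bold>\<cdot> u)"
proof -
  have "W \<tturnstile> Imp (And (Eq (\<sigma> \<^bold>\<rightarrow> \<tau>) f g) (Eq \<sigma> t u)) (Eq \<tau> (f \<^bold>\<cdot> t) (g \<^bold>\<cdot> u))"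
    using forces_wff[OF assms(1,2)] forces_wff[OF assms(1,3)]
    by (auto intro!: forces_ax EHA_or_ax.intros intro: has_ty.intros)
  then show ?thesis using assms by (auto intro: forces_mp simp: forces_And)
qed

definition eq_subst :: "world \<Rightarrow> ty list \<Rightarrow> (nat \<Rightarrow> tm) \<Rightarrow> (nat \<Rightarrow> tm) \<Rightarrow> bool" where
  "eq_subst W \<Gamma> \<theta> \<theta>' \<longleftrightarrow> (\<forall>i<length \<Gamma>. W \<tturnstile> Eq (\<Gamma> ! i) (\<theta> i) (\<theta>' i))"

lemma eq_subst_sym: "world W \<Longrightarrow> eq_subst W \<Gamma> \<theta> \<theta>' \<Longrightarrow> eq_subst W \<Gamma> \<theta>' \<theta>"
  by (auto simp: eq_subst_def intro: eq_symI)

lemma eq_subst_ext: "W \<sqsubseteq> W' \<Longrightarrow> eq_subst W \<Gamma> \<theta> \<theta>' \<Longrightarrow> eq_subst W' \<Gamma> \<theta> \<theta>'"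
  by (auto simp: eq_subst_def intro: forces_mono)

lemma eq_subst_ty: "world W \<Longrightarrow> eq_subst W \<Gamma> \<theta> \<theta>' \<Longrightarrow> subst_ty (fst W) \<theta> \<Gamma> \<and> subst_ty (fst W) \<theta>' \<Gamma>"
  by (auto simp: eq_subst_def subst_ty_def dest: forces_wff)

lemma eq_subst_case_nat:
  "eq_subst W \<Gamma> \<theta> \<theta>' \<Longrightarrow> W \<tturnstile> Eq \<sigma> t u \<Longrightarrow> eq_subst W (\<sigma> # \<Gamma>) (case_nat t \<theta>) (case_nat u \<theta>')"
  by (auto simp: eq_subst_def less_Suc_eq_0_disj)

lemma tsubst_eq:
  "has_ty \<Gamma> t \<tau> \<Longrightarrow> world W \<Longrightarrow> eq_subst W \<Gamma> \<theta> \<theta>' \<Longrightarrow> W \<tturnstile> Eq \<tau> (tsubst \<theta> t) (tsubst \<theta>' t)"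
  by (induction rule: has_ty.induct)
    (auto simp: eq_subst_def intro: eq_appI eq_reflI has_ty.intros)

text \<open>The axioms give congruence for application only; replacement in formulae is obtained by
  induction on the formula. An implication needs its antecedent transported backwards, which is
  possible since both substitutions are generalised and equality is symmetric. Under a quantifier
  both substitutions are extended by the same term.\<close>

lemma leibniz:
  assumes "world W" "eq_subst W \<Gamma> \<theta> \<theta>'" "wff \<Gamma> \<phi>" "internal \<phi>" "or_free \<phi>" "W \<tturnstile> fsubst \<theta> \<phi>"
  shows "W \<tturnstile> fsubst \<theta>' \<phi>"
  using assms
proof (induction \<phi> arbitrary: W \<Gamma> \<theta> \<theta>')
  case (Eq \<sigma> t u)
  have "W \<tturnstile> Eq \<sigma> (tsubst \<theta>' t) (tsubst \<theta> t)" "W \<tturnstile> Eq \<sigma> (tsubst \<theta> u) (tsubst \<theta>' u)"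
    using Eq.prems(1,2,3) eq_subst_sym[OF Eq.prems(1,2)] by (auto intro!: tsubst_eq[of \<Gamma>])
  then show ?case using Eq.prems(1,6) eq_transI by (metis fsubst.simps(2))
next
  case (And \<phi> \<psi>)
  then show ?case by (auto simp: forces_And)
next
  case (Imp \<phi> \<psi>)
  show ?case unfolding fsubst.simps
  proof (rule forces_impI)
    show "wff (fst W) (fsubst \<theta>' \<phi>)"
      using Imp.prems eq_subst_ty[OF Imp.prems(1,2)] by (auto intro!: wff_fsubst)
    fix W' assume W': "W \<sqsubseteq> W'" "W' \<tturnstile> fsubst \<theta>' \<phi>"
    have eq: "world W'" "eq_subst W' \<Gamma> \<theta> \<theta>'" "eq_subst W' \<Gamma> \<theta>' \<theta>"
      using W'(1) Imp.prems(2) ext_world eq_subst_ext eq_subst_sym by metis+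
    have "W' \<tturnstile> fsubst \<theta> \<phi>"
      by (rule Imp.IH(1)[of W' \<Gamma> \<theta>'])
        (use Imp.prems W' eq in auto)
    with forces_mono[OF W'(1) Imp.prems(6)[simplified]] have "W' \<tturnstile> fsubst \<theta> \<psi>"
      by (rule forces_mp)
    then show "W' \<tturnstile> fsubst \<theta>' \<psi>"
      by (rule Imp.IH(2)[of W' \<Gamma> \<theta>, rotated -1]) (use Imp.prems eq in auto)
  qed (use Imp.prems in auto)
next
  case (All \<sigma> \<phi>)
  show ?case unfolding fsubst.simps
  proof (rule forces_allI)
    show "wff (\<sigma> # fst W) (fsubst (up \<theta>') \<phi>)"
      using All.prems eq_subst_ty[OF All.prems(1,2)] by (auto intro!: wff_fsubst subst_ty_up)
    fix W' t assume W': "W \<sqsubseteq> W'" "hty W' t \<sigma>"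
    have "W' \<tturnstile> fsubst (case_nat t \<theta>) \<phi>"
      using forces_allE[OF forces_mono[OF W'(1) All.prems(6)[simplified]] W'(2)] by simp
    then have "W' \<tturnstile> fsubst (case_nat t \<theta>') \<phi>"
      by (rule All.IH[of W' "\<sigma> # \<Gamma>", rotated -1])
        (use All.prems W' in \<open>auto intro!: eq_subst_case_nat eq_reflI intro: ext_world eq_subst_ext\<close>)
    then show "W' \<tturnstile> finst t (fsubst (up \<theta>') \<phi>)" by simp
  qed (use All.prems in auto)
next
  case (Ex \<sigma> \<phi>)
  have wf: "wff (\<sigma> # fst W) (fsubst (up \<theta>') \<phi>)"
    using Ex.prems eq_subst_ty[OF Ex.prems(1,2)] by (auto intro!: wff_fsubst subst_ty_up)
  show ?case unfolding fsubst.simps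
  proof (rule forces_exE[OF Ex.prems(6)[simplified]])
    fix W' t assume W': "W \<sqsubseteq> W'" "hty W' t \<sigma>" "W' \<tturnstile> finst t (fsubst (up \<theta>) \<phi>)"
    have "W' \<tturnstile> fsubst (case_nat t \<theta>) \<phi>" using W' by simp
    then have "W' \<tturnstile> fsubst (case_nat t \<theta>') \<phi>"
      by (rule Ex.IH[of W' "\<sigma> # \<Gamma>", rotated -1])
        (use Ex.prems W' in \<open>auto intro!: eq_subst_case_nat eq_reflI intro: ext_world eq_subst_ext\<close>)
    then show "W' \<tturnstile> Ex \<sigma> (fsubst (up \<theta>') \<phi>)"
      using W' wf Ex.prems by (auto intro!: forces_exI[of _ t] intro: wff_ext1)
  qed (use Ex.prems wf in auto)
qed auto

end

section \<open>Typed tuples and evaluation of open terms\<close>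

fun rel3 :: "('a \<Rightarrow> 'b \<Rightarrow> 'c \<Rightarrow> bool) \<Rightarrow> 'a list \<Rightarrow> 'b list \<Rightarrow> 'c list \<Rightarrow> bool" where
  "rel3 P [] [] [] = True"
| "rel3 P (a # as) (b # bs) (c # cs) = (P a b c \<and> rel3 P as bs cs)"
| "rel3 P _ _ _ = False"

lemma rel3_conv_nth:
  "rel3 P as bs cs \<longleftrightarrow> length bs = length as \<and> length cs = length as \<and> (\<forall>i<length as. P (as ! i) (bs ! i) (cs ! i))"
  by (induction P as bs cs rule: rel3.induct) (auto simp: less_Suc_eq_0_disj)

lemma rel3_append:
  "length bs = length as \<Longrightarrow> length cs = length as \<Longrightarrow>
    rel3 P (as @ as') (bs @ bs') (cs @ cs') \<longleftrightarrow> rel3 P as bs cs \<and> rel3 P as' bs' cs'"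
  by (induction P as bs cs rule: rel3.induct) auto

lemma rel3_length: "rel3 P as bs cs \<Longrightarrow> length bs = length as \<and> length cs = length as"
  by (simp add: rel3_conv_nth)

lemma rel3_mono: "rel3 P as bs cs \<Longrightarrow> (\<And>a b c. P a b c \<Longrightarrow> Q a b c) \<Longrightarrow> rel3 Q as bs cs"
  by (simp add: rel3_conv_nth)

text \<open>An open term over a list of types is read as a function of a tuple: variable
  \<open>i\<close> is the \<open>i\<close>-th argument. With this order a context
  \<open>\<Gamma> @ \<Gamma>'\<close> is evaluated at a concatenation of tuples, in contrast to
  bound variables, which count from the innermost binder.\<close>

definition inst :: "tm list \<Rightarrow> tm \<Rightarrow> tm" where
  "inst xs = tsubst (\<lambda>i. xs ! i)"

lemma inst_simps [simp]:
  "inst xs (Var i) = xs ! i" "inst xs (Cst c) = Cst c" "inst xs (f \<^bold>\<cdot> t) = inst xs f \<^bold>\<cdot> inst xs t"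
  by (simp_all add: inst_def)

lemma inst_closed: "has_ty [] t \<tau> \<Longrightarrow> inst xs t = t"
  unfolding inst_def by (rule tsubst_closed)

lemma subst_ty_nth: "list_all2 (has_ty \<Gamma>) xs \<sigma>s \<Longrightarrow> subst_ty \<Gamma> (\<lambda>i. xs ! i) \<sigma>s"
  by (auto simp: subst_ty_def list_all2_conv_all_nth)

lemma has_ty_inst: "has_ty \<sigma>s t \<tau> \<Longrightarrow> list_all2 (has_ty \<Gamma>) xs \<sigma>s \<Longrightarrow> has_ty \<Gamma> (inst xs t) \<tau>"
  unfolding inst_def by (rule has_ty_tsubst[OF _ subst_ty_nth])

lemma has_ty_apps: "has_ty \<Gamma> f (arrs \<sigma>s \<tau>) \<Longrightarrow> list_all2 (has_ty \<Gamma>) xs \<sigma>s \<Longrightarrow> has_ty \<Gamma> (apps f xs) \<tau>"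
proof (induction xs arbitrary: f \<sigma>s)
  case (Cons x xs)
  then obtain \<sigma> \<sigma>s' where "\<sigma>s = \<sigma> # \<sigma>s'" "has_ty \<Gamma> x \<sigma>" "list_all2 (has_ty \<Gamma>) xs \<sigma>s'"
    by (auto simp: list_all2_Cons1)
  then show ?case using Cons.IH[of "f \<^bold>\<cdot> x" \<sigma>s'] Cons.prems(1) has_ty.intros(3) by simp
qed simp

lemma finst_simps [simp]:
  "finst t Bot = Bot"
  "finst t (Eq \<sigma> u v) = Eq \<sigma> (tsubst (case_nat t Var) u) (tsubst (case_nat t Var) v)"
  "finst t (And \<phi> \<psi>) = And (finst t \<phi>) (finst t \<psi>)"
  "finst t (Imp \<phi> \<psi>) = Imp (finst t \<phi>) (finst t \<psi>)"
  "finst t (All \<sigma> \<phi>) = All \<sigma> (fsubst (up (case_nat t Var)) \<phi>)"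
  "finst t (Ex \<sigma> \<phi>) = Ex \<sigma> (fsubst (up (case_nat t Var)) \<phi>)"
  by (simp_all add: finst_def)

lemma tsubst_case_nat_tlift [simp]:
  "tsubst (case_nat t \<theta>) (tlift (Suc n) u) = tsubst \<theta> (tlift n u)"
  by (simp add: tsubst_tlift)

lemma finst_fsucc: "finst t (fsucc \<phi>) = finst (suc t) \<phi>"
proof -
  have "(\<lambda>i. tsubst (case_nat t Var) (case_nat (suc (Var 0)) (\<lambda>i. Var (Suc i)) i)) = case_nat (suc t) Var"
    by (auto simp: fun_eq_iff split: nat.split)
  then show ?thesis by (simp add: finst_def fsucc_def fsubst_fsubst)
qed

lemma wff_fsucc: "wff (N # \<Gamma>) \<phi> \<Longrightarrow> wff (N # \<Gamma>) (fsucc \<phi>)"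
  unfolding fsucc_def
  by (erule wff_fsubst)
    (auto simp: subst_ty_def less_Suc_eq_0_disj intro!: has_ty.intros has_ty_VarI cst_ty.intros)

lemma has_ty_zero [simp]: "has_ty \<Gamma> zero N"
  by (auto intro!: has_ty.intros cst_ty.intros)

lemma has_ty_suc: "has_ty \<Gamma> t N \<Longrightarrow> has_ty \<Gamma> (suc t) N"
  by (auto intro!: has_ty.intros cst_ty.intros)

lemma has_ty_Rec1: "has_ty \<Gamma> (Cst (Rec [\<sigma>] 0)) (\<sigma> \<^bold>\<rightarrow> (N \<^bold>\<rightarrow> \<sigma> \<^bold>\<rightarrow> \<sigma>) \<^bold>\<rightarrow> N \<^bold>\<rightarrow> \<sigma>)"
  using cst_ty.intros(5)[of 0 "[\<sigma>]"] by (auto intro: has_ty.intros)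

lemma has_ty_K: "has_ty \<Gamma> t \<sigma> \<Longrightarrow> has_ty \<Gamma> (Cst (CombK \<sigma> \<tau>) \<^bold>\<cdot> t) (\<tau> \<^bold>\<rightarrow> \<sigma>)"
  by (auto intro!: has_ty.intros cst_ty.intros)

lemma has_ty_plus: "has_ty \<Gamma> m N \<Longrightarrow> has_ty \<Gamma> n N \<Longrightarrow> has_ty \<Gamma> (plus_tm m n) N"
  unfolding plus_tm_def
  by (rule has_ty.intros(3) has_ty_Rec1 has_ty_K has_ty.intros(2) cst_ty.intros | assumption)+

lemma tsubst_plus [simp]: "tsubst \<theta> (plus_tm m n) = plus_tm (tsubst \<theta> m) (tsubst \<theta> n)"
  by (simp add: plus_tm_def)

context ha_theory
begin

abbreviation eqs :: "world \<Rightarrow> ty list \<Rightarrow> tm list \<Rightarrow> tm list \<Rightarrow> bool" where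
  "eqs W \<equiv> rel3 (\<lambda>\<sigma> t u. W \<tturnstile> Eq \<sigma> t u)"

abbreviation mems :: "world \<Rightarrow> ty list \<Rightarrow> tm list \<Rightarrow> tm list \<Rightarrow> bool" where
  "mems W \<equiv> rel3 (\<lambda>\<sigma> y s. W \<tturnstile> Mem \<sigma> y s)"

lemma eqs_ext: "W \<sqsubseteq> W' \<Longrightarrow> eqs W \<sigma>s ts us \<Longrightarrow> eqs W' \<sigma>s ts us"
  by (auto intro: forces_mono elim: rel3_mono)

lemma mems_ext: "W \<sqsubseteq> W' \<Longrightarrow> mems W \<sigma>s ts us \<Longrightarrow> mems W' \<sigma>s ts us"
  by (auto intro: forces_mono elim: rel3_mono)

lemma eqs_refl: "htys W ts \<sigma>s \<Longrightarrow> eqs W \<sigma>s ts ts"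
  by (auto simp: rel3_conv_nth list_all2_conv_all_nth intro: eq_reflI)

lemma eqs_sym: "world W \<Longrightarrow> eqs W \<sigma>s ts us \<Longrightarrow> eqs W \<sigma>s us ts"
  by (auto simp: rel3_conv_nth intro: eq_symI)

lemma eqs_subst: "eqs W \<sigma>s ts us \<Longrightarrow> eq_subst W \<sigma>s (\<lambda>i. ts ! i) (\<lambda>i. us ! i)"
  by (simp add: rel3_conv_nth eq_subst_def)

lemma inst_eq: "has_ty \<sigma>s t \<tau> \<Longrightarrow> world W \<Longrightarrow> eqs W \<sigma>s xs ys \<Longrightarrow> W \<tturnstile> Eq \<tau> (inst xs t) (inst ys t)"
  unfolding inst_def by (rule tsubst_eq[OF _ _ eqs_subst])

section \<open>Combinatory completeness\<close>

lemma comb_k_eq: "hty W t \<sigma> \<Longrightarrow> hty W u \<tau> \<Longrightarrow> W \<tturnstile> Eq \<sigma> (Cst (CombK \<sigma> \<tau>) \<^bold>\<cdot> t \<^bold>\<cdot> u) t"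
  by (rule forces_ax) (auto intro: EHA_or_ax.intros intro!: has_ty.intros cst_ty.intros)

lemma comb_s_eq:
  assumes "hty W t (\<rho> \<^bold>\<rightarrow> \<sigma> \<^bold>\<rightarrow> \<tau>)" "hty W u (\<rho> \<^bold>\<rightarrow> \<sigma>)" "hty W v \<rho>"
  shows "W \<tturnstile> Eq \<tau> (Cst (CombS \<rho> \<sigma> \<tau>) \<^bold>\<cdot> t \<^bold>\<cdot> u \<^bold>\<cdot> v) (t \<^bold>\<cdot> v \<^bold>\<cdot> (u \<^bold>\<cdot> v))"
proof (rule forces_ax)
  show "wff (fst W) (Eq \<tau> (Cst (CombS \<rho> \<sigma> \<tau>) \<^bold>\<cdot> t \<^bold>\<cdot> u \<^bold>\<cdot> v) (t \<^bold>\<cdot> v \<^bold>\<cdot> (u \<^bold>\<cdot> v)))"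
    using assms by simp (blast intro: has_ty.intros cst_ty.intros)
qed (auto intro: EHA_or_ax.intros)

text \<open>Bracket abstraction of the last variable of the context: K for constants and for the
  other variables, S K K for the abstracted variable, S for applications. The equation is one of the
  theory, in an arbitrary world, because K and S reduce only up to provable equality.\<close>

lemma lam1:
  assumes "has_ty (\<Gamma> @ [\<sigma>]) t \<tau>"
  shows "\<exists>t'. has_ty \<Gamma> t' (\<sigma> \<^bold>\<rightarrow> \<tau>) \<and> (\<forall>W xs u. world W \<longrightarrow> htys W xs \<Gamma> \<longrightarrow> hty W u \<sigma> \<longrightarrow>
    W \<tturnstile> Eq \<tau> (inst xs t' \<^bold>\<cdot> u) (inst (xs @ [u]) t))"
  using assms
proof (induction t arbitrary: \<tau>)
  case (Var i)
  then have i: "i < length \<Gamma> + 1" "\<tau> = (\<Gamma> @ [\<sigma>]) ! i" by (auto elim!: has_ty_VarE)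
  show ?case
  proof (cases "i < length \<Gamma>")
    case True
    show ?thesis
    proof (intro HOL.exI[of _ "Cst (CombK \<tau> \<sigma>) \<^bold>\<cdot> Var i"] conjI HOL.allI HOL.impI)
      show "has_ty \<Gamma> (Cst (CombK \<tau> \<sigma>) \<^bold>\<cdot> Var i) (\<sigma> \<^bold>\<rightarrow> \<tau>)"
        using True i by (auto intro!: has_ty_K has_ty_VarI simp: nth_append)
      fix W xs u assume "world W" "htys W xs \<Gamma>" "hty W u \<sigma>"
      then show "W \<tturnstile> Eq \<tau> (inst xs (Cst (CombK \<tau> \<sigma>) \<^bold>\<cdot> Var i) \<^bold>\<cdot> u) (inst (xs @ [u]) (Var i))"
        using True i by (auto simp: nth_append list_all2_conv_all_nth intro!: comb_k_eq)
    qed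
  next
    case False
    then have [simp]: "i = length \<Gamma>" "\<tau> = \<sigma>" using i by (auto simp: nth_append)
    \<comment> \<open>The identity as S K K. The first K discards an argument of function type,
      namely the value of the second K.\<close>
    let ?s = "Cst (CombS \<sigma> (\<sigma> \<^bold>\<rightarrow> \<sigma>) \<sigma>)" and ?k = "Cst (CombK \<sigma> (\<sigma> \<^bold>\<rightarrow> \<sigma>))" and ?k' = "Cst (CombK \<sigma> \<sigma>)"
    have ty: "has_ty \<Gamma>' ?k (\<sigma> \<^bold>\<rightarrow> (\<sigma> \<^bold>\<rightarrow> \<sigma>) \<^bold>\<rightarrow> \<sigma>)" "has_ty \<Gamma>' ?k' (\<sigma> \<^bold>\<rightarrow> \<sigma> \<^bold>\<rightarrow> \<sigma>)" for \<Gamma>'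
      by (auto intro!: has_ty.intros cst_ty.intros)
    show ?thesis
    proof (intro HOL.exI[of _ "?s \<^bold>\<cdot> ?k \<^bold>\<cdot> ?k'"] conjI HOL.allI HOL.impI)
      show "has_ty \<Gamma> (?s \<^bold>\<cdot> ?k \<^bold>\<cdot> ?k') (\<sigma> \<^bold>\<rightarrow> \<tau>)"
        by (auto intro!: has_ty.intros cst_ty.intros)
      fix W xs u assume W: "world W" "htys W xs \<Gamma>" "hty W u \<sigma>"
      have "W \<tturnstile> Eq \<sigma> (?s \<^bold>\<cdot> ?k \<^bold>\<cdot> ?k' \<^bold>\<cdot> u) (?k \<^bold>\<cdot> u \<^bold>\<cdot> (?k' \<^bold>\<cdot> u))"
        by (rule comb_s_eq) (use W ty in auto)
      moreover have "W \<tturnstile> Eq \<sigma> (?k \<^bold>\<cdot> u \<^bold>\<cdot> (?k' \<^bold>\<cdot> u)) u"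
        by (rule comb_k_eq) (use W in \<open>auto intro: has_ty_K\<close>)
      ultimately have "W \<tturnstile> Eq \<sigma> (?s \<^bold>\<cdot> ?k \<^bold>\<cdot> ?k' \<^bold>\<cdot> u) u" by (rule eq_transI[OF W(1)])
      then show "W \<tturnstile> Eq \<tau> (inst xs (?s \<^bold>\<cdot> ?k \<^bold>\<cdot> ?k') \<^bold>\<cdot> u) (inst (xs @ [u]) (Var i))"
        using list_all2_lengthD[OF W(2)] by (simp add: nth_append)
    qed
  qed
next
  case (Cst c)
  then have c: "has_ty \<Gamma>' (Cst c) \<tau>" for \<Gamma>' by (auto elim: has_ty_CstE intro: has_ty.intros)
  show ?case
    by (rule HOL.exI[of _ "Cst (CombK \<tau> \<sigma>) \<^bold>\<cdot> Cst c"]) (auto intro!: has_ty_K comb_k_eq c)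
next
  case (App f t)
  then obtain \<rho> where "has_ty (\<Gamma> @ [\<sigma>]) f (\<rho> \<^bold>\<rightarrow> \<tau>)" "has_ty (\<Gamma> @ [\<sigma>]) t \<rho>"
    by (auto elim: has_ty_AppE)
  then obtain f' t' where f': "has_ty \<Gamma> f' (\<sigma> \<^bold>\<rightarrow> \<rho> \<^bold>\<rightarrow> \<tau>)" and t': "has_ty \<Gamma> t' (\<sigma> \<^bold>\<rightarrow> \<rho>)"
    and eqf: "\<And>W xs u. world W \<Longrightarrow> htys W xs \<Gamma> \<Longrightarrow> hty W u \<sigma> \<Longrightarrow>
      W \<tturnstile> Eq (\<rho> \<^bold>\<rightarrow> \<tau>) (inst xs f' \<^bold>\<cdot> u) (inst (xs @ [u]) f)"
    and eqt: "\<And>W xs u. world W \<Longrightarrow> htys W xs \<Gamma> \<Longrightarrow> hty W u \<sigma> \<Longrightarrow>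
      W \<tturnstile> Eq \<rho> (inst xs t' \<^bold>\<cdot> u) (inst (xs @ [u]) t)"
    using App.IH by metis
  let ?s = "Cst (CombS \<sigma> \<rho> \<tau>)"
  show ?case
  proof (intro HOL.exI[of _ "?s \<^bold>\<cdot> f' \<^bold>\<cdot> t'"] conjI HOL.allI HOL.impI)
    show "has_ty \<Gamma> (?s \<^bold>\<cdot> f' \<^bold>\<cdot> t') (\<sigma> \<^bold>\<rightarrow> \<tau>)"
      using f' t' by (blast intro: has_ty.intros cst_ty.intros)
    fix W xs u assume W: "world W" "htys W xs \<Gamma>" "hty W u \<sigma>"
    have "W \<tturnstile> Eq \<tau> (?s \<^bold>\<cdot> inst xs f' \<^bold>\<cdot> inst xs t' \<^bold>\<cdot> u) (inst xs f' \<^bold>\<cdot> u \<^bold>\<cdot> (inst xs t' \<^bold>\<cdot> u))"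
      by (rule comb_s_eq) (use W f' t' in \<open>auto intro: has_ty_inst\<close>)
    moreover have "W \<tturnstile> Eq \<tau> (inst xs f' \<^bold>\<cdot> u \<^bold>\<cdot> (inst xs t' \<^bold>\<cdot> u)) (inst (xs @ [u]) (f \<^bold>\<cdot> t))"
      using eq_appI[OF W(1) eqf[OF W] eqt[OF W]] by simp
    ultimately show "W \<tturnstile> Eq \<tau> (inst xs (?s \<^bold>\<cdot> f' \<^bold>\<cdot> t') \<^bold>\<cdot> u) (inst (xs @ [u]) (f \<^bold>\<cdot> t))"
      using eq_transI[OF W(1)] by simp
  qed
qed

text \<open>Abstraction proceeds from the last variable of \<open>\<Gamma>'\<close> to the first, so
  that the arguments can be supplied in the order of the tuple.\<close>

lemma lam:
  assumes "has_ty (\<Gamma> @ \<Gamma>') t \<tau>"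
  shows "\<exists>t'. has_ty \<Gamma> t' (arrs \<Gamma>' \<tau>) \<and> (\<forall>W xs us. world W \<longrightarrow> htys W xs \<Gamma> \<longrightarrow> htys W us \<Gamma>' \<longrightarrow>
    W \<tturnstile> Eq \<tau> (apps (inst xs t') us) (inst (xs @ us) t))"
  using assms
proof (induction \<Gamma>' arbitrary: t \<tau> rule: rev_induct)
  case Nil
  then show ?case by (auto intro!: HOL.exI[of _ t] eq_reflI has_ty_inst)
next
  case (snoc \<sigma> \<Gamma>')
  then obtain t1 where t1: "has_ty (\<Gamma> @ \<Gamma>') t1 (\<sigma> \<^bold>\<rightarrow> \<tau>)"
    and eq1: "\<And>W xs u. world W \<Longrightarrow> htys W xs (\<Gamma> @ \<Gamma>') \<Longrightarrow> hty W u \<sigma> \<Longrightarrow>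
      W \<tturnstile> Eq \<tau> (inst xs t1 \<^bold>\<cdot> u) (inst (xs @ [u]) t)"
    using lam1[of "\<Gamma> @ \<Gamma>'" \<sigma> t \<tau>] by auto
  obtain t' where t': "has_ty \<Gamma> t' (arrs \<Gamma>' (\<sigma> \<^bold>\<rightarrow> \<tau>))"
    and eq': "\<And>W xs us. world W \<Longrightarrow> htys W xs \<Gamma> \<Longrightarrow> htys W us \<Gamma>' \<Longrightarrow>
      W \<tturnstile> Eq (\<sigma> \<^bold>\<rightarrow> \<tau>) (apps (inst xs t') us) (inst (xs @ us) t1)"
    using snoc.IH[OF t1] by auto
  show ?case
  proof (intro HOL.exI[of _ t'] conjI HOL.allI HOL.impI)
    show "has_ty \<Gamma> t' (arrs (\<Gamma>' @ [\<sigma>]) \<tau>)" using t' by simp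
    fix W xs us assume W: "world W" "htys W xs \<Gamma>" "htys W us (\<Gamma>' @ [\<sigma>])"
    then obtain us' u where us: "us = us' @ [u]" "htys W us' \<Gamma>'" "hty W u \<sigma>"
      by (auto simp: list_all2_append2 list_all2_Cons2)
    have "W \<tturnstile> Eq \<tau> (apps (inst xs t') us' \<^bold>\<cdot> u) (inst (xs @ us') t1 \<^bold>\<cdot> u)"
      using eq_appI[OF W(1) eq'[OF W(1,2) us(2)] eq_reflI[OF us(3)]] .
    moreover have "W \<tturnstile> Eq \<tau> (inst (xs @ us') t1 \<^bold>\<cdot> u) (inst ((xs @ us') @ [u]) t)"
      by (rule eq1) (use W us in \<open>auto intro: list_all2_appendI\<close>)
    ultimately show "W \<tturnstile> Eq \<tau> (apps (inst xs t') us) (inst (xs @ us) t)"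
      using eq_transI[OF W(1)] us by (simp add: apps_append)
  qed
qed

section \<open>Recursion, induction and case distinction on numbers\<close>

lemma rec1_zero_eq:
  "hty W t \<sigma> \<Longrightarrow> hty W u (N \<^bold>\<rightarrow> \<sigma> \<^bold>\<rightarrow> \<sigma>) \<Longrightarrow> W \<tturnstile> Eq \<sigma> (Cst (Rec [\<sigma>] 0) \<^bold>\<cdot> t \<^bold>\<cdot> u \<^bold>\<cdot> zero) t"
  using EHA_or_ax.rec_zero[of "[t]" "[\<sigma>]" "[u]" 0]
  by (auto intro!: forces_ax) (rule has_ty_Rec1 has_ty_zero has_ty.intros(3) | assumption)+

lemma rec1_suc_eq:
  "hty W t \<sigma> \<Longrightarrow> hty W u (N \<^bold>\<rightarrow> \<sigma> \<^bold>\<rightarrow> \<sigma>) \<Longrightarrow> hty W v N \<Longrightarrow>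
    W \<tturnstile> Eq \<sigma> (Cst (Rec [\<sigma>] 0) \<^bold>\<cdot> t \<^bold>\<cdot> u \<^bold>\<cdot> suc v) (u \<^bold>\<cdot> v \<^bold>\<cdot> (Cst (Rec [\<sigma>] 0) \<^bold>\<cdot> t \<^bold>\<cdot> u \<^bold>\<cdot> v))"
  using EHA_or_ax.rec_suc[of "[t]" "[\<sigma>]" "[u]" 0 v]
  by (auto intro!: forces_ax) (rule has_ty_Rec1 has_ty_suc has_ty.intros(3) | assumption)+

lemma lrec_empty_eq:
  "hty W t \<rho> \<Longrightarrow> hty W u (\<sigma> \<^bold>\<rightarrow> Seq \<sigma> \<^bold>\<rightarrow> \<rho> \<^bold>\<rightarrow> \<rho>) \<Longrightarrow>
    W \<tturnstile> Eq \<rho> (Cst (LRec \<sigma> \<rho>) \<^bold>\<cdot> t \<^bold>\<cdot> u \<^bold>\<cdot> Cst (Empty \<sigma>)) t"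
  by (rule forces_ax) (auto intro: EHA_or_ax.intros intro!: has_ty.intros cst_ty.intros)

lemma lrec_prep_eq:
  assumes "hty W t \<rho>" "hty W u (\<sigma> \<^bold>\<rightarrow> Seq \<sigma> \<^bold>\<rightarrow> \<rho> \<^bold>\<rightarrow> \<rho>)" "hty W a \<sigma>" "hty W s (Seq \<sigma>)"
  shows "W \<tturnstile> Eq \<rho> (Cst (LRec \<sigma> \<rho>) \<^bold>\<cdot> t \<^bold>\<cdot> u \<^bold>\<cdot> (Cst (Prep \<sigma>) \<^bold>\<cdot> a \<^bold>\<cdot> s))
    (u \<^bold>\<cdot> a \<^bold>\<cdot> s \<^bold>\<cdot> (Cst (LRec \<sigma> \<rho>) \<^bold>\<cdot> t \<^bold>\<cdot> u \<^bold>\<cdot> s))"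
proof (rule forces_ax)
  show "wff (fst W) (Eq \<rho> (Cst (LRec \<sigma> \<rho>) \<^bold>\<cdot> t \<^bold>\<cdot> u \<^bold>\<cdot> (Cst (Prep \<sigma>) \<^bold>\<cdot> a \<^bold>\<cdot> s))
    (u \<^bold>\<cdot> a \<^bold>\<cdot> s \<^bold>\<cdot> (Cst (LRec \<sigma> \<rho>) \<^bold>\<cdot> t \<^bold>\<cdot> u \<^bold>\<cdot> s)))"
    using assms by simp (meson has_ty.intros cst_ty.intros)
qed (auto intro: EHA_or_ax.intros)

text \<open>The induction axiom as a rule on worlds. The step is demanded in all larger worlds,
  since it has to yield a universally quantified implication.\<close>

lemma nat_induct:
  assumes "world W" "wff (N # fst W) \<phi>" "internal \<phi>" "or_free \<phi>" "W \<tturnstile> finst zero \<phi>"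
    and step: "\<And>W' t. W \<sqsubseteq> W' \<Longrightarrow> hty W' t N \<Longrightarrow> W' \<tturnstile> finst t \<phi> \<Longrightarrow> W' \<tturnstile> finst (suc t) \<phi>"
    and "hty W t N"
  shows "W \<tturnstile> finst t \<phi>"
proof -
  have "W \<tturnstile> Imp (And (finst zero \<phi>) (All N (Imp \<phi> (fsucc \<phi>)))) (All N \<phi>)"
    by (rule forces_ax)
      (use assms(2-4) in \<open>auto intro: EHA_or_ax.intros intro!: wff_finst wff_fsucc\<close>)
  moreover have "W \<tturnstile> All N (Imp \<phi> (fsucc \<phi>))"
  proof (rule forces_allI)
    fix W' t assume W': "W \<sqsubseteq> W'" "hty W' t N"
    show "W' \<tturnstile> finst t (Imp \<phi> (fsucc \<phi>))"
      unfolding finst_simps finst_fsucc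
    proof (rule forces_impI)
      show "world W'" using W' by (auto intro: ext_world)
      show "internal (finst t \<phi>)" using assms by simp
      show "wff (fst W') (finst t \<phi>)" using assms W' by (auto intro: wff_finst wff_ext1)
      fix W'' assume "W' \<sqsubseteq> W''" "W'' \<tturnstile> finst t \<phi>"
      then show "W'' \<tturnstile> finst (suc t) \<phi>" using W' by (auto intro: step ext_trans hty_ext)
    qed
  qed (use assms in \<open>auto intro: wff_fsucc\<close>)
  ultimately have "W \<tturnstile> All N \<phi>" using assms(5) by (auto simp: forces_And dest!: forces_mp)
  then show ?thesis using assms by (auto intro: forces_allE)
qed

lemma nat_cases:
  assumes "world W" "hty W t N" "wff (fst W) \<chi>" "internal \<chi>" "or_free \<chi>"
    and z: "\<And>W'. W \<sqsubseteq> W' \<Longrightarrow> W' \<tturnstile> Eq N t zero \<Longrightarrow> W' \<tturnstile> \<chi>"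
    and s: "\<And>W' u. W \<sqsubseteq> W' \<Longrightarrow> hty W' u N \<Longrightarrow> W' \<tturnstile> Eq N t (suc u) \<Longrightarrow> W' \<tturnstile> \<chi>"
  shows "W \<tturnstile> \<chi>"
proof -
  \<comment> \<open>Induction on \<open>n\<close> for \<open>t = n \<longrightarrow> \<chi>\<close>,
    finally taken at \<open>t\<close> itself. Base and step are exactly the two cases.\<close>
  let ?\<phi> = "Imp (Eq N (tlift 1 t) (Var 0)) (flift \<chi>)"
  have fi: "finst u ?\<phi> = Imp (Eq N t u) \<chi>" for u by simp
  have "W \<tturnstile> finst t ?\<phi>"
  proof (rule nat_induct)
    show "wff (N # fst W) ?\<phi>"
      using assms has_ty_tlift1[of "fst W" t N N] by (auto intro: wff_flift has_ty_VarI)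
    show "W \<tturnstile> finst zero ?\<phi>"
      unfolding fi by (rule forces_impI) (use assms in auto)
    fix W' u assume W': "W \<sqsubseteq> W'" "hty W' u N"
    show "W' \<tturnstile> finst (suc u) ?\<phi>"
      unfolding fi
    proof (rule forces_impI)
      show "world W'" using W' by (auto intro: ext_world)
      show "wff (fst W') (Eq N t (suc u))" using W' assms by (auto intro: has_ty_suc hty_ext)
      fix W'' assume "W' \<sqsubseteq> W''" "W'' \<tturnstile> Eq N t (suc u)"
      then show "W'' \<tturnstile> \<chi>" using s W' by (meson ext_trans hty_ext)
    qed simp
  qed (use assms in auto)
  then show ?thesis unfolding fi using eq_reflI[OF assms(2)] by (rule forces_mp)
qed

lemma suc_eq: "world W \<Longrightarrow> W \<tturnstile> Eq N t u \<Longrightarrow> W \<tturnstile> Eq N (suc t) (suc u)"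
  by (rule eq_appI[of _ N]) (auto intro!: eq_reflI has_ty.intros cst_ty.intros)

lemma suc_neq_zero:
  assumes "world W" "W \<tturnstile> Eq N (suc u) zero"
  shows "W \<tturnstile> Bot"
proof -
  have "W \<tturnstile> Neg (Eq N (suc u) zero)"
    by (rule forces_ax) (use forces_wff[OF assms] in \<open>auto intro: EHA_or_ax.intros\<close>)
  then show ?thesis using assms(2) by (rule forces_mp)
qed

lemma suc_injectD:
  assumes "world W" "W \<tturnstile> Eq N (suc t) (suc u)" "hty W t N" "hty W u N"
  shows "W \<tturnstile> Eq N t u"
proof -
  have "W \<tturnstile> Imp (Eq N (suc t) (suc u)) (Eq N t u)"
    by (rule forces_ax) (use forces_wff[OF assms(1,2)] assms(3,4) in \<open>auto intro: EHA_or_ax.intros\<close>)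
  then show ?thesis using assms(2) by (rule forces_mp)
qed

lemma eq_suc_neq_zero:
  assumes "world W" "W \<tturnstile> Eq N t (suc u)"
  shows "W \<tturnstile> Neg (Eq N t zero)"
proof (rule forces_impI[OF assms(1)])
  show "wff (fst W) (Eq N t zero)" using forces_wff[OF assms] by simp
  fix W' assume W': "W \<sqsubseteq> W'" "W' \<tturnstile> Eq N t zero"
  then have w: "world W'" by (auto intro: ext_world)
  have "W' \<tturnstile> Eq N (suc u) zero"
    using eq_transI[OF w eq_symI[OF w forces_mono[OF W'(1) assms(2)]] W'(2)] .
  then show "W' \<tturnstile> Bot" by (rule suc_neq_zero[OF w])
qed simp

lemma nat_cases_zero:
  assumes "world W" "hty W t N" "wff (fst W) \<chi>" "internal \<chi>" "or_free \<chi>"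
    and z: "\<And>W'. W \<sqsubseteq> W' \<Longrightarrow> W' \<tturnstile> Eq N t zero \<Longrightarrow> W' \<tturnstile> \<chi>"
    and s: "\<And>W'. W \<sqsubseteq> W' \<Longrightarrow> W' \<tturnstile> Neg (Eq N t zero) \<Longrightarrow> W' \<tturnstile> \<chi>"
  shows "W \<tturnstile> \<chi>"
proof (rule nat_cases[OF assms(1-6)])
  fix W' u assume W': "W \<sqsubseteq> W'" "W' \<tturnstile> Eq N t (suc u)"
  show "W' \<tturnstile> \<chi>" by (rule s[OF W'(1) eq_suc_neq_zero[OF ext_world[OF W'(1)] W'(2)]])
qed auto

text \<open>Recursion on \<open>z\<close> with base \<open>a\<close> and step K (K b), which ignores
  the predecessor and the recursive value.\<close>

definition cond :: "ty \<Rightarrow> tm \<Rightarrow> tm \<Rightarrow> tm \<Rightarrow> tm" where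
  "cond \<sigma> z a b =
    Cst (Rec [\<sigma>] 0) \<^bold>\<cdot> a \<^bold>\<cdot> (Cst (CombK (\<sigma> \<^bold>\<rightarrow> \<sigma>) N) \<^bold>\<cdot> (Cst (CombK \<sigma> \<sigma>) \<^bold>\<cdot> b)) \<^bold>\<cdot> z"

lemma has_ty_cond:
  "has_ty \<Gamma> z N \<Longrightarrow> has_ty \<Gamma> a \<sigma> \<Longrightarrow> has_ty \<Gamma> b \<sigma> \<Longrightarrow> has_ty \<Gamma> (cond \<sigma> z a b) \<sigma>"
  unfolding cond_def by (rule has_ty.intros(3) has_ty_Rec1 has_ty_K | assumption)+

lemma inst_cond [simp]: "inst xs (cond \<sigma> z a b) = cond \<sigma> (inst xs z) (inst xs a) (inst xs b)"
  by (simp add: cond_def)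

lemma cond_zero:
  assumes "world W" "hty W a \<sigma>" "hty W b \<sigma>" "W \<tturnstile> Eq N z zero"
  shows "W \<tturnstile> Eq \<sigma> (cond \<sigma> z a b) a"
proof -
  have "W \<tturnstile> Eq \<sigma> (cond \<sigma> z a b) (cond \<sigma> zero a b)"
    unfolding cond_def
    by (rule eq_appI[OF assms(1) eq_reflI assms(4)])
      (rule has_ty.intros(3) has_ty_Rec1 has_ty_K assms)+
  moreover have "W \<tturnstile> Eq \<sigma> (cond \<sigma> zero a b) a"
    unfolding cond_def by (rule rec1_zero_eq) (use assms in \<open>auto intro: has_ty_K\<close>)
  ultimately show ?thesis by (rule eq_transI[OF assms(1)])
qed

lemma cond_suc:
  assumes "world W" "hty W a \<sigma>" "hty W b \<sigma>" "hty W u N" "W \<tturnstile> Eq N z (suc u)"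
  shows "W \<tturnstile> Eq \<sigma> (cond \<sigma> z a b) b"
proof -
  let ?k = "Cst (CombK (\<sigma> \<^bold>\<rightarrow> \<sigma>) N) \<^bold>\<cdot> (Cst (CombK \<sigma> \<sigma>) \<^bold>\<cdot> b)"
  have ty: "hty W (cond \<sigma> u a b) \<sigma>" "hty W (Cst (CombK \<sigma> \<sigma>) \<^bold>\<cdot> b) (\<sigma> \<^bold>\<rightarrow> \<sigma>)"
    using assms by (auto intro: has_ty_cond has_ty_K)
  have "W \<tturnstile> Eq \<sigma> (cond \<sigma> z a b) (cond \<sigma> (suc u) a b)"
    unfolding cond_def
    by (rule eq_appI[OF assms(1) eq_reflI assms(5)])
      (rule has_ty.intros(3) has_ty_Rec1 has_ty_K assms)+
  moreover have "W \<tturnstile> Eq \<sigma> (cond \<sigma> (suc u) a b) (?k \<^bold>\<cdot> u \<^bold>\<cdot> cond \<sigma> u a b)"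
    unfolding cond_def by (rule rec1_suc_eq) (use assms in \<open>auto intro: has_ty_K\<close>)
  moreover have "W \<tturnstile> Eq \<sigma> (?k \<^bold>\<cdot> u \<^bold>\<cdot> cond \<sigma> u a b) (Cst (CombK \<sigma> \<sigma>) \<^bold>\<cdot> b \<^bold>\<cdot> cond \<sigma> u a b)"
    by (rule eq_appI[OF assms(1) comb_k_eq eq_reflI]) (use assms ty in auto)
  moreover have "W \<tturnstile> Eq \<sigma> (Cst (CombK \<sigma> \<sigma>) \<^bold>\<cdot> b \<^bold>\<cdot> cond \<sigma> u a b) b"
    by (rule comb_k_eq) (use assms ty in auto)
  ultimately show ?thesis using eq_transI[OF assms(1)] by blast
qed

lemma plus_zero: "world W \<Longrightarrow> hty W m N \<Longrightarrow> W \<tturnstile> Eq N (plus_tm m zero) m"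
  unfolding plus_tm_def by (rule rec1_zero_eq) (auto intro!: has_ty_K has_ty.intros cst_ty.intros)

lemma plus_suc:
  assumes "world W" "hty W m N" "hty W n N"
  shows "W \<tturnstile> Eq N (plus_tm m (suc n)) (suc (plus_tm m n))"
proof -
  let ?k = "Cst (CombK (N \<^bold>\<rightarrow> N) N) \<^bold>\<cdot> Cst Succ"
  have s: "hty W (Cst Succ) (N \<^bold>\<rightarrow> N)" by (auto intro!: has_ty.intros cst_ty.intros)
  have "W \<tturnstile> Eq N (plus_tm m (suc n)) (?k \<^bold>\<cdot> n \<^bold>\<cdot> plus_tm m n)"
    unfolding plus_tm_def by (rule rec1_suc_eq) (use assms s in \<open>auto intro: has_ty_K\<close>)
  moreover have "W \<tturnstile> Eq N (?k \<^bold>\<cdot> n \<^bold>\<cdot> plus_tm m n) (suc (plus_tm m n))"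
    by (rule eq_appI[OF assms(1) comb_k_eq eq_reflI]) (use assms s in \<open>auto intro: has_ty_plus\<close>)
  ultimately show ?thesis by (rule eq_transI[OF assms(1)])
qed

text \<open>\<open>plus_tm\<close> recurses on its second argument, so a successor on the left has
  to be moved outwards by induction. Shifting an index by one in a prepended sequence depends on
  this.\<close>

lemma suc_plus:
  assumes "world W" "hty W m N" "hty W n N"
  shows "W \<tturnstile> Eq N (plus_tm (suc m) n) (suc (plus_tm m n))"
proof -
  let ?\<phi> = "Eq N (plus_tm (suc (tlift 1 m)) (Var 0)) (suc (plus_tm (tlift 1 m) (Var 0)))"
  have fi: "finst u ?\<phi> = Eq N (plus_tm (suc m) u) (suc (plus_tm m u))" for u by simp
  have "W \<tturnstile> finst n ?\<phi>"
  proof (rule nat_induct)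
    show "wff (N # fst W) ?\<phi>"
      using assms has_ty_tlift1[of "fst W" m N N]
      by (auto intro!: has_ty_plus has_ty_suc has_ty_VarI)
    have "W \<tturnstile> Eq N (plus_tm (suc m) zero) (suc m)"
      by (rule plus_zero) (use assms in \<open>auto intro: has_ty_suc\<close>)
    moreover have "W \<tturnstile> Eq N (suc m) (suc (plus_tm m zero))"
      by (rule suc_eq[OF assms(1) eq_symI[OF assms(1) plus_zero[OF assms(1,2)]]])
    ultimately show "W \<tturnstile> finst zero ?\<phi>" unfolding fi by (rule eq_transI[OF assms(1)])
    fix W' t assume W': "W \<sqsubseteq> W'" "hty W' t N" and IH: "W' \<tturnstile> finst t ?\<phi>"
    have w: "world W'" and m: "hty W' m N" using W' assms by (auto intro: ext_world hty_ext)
    have "W' \<tturnstile> Eq N (plus_tm (suc m) (suc t)) (suc (plus_tm (suc m) t))"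
      by (rule plus_suc) (use w m W' in \<open>auto intro: has_ty_suc\<close>)
    moreover have "W' \<tturnstile> Eq N (suc (plus_tm (suc m) t)) (suc (suc (plus_tm m t)))"
      using IH unfolding fi by (rule suc_eq[OF w])
    moreover have "W' \<tturnstile> Eq N (suc (suc (plus_tm m t))) (suc (plus_tm m (suc t)))"
      by (rule suc_eq[OF w eq_symI[OF w plus_suc[OF w m W'(2)]]])
    ultimately show "W' \<tturnstile> finst (suc t) ?\<phi>" unfolding fi using eq_transI[OF w] by blast
  qed (use assms in auto)
  then show ?thesis unfolding fi .
qed

end

section \<open>Finite sequences\<close>

abbreviation prep :: "ty \<Rightarrow> tm \<Rightarrow> tm \<Rightarrow> tm" where
  "prep \<sigma> a s \<equiv> Cst (Prep \<sigma>) \<^bold>\<cdot> a \<^bold>\<cdot> s"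

lemma tsubst_null [simp]: "tsubst \<theta> (null_tm \<sigma>) = null_tm \<sigma>"
  by (rule tsubst_closed[OF has_ty_null])

lemma tsubst_len [simp]: "tsubst \<theta> (len_tm \<sigma> s) = len_tm \<sigma> (tsubst \<theta> s)"
  by (simp add: len_tm_def)

lemma tsubst_head [simp]: "tsubst \<theta> (head_tm \<sigma> s) = head_tm \<sigma> (tsubst \<theta> s)"
  by (simp add: head_tm_def)

lemma tsubst_tail [simp]: "tsubst \<theta> (tail_fn \<sigma>) = tail_fn \<sigma>"
  by (simp add: tail_fn_def)

lemma tsubst_nth [simp]: "tsubst \<theta> (nth_tm \<sigma> s i) = nth_tm \<sigma> (tsubst \<theta> s) (tsubst \<theta> i)"
  by (simp add: nth_tm_def)

lemma tsubst_up_tlift: "tsubst (up \<theta>) (tlift (Suc 0) t) = tlift (Suc 0) (tsubst \<theta> t)"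
  by (simp add: tsubst_tlift tlift_tsubst)

lemma fsubst_Less [simp]: "fsubst \<theta> (Less m n) = Less (tsubst \<theta> m) (tsubst \<theta> n)"
  by (simp add: Less_def tsubst_up_tlift)

lemma fsubst_Mem [simp]: "fsubst \<theta> (Mem \<sigma> a s) = Mem \<sigma> (tsubst \<theta> a) (tsubst \<theta> s)"
  by (simp add: Mem_def tsubst_up_tlift)

lemma finst_Mem [simp]:
  "finst t (Mem \<sigma> a s) = Mem \<sigma> (tsubst (case_nat t Var) a) (tsubst (case_nat t Var) s)"
  by (simp add: finst_def)

lemma internal_Less [simp]: "internal (Less m n)" and or_free_Less [simp]: "or_free (Less m n)"
  by (simp_all add: Less_def)

lemma internal_Mem [simp]: "internal (Mem \<sigma> a s)" and or_free_Mem [simp]: "or_free (Mem \<sigma> a s)"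
  by (simp_all add: Mem_def)

lemma has_ty_len_fn:
  "has_ty \<Gamma> (Cst (CombK (Seq \<sigma> \<^bold>\<rightarrow> N \<^bold>\<rightarrow> N) \<sigma>) \<^bold>\<cdot> (Cst (CombK (N \<^bold>\<rightarrow> N) (Seq \<sigma>)) \<^bold>\<cdot> Cst Succ))
    (\<sigma> \<^bold>\<rightarrow> Seq \<sigma> \<^bold>\<rightarrow> N \<^bold>\<rightarrow> N)"
  by (auto intro!: has_ty.intros cst_ty.intros)

lemma has_ty_len: "has_ty \<Gamma> s (Seq \<sigma>) \<Longrightarrow> has_ty \<Gamma> (len_tm \<sigma> s) N"
  unfolding len_tm_def by (auto intro!: has_ty.intros cst_ty.intros)

lemma has_ty_null': "has_ty \<Gamma> (null_tm \<sigma>) \<sigma>"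
  by (rule has_ty_closed[OF has_ty_null])

lemma has_ty_head_fn:
  "has_ty \<Gamma> (Cst (CombS \<sigma> (\<sigma> \<^bold>\<rightarrow> \<sigma>) (Seq \<sigma> \<^bold>\<rightarrow> \<sigma> \<^bold>\<rightarrow> \<sigma>)) \<^bold>\<cdot>
    (Cst (CombK ((\<sigma> \<^bold>\<rightarrow> \<sigma>) \<^bold>\<rightarrow> Seq \<sigma> \<^bold>\<rightarrow> \<sigma> \<^bold>\<rightarrow> \<sigma>) \<sigma>) \<^bold>\<cdot> Cst (CombK (\<sigma> \<^bold>\<rightarrow> \<sigma>) (Seq \<sigma>))) \<^bold>\<cdot>
    Cst (CombK \<sigma> \<sigma>)) (\<sigma> \<^bold>\<rightarrow> Seq \<sigma> \<^bold>\<rightarrow> \<sigma> \<^bold>\<rightarrow> \<sigma>)"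
  by (auto intro!: has_ty.intros cst_ty.intros)

lemma has_ty_LRec: "has_ty \<Gamma> (Cst (LRec \<sigma> \<rho>)) (\<rho> \<^bold>\<rightarrow> (\<sigma> \<^bold>\<rightarrow> Seq \<sigma> \<^bold>\<rightarrow> \<rho> \<^bold>\<rightarrow> \<rho>) \<^bold>\<rightarrow> Seq \<sigma> \<^bold>\<rightarrow> \<rho>)"
  by (auto intro!: has_ty.intros cst_ty.intros)

lemma has_ty_head: "has_ty \<Gamma> s (Seq \<sigma>) \<Longrightarrow> has_ty \<Gamma> (head_tm \<sigma> s) \<sigma>"
  unfolding head_tm_def
  by (rule has_ty_LRec has_ty_head_fn has_ty_null' has_ty.intros(3) | assumption)+

lemma has_ty_tail_step:
  "has_ty \<Gamma> (Cst (CombK (Seq \<sigma> \<^bold>\<rightarrow> Seq \<sigma> \<^bold>\<rightarrow> Seq \<sigma>) \<sigma>) \<^bold>\<cdot> Cst (CombK (Seq \<sigma>) (Seq \<sigma>)))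
    (\<sigma> \<^bold>\<rightarrow> Seq \<sigma> \<^bold>\<rightarrow> Seq \<sigma> \<^bold>\<rightarrow> Seq \<sigma>)"
  by (auto intro!: has_ty.intros cst_ty.intros)

lemma has_ty_tail: "has_ty \<Gamma> (tail_fn \<sigma>) (Seq \<sigma> \<^bold>\<rightarrow> Seq \<sigma>)"
  unfolding tail_fn_def by (auto intro!: has_ty.intros cst_ty.intros)

text \<open>The iterated tail inside \<open>nth_tm\<close>; naming it separates the recursion on the
  index from the final head.\<close>

definition drop_tm :: "ty \<Rightarrow> tm \<Rightarrow> tm \<Rightarrow> tm" where
  "drop_tm \<sigma> s i = Cst (Rec [Seq \<sigma>] 0) \<^bold>\<cdot> s \<^bold>\<cdot> (Cst (CombK (Seq \<sigma> \<^bold>\<rightarrow> Seq \<sigma>) N) \<^bold>\<cdot> tail_fn \<sigma>) \<^bold>\<cdot> i"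

lemma nth_tm_drop: "nth_tm \<sigma> s i = head_tm \<sigma> (drop_tm \<sigma> s i)"
  by (simp add: nth_tm_def drop_tm_def)

lemma tsubst_drop [simp]: "tsubst \<theta> (drop_tm \<sigma> s i) = drop_tm \<sigma> (tsubst \<theta> s) (tsubst \<theta> i)"
  by (simp add: drop_tm_def)

lemma has_ty_drop: "has_ty \<Gamma> s (Seq \<sigma>) \<Longrightarrow> has_ty \<Gamma> i N \<Longrightarrow> has_ty \<Gamma> (drop_tm \<sigma> s i) (Seq \<sigma>)"
  unfolding drop_tm_def by (rule has_ty_Rec1 has_ty_K has_ty_tail has_ty.intros(3) | assumption)+

lemma has_ty_nth: "has_ty \<Gamma> s (Seq \<sigma>) \<Longrightarrow> has_ty \<Gamma> i N \<Longrightarrow> has_ty \<Gamma> (nth_tm \<sigma> s i) \<sigma>"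
  unfolding nth_tm_drop by (intro has_ty_head has_ty_drop)

lemma has_ty_Empty: "has_ty \<Gamma> (Cst (Empty \<sigma>)) (Seq \<sigma>)"
  by (auto intro!: has_ty.intros cst_ty.intros)

lemma has_ty_Prep: "has_ty \<Gamma> a \<sigma> \<Longrightarrow> has_ty \<Gamma> s (Seq \<sigma>) \<Longrightarrow> has_ty \<Gamma> (prep \<sigma> a s) (Seq \<sigma>)"
  by (auto intro!: has_ty.intros cst_ty.intros)

lemma wff_Less: "has_ty \<Gamma> m N \<Longrightarrow> has_ty \<Gamma> n N \<Longrightarrow> wff \<Gamma> (Less m n)"
  using has_ty_tlift1[of \<Gamma> m N N] has_ty_tlift1[of \<Gamma> n N N]
  by (auto simp: Less_def intro!: has_ty_plus has_ty_suc has_ty_VarI)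

lemma wff_Mem: "has_ty \<Gamma> a \<sigma> \<Longrightarrow> has_ty \<Gamma> s (Seq \<sigma>) \<Longrightarrow> wff \<Gamma> (Mem \<sigma> a s)"
  using has_ty_tlift1[of \<Gamma> a \<sigma> N] has_ty_tlift1[of \<Gamma> s "Seq \<sigma>" N]
  by (auto simp: Mem_def intro!: wff_Less has_ty_len has_ty_nth has_ty_VarI)

context ha_theory
begin

section \<open>Length, head, tail and iterated tail\<close>

lemma len_empty: "W \<tturnstile> Eq N (len_tm \<sigma> (Cst (Empty \<sigma>))) zero"
  unfolding len_tm_def by (rule lrec_empty_eq[OF has_ty_zero has_ty_len_fn])

lemma len_prep:
  assumes "world W" "hty W a \<sigma>" "hty W s (Seq \<sigma>)"
  shows "W \<tturnstile> Eq N (len_tm \<sigma> (prep \<sigma> a s)) (suc (len_tm \<sigma> s))"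
proof -
  let ?k = "Cst (CombK (N \<^bold>\<rightarrow> N) (Seq \<sigma>)) \<^bold>\<cdot> Cst Succ"
  let ?f = "Cst (CombK (Seq \<sigma> \<^bold>\<rightarrow> N \<^bold>\<rightarrow> N) \<sigma>) \<^bold>\<cdot> ?k"
  have ty: "hty W ?k (Seq \<sigma> \<^bold>\<rightarrow> N \<^bold>\<rightarrow> N)" "hty W (Cst Succ) (N \<^bold>\<rightarrow> N)" "hty W (len_tm \<sigma> s) N"
    using assms has_ty_len by (auto intro!: has_ty.intros cst_ty.intros)
  have "W \<tturnstile> Eq N (len_tm \<sigma> (prep \<sigma> a s)) (?f \<^bold>\<cdot> a \<^bold>\<cdot> s \<^bold>\<cdot> len_tm \<sigma> s)"
    unfolding len_tm_def by (rule lrec_prep_eq[OF has_ty_zero has_ty_len_fn assms(2,3)])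
  moreover have "W \<tturnstile> Eq N (?f \<^bold>\<cdot> a \<^bold>\<cdot> s \<^bold>\<cdot> len_tm \<sigma> s) (?k \<^bold>\<cdot> s \<^bold>\<cdot> len_tm \<sigma> s)"
    by (rule eq_appI[OF assms(1) eq_appI[OF assms(1) comb_k_eq eq_reflI] eq_reflI])
      (use assms ty in auto)
  moreover have "W \<tturnstile> Eq N (?k \<^bold>\<cdot> s \<^bold>\<cdot> len_tm \<sigma> s) (suc (len_tm \<sigma> s))"
    by (rule eq_appI[OF assms(1) comb_k_eq eq_reflI]) (use assms ty in auto)
  ultimately show ?thesis using eq_transI[OF assms(1)] by blast
qed

lemma head_prep:
  assumes "world W" "hty W a \<sigma>" "hty W s (Seq \<sigma>)"
  shows "W \<tturnstile> Eq \<sigma> (head_tm \<sigma> (prep \<sigma> a s)) a"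
proof -
  let ?k = "Cst (CombK (\<sigma> \<^bold>\<rightarrow> \<sigma>) (Seq \<sigma>))" and ?k' = "Cst (CombK \<sigma> \<sigma>)"
  let ?kk = "Cst (CombK ((\<sigma> \<^bold>\<rightarrow> \<sigma>) \<^bold>\<rightarrow> Seq \<sigma> \<^bold>\<rightarrow> \<sigma> \<^bold>\<rightarrow> \<sigma>) \<sigma>) \<^bold>\<cdot> ?k"
  let ?f = "Cst (CombS \<sigma> (\<sigma> \<^bold>\<rightarrow> \<sigma>) (Seq \<sigma> \<^bold>\<rightarrow> \<sigma> \<^bold>\<rightarrow> \<sigma>)) \<^bold>\<cdot> ?kk \<^bold>\<cdot> ?k'"
  have ty: "hty W ?k ((\<sigma> \<^bold>\<rightarrow> \<sigma>) \<^bold>\<rightarrow> Seq \<sigma> \<^bold>\<rightarrow> \<sigma> \<^bold>\<rightarrow> \<sigma>)" "hty W ?k' (\<sigma> \<^bold>\<rightarrow> \<sigma> \<^bold>\<rightarrow> \<sigma>)"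
    "hty W ?kk (\<sigma> \<^bold>\<rightarrow> (\<sigma> \<^bold>\<rightarrow> \<sigma>) \<^bold>\<rightarrow> Seq \<sigma> \<^bold>\<rightarrow> \<sigma> \<^bold>\<rightarrow> \<sigma>)" "hty W (head_tm \<sigma> s) \<sigma>" "hty W (?k' \<^bold>\<cdot> a) (\<sigma> \<^bold>\<rightarrow> \<sigma>)"
    using assms by (auto intro!: has_ty_head has_ty_K) (auto intro!: has_ty.intros cst_ty.intros)
  note w = assms(1) and tr = eq_transI[OF assms(1)] and ap = eq_appI[OF assms(1)]
  have 1: "W \<tturnstile> Eq \<sigma> (head_tm \<sigma> (prep \<sigma> a s)) (?f \<^bold>\<cdot> a \<^bold>\<cdot> s \<^bold>\<cdot> head_tm \<sigma> s)"
    unfolding head_tm_def by (rule lrec_prep_eq[OF has_ty_null' has_ty_head_fn assms(2,3)])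
  \<comment> \<open>The step term has the form S (K K) K and sends \<open>a\<close> to K (K a), the
    function that ignores the tail and the recursive value.\<close>
  have "W \<tturnstile> Eq (Seq \<sigma> \<^bold>\<rightarrow> \<sigma> \<^bold>\<rightarrow> \<sigma>) (?f \<^bold>\<cdot> a) (?kk \<^bold>\<cdot> a \<^bold>\<cdot> (?k' \<^bold>\<cdot> a))"
    by (rule comb_s_eq) (use assms ty in auto)
  moreover have "W \<tturnstile> Eq (Seq \<sigma> \<^bold>\<rightarrow> \<sigma> \<^bold>\<rightarrow> \<sigma>) (?kk \<^bold>\<cdot> a \<^bold>\<cdot> (?k' \<^bold>\<cdot> a)) (?k \<^bold>\<cdot> (?k' \<^bold>\<cdot> a))"
    by (rule ap[OF comb_k_eq eq_reflI]) (use assms ty in auto)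
  ultimately have "W \<tturnstile> Eq (Seq \<sigma> \<^bold>\<rightarrow> \<sigma> \<^bold>\<rightarrow> \<sigma>) (?f \<^bold>\<cdot> a) (?k \<^bold>\<cdot> (?k' \<^bold>\<cdot> a))" by (rule tr)
  then have 2: "W \<tturnstile> Eq \<sigma> (?f \<^bold>\<cdot> a \<^bold>\<cdot> s \<^bold>\<cdot> head_tm \<sigma> s) (?k \<^bold>\<cdot> (?k' \<^bold>\<cdot> a) \<^bold>\<cdot> s \<^bold>\<cdot> head_tm \<sigma> s)"
    by (rule ap[OF ap[OF _ eq_reflI] eq_reflI]) (use assms ty in auto)
  have 3: "W \<tturnstile> Eq \<sigma> (?k \<^bold>\<cdot> (?k' \<^bold>\<cdot> a) \<^bold>\<cdot> s \<^bold>\<cdot> head_tm \<sigma> s) (?k' \<^bold>\<cdot> a \<^bold>\<cdot> head_tm \<sigma> s)"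
    by (rule ap[OF comb_k_eq eq_reflI]) (use assms ty in auto)
  have 4: "W \<tturnstile> Eq \<sigma> (?k' \<^bold>\<cdot> a \<^bold>\<cdot> head_tm \<sigma> s) a"
    by (rule comb_k_eq) (use assms ty in auto)
  show ?thesis by (rule tr[OF 1 tr[OF 2 tr[OF 3 4]]])
qed

lemma tail_prep:
  assumes "world W" "hty W a \<sigma>" "hty W s (Seq \<sigma>)"
  shows "W \<tturnstile> Eq (Seq \<sigma>) (tail_fn \<sigma> \<^bold>\<cdot> (prep \<sigma> a s)) s"
proof -
  let ?k = "Cst (CombK (Seq \<sigma>) (Seq \<sigma>))" and ?t = "tail_fn \<sigma> \<^bold>\<cdot> s"
  let ?f = "Cst (CombK (Seq \<sigma> \<^bold>\<rightarrow> Seq \<sigma> \<^bold>\<rightarrow> Seq \<sigma>) \<sigma>) \<^bold>\<cdot> ?k"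
  have ty: "hty W ?k (Seq \<sigma> \<^bold>\<rightarrow> Seq \<sigma> \<^bold>\<rightarrow> Seq \<sigma>)" "hty W ?t (Seq \<sigma>)"
    using assms has_ty.intros(3)[OF has_ty_tail] by (auto intro!: has_ty.intros(2) cst_ty.intros)
  note tr = eq_transI[OF assms(1)] and ap = eq_appI[OF assms(1)]
  have 1: "W \<tturnstile> Eq (Seq \<sigma>) (tail_fn \<sigma> \<^bold>\<cdot> (prep \<sigma> a s)) (?f \<^bold>\<cdot> a \<^bold>\<cdot> s \<^bold>\<cdot> ?t)"
    unfolding tail_fn_def by (rule lrec_prep_eq[OF has_ty_Empty has_ty_tail_step assms(2,3)])
  have 2: "W \<tturnstile> Eq (Seq \<sigma>) (?f \<^bold>\<cdot> a \<^bold>\<cdot> s \<^bold>\<cdot> ?t) (?k \<^bold>\<cdot> s \<^bold>\<cdot> ?t)"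
    by (rule ap[OF ap[OF comb_k_eq eq_reflI] eq_reflI]) (use assms ty in auto)
  have 3: "W \<tturnstile> Eq (Seq \<sigma>) (?k \<^bold>\<cdot> s \<^bold>\<cdot> ?t) s"
    by (rule comb_k_eq) (use assms ty in auto)
  show ?thesis by (rule tr[OF 1 tr[OF 2 3]])
qed

lemma drop_zero:
  "hty W s (Seq \<sigma>) \<Longrightarrow> W \<tturnstile> Eq (Seq \<sigma>) (drop_tm \<sigma> s zero) s"
  unfolding drop_tm_def by (rule rec1_zero_eq) (auto intro: has_ty_K has_ty_tail)

lemma drop_suc:
  assumes "world W" "hty W s (Seq \<sigma>)" "hty W i N"
  shows "W \<tturnstile> Eq (Seq \<sigma>) (drop_tm \<sigma> s (suc i)) (tail_fn \<sigma> \<^bold>\<cdot> drop_tm \<sigma> s i)"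
proof -
  let ?k = "Cst (CombK (Seq \<sigma> \<^bold>\<rightarrow> Seq \<sigma>) N) \<^bold>\<cdot> tail_fn \<sigma>"
  have "W \<tturnstile> Eq (Seq \<sigma>) (drop_tm \<sigma> s (suc i)) (?k \<^bold>\<cdot> i \<^bold>\<cdot> drop_tm \<sigma> s i)"
    unfolding drop_tm_def by (rule rec1_suc_eq) (use assms in \<open>auto intro: has_ty_K has_ty_tail\<close>)
  moreover have "W \<tturnstile> Eq (Seq \<sigma>) (?k \<^bold>\<cdot> i \<^bold>\<cdot> drop_tm \<sigma> s i) (tail_fn \<sigma> \<^bold>\<cdot> drop_tm \<sigma> s i)"
    by (rule eq_appI[OF assms(1) comb_k_eq eq_reflI])
      (use assms in \<open>auto intro: has_ty_tail has_ty_drop\<close>)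
  ultimately show ?thesis by (rule eq_transI[OF assms(1)])
qed

lemma tail_eq: "world W \<Longrightarrow> W \<tturnstile> Eq (Seq \<sigma>) s t \<Longrightarrow> W \<tturnstile> Eq (Seq \<sigma>) (tail_fn \<sigma> \<^bold>\<cdot> s) (tail_fn \<sigma> \<^bold>\<cdot> t)"
  by (rule eq_appI[of _ "Seq \<sigma>"]) (auto intro: eq_reflI has_ty_tail)

lemma head_eq:
  assumes "world W" "W \<tturnstile> Eq (Seq \<sigma>) s t"
  shows "W \<tturnstile> Eq \<sigma> (head_tm \<sigma> s) (head_tm \<sigma> t)"
  unfolding head_tm_def
  by (rule eq_appI[OF assms(1) eq_reflI assms(2)])
    (rule has_ty_LRec has_ty_head_fn has_ty_null' has_ty.intros(3))+

lemma len_eq: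
  assumes "world W" "W \<tturnstile> Eq (Seq \<sigma>) s t"
  shows "W \<tturnstile> Eq N (len_tm \<sigma> s) (len_tm \<sigma> t)"
  unfolding len_tm_def
  by (rule eq_appI[OF assms(1) eq_reflI assms(2)])
    (rule has_ty_LRec has_ty_len_fn has_ty_zero has_ty.intros(3))+

lemma drop_eq:
  assumes "world W" "hty W s (Seq \<sigma>)" "W \<tturnstile> Eq N i j"
  shows "W \<tturnstile> Eq (Seq \<sigma>) (drop_tm \<sigma> s i) (drop_tm \<sigma> s j)"
  unfolding drop_tm_def
  by (rule eq_appI[OF assms(1) eq_reflI assms(3)])
    (rule has_ty_Rec1 has_ty_K has_ty_tail assms(2) has_ty.intros(3))+

lemma plus_eq:
  assumes "world W" "W \<tturnstile> Eq N i j" "W \<tturnstile> Eq N k l"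
  shows "W \<tturnstile> Eq N (plus_tm i k) (plus_tm j l)"
proof -
  have "W \<tturnstile> Eq N (inst [i, k] (plus_tm (Var 0) (Var 1))) (inst [j, l] (plus_tm (Var 0) (Var 1)))"
    by (rule inst_eq[of "[N, N]"]) (use assms in \<open>auto intro!: has_ty_plus has_ty_VarI\<close>)
  then show ?thesis by (simp add: inst_def)
qed

text \<open>\<open>drop_tm\<close> applies tails on the outside, whereas the prepended element sits
  inside. Both sides agree at index zero and obey the same recursion in the index, so induction on
  \<open>i\<close> identifies them.\<close>

lemma drop_prep_suc:
  assumes "world W" "hty W a \<sigma>" "hty W s (Seq \<sigma>)" "hty W i N"
  shows "W \<tturnstile> Eq (Seq \<sigma>) (drop_tm \<sigma> (prep \<sigma> a s) (suc i)) (drop_tm \<sigma> s i)"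
proof -
  let ?p = "prep \<sigma> a s"
  let ?\<phi> = "Eq (Seq \<sigma>) (drop_tm \<sigma> (tlift 1 ?p) (suc (Var 0))) (drop_tm \<sigma> (tlift 1 s) (Var 0))"
  have fi: "finst u ?\<phi> = Eq (Seq \<sigma>) (drop_tm \<sigma> ?p (suc u)) (drop_tm \<sigma> s u)" for u by simp
  have p: "hty W ?p (Seq \<sigma>)" using assms by (auto intro: has_ty_Prep)
  have "W \<tturnstile> finst i ?\<phi>"
  proof (rule nat_induct)
    show "wff (N # fst W) ?\<phi>"
      using has_ty_tlift1[OF assms(3), of N] has_ty_tlift1[OF p, of N] unfolding wff.simps
      by (auto simp del: tlift_simps intro!: has_ty_drop has_ty_suc has_ty_VarI)
    have "W \<tturnstile> Eq (Seq \<sigma>) (drop_tm \<sigma> ?p (suc zero)) (tail_fn \<sigma> \<^bold>\<cdot> drop_tm \<sigma> ?p zero)"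
      by (rule drop_suc) (use assms p in auto)
    moreover have "W \<tturnstile> Eq (Seq \<sigma>) (tail_fn \<sigma> \<^bold>\<cdot> drop_tm \<sigma> ?p zero) (tail_fn \<sigma> \<^bold>\<cdot> ?p)"
      by (rule tail_eq[OF assms(1) drop_zero[OF p]])
    moreover have "W \<tturnstile> Eq (Seq \<sigma>) (tail_fn \<sigma> \<^bold>\<cdot> ?p) s" by (rule tail_prep[OF assms(1-3)])
    moreover have "W \<tturnstile> Eq (Seq \<sigma>) s (drop_tm \<sigma> s zero)"
      by (rule eq_symI[OF assms(1) drop_zero[OF assms(3)]])
    ultimately show "W \<tturnstile> finst zero ?\<phi>" unfolding fi using eq_transI[OF assms(1)] by blast
    fix W' t assume W': "W \<sqsubseteq> W'" "hty W' t N" and IH: "W' \<tturnstile> finst t ?\<phi>"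
    have w: "world W'" and s: "hty W' s (Seq \<sigma>)" "hty W' ?p (Seq \<sigma>)"
      using W'(1) assms(3) p ext_world hty_ext by blast+
    have "W' \<tturnstile> Eq (Seq \<sigma>) (drop_tm \<sigma> ?p (suc (suc t))) (tail_fn \<sigma> \<^bold>\<cdot> drop_tm \<sigma> ?p (suc t))"
      by (rule drop_suc) (use w s W' in \<open>auto intro: has_ty_suc\<close>)
    moreover have "W' \<tturnstile> Eq (Seq \<sigma>) (tail_fn \<sigma> \<^bold>\<cdot> drop_tm \<sigma> ?p (suc t)) (tail_fn \<sigma> \<^bold>\<cdot> drop_tm \<sigma> s t)"
      using IH unfolding fi by (rule tail_eq[OF w])
    moreover have "W' \<tturnstile> Eq (Seq \<sigma>) (tail_fn \<sigma> \<^bold>\<cdot> drop_tm \<sigma> s t) (drop_tm \<sigma> s (suc t))"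
      by (rule eq_symI[OF w drop_suc[OF w s(1) W'(2)]])
    ultimately show "W' \<tturnstile> finst (suc t) ?\<phi>" unfolding fi using eq_transI[OF w] by blast
  qed (use assms in auto)
  then show ?thesis unfolding fi .
qed

section \<open>Membership in a finite sequence\<close>

lemma LessI: "hty W k N \<Longrightarrow> hty W m N \<Longrightarrow> hty W n N \<Longrightarrow> W \<tturnstile> Eq N (plus_tm m (suc k)) n \<Longrightarrow> W \<tturnstile> Less m n"
  using wff_Less[of "fst W" m n] unfolding Less_def by (auto intro!: forces_exI[of _ k])

lemma LessE:
  assumes "W \<tturnstile> Less m n" "world W" "wff (fst W) \<chi>"
    and "\<And>W' k. W \<sqsubseteq> W' \<Longrightarrow> hty W' k N \<Longrightarrow> W' \<tturnstile> Eq N (plus_tm m (suc k)) n \<Longrightarrow> W' \<tturnstile> \<chi>"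
  shows "W \<tturnstile> \<chi>"
  by (rule forces_exE[OF assms(1)[unfolded Less_def] assms(2,3)]) (use assms(4) in auto)

lemma MemI:
  "hty W i N \<Longrightarrow> hty W a \<sigma> \<Longrightarrow> hty W s (Seq \<sigma>) \<Longrightarrow> W \<tturnstile> Less i (len_tm \<sigma> s) \<Longrightarrow>
    W \<tturnstile> Eq \<sigma> a (nth_tm \<sigma> s i) \<Longrightarrow> W \<tturnstile> Mem \<sigma> a s"
  using wff_Mem[of "fst W" a \<sigma> s] unfolding Mem_def
  by (auto intro!: forces_exI[of _ i] simp: forces_And) (auto simp: finst_def)

lemma MemE:
  assumes "W \<tturnstile> Mem \<sigma> a s" "world W" "wff (fst W) \<chi>"
    and "\<And>W' i k. W \<sqsubseteq> W' \<Longrightarrow> hty W' i N \<Longrightarrow> hty W' k N \<Longrightarrow>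
      W' \<tturnstile> Eq N (plus_tm i (suc k)) (len_tm \<sigma> s) \<Longrightarrow> W' \<tturnstile> Eq \<sigma> a (nth_tm \<sigma> s i) \<Longrightarrow> W' \<tturnstile> \<chi>"
  shows "W \<tturnstile> \<chi>"
proof (rule forces_exE[OF assms(1)[unfolded Mem_def] assms(2,3)])
  fix W' i assume W': "W \<sqsubseteq> W'" "hty W' i N" and
    "W' \<tturnstile> finst i (And (Less (Var 0) (len_tm \<sigma> (tlift 1 s))) (Eq \<sigma> (tlift 1 a) (nth_tm \<sigma> (tlift 1 s) (Var 0))))"
  then have m: "W' \<tturnstile> Less i (len_tm \<sigma> s)" "W' \<tturnstile> Eq \<sigma> a (nth_tm \<sigma> s i)"
    by (auto simp: forces_And finst_def)
  show "W' \<tturnstile> \<chi>"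
  proof (rule LessE[OF m(1)])
    fix W'' k assume "W' \<sqsubseteq> W''" "hty W'' k N" "W'' \<tturnstile> Eq N (plus_tm i (suc k)) (len_tm \<sigma> s)"
    then show "W'' \<tturnstile> \<chi>" using assms(4) W' m(2) by (meson ext_trans hty_ext forces_mono)
  qed (use W' assms in \<open>auto intro: ext_world wff_ext\<close>)
qed simp

lemma Mem_cong:
  assumes "world W" "W \<tturnstile> Eq \<sigma> a b" "W \<tturnstile> Eq (Seq \<sigma>) s t" "W \<tturnstile> Mem \<sigma> a s"
  shows "W \<tturnstile> Mem \<sigma> b t"
proof -
  have "W \<tturnstile> fsubst (case_nat b (case_nat t Var)) (Mem \<sigma> (Var 0) (Var 1))"
    by (rule leibniz[of W "[\<sigma>, Seq \<sigma>]" "case_nat a (case_nat s Var)"])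
      (use assms in \<open>auto simp: eq_subst_def less_Suc_eq intro!: wff_Mem has_ty_VarI\<close>)
  then show ?thesis by simp
qed

lemma zero_plus:
  assumes "world W" "hty W n N"
  shows "W \<tturnstile> Eq N (plus_tm zero n) n"
proof -
  let ?\<phi> = "Eq N (plus_tm zero (Var 0)) (Var 0)"
  have fi: "finst u ?\<phi> = Eq N (plus_tm zero u) u" for u by simp
  have "W \<tturnstile> finst n ?\<phi>"
  proof (rule nat_induct)
    show "wff (N # fst W) ?\<phi>" by (auto intro!: has_ty_plus has_ty_VarI)
    show "W \<tturnstile> finst zero ?\<phi>" unfolding fi by (rule plus_zero) (use assms in auto)
    fix W' t assume W': "W \<sqsubseteq> W'" "hty W' t N" and IH: "W' \<tturnstile> finst t ?\<phi>"
    have w: "world W'" using W' by (auto intro: ext_world)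
    show "W' \<tturnstile> finst (suc t) ?\<phi>"
      using eq_transI[OF w plus_suc[OF w has_ty_zero W'(2)] suc_eq[OF w IH[unfolded fi]]] unfolding fi .
  qed (use assms in auto)
  then show ?thesis unfolding fi .
qed

lemma Mem_Prep_head:
  assumes "world W" "hty W a \<sigma>" "hty W s (Seq \<sigma>)"
  shows "W \<tturnstile> Mem \<sigma> a (prep \<sigma> a s)"
proof -
  let ?p = "prep \<sigma> a s"
  note w = assms(1) and tr = eq_transI[OF assms(1)] and sy = eq_symI[OF assms(1)]
  have p: "hty W ?p (Seq \<sigma>)" using assms by (auto intro: has_ty_Prep)
  have l: "hty W (len_tm \<sigma> s) N" using assms by (auto intro: has_ty_len)
  show ?thesis
  proof (rule MemI[of _ zero])
    \<comment> \<open>\<open>Less\<close> is witnessed by the predecessor of the difference, which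
      for index zero is the length of \<open>s\<close>.\<close>
    have "W \<tturnstile> Eq N (plus_tm zero (suc (len_tm \<sigma> s))) (len_tm \<sigma> ?p)"
      by (rule tr[OF zero_plus[OF w has_ty_suc[OF l]] sy[OF len_prep[OF assms]]])
    then show "W \<tturnstile> Less zero (len_tm \<sigma> ?p)"
      by (rule LessI[rotated 3]) (use l p in \<open>auto intro: has_ty_len\<close>)
    show "W \<tturnstile> Eq \<sigma> a (nth_tm \<sigma> ?p zero)"
      unfolding nth_tm_drop
      by (rule sy[OF tr[OF head_eq[OF w drop_zero[OF p]] head_prep[OF assms]]])
  qed (use assms p in auto)
qed

lemma Mem_Prep_tail:
  assumes "world W" "hty W a \<sigma>" "hty W s (Seq \<sigma>)" "hty W x \<sigma>" "W \<tturnstile> Mem \<sigma> x s"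
  shows "W \<tturnstile> Mem \<sigma> x (prep \<sigma> a s)"
proof (rule MemE[OF assms(5,1)])
  let ?p = "prep \<sigma> a s"
  have p: "hty W ?p (Seq \<sigma>)" using assms by (auto intro: has_ty_Prep)
  then show "wff (fst W) (Mem \<sigma> x ?p)" using assms by (auto intro: wff_Mem)
  fix W' i k
  assume W': "W \<sqsubseteq> W'" "hty W' i N" "hty W' k N" "W' \<tturnstile> Eq N (plus_tm i (suc k)) (len_tm \<sigma> s)"
    "W' \<tturnstile> Eq \<sigma> x (nth_tm \<sigma> s i)"
  have w: "world W'" using W' by (auto intro: ext_world)
  have ty: "hty W' a \<sigma>" "hty W' s (Seq \<sigma>)" "hty W' x \<sigma>" "hty W' ?p (Seq \<sigma>)"
    using W'(1) assms p hty_ext by blast+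
  note tr = eq_transI[OF w] and sy = eq_symI[OF w]
  show "W' \<tturnstile> Mem \<sigma> x ?p"
  proof (rule MemI[of _ "suc i"])
    have "W' \<tturnstile> Eq N (plus_tm (suc i) (suc k)) (len_tm \<sigma> ?p)"
      by (rule tr[OF suc_plus[OF w W'(2) has_ty_suc[OF W'(3)]]
            tr[OF suc_eq[OF w W'(4)] sy[OF len_prep[OF w ty(1,2)]]]])
    then show "W' \<tturnstile> Less (suc i) (len_tm \<sigma> ?p)"
      by (rule LessI[rotated 3]) (use W' ty in \<open>auto intro: has_ty_len has_ty_suc\<close>)
    show "W' \<tturnstile> Eq \<sigma> x (nth_tm \<sigma> ?p (suc i))"
      using tr[OF W'(5)[unfolded nth_tm_drop] head_eq[OF w sy[OF drop_prep_suc[OF w ty(1,2) W'(2)]]]]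
      unfolding nth_tm_drop .
  qed (use ty W' in \<open>auto intro: has_ty_suc\<close>)
qed

text \<open>The index witnessing membership is zero or a successor. The first case gives equality
  with the head, the second gives membership in the tail with the index lowered by one. As numerical
  case distinction is behind it, the goal is \<or>-free.\<close>

lemma Mem_Prep_cases:
  assumes "W \<tturnstile> Mem \<sigma> x (prep \<sigma> a s)" "world W" "hty W a \<sigma>" "hty W s (Seq \<sigma>)" "hty W x \<sigma>"
    and \<chi>: "wff (fst W) \<chi>" "internal \<chi>" "or_free \<chi>"
    and h: "\<And>W'. W \<sqsubseteq> W' \<Longrightarrow> W' \<tturnstile> Eq \<sigma> x a \<Longrightarrow> W' \<tturnstile> \<chi>"
    and t: "\<And>W'. W \<sqsubseteq> W' \<Longrightarrow> W' \<tturnstile> Mem \<sigma> x s \<Longrightarrow> W' \<tturnstile> \<chi>"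
  shows "W \<tturnstile> \<chi>"
proof (rule MemE[OF assms(1,2) \<chi>(1)])
  let ?p = "prep \<sigma> a s"
  have p: "hty W ?p (Seq \<sigma>)" using assms by (auto intro: has_ty_Prep)
  fix W1 i k
  assume W1: "W \<sqsubseteq> W1" "hty W1 i N" "hty W1 k N" "W1 \<tturnstile> Eq N (plus_tm i (suc k)) (len_tm \<sigma> ?p)"
    "W1 \<tturnstile> Eq \<sigma> x (nth_tm \<sigma> ?p i)"
  show "W1 \<tturnstile> \<chi>"
  proof (rule nat_cases[of W1 i])
    fix W2 assume W2: "W1 \<sqsubseteq> W2" "W2 \<tturnstile> Eq N i zero"
    have e: "W \<sqsubseteq> W2" using W1 W2 ext_trans by blast
    have w: "world W2" using W2 by (auto intro: ext_world)
    have ty: "hty W2 a \<sigma>" "hty W2 s (Seq \<sigma>)" "hty W2 ?p (Seq \<sigma>)"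
      using e assms p hty_ext by blast+
    note tr = eq_transI[OF w] and sy = eq_symI[OF w]
    have "W2 \<tturnstile> Eq \<sigma> x a"
      by (rule tr[OF forces_mono[OF W2(1) W1(5), unfolded nth_tm_drop]
          tr[OF head_eq[OF w tr[OF drop_eq[OF w ty(3) W2(2)] drop_zero[OF ty(3)]]] head_prep[OF w ty(1,2)]]])
    then show "W2 \<tturnstile> \<chi>" by (rule h[OF e])
  next
    fix W2 j assume W2: "W1 \<sqsubseteq> W2" "hty W2 j N" "W2 \<tturnstile> Eq N i (suc j)"
    have e: "W \<sqsubseteq> W2" using W1 W2 ext_trans by blast
    have w: "world W2" using W2 by (auto intro: ext_world)
    have ty: "hty W2 a \<sigma>" "hty W2 s (Seq \<sigma>)" "hty W2 ?p (Seq \<sigma>)" "hty W2 x \<sigma>" "hty W2 k N"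
      using e assms p W1 W2 hty_ext by blast+
    note tr = eq_transI[OF w] and sy = eq_symI[OF w]
    have k: "hty W2 (suc k) N" using ty by (auto intro: has_ty_suc)
    \<comment> \<open>Cancelling S on both sides lowers the bound on the index together with the
      index.\<close>
    have "W2 \<tturnstile> Eq N (suc (plus_tm j (suc k))) (suc (len_tm \<sigma> s))"
      by (rule tr[OF sy[OF suc_plus[OF w W2(2) k]]
            tr[OF plus_eq[OF w sy[OF W2(3)] eq_reflI[OF k]]
              tr[OF forces_mono[OF W2(1) W1(4)] len_prep[OF w ty(1,2)]]]])
    then have "W2 \<tturnstile> Eq N (plus_tm j (suc k)) (len_tm \<sigma> s)"
      by (rule suc_injectD[OF w]) (use W2 k ty in \<open>auto intro: has_ty_plus has_ty_len\<close>)
    then have "W2 \<tturnstile> Less j (len_tm \<sigma> s)"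
      by (rule LessI[rotated 3]) (use W2 ty in \<open>auto intro: has_ty_len\<close>)
    moreover have "W2 \<tturnstile> Eq \<sigma> x (nth_tm \<sigma> s j)"
      using tr[OF forces_mono[OF W2(1) W1(5), unfolded nth_tm_drop]
          head_eq[OF w tr[OF drop_eq[OF w ty(3) W2(3)] drop_prep_suc[OF w ty(1,2) W2(2)]]]]
      unfolding nth_tm_drop .
    ultimately have "W2 \<tturnstile> Mem \<sigma> x s" using W2 ty by (auto intro: MemI)
    then show "W2 \<tturnstile> \<chi>" by (rule t[OF e])
  qed (use W1 \<chi> in \<open>auto intro: ext_world wff_ext\<close>)
qed

lemma Mem_Empty:
  assumes "W \<tturnstile> Mem \<sigma> x (Cst (Empty \<sigma>))" "world W"
  shows "W \<tturnstile> Bot"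
proof (rule MemE[OF assms])
  fix W' i k
  assume W': "W \<sqsubseteq> W'" "hty W' i N" "hty W' k N" "W' \<tturnstile> Eq N (plus_tm i (suc k)) (len_tm \<sigma> (Cst (Empty \<sigma>)))"
  have w: "world W'" using W' by (auto intro: ext_world)
  note tr = eq_transI[OF w] and sy = eq_symI[OF w]
  show "W' \<tturnstile> Bot"
    by (rule suc_neq_zero[OF w tr[OF sy[OF plus_suc[OF w W'(2,3)]] tr[OF W'(4) len_empty]]])
qed simp

section \<open>Case distinction and induction on sequences\<close>

lemma seq_case:
  assumes "world W" "hty W s (Seq \<sigma>)"
    and \<chi>: "wff (fst W) \<chi>" "internal \<chi>" "or_free \<chi>"
    and e: "\<And>W'. W \<sqsubseteq> W' \<Longrightarrow> W' \<tturnstile> Eq (Seq \<sigma>) s (Cst (Empty \<sigma>)) \<Longrightarrow> W' \<tturnstile> \<chi>"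
    and p: "\<And>W' a s'. W \<sqsubseteq> W' \<Longrightarrow> hty W' a \<sigma> \<Longrightarrow> hty W' s' (Seq \<sigma>) \<Longrightarrow>
      W' \<tturnstile> Eq (Seq \<sigma>) s (prep \<sigma> a s') \<Longrightarrow> W' \<tturnstile> \<chi>"
  shows "W \<tturnstile> \<chi>"
proof -
  let ?E = "Ex \<sigma> (Ex (Seq \<sigma>) (Eq (Seq \<sigma>) (tlift 3 s) (Cst (Prep \<sigma>) \<^bold>\<cdot> Var 1 \<^bold>\<cdot> Var 0)))"
  let ?\<phi> = "And (Imp (Eq N (Var 0) zero) (Eq (Seq \<sigma>) (tlift 1 s) (Cst (Empty \<sigma>)))) (Imp (Neg (Eq N (Var 0) zero)) ?E)"
  have "has_ty ([Seq \<sigma>, \<sigma>, N] @ fst W) (tlift 3 s) (Seq \<sigma>)"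
    by (rule has_ty_tlift[OF assms(2)]) simp
  then have "wff (fst W) (Ex N ?\<phi>)"
    using has_ty_tlift1[OF assms(2), of N]
    by (auto intro!: has_ty_VarI has_ty_Empty has_ty_Prep)
  then have ax: "W \<tturnstile> Ex N ?\<phi>"
    by (intro forces_ax UnI1 EHA_or_ax.seq_cases) auto
  show ?thesis
  proof (rule forces_exE[OF ax assms(1) \<chi>(1)])
    fix W1 n assume W1: "W \<sqsubseteq> W1" "hty W1 n N" "W1 \<tturnstile> finst n ?\<phi>"
    let ?F = "\<lambda>\<theta>. Eq (Seq \<sigma>) (tsubst \<theta> (tlift 3 s)) (Cst (Prep \<sigma>) \<^bold>\<cdot> \<theta> 1 \<^bold>\<cdot> \<theta> 0)"
    have z: "W1 \<tturnstile> Imp (Eq N n zero) (Eq (Seq \<sigma>) s (Cst (Empty \<sigma>)))"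
      and nz: "W1 \<tturnstile> Imp (Neg (Eq N n zero)) (finst n ?E)"
      using W1(3) by (simp_all add: forces_And)
    \<comment> \<open>The number supplied by the axiom is a flag: zero announces the empty sequence,
      any other value a prepended one.\<close>
    show "W1 \<tturnstile> \<chi>"
    proof (rule nat_cases_zero[of W1 n])
      fix W2 assume W2: "W1 \<sqsubseteq> W2" "W2 \<tturnstile> Eq N n zero"
      show "W2 \<tturnstile> \<chi>"
        by (rule e[OF ext_trans[OF W1(1) W2(1)] forces_mp[OF forces_mono[OF W2(1) z] W2(2)]])
    next
      fix W2 assume W2: "W1 \<sqsubseteq> W2" "W2 \<tturnstile> Neg (Eq N n zero)"
      have w2: "world W2" "W \<sqsubseteq> W2" using W1 W2 ext_world ext_trans by blast+
      have "W2 \<tturnstile> finst n ?E" by (rule forces_mp[OF forces_mono[OF W2(1) nz] W2(2)])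
      then show "W2 \<tturnstile> \<chi>" unfolding finst_simps
      proof (rule forces_exE[OF _ w2(1) wff_ext[OF w2(2) \<chi>(1)]])
        fix W3 a assume W3: "W2 \<sqsubseteq> W3" "hty W3 a \<sigma>"
          "W3 \<tturnstile> finst a (fsubst (up (case_nat n Var)) (Ex (Seq \<sigma>) (Eq (Seq \<sigma>) (tlift 3 s) (Cst (Prep \<sigma>) \<^bold>\<cdot> Var 1 \<^bold>\<cdot> Var 0))))"
        have w3: "world W3" "W \<sqsubseteq> W3" using W3 w2 ext_world ext_trans by blast+
        show "W3 \<tturnstile> \<chi>"
          using W3(3)[unfolded finst_fsubst_up, unfolded fsubst.simps]
        proof (rule forces_exE[OF _ w3(1) wff_ext[OF w3(2) \<chi>(1)]])
          fix W4 s' assume W4: "W3 \<sqsubseteq> W4" "hty W4 s' (Seq \<sigma>)"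
            "W4 \<tturnstile> finst s' (Eq (Seq \<sigma>) (tsubst (up (case_nat a (case_nat n Var))) (tlift 3 s))
              (tsubst (up (case_nat a (case_nat n Var))) (Cst (Prep \<sigma>) \<^bold>\<cdot> Var 1 \<^bold>\<cdot> Var 0)))"
          \<comment> \<open>All three bound variables of the axiom are instantiated now, which
            cancels the lifting of \<open>s\<close> by 3.\<close>
          have "tsubst (case_nat s' Var) (tsubst (up (case_nat a (case_nat n Var))) (tlift 3 s)) = s"
            by (simp add: tsubst_tsubst tsubst_case_nat_up numeral_3_eq_3)
          then have "W4 \<tturnstile> Eq (Seq \<sigma>) s (prep \<sigma> a s')"
            using W4(3) by (simp add: tsubst_tlift)
          then show "W4 \<tturnstile> \<chi>" using p W3 W4 w3 ext_trans hty_ext by meson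
        qed simp
      qed simp
    qed (use W1 \<chi> in \<open>auto intro: ext_world wff_ext\<close>)
  qed simp
qed

lemma finst_cong:
  assumes "world W" "W \<tturnstile> Eq \<sigma> t u" "wff (\<sigma> # fst W) \<phi>" "internal \<phi>" "or_free \<phi>" "W \<tturnstile> finst t \<phi>"
  shows "W \<tturnstile> finst u \<phi>"
proof -
  have "eq_subst W (fst W) Var Var" by (auto simp: eq_subst_def intro!: eq_reflI has_ty_VarI)
  from leibniz[OF assms(1) eq_subst_case_nat[OF this assms(2)] assms(3-5)] show ?thesis
    using assms(6) by (simp add: finst_def)
qed

text \<open>The theory has only numerical induction. It is applied to
  \<open>\<forall>s (|s| = n \<longrightarrow> \<phi>(s))\<close> and the result is taken at the
  length of \<open>s\<close>.\<close>

lemma seq_induct: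
  assumes "world W" and \<phi>: "wff (Seq \<sigma> # fst W) \<phi>" "internal \<phi>" "or_free \<phi>"
    and e: "W \<tturnstile> finst (Cst (Empty \<sigma>)) \<phi>"
    and step: "\<And>W' a s. W \<sqsubseteq> W' \<Longrightarrow> hty W' a \<sigma> \<Longrightarrow> hty W' s (Seq \<sigma>) \<Longrightarrow> W' \<tturnstile> finst s \<phi> \<Longrightarrow>
      W' \<tturnstile> finst (prep \<sigma> a s) \<phi>"
    and s: "hty W s (Seq \<sigma>)"
  shows "W \<tturnstile> finst s \<phi>"
proof -
  \<comment> \<open>Makes room for the number: index 0 of \<phi> stays the sequence, every other
    index moves up by one, and \<open>n\<close> takes index 1.\<close>
  let ?\<rho> = "case_nat (Var 0) (\<lambda>i. Var (Suc (Suc i)))"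
  let ?\<chi> = "Imp (Eq N (len_tm \<sigma> (Var 0)) (Var 1)) (fsubst ?\<rho> \<phi>)"
  let ?\<psi> = "All (Seq \<sigma>) ?\<chi>"
  have fi: "finst s (fsubst (up (case_nat n Var)) ?\<chi>) = Imp (Eq N (len_tm \<sigma> s) n) (finst s \<phi>)" for n s
  proof -
    have "(\<lambda>i. tsubst (case_nat s (case_nat n Var)) (?\<rho> i)) = case_nat s Var"
      by (auto simp: fun_eq_iff split: nat.split)
    then show ?thesis unfolding finst_fsubst_up by (simp add: fsubst_fsubst finst_def)
  qed
  have fa: "finst n ?\<psi> = All (Seq \<sigma>) (fsubst (up (case_nat n Var)) ?\<chi>)" for n by simp
  have wf: "wff (N # fst W) ?\<psi>"
  proof -
    have "subst_ty (Seq \<sigma> # N # fst W) ?\<rho> (Seq \<sigma> # fst W)"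
      by (auto simp: subst_ty_def less_Suc_eq_0_disj intro!: has_ty_VarI)
    then show ?thesis using \<phi>(1) by (auto intro!: wff_fsubst has_ty_len has_ty_VarI)
  qed
  have wf': "wff (Seq \<sigma> # fst W') (fsubst (up (case_nat n Var)) ?\<chi>)" if "W \<sqsubseteq> W'" "hty W' n N" for W' n
    using wff_finst[OF wff_ext1[OF that(1) wf] that(2)] unfolding fa by simp
  have "W \<tturnstile> finst (len_tm \<sigma> s) ?\<psi>"
  proof (rule nat_induct[OF assms(1) wf])
    show "W \<tturnstile> finst zero ?\<psi>" unfolding fa
    proof (rule forces_allI[OF assms(1) wf'[OF ext_refl[OF assms(1)] has_ty_zero]])
      fix W1 s assume W1: "W \<sqsubseteq> W1" "hty W1 s (Seq \<sigma>)"
      have w1: "world W1" using W1 ext_world by blast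
      have "W1 \<tturnstile> Imp (Eq N (len_tm \<sigma> s) zero) (finst s \<phi>)"
      proof (rule forces_impI[OF w1])
        fix W2 assume W2: "W1 \<sqsubseteq> W2" "W2 \<tturnstile> Eq N (len_tm \<sigma> s) zero"
        have w2: "world W2" "W \<sqsubseteq> W2" using W1 W2 ext_world ext_trans by blast+
        have s: "hty W2 s (Seq \<sigma>)" using W1 W2 hty_ext by blast
        show "W2 \<tturnstile> finst s \<phi>"
        proof (rule seq_case[OF w2(1) s])
          show "wff (fst W2) (finst s \<phi>)" using wff_finst[OF wff_ext1[OF w2(2) \<phi>(1)] s] .
          fix W3 assume W3: "W2 \<sqsubseteq> W3" "W3 \<tturnstile> Eq (Seq \<sigma>) s (Cst (Empty \<sigma>))"
          have w3: "world W3" "W \<sqsubseteq> W3" using W3 w2 ext_world ext_trans by blast+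
          show "W3 \<tturnstile> finst s \<phi>"
            by (rule finst_cong[OF w3(1) eq_symI[OF w3(1) W3(2)] wff_ext1[OF w3(2) \<phi>(1)] \<phi>(2,3) forces_mono[OF w3(2) e]])
        next
          fix W3 a s' assume W3: "W2 \<sqsubseteq> W3" "hty W3 a \<sigma>" "hty W3 s' (Seq \<sigma>)"
            "W3 \<tturnstile> Eq (Seq \<sigma>) s (prep \<sigma> a s')"
          have w3: "world W3" "W \<sqsubseteq> W3" using W3 w2 ext_world ext_trans by blast+
          note tr = eq_transI[OF w3(1)] and sy = eq_symI[OF w3(1)]
          have "W3 \<tturnstile> Bot"
            by (rule suc_neq_zero[OF w3(1) tr[OF sy[OF len_prep[OF w3(1) W3(2,3)]]
                tr[OF sy[OF len_eq[OF w3(1) W3(4)]] forces_mono[OF W3(1) W2(2)]]]])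
          then show "W3 \<tturnstile> finst s \<phi>"
            using wff_finst[OF wff_ext1[OF w3(2) \<phi>(1)] hty_ext[OF W3(1) s]] \<phi>
            by (auto intro: forces_botE)
        qed (use \<phi> in auto)
      qed (use W1 in \<open>auto intro: has_ty_len\<close>)
      then show "W1 \<tturnstile> finst s (fsubst (up (case_nat zero Var)) ?\<chi>)" unfolding fi .
    qed
  next
    fix W1 n assume W1: "W \<sqsubseteq> W1" "hty W1 n N" and IH: "W1 \<tturnstile> finst n ?\<psi>"
    have w1: "world W1" using W1 ext_world by blast
    show "W1 \<tturnstile> finst (suc n) ?\<psi>" unfolding fa
    proof (rule forces_allI[OF w1 wf'[OF W1(1) has_ty_suc[OF W1(2)]]])
      fix W2 s assume W2: "W1 \<sqsubseteq> W2" "hty W2 s (Seq \<sigma>)"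
      have w2: "world W2" "W \<sqsubseteq> W2" using W1 W2 ext_world ext_trans by blast+
      have "W2 \<tturnstile> Imp (Eq N (len_tm \<sigma> s) (suc n)) (finst s \<phi>)"
      proof (rule forces_impI[OF w2(1)])
        show "wff (fst W2) (Eq N (len_tm \<sigma> s) (suc n))"
          using W1 W2 by (auto intro: has_ty_len has_ty_suc hty_ext)
        fix W3 assume W3: "W2 \<sqsubseteq> W3" "W3 \<tturnstile> Eq N (len_tm \<sigma> s) (suc n)"
        have w3: "world W3" "W \<sqsubseteq> W3" using w2 W3 ext_world ext_trans by blast+
        have s: "hty W3 s (Seq \<sigma>)" using W2 W3 hty_ext by blast
        show "W3 \<tturnstile> finst s \<phi>"
        proof (rule seq_case[OF w3(1) s])
          show "wff (fst W3) (finst s \<phi>)" using wff_finst[OF wff_ext1[OF w3(2) \<phi>(1)] s] .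
          \<comment> \<open>An empty sequence of successor length is contradictory, but the base
            case settles it without deriving the contradiction.\<close>
          fix W4 assume W4: "W3 \<sqsubseteq> W4" "W4 \<tturnstile> Eq (Seq \<sigma>) s (Cst (Empty \<sigma>))"
          have w4: "world W4" "W \<sqsubseteq> W4" using W4 w3 ext_world ext_trans by blast+
          show "W4 \<tturnstile> finst s \<phi>"
            by (rule finst_cong[OF w4(1) eq_symI[OF w4(1) W4(2)] wff_ext1[OF w4(2) \<phi>(1)] \<phi>(2,3) forces_mono[OF w4(2) e]])
        next
          fix W4 a s' assume W4: "W3 \<sqsubseteq> W4" "hty W4 a \<sigma>" "hty W4 s' (Seq \<sigma>)"
            "W4 \<tturnstile> Eq (Seq \<sigma>) s (prep \<sigma> a s')"
          have w4: "world W4" "W \<sqsubseteq> W4" "W1 \<sqsubseteq> W4"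
            using ext_world[OF W4(1)] ext_trans[OF w3(2) W4(1)] ext_trans[OF W2(1) ext_trans[OF W3(1) W4(1)]] by auto
          have n: "hty W4 n N" using W1 w4 hty_ext by blast
          note tr = eq_transI[OF w4(1)] and sy = eq_symI[OF w4(1)]
          have "W4 \<tturnstile> Eq N (suc (len_tm \<sigma> s')) (suc n)"
            by (rule tr[OF sy[OF len_prep[OF w4(1) W4(2,3)]]
                tr[OF sy[OF len_eq[OF w4(1) W4(4)]] forces_mono[OF W4(1) W3(2)]]])
          then have l: "W4 \<tturnstile> Eq N (len_tm \<sigma> s') n"
            by (rule suc_injectD[OF w4(1)]) (use W4 n in \<open>auto intro: has_ty_len\<close>)
          have "W4 \<tturnstile> Imp (Eq N (len_tm \<sigma> s') n) (finst s' \<phi>)"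
            using forces_allE[OF forces_mono[OF w4(3) IH[unfolded fa]] W4(3)] unfolding fi .
          from step[OF w4(2) W4(2,3) forces_mp[OF this l]]
          show "W4 \<tturnstile> finst s \<phi>"
            by (rule finst_cong[OF w4(1) sy[OF W4(4)] wff_ext1[OF w4(2) \<phi>(1)] \<phi>(2,3)])
        qed (use \<phi> in auto)
      qed simp
      then show "W2 \<tturnstile> finst s (fsubst (up (case_nat (suc n) Var)) ?\<chi>)" unfolding fi .
    qed
  qed (use \<phi> s in \<open>auto intro: has_ty_len\<close>)
  from forces_allE[OF this[unfolded fa] s] have "W \<tturnstile> Imp (Eq N (len_tm \<sigma> s) (len_tm \<sigma> s)) (finst s \<phi>)"
    unfolding fi .
  then show ?thesis by (rule forces_mp) (rule eq_reflI[OF has_ty_len[OF s]])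
qed

section \<open>Concatenation and unions of sequences\<close>

definition append_step :: "ty \<Rightarrow> tm" where
  "append_step \<sigma> = Cst (CombS \<sigma> (Seq \<sigma> \<^bold>\<rightarrow> Seq \<sigma>) (Seq \<sigma> \<^bold>\<rightarrow> Seq \<sigma> \<^bold>\<rightarrow> Seq \<sigma>)) \<^bold>\<cdot>
    (Cst (CombK ((Seq \<sigma> \<^bold>\<rightarrow> Seq \<sigma>) \<^bold>\<rightarrow> Seq \<sigma> \<^bold>\<rightarrow> Seq \<sigma> \<^bold>\<rightarrow> Seq \<sigma>) \<sigma>) \<^bold>\<cdot>
      Cst (CombK (Seq \<sigma> \<^bold>\<rightarrow> Seq \<sigma>) (Seq \<sigma>))) \<^bold>\<cdot> Cst (Prep \<sigma>)"

definition append_tm :: "ty \<Rightarrow> tm \<Rightarrow> tm \<Rightarrow> tm" where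
  "append_tm \<sigma> s t = Cst (LRec \<sigma> (Seq \<sigma>)) \<^bold>\<cdot> t \<^bold>\<cdot> append_step \<sigma> \<^bold>\<cdot> s"

lemma has_ty_append_step: "has_ty \<Gamma> (append_step \<sigma>) (\<sigma> \<^bold>\<rightarrow> Seq \<sigma> \<^bold>\<rightarrow> Seq \<sigma> \<^bold>\<rightarrow> Seq \<sigma>)"
  unfolding append_step_def by (auto intro!: has_ty.intros cst_ty.intros)

lemma has_ty_append:
  "has_ty \<Gamma> s (Seq \<sigma>) \<Longrightarrow> has_ty \<Gamma> t (Seq \<sigma>) \<Longrightarrow> has_ty \<Gamma> (append_tm \<sigma> s t) (Seq \<sigma>)"
  unfolding append_tm_def by (rule has_ty_LRec has_ty_append_step has_ty.intros(3) | assumption)+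

lemma tsubst_append [simp]:
  "tsubst \<theta> (append_tm \<sigma> s t) = append_tm \<sigma> (tsubst \<theta> s) (tsubst \<theta> t)"
  by (simp add: append_tm_def append_step_def)

lemma append_prep:
  assumes "world W" "hty W a \<sigma>" "hty W s (Seq \<sigma>)" "hty W t (Seq \<sigma>)"
  shows "W \<tturnstile> Eq (Seq \<sigma>) (append_tm \<sigma> (prep \<sigma> a s) t) (Cst (Prep \<sigma>) \<^bold>\<cdot> a \<^bold>\<cdot> append_tm \<sigma> s t)"
proof -
  let ?k = "Cst (CombK (Seq \<sigma> \<^bold>\<rightarrow> Seq \<sigma>) (Seq \<sigma>))" and ?p = "Cst (Prep \<sigma>)" and ?r = "append_tm \<sigma> s t"
  let ?kk = "Cst (CombK ((Seq \<sigma> \<^bold>\<rightarrow> Seq \<sigma>) \<^bold>\<rightarrow> Seq \<sigma> \<^bold>\<rightarrow> Seq \<sigma> \<^bold>\<rightarrow> Seq \<sigma>) \<sigma>) \<^bold>\<cdot> ?k"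
  have ty: "hty W ?k ((Seq \<sigma> \<^bold>\<rightarrow> Seq \<sigma>) \<^bold>\<rightarrow> Seq \<sigma> \<^bold>\<rightarrow> Seq \<sigma> \<^bold>\<rightarrow> Seq \<sigma>)" "hty W ?p (\<sigma> \<^bold>\<rightarrow> Seq \<sigma> \<^bold>\<rightarrow> Seq \<sigma>)"
    "hty W ?kk (\<sigma> \<^bold>\<rightarrow> (Seq \<sigma> \<^bold>\<rightarrow> Seq \<sigma>) \<^bold>\<rightarrow> Seq \<sigma> \<^bold>\<rightarrow> Seq \<sigma> \<^bold>\<rightarrow> Seq \<sigma>)" "hty W (?p \<^bold>\<cdot> a) (Seq \<sigma> \<^bold>\<rightarrow> Seq \<sigma>)" "hty W ?r (Seq \<sigma>)"
    using assms has_ty_append by (auto intro!: has_ty.intros cst_ty.intros)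
  note w = assms(1) and tr = eq_transI[OF assms(1)] and ap = eq_appI[OF assms(1)]
  have 1: "W \<tturnstile> Eq (Seq \<sigma>) (append_tm \<sigma> (prep \<sigma> a s) t) (append_step \<sigma> \<^bold>\<cdot> a \<^bold>\<cdot> s \<^bold>\<cdot> ?r)"
    unfolding append_tm_def by (rule lrec_prep_eq[OF assms(4) has_ty_append_step assms(2,3)])
  \<comment> \<open>\<open>append_step\<close> is S (K K) C with C for prepending. It sends
    \<open>a\<close> to K (C a), which drops the tail and prepends \<open>a\<close> to the recursive
    value.\<close>
  have "W \<tturnstile> Eq (Seq \<sigma> \<^bold>\<rightarrow> Seq \<sigma> \<^bold>\<rightarrow> Seq \<sigma>) (append_step \<sigma> \<^bold>\<cdot> a) (?kk \<^bold>\<cdot> a \<^bold>\<cdot> (?p \<^bold>\<cdot> a))"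
    unfolding append_step_def by (rule comb_s_eq) (use assms ty in auto)
  moreover have "W \<tturnstile> Eq (Seq \<sigma> \<^bold>\<rightarrow> Seq \<sigma> \<^bold>\<rightarrow> Seq \<sigma>) (?kk \<^bold>\<cdot> a \<^bold>\<cdot> (?p \<^bold>\<cdot> a)) (?k \<^bold>\<cdot> (?p \<^bold>\<cdot> a))"
    by (rule ap[OF comb_k_eq eq_reflI]) (use assms ty in auto)
  ultimately have "W \<tturnstile> Eq (Seq \<sigma> \<^bold>\<rightarrow> Seq \<sigma> \<^bold>\<rightarrow> Seq \<sigma>) (append_step \<sigma> \<^bold>\<cdot> a) (?k \<^bold>\<cdot> (?p \<^bold>\<cdot> a))" by (rule tr)
  then have 2: "W \<tturnstile> Eq (Seq \<sigma>) (append_step \<sigma> \<^bold>\<cdot> a \<^bold>\<cdot> s \<^bold>\<cdot> ?r) (?k \<^bold>\<cdot> (?p \<^bold>\<cdot> a) \<^bold>\<cdot> s \<^bold>\<cdot> ?r)"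
    by (rule ap[OF ap[OF _ eq_reflI] eq_reflI]) (use assms ty in auto)
  have 3: "W \<tturnstile> Eq (Seq \<sigma>) (?k \<^bold>\<cdot> (?p \<^bold>\<cdot> a) \<^bold>\<cdot> s \<^bold>\<cdot> ?r) (?p \<^bold>\<cdot> a \<^bold>\<cdot> ?r)"
    by (rule ap[OF comb_k_eq eq_reflI]) (use assms ty in auto)
  show ?thesis by (rule tr[OF 1 tr[OF 2 3]])
qed

lemma append_empty:
  "hty W t (Seq \<sigma>) \<Longrightarrow> W \<tturnstile> Eq (Seq \<sigma>) (append_tm \<sigma> (Cst (Empty \<sigma>)) t) t"
  unfolding append_tm_def by (rule lrec_empty_eq[OF _ has_ty_append_step])

lemma Mem_append_right:
  assumes "world W" "hty W x \<sigma>" "hty W s (Seq \<sigma>)" "hty W t (Seq \<sigma>)" "W \<tturnstile> Mem \<sigma> x t"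
  shows "W \<tturnstile> Mem \<sigma> x (append_tm \<sigma> s t)"
proof -
  let ?\<phi> = "Mem \<sigma> (tlift 1 x) (append_tm \<sigma> (Var 0) (tlift 1 t))"
  have fi: "finst s ?\<phi> = Mem \<sigma> x (append_tm \<sigma> s t)" for s by simp
  have "W \<tturnstile> finst s ?\<phi>"
  proof (rule seq_induct[OF assms(1)])
    show "wff (Seq \<sigma> # fst W) ?\<phi>"
      using has_ty_tlift1[OF assms(2)] has_ty_tlift1[OF assms(4)]
      by (intro wff_Mem has_ty_append has_ty_VarI) auto
    show "W \<tturnstile> finst (Cst (Empty \<sigma>)) ?\<phi>" unfolding fi
      by (rule Mem_cong[OF assms(1) eq_reflI[OF assms(2)] eq_symI[OF assms(1) append_empty[OF assms(4)]] assms(5)])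
    fix W' a s assume W': "W \<sqsubseteq> W'" "hty W' a \<sigma>" "hty W' s (Seq \<sigma>)" and IH: "W' \<tturnstile> finst s ?\<phi>"
    have w: "world W'" and ty: "hty W' x \<sigma>" "hty W' t (Seq \<sigma>)"
      using W' assms ext_world hty_ext by blast+
    show "W' \<tturnstile> finst (prep \<sigma> a s) ?\<phi>" unfolding fi
      by (rule Mem_cong[OF w eq_reflI[OF ty(1)] eq_symI[OF w append_prep[OF w W'(2,3) ty(2)]]
          Mem_Prep_tail[OF w W'(2) has_ty_append[OF W'(3) ty(2)] ty(1) IH[unfolded fi]]])
  qed (use assms in auto)
  then show ?thesis unfolding fi .
qed

text \<open>Membership in \<open>s\<close> changes along the induction on \<open>s\<close>, so it is
  made a premise of the induction formula. For a prepended sequence, \<open>x\<close> is either the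
  head, which stays in front, or covered by the induction hypothesis.\<close>

lemma Mem_append_left:
  assumes "world W" "hty W x \<sigma>" "hty W s (Seq \<sigma>)" "hty W t (Seq \<sigma>)" "W \<tturnstile> Mem \<sigma> x s"
  shows "W \<tturnstile> Mem \<sigma> x (append_tm \<sigma> s t)"
proof -
  let ?\<phi> = "Imp (Mem \<sigma> (tlift 1 x) (Var 0)) (Mem \<sigma> (tlift 1 x) (append_tm \<sigma> (Var 0) (tlift 1 t)))"
  have fi: "finst s ?\<phi> = Imp (Mem \<sigma> x s) (Mem \<sigma> x (append_tm \<sigma> s t))" for s by simp
  have "W \<tturnstile> finst s ?\<phi>"
  proof (rule seq_induct[OF assms(1)])
    show "wff (Seq \<sigma> # fst W) ?\<phi>"
      using has_ty_tlift1[OF assms(2)] has_ty_tlift1[OF assms(4)] unfolding wff.simps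
      by (intro conjI wff_Mem has_ty_append has_ty_VarI) auto
    show "W \<tturnstile> finst (Cst (Empty \<sigma>)) ?\<phi>" unfolding fi
    proof (rule forces_impI[OF assms(1)])
      fix W' assume W': "W \<sqsubseteq> W'" "W' \<tturnstile> Mem \<sigma> x (Cst (Empty \<sigma>))"
      have w: "world W'" and ty: "hty W' x \<sigma>" "hty W' t (Seq \<sigma>)"
        using W' assms ext_world hty_ext by blast+
      show "W' \<tturnstile> Mem \<sigma> x (append_tm \<sigma> (Cst (Empty \<sigma>)) t)"
        by (rule forces_botE[OF Mem_Empty[OF W'(2) w]]) (use ty in \<open>auto intro: wff_Mem has_ty_append has_ty_Empty\<close>)
    qed (use assms in \<open>auto intro: wff_Mem has_ty_Empty\<close>)
    fix W' a s assume W': "W \<sqsubseteq> W'" "hty W' a \<sigma>" "hty W' s (Seq \<sigma>)" and IH: "W' \<tturnstile> finst s ?\<phi>"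
    have w: "world W'" and ty: "hty W' x \<sigma>" "hty W' t (Seq \<sigma>)"
      using W' assms ext_world hty_ext by blast+
    show "W' \<tturnstile> finst (prep \<sigma> a s) ?\<phi>" unfolding fi
    proof (rule forces_impI[OF w])
      fix W2 assume W2: "W' \<sqsubseteq> W2" "W2 \<tturnstile> Mem \<sigma> x (prep \<sigma> a s)"
      have w2: "world W2" and ty2: "hty W2 x \<sigma>" "hty W2 t (Seq \<sigma>)" "hty W2 a \<sigma>" "hty W2 s (Seq \<sigma>)"
        using W2 W' ty ext_world hty_ext by blast+
      show "W2 \<tturnstile> Mem \<sigma> x (append_tm \<sigma> (prep \<sigma> a s) t)"
      proof (rule Mem_Prep_cases[OF W2(2) w2 ty2(3,4,1)])
        fix W3 assume W3: "W2 \<sqsubseteq> W3" "W3 \<tturnstile> Eq \<sigma> x a"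
        have w: "world W3" and ty: "hty W3 x \<sigma>" "hty W3 t (Seq \<sigma>)" "hty W3 a \<sigma>" "hty W3 s (Seq \<sigma>)"
          using W3 ty2 ext_world hty_ext by blast+
        show "W3 \<tturnstile> Mem \<sigma> x (append_tm \<sigma> (prep \<sigma> a s) t)"
          by (rule Mem_cong[OF w eq_symI[OF w W3(2)] eq_symI[OF w append_prep[OF w ty(3,4,2)]]
              Mem_Prep_head[OF w ty(3) has_ty_append[OF ty(4,2)]]])
      next
        fix W3 assume W3: "W2 \<sqsubseteq> W3" "W3 \<tturnstile> Mem \<sigma> x s"
        have e: "W' \<sqsubseteq> W3" by (rule ext_trans[OF W2(1) W3(1)])
        have w: "world W3"
          and ty: "hty W3 x \<sigma>" "hty W3 t (Seq \<sigma>)" "hty W3 a \<sigma>" "hty W3 s (Seq \<sigma>)"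
          using W3(1) ty2 ext_world hty_ext by blast+
        show "W3 \<tturnstile> Mem \<sigma> x (append_tm \<sigma> (prep \<sigma> a s) t)"
          by (rule Mem_cong[OF w eq_reflI[OF ty(1)] eq_symI[OF w append_prep[OF w ty(3,4,2)]]
              Mem_Prep_tail[OF w ty(3) has_ty_append[OF ty(4,2)] ty(1)
                forces_mp[OF forces_mono[OF e IH[unfolded fi]] W3(2)]]])
      qed (use ty2 in \<open>auto intro!: wff_Mem has_ty_append has_ty_Prep\<close>)
    qed (use ty W' in \<open>auto intro!: wff_Mem has_ty_Prep\<close>)
  qed (use assms in auto)
  then show ?thesis unfolding fi using assms(5) by (rule forces_mp)
qed

text \<open>The witness \<open>b\<close> is the union of the \<open>t(z)\<close> for \<open>z\<close> in \<open>Z\<close>. Only one inclusion is needed: enlarging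
  a set of challenges never hurts.\<close>

lemma union1:
  assumes "has_ty (\<Gamma> @ [\<tau>]) t (Seq \<sigma>)" "has_ty \<Gamma> Z (Seq \<tau>)"
  shows "\<exists>b. has_ty \<Gamma> b (Seq \<sigma>) \<and> (\<forall>W xs z y. world W \<longrightarrow> htys W xs \<Gamma> \<longrightarrow> hty W z \<tau> \<longrightarrow> hty W y \<sigma> \<longrightarrow>
    W \<tturnstile> Mem \<tau> z (inst xs Z) \<longrightarrow> W \<tturnstile> Mem \<sigma> y (inst (xs @ [z]) t) \<longrightarrow> W \<tturnstile> Mem \<sigma> y (inst xs b))"
proof -
  obtain f where f: "has_ty \<Gamma> f (\<tau> \<^bold>\<rightarrow> Seq \<sigma>)"
    and feq: "\<And>W xs u. world W \<Longrightarrow> htys W xs \<Gamma> \<Longrightarrow> hty W u \<tau> \<Longrightarrow>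
      W \<tturnstile> Eq (Seq \<sigma>) (inst xs f \<^bold>\<cdot> u) (inst (xs @ [u]) t)"
    using lam1[OF assms(1)] by metis
  \<comment> \<open>The step of the union, to be abstracted over head, tail and recursive value
    (variables 1 to 3); variable 0, the function whose values are united, stays open.\<close>
  let ?C = "[\<tau> \<^bold>\<rightarrow> Seq \<sigma>]" and ?D = "[\<tau>, Seq \<tau>, Seq \<sigma>]"
  have "has_ty (?C @ ?D) (append_tm \<sigma> (Var 0 \<^bold>\<cdot> Var 1) (Var 3)) (Seq \<sigma>)"
    by (intro has_ty_append has_ty.intros(3)[of _ _ \<tau>] has_ty_VarI) auto
  from lam[OF this] obtain st where st: "has_ty ?C st (arrs ?D (Seq \<sigma>))"
    and steq: "\<And>W xs us. world W \<Longrightarrow> htys W xs ?C \<Longrightarrow> htys W us ?D \<Longrightarrow>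
      W \<tturnstile> Eq (Seq \<sigma>) (apps (inst xs st) us) (inst (xs @ us) (append_tm \<sigma> (Var 0 \<^bold>\<cdot> Var 1) (Var 3)))"
    by blast
  define U where "U g s = Cst (LRec \<tau> (Seq \<sigma>)) \<^bold>\<cdot> Cst (Empty \<sigma>) \<^bold>\<cdot> inst [g] st \<^bold>\<cdot> s" for g s
  have ist: "has_ty \<Gamma>' (inst [g] st) (\<tau> \<^bold>\<rightarrow> Seq \<tau> \<^bold>\<rightarrow> Seq \<sigma> \<^bold>\<rightarrow> Seq \<sigma>)" if "has_ty \<Gamma>' g (\<tau> \<^bold>\<rightarrow> Seq \<sigma>)" for \<Gamma>' g
    using has_ty_inst[OF st, of \<Gamma>' "[g]"] that by simp
  have U: "has_ty \<Gamma>' (U g s) (Seq \<sigma>)" if "has_ty \<Gamma>' g (\<tau> \<^bold>\<rightarrow> Seq \<sigma>)" "has_ty \<Gamma>' s (Seq \<tau>)" for \<Gamma>' g s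
    unfolding U_def by (rule has_ty_LRec has_ty_Empty ist that has_ty.intros(3))+
  have inst_inst: "tsubst \<theta> (inst [g] st) = inst [tsubst \<theta> g] st" for \<theta> g
    unfolding inst_def tsubst_tsubst by (rule tsubst_cong[OF st]) simp
  have sub: "tsubst \<theta> (U g s) = U (tsubst \<theta> g) (tsubst \<theta> s)" for \<theta> g s
    by (simp add: U_def inst_inst)
  have Ueq: "W \<tturnstile> Eq (Seq \<sigma>) (U g (prep \<tau> a s)) (append_tm \<sigma> (g \<^bold>\<cdot> a) (U g s))"
    if W: "world W" "hty W g (\<tau> \<^bold>\<rightarrow> Seq \<sigma>)" "hty W a \<tau>" "hty W s (Seq \<tau>)" for W g a s
  proof -
    have "W \<tturnstile> Eq (Seq \<sigma>) (U g (prep \<tau> a s)) (inst [g] st \<^bold>\<cdot> a \<^bold>\<cdot> s \<^bold>\<cdot> U g s)"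
      unfolding U_def by (rule lrec_prep_eq[OF has_ty_Empty ist[OF W(2)] W(3,4)])
    moreover have "W \<tturnstile> Eq (Seq \<sigma>) (inst [g] st \<^bold>\<cdot> a \<^bold>\<cdot> s \<^bold>\<cdot> U g s) (append_tm \<sigma> (g \<^bold>\<cdot> a) (U g s))"
      using steq[OF W(1), of "[g]" "[a, s, U g s]"] W(2-4) U[OF W(2,4)] by (simp add: inst_def)
    ultimately show ?thesis by (rule eq_transI[OF W(1)])
  qed
  have main: "W \<tturnstile> Mem \<sigma> y (U g s)"
    if w: "world W" and g: "hty W g (\<tau> \<^bold>\<rightarrow> Seq \<sigma>)" and z: "hty W z \<tau>" and y: "hty W y \<sigma>" and s: "hty W s (Seq \<tau>)"
      and zs: "W \<tturnstile> Mem \<tau> z s" and yg: "W \<tturnstile> Mem \<sigma> y (g \<^bold>\<cdot> z)" for W g z y s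
  proof -
    \<comment> \<open>Induction on the index sequence \<open>s\<close>. For \<open>z\<close> equal
      to the head, \<open>g z\<close> is the first part of the concatenation; otherwise the
      induction hypothesis places \<open>y\<close> in the second part.\<close>
    let ?\<phi> = "Imp (Mem \<tau> (tlift 1 z) (Var 0)) (Mem \<sigma> (tlift 1 y) (U (tlift 1 g) (Var 0)))"
    have fi: "finst s ?\<phi> = Imp (Mem \<tau> z s) (Mem \<sigma> y (U g s))" for s by (simp add: sub)
    have "W \<tturnstile> finst s ?\<phi>"
    proof (rule seq_induct[OF w])
      show "wff (Seq \<tau> # fst W) ?\<phi>"
        using has_ty_tlift1[OF z] has_ty_tlift1[OF y] has_ty_tlift1[OF g] unfolding wff.simps
        by (intro conjI wff_Mem U has_ty_VarI) auto
      show "W \<tturnstile> finst (Cst (Empty \<tau>)) ?\<phi>" unfolding fi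
      proof (rule forces_impI[OF w])
        fix W' assume W': "W \<sqsubseteq> W'" "W' \<tturnstile> Mem \<tau> z (Cst (Empty \<tau>))"
        have w': "world W'" and ty: "hty W' y \<sigma>" "hty W' g (\<tau> \<^bold>\<rightarrow> Seq \<sigma>)"
          using W' y g ext_world hty_ext by blast+
        show "W' \<tturnstile> Mem \<sigma> y (U g (Cst (Empty \<tau>)))"
          by (rule forces_botE[OF Mem_Empty[OF W'(2) w']]) (use ty in \<open>auto intro: wff_Mem U has_ty_Empty\<close>)
      qed (use z in \<open>auto intro: wff_Mem has_ty_Empty\<close>)
      fix W' a s assume W': "W \<sqsubseteq> W'" "hty W' a \<tau>" "hty W' s (Seq \<tau>)" and IH: "W' \<tturnstile> finst s ?\<phi>"
      have w': "world W'" and ty: "hty W' y \<sigma>" "hty W' g (\<tau> \<^bold>\<rightarrow> Seq \<sigma>)" "hty W' z \<tau>"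
        using W' y g z ext_world hty_ext by blast+
      show "W' \<tturnstile> finst (prep \<tau> a s) ?\<phi>" unfolding fi
      proof (rule forces_impI[OF w'])
        fix W2 assume W2: "W' \<sqsubseteq> W2" "W2 \<tturnstile> Mem \<tau> z (prep \<tau> a s)"
        have w2: "world W2" and ty2: "hty W2 y \<sigma>" "hty W2 g (\<tau> \<^bold>\<rightarrow> Seq \<sigma>)" "hty W2 z \<tau>" "hty W2 a \<tau>" "hty W2 s (Seq \<tau>)"
          using W2 W' ty ext_world hty_ext by blast+
        show "W2 \<tturnstile> Mem \<sigma> y (U g (prep \<tau> a s))"
        proof (rule Mem_Prep_cases[OF W2(2) w2 ty2(4,5,3)])
          fix W3 assume W3: "W2 \<sqsubseteq> W3" "W3 \<tturnstile> Eq \<tau> z a"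
          have e: "W \<sqsubseteq> W3" by (rule ext_trans[OF ext_trans[OF W'(1) W2(1)] W3(1)])
          have w: "world W3"
            and ty: "hty W3 y \<sigma>" "hty W3 g (\<tau> \<^bold>\<rightarrow> Seq \<sigma>)" "hty W3 z \<tau>" "hty W3 a \<tau>" "hty W3 s (Seq \<tau>)"
            using W3(1) ty2 ext_world hty_ext by blast+
          have "W3 \<tturnstile> Mem \<sigma> y (g \<^bold>\<cdot> a)"
            by (rule Mem_cong[OF w eq_reflI[OF ty(1)] eq_appI[OF w eq_reflI[OF ty(2)] W3(2)] forces_mono[OF e yg]])
          then show "W3 \<tturnstile> Mem \<sigma> y (U g (prep \<tau> a s))"
            by (rule Mem_cong[OF w eq_reflI[OF ty(1)] eq_symI[OF w Ueq[OF w ty(2,4,5)]]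
                Mem_append_left[OF w ty(1) has_ty.intros(3)[OF ty(2,4)] U[OF ty(2,5)]]])
        next
          fix W3 assume W3: "W2 \<sqsubseteq> W3" "W3 \<tturnstile> Mem \<tau> z s"
          have e: "W' \<sqsubseteq> W3" by (rule ext_trans[OF W2(1) W3(1)])
          have w: "world W3"
            and ty: "hty W3 y \<sigma>" "hty W3 g (\<tau> \<^bold>\<rightarrow> Seq \<sigma>)" "hty W3 z \<tau>" "hty W3 a \<tau>" "hty W3 s (Seq \<tau>)"
            using W3(1) ty2 ext_world hty_ext by blast+
          show "W3 \<tturnstile> Mem \<sigma> y (U g (prep \<tau> a s))"
            by (rule Mem_cong[OF w eq_reflI[OF ty(1)] eq_symI[OF w Ueq[OF w ty(2,4,5)]]
                Mem_append_right[OF w ty(1) has_ty.intros(3)[OF ty(2,4)] U[OF ty(2,5)]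
                  forces_mp[OF forces_mono[OF e IH[unfolded fi]] W3(2)]]])
        qed (use ty2 in \<open>auto intro!: wff_Mem U has_ty_Prep\<close>)
      qed (use ty W' in \<open>auto intro!: wff_Mem has_ty_Prep\<close>)
    qed (use s in auto)
    then show ?thesis unfolding fi using zs by (rule forces_mp)
  qed
  show ?thesis
  proof (intro HOL.exI[of _ "U f Z"] conjI HOL.allI HOL.impI)
    show "has_ty \<Gamma> (U f Z) (Seq \<sigma>)" by (rule U[OF f assms(2)])
    fix W xs z y assume W: "world W" "htys W xs \<Gamma>" "hty W z \<tau>" "hty W y \<sigma>"
      "W \<tturnstile> Mem \<tau> z (inst xs Z)" "W \<tturnstile> Mem \<sigma> y (inst (xs @ [z]) t)"
    have "W \<tturnstile> Mem \<sigma> y (inst xs f \<^bold>\<cdot> z)"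
      by (rule Mem_cong[OF W(1) eq_reflI[OF W(4)] eq_symI[OF W(1) feq[OF W(1-3)]] W(6)])
    then have "W \<tturnstile> Mem \<sigma> y (U (inst xs f) (inst xs Z))"
      using main[OF W(1) has_ty_inst[OF f W(2)] W(3,4) has_ty_inst[OF assms(2) W(2)] W(5)] by blast
    then show "W \<tturnstile> Mem \<sigma> y (inst xs (U f Z))" by (simp add: inst_def sub[unfolded inst_def])
  qed
qed

text \<open>Nested unions, with the last component innermost. The index sequence of that component
  does not mention the other index variables, so its value is the same over the longer
  tuple.\<close>

lemma union:
  assumes "has_ty (\<Gamma> @ \<tau>s) t (Seq \<sigma>)" "list_all2 (has_ty \<Gamma>) Zs (map Seq \<tau>s)"
  shows "\<exists>b. has_ty \<Gamma> b (Seq \<sigma>) \<and> (\<forall>W xs zs y. world W \<longrightarrow> htys W xs \<Gamma> \<longrightarrow> htys W zs \<tau>s \<longrightarrow> hty W y \<sigma> \<longrightarrow>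
    mems W \<tau>s zs (map (inst xs) Zs) \<longrightarrow> W \<tturnstile> Mem \<sigma> y (inst (xs @ zs) t) \<longrightarrow> W \<tturnstile> Mem \<sigma> y (inst xs b))"
  using assms
proof (induction \<tau>s arbitrary: t Zs rule: rev_induct)
  case Nil
  then show ?case by (intro HOL.exI[of _ t]) auto
next
  case (snoc \<tau> \<tau>s)
  then obtain Zs' Z where Zs: "Zs = Zs' @ [Z]" "list_all2 (has_ty \<Gamma>) Zs' (map Seq \<tau>s)" "has_ty \<Gamma> Z (Seq \<tau>)"
    by (auto simp: list_all2_append2 list_all2_Cons2)
  obtain b1 where b1: "has_ty (\<Gamma> @ \<tau>s) b1 (Seq \<sigma>)" and
    m1: "\<And>W xs z y. world W \<Longrightarrow> htys W xs (\<Gamma> @ \<tau>s) \<Longrightarrow> hty W z \<tau> \<Longrightarrow> hty W y \<sigma> \<Longrightarrow>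
    W \<tturnstile> Mem \<tau> z (inst xs Z) \<Longrightarrow> W \<tturnstile> Mem \<sigma> y (inst (xs @ [z]) t) \<Longrightarrow> W \<tturnstile> Mem \<sigma> y (inst xs b1)"
    using union1[of "\<Gamma> @ \<tau>s" \<tau> t \<sigma> Z] snoc.prems(1) has_ty_mono[OF Zs(3)] by auto
  obtain b where b: "has_ty \<Gamma> b (Seq \<sigma>)" and
    m: "\<And>W xs zs y. world W \<Longrightarrow> htys W xs \<Gamma> \<Longrightarrow> htys W zs \<tau>s \<Longrightarrow> hty W y \<sigma> \<Longrightarrow>
    mems W \<tau>s zs (map (inst xs) Zs') \<Longrightarrow> W \<tturnstile> Mem \<sigma> y (inst (xs @ zs) b1) \<Longrightarrow> W \<tturnstile> Mem \<sigma> y (inst xs b)"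
    using snoc.IH[OF b1 Zs(2)] by auto
  show ?case
  proof (intro HOL.exI[of _ b] conjI HOL.allI HOL.impI b)
    fix W xs zs y assume W: "world W" "htys W xs \<Gamma>" "htys W zs (\<tau>s @ [\<tau>])" "hty W y \<sigma>"
      "mems W (\<tau>s @ [\<tau>]) zs (map (inst xs) Zs)" "W \<tturnstile> Mem \<sigma> y (inst (xs @ zs) t)"
    then obtain zs' z where zs: "zs = zs' @ [z]" "htys W zs' \<tau>s" "hty W z \<tau>"
      by (auto simp: list_all2_append2 list_all2_Cons2)
    have l: "length zs' = length \<tau>s" "length Zs' = length \<tau>s"
      using zs(2) Zs(2) by (auto dest: list_all2_lengthD)
    then have mm: "mems W \<tau>s zs' (map (inst xs) Zs')" "W \<tturnstile> Mem \<tau> z (inst xs Z)"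
      using W(5) by (simp_all add: zs(1) Zs(1) rel3_append)
    have "inst (xs @ zs') Z = inst xs Z"
      unfolding inst_def by (rule tsubst_cong[OF Zs(3)]) (simp add: nth_append list_all2_lengthD[OF W(2)])
    then have "W \<tturnstile> Mem \<sigma> y (inst (xs @ zs') b1)"
      using m1[OF W(1) list_all2_appendI[OF W(2) zs(2)] zs(3) W(4)] W(6) zs(1) mm(2) by simp
    then show "W \<tturnstile> Mem \<sigma> y (inst xs b)" by (rule m[OF W(1,2) zs(2) W(4) mm(1)])
  qed
qed

end

section \<open>The matrix of the translation\<close>

text \<open>Worlds are pairs; quantifiers over them should stay quantifiers over a single
  world.\<close>

declare split_paired_All [simp del]

lemma ups: "(up ^^ n) \<theta> i = (if i < n then Var i else tlift n (\<theta> (i - n)))"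
proof (induction n arbitrary: i)
  case (Suc n)
  show ?case using Suc by (cases i) auto
qed simp

lemma tsubst_ups_tlift: "tsubst ((up ^^ n) \<theta>) (tlift n t) = tlift n (tsubst \<theta> t)"
  by (simp add: tsubst_tlift ups tlift_tsubst)

lemma subst_ty_ups: "subst_ty \<Gamma>' \<theta> \<Gamma> \<Longrightarrow> length \<Delta> = n \<Longrightarrow> subst_ty (\<Delta> @ \<Gamma>') ((up ^^ n) \<theta>) (\<Delta> @ \<Gamma>)"
  by (induction \<Delta> arbitrary: n) (auto intro: subst_ty_up)

lemma length_vars [simp]: "length (vars n) = n"
  by (simp add: vars_def)

lemma nth_vars: "i < n \<Longrightarrow> vars n ! i = Var (n - Suc i)"
  by (simp add: vars_def rev_nth)

lemma tsubst_ups_vars: "map (tsubst ((up ^^ n) \<theta>)) (vars n) = vars n"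
  by (rule nth_equalityI) (auto simp: nth_vars ups)

lemma has_ty_vars: "list_all2 (has_ty (rev \<tau>s @ \<Gamma>)) (vars (length \<tau>s)) \<tau>s"
  by (auto simp: list_all2_conv_all_nth nth_vars nth_append rev_nth intro!: has_ty_VarI)

text \<open>Simultaneous instantiation of a block of binders. The reversal matches
  \<open>vars\<close>: terms are listed outermost first, while index 0 is the innermost
  variable.\<close>

definition blk :: "tm list \<Rightarrow> nat \<Rightarrow> tm" where
  "blk ys i = (if i < length ys then rev ys ! i else Var (i - length ys))"

lemma tsubst_blk_tlift: "length ys = n \<Longrightarrow> tsubst (blk ys) (tlift n t) = t"
  by (simp add: tsubst_tlift blk_def)

lemma tsubst_blk_vars: "length ys = n \<Longrightarrow> map (tsubst (blk ys)) (vars n) = ys"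
  by (rule nth_equalityI) (auto simp: nth_vars blk_def rev_nth)

text \<open>Instantiating the outermost binder and then the remaining block amounts to one
  instantiation of the whole block; this drives the inductions over blocks of quantifiers.\<close>

lemma blk_Cons:
  "length ys = n \<Longrightarrow> tsubst (blk ys) ((up ^^ n) (case_nat y Var) i) = blk (y # ys) i"
  by (auto simp: ups tsubst_blk_tlift nth_append blk_def not_less split: nat.split)

lemma fsubst_BAlls:
  "length ss = length \<tau>s \<Longrightarrow>
    fsubst \<theta> (BAlls \<tau>s ss \<phi>) = BAlls \<tau>s (map (tsubst \<theta>) ss) (fsubst ((up ^^ length \<tau>s) \<theta>) \<phi>)"
proof (induction \<tau>s arbitrary: ss \<theta>)
  case (Cons \<tau> \<tau>s)
  then obtain s ss' where "ss = s # ss'" by (cases ss) auto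
  then show ?case using Cons
    by (simp add: o_def tsubst_up_tlift funpow_swap1)
qed simp

lemma internal_BAlls [simp]: "internal (BAlls \<tau>s ss \<phi>) = internal \<phi>"
  by (induction \<tau>s ss \<phi> rule: BAlls.induct) auto

lemma or_free_BAlls [simp]: "or_free (BAlls \<tau>s ss \<phi>) = or_free \<phi>"
  by (induction \<tau>s ss \<phi> rule: BAlls.induct) auto

lemma wff_BAlls:
  "list_all2 (has_ty \<Gamma>) ss (map Seq \<tau>s) \<Longrightarrow> wff (rev \<tau>s @ \<Gamma>) \<phi> \<Longrightarrow> wff \<Gamma> (BAlls \<tau>s ss \<phi>)"
proof (induction \<tau>s arbitrary: \<Gamma> ss)
  case (Cons \<tau> \<tau>s)
  then obtain s ss' where s: "ss = s # ss'" "has_ty \<Gamma> s (Seq \<tau>)" "list_all2 (has_ty \<Gamma>) ss' (map Seq \<tau>s)"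
    by (auto simp: list_all2_Cons2)
  have "list_all2 (has_ty (\<tau> # \<Gamma>)) (map (tlift 1) ss') (map Seq \<tau>s)"
    using s(3) has_ty_tlift1 by (auto simp: list_all2_conv_all_nth)
  then have "wff (\<tau> # \<Gamma>) (BAlls \<tau>s (map (tlift 1) ss') \<phi>)"
    using Cons.IH[of "\<tau> # \<Gamma>"] Cons.prems(2) by simp
  moreover have "wff (\<tau> # \<Gamma>) (Mem \<tau> (Var 0) (tlift 1 s))"
    by (rule wff_Mem) (auto intro: has_ty_VarI has_ty_tlift1[OF s(2), simplified])
  ultimately show ?case using s by simp
qed simp

lemma Uty_fsubst [simp]: "Uty (fsubst \<theta> \<Phi>) = Uty \<Phi>"
  by (induction \<Phi> arbitrary: \<theta>) auto

text \<open>Substitutions into \<Phi> are absorbed by the assignment \<open>as\<close>, which goes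
  down the recursion of \<open>Umat\<close> next to the formula. Instances and liftings of a formula
  can therefore share its realizers.\<close>

lemma Umat_fsubst_fm: "Umat (fsubst \<eta> \<Phi>) as xs ys = Umat \<Phi> (\<lambda>i. tsubst as (\<eta> i)) xs ys"
proof (induction \<Phi> arbitrary: \<eta> as xs ys)
  case (Imp \<Phi> \<Psi>)
  then show ?case by (simp add: Let_def o_def tlift_tsubst)
next
  case (Ex \<sigma> \<Phi>)
  have "tsubst (\<lambda>i. tlift n (up as i)) (up \<eta> i) = tlift n (up (\<lambda>i. tsubst as (\<eta> i)) i)" for n i
    using arg_cong[OF tsubst_up_up[of as \<eta> i], of "tlift n"] by (simp add: tlift_tsubst)
  then show ?case using Ex by (simp add: Let_def o_def)
next
  case (All \<sigma> \<Phi>)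
  then show ?case by (simp add: tsubst_up_up)
next
  case (AllSt \<sigma> \<Phi>)
  have "(\<lambda>i. tsubst (case_nat z as) (up \<eta> i)) = case_nat z (\<lambda>i. tsubst as (\<eta> i))" for z
    by (auto simp: fun_eq_iff tsubst_tlift split: nat.split)
  then show ?case using AllSt by (simp add: Let_def)
next
  case (ExSt \<sigma> \<Phi>)
  have "(\<lambda>i. tsubst (case_nat z as) (up \<eta> i)) = case_nat z (\<lambda>i. tsubst as (\<eta> i))" for z
    by (auto simp: fun_eq_iff tsubst_tlift split: nat.split)
  then show ?case using ExSt by (simp add: Let_def)
qed (simp_all add: tsubst_tsubst Let_def)

lemma Umat_finst: "Umat (finst t \<Phi>) as xs ys = Umat \<Phi> (case_nat (tsubst as t) as) xs ys"
  unfolding finst_def Umat_fsubst_fm by (simp add: tsubst_case_nat_Var)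

lemma Umat_flift: "Umat (flift \<Phi>) as xs ys = Umat \<Phi> (\<lambda>i. as (Suc i)) xs ys"
  unfolding flift_def Umat_fsubst_fm by simp

lemma Uty_finst [simp]: "Uty (finst t \<Phi>) = Uty \<Phi>"
  by (simp add: finst_def)

lemma Uty_flift [simp]: "Uty (flift \<Phi>) = Uty \<Phi>"
  by (simp add: flift_def)

lemma Uty_fsucc [simp]: "Uty (fsucc \<Phi>) = Uty \<Phi>"
  by (simp add: fsucc_def)

text \<open>A substitution into the matrix acts on parameters, realizers and challenges separately.
  The length conditions keep \<open>hd\<close> and \<open>last\<close> away from empty
  lists.\<close>

lemma fsubst_Umat:
  "length xs = length (Uex \<Phi>) \<Longrightarrow> length ys = length (Uall \<Phi>) \<Longrightarrow>
    fsubst \<theta> (Umat \<Phi> as xs ys) = Umat \<Phi> (\<lambda>i. tsubst \<theta> (as i)) (map (tsubst \<theta>) xs) (map (tsubst \<theta>) ys)"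
proof (induction \<Phi> arbitrary: \<theta> as xs ys)
  case (St \<sigma> t)
  then show ?case by (cases xs) (auto simp: tsubst_tsubst)
next
  case (Or \<Phi> \<Psi>)
  then show ?case by (cases xs) (auto simp: Let_def take_map drop_map)
next
  case (Imp \<Phi> \<Psi>)
  have "fsubst ((up ^^ length (Uall \<Phi>)) \<theta>) (Umat \<Phi> (tlift (length (Uall \<Phi>)) \<circ> as)
      (map (tlift (length (Uall \<Phi>))) (take (length (Uex \<Phi>)) ys)) (vars (length (Uall \<Phi>)))) =
    Umat \<Phi> (tlift (length (Uall \<Phi>)) \<circ> (\<lambda>i. tsubst \<theta> (as i)))
      (map (tlift (length (Uall \<Phi>))) (map (tsubst \<theta>) (take (length (Uex \<Phi>)) ys))) (vars (length (Uall \<Phi>)))"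
    using Imp.prems by (subst Imp.IH) (auto simp: tsubst_ups_vars tsubst_ups_tlift o_def)
  then show ?case using Imp.prems
    by (simp add: Let_def fsubst_BAlls take_map drop_map Imp.IH(2) o_def tsubst_apps flip: map_append)
next
  case (Ex \<sigma> \<Phi>)
  let ?n = "length (Uall \<Phi>)"
  have 1: "tsubst ((up ^^ ?n) (up \<theta>)) (tlift (?n + 1) t) = tlift (?n + 1) (tsubst \<theta> t)" for t
    using tsubst_ups_tlift[of ?n "up \<theta>" "tlift 1 t"]
    by (simp add: tsubst_up_tlift add.commute)
  have 2: "tsubst ((up ^^ ?n) (up \<theta>)) (tlift ?n (up as i)) = tlift ?n (up (\<lambda>i. tsubst \<theta> (as i)) i)" for i
    by (simp add: tsubst_ups_tlift tsubst_up_up)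
  have "fsubst ((up ^^ ?n) (up \<theta>)) (Umat \<Phi> (tlift ?n \<circ> up as) (map (tlift (?n + 1)) xs) (vars ?n)) =
      Umat \<Phi> (tlift ?n \<circ> up (\<lambda>i. tsubst \<theta> (as i))) (map (tlift (?n + 1)) (map (tsubst \<theta>) xs)) (vars ?n)"
    using Ex.prems 1 2 by (subst Ex.IH) (auto simp: tsubst_ups_vars o_def)
  then show ?case using Ex.prems by (simp add: Let_def fsubst_BAlls o_def tsubst_up_tlift)
next
  case (All \<sigma> \<Phi>)
  then show ?case by (simp add: tsubst_up_up tsubst_up_tlift o_def)
next
  case (ExSt \<sigma> \<Phi>)
  then obtain x xs' where "xs = x # xs'" by (cases xs) auto
  then show ?case using ExSt by (simp add: tsubst_case_nat cong: nat.case_cong) 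
next
  case (AllSt \<sigma> \<Phi>)
  then have "ys \<noteq> []" by auto
  then show ?case using AllSt by (simp add: Let_def last_map map_butlast o_def tsubst_case_nat)
qed (auto simp: tsubst_tsubst Let_def take_map drop_map)

lemma internal_Umat [simp]: "internal (Umat \<Phi> as xs ys)"
  by (induction \<Phi> arbitrary: as xs ys) (auto simp: Let_def)

text \<open>This includes formulae with disjunctions, whose matrix only tests the flag. Hence
  replacement, induction and case distinction apply to every matrix.\<close>

lemma or_free_Umat [simp]: "or_free (Umat \<Phi> as xs ys)"
  by (induction \<Phi> arbitrary: as xs ys) (auto simp: Let_def)

lemma list_all2_tlift:
  "list_all2 (has_ty \<Gamma>) xs \<sigma>s \<Longrightarrow> length \<Delta> = n \<Longrightarrow> list_all2 (has_ty (\<Delta> @ \<Gamma>)) (map (tlift n) xs) \<sigma>s"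
  by (auto simp: list_all2_conv_all_nth intro: has_ty_tlift)

lemma list_all2_tlift1:
  "list_all2 (has_ty \<Gamma>) xs \<sigma>s \<Longrightarrow> list_all2 (has_ty (\<sigma> # \<Gamma>)) (map (tlift 1) xs) \<sigma>s"
  using list_all2_tlift[of \<Gamma> xs \<sigma>s "[\<sigma>]" 1] by simp

lemma list_all2_split:
  assumes "list_all2 P xs (as @ bs)"
  shows "list_all2 P (take (length as) xs) as" "list_all2 P (drop (length as) xs) bs"
  using assms by (auto simp: list_all2_append2)

lemma has_ty_map_apps:
  "list_all2 (has_ty \<Gamma>) Us (map (arrs \<sigma>s) \<tau>s) \<Longrightarrow> list_all2 (has_ty \<Gamma>) xs \<sigma>s \<Longrightarrow>
    list_all2 (has_ty \<Gamma>) (map (\<lambda>U. apps U xs) Us) \<tau>s"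
  unfolding list_all2_map1 list_all2_map2 by (erule list_all2_mono) (rule has_ty_apps)

lemma wff_Umat:
  "wff \<Gamma> \<Phi> \<Longrightarrow> subst_ty \<Gamma>' as \<Gamma> \<Longrightarrow> list_all2 (has_ty \<Gamma>') xs (Uex \<Phi>) \<Longrightarrow> list_all2 (has_ty \<Gamma>') ys (Uall \<Phi>) \<Longrightarrow>
    wff \<Gamma>' (Umat \<Phi> as xs ys)"
proof (induction \<Phi> arbitrary: \<Gamma> \<Gamma>' as xs ys)
  case (Eq \<sigma> t u)
  then show ?case by (auto intro: has_ty_tsubst)
next
  case (St \<sigma> t)
  then show ?case by (auto intro: has_ty_tsubst simp: list_all2_Cons2)
next
  case (And \<Phi> \<Psi>)
  then show ?case using list_all2_split[of "has_ty \<Gamma>'" xs] list_all2_split[of "has_ty \<Gamma>'" ys]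
    by (auto simp: Let_def)
next
  case (Or \<Phi> \<Psi>)
  then obtain z zs where "xs = z # zs" "has_ty \<Gamma>' z N" "list_all2 (has_ty \<Gamma>') zs (Uex \<Phi> @ Uex \<Psi>)"
    by (auto simp: list_all2_Cons2)
  then show ?case using Or list_all2_split[of "has_ty \<Gamma>'" zs] list_all2_split[of "has_ty \<Gamma>'" ys]
    by (auto simp: Let_def)
next
  case (Imp \<Phi> \<Psi>)
  let ?n = "length (Uall \<Phi>)"
  let ?Us = "take (length (Uex \<Psi>)) xs" and ?Ys = "drop (length (Uex \<Psi>)) xs"
  let ?xs = "take (length (Uex \<Phi>)) ys" and ?vs = "drop (length (Uex \<Phi>)) ys"
  have U: "list_all2 (has_ty \<Gamma>') ?Us (map (arrs (Uex \<Phi>)) (Uex \<Psi>))"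
    "list_all2 (has_ty \<Gamma>') ?Ys (map (arrs (Uex \<Phi> @ Uall \<Psi>)) (map Seq (Uall \<Phi>)))"
    using list_all2_split[of "has_ty \<Gamma>'" xs "map (arrs (Uex \<Phi>)) (Uex \<Psi>)"] Imp.prems by (auto simp: o_def)
  have x: "list_all2 (has_ty \<Gamma>') ?xs (Uex \<Phi>)" "list_all2 (has_ty \<Gamma>') ?vs (Uall \<Psi>)"
    using list_all2_split[of "has_ty \<Gamma>'" ys "Uex \<Phi>"] Imp.prems by auto
  have "wff \<Gamma>' (BAlls (Uall \<Phi>) (map (\<lambda>Y. apps Y (?xs @ ?vs)) ?Ys)
          (Umat \<Phi> (tlift ?n \<circ> as) (map (tlift ?n) ?xs) (vars ?n)))"
    using Imp.prems x U
    by (intro wff_BAlls has_ty_map_apps[OF U(2)] Imp.IH(1) has_ty_vars list_all2_tlift subst_ty_lift list_all2_appendI) auto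
  moreover have "wff \<Gamma>' (Umat \<Psi> as (map (\<lambda>U. apps U ?xs) ?Us) ?vs)"
    using Imp.prems x U by (intro Imp.IH(2) has_ty_map_apps[OF U(1)]) auto
  ultimately show ?case by (simp add: Let_def)
next
  case (Ex \<sigma> \<Phi>)
  let ?n = "length (Uall \<Phi>)"
  have "wff (\<sigma> # \<Gamma>') (BAlls (Uall \<Phi>) (map (tlift 1) ys)
          (Umat \<Phi> (tlift ?n \<circ> up as) (map (tlift (?n + 1)) xs) (vars ?n)))"
  proof (intro wff_BAlls Ex.IH)
    show "wff (\<sigma> # \<Gamma>) \<Phi>" using Ex.prems by simp
    show "subst_ty (rev (Uall \<Phi>) @ \<sigma> # \<Gamma>') (tlift ?n \<circ> up as) (\<sigma> # \<Gamma>)"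
      by (intro subst_ty_lift subst_ty_up Ex.prems) simp
    show "list_all2 (has_ty (rev (Uall \<Phi>) @ \<sigma> # \<Gamma>')) (map (tlift (?n + 1)) xs) (Uex \<Phi>)"
      using list_all2_tlift[of \<Gamma>' xs "Uex \<Phi>" "rev (Uall \<Phi>) @ [\<sigma>]"] Ex.prems by simp
    show "list_all2 (has_ty (\<sigma> # \<Gamma>')) (map (tlift 1) ys) (map Seq (Uall \<Phi>))"
      by (rule list_all2_tlift1) (use Ex.prems in simp)
  qed (rule has_ty_vars)
  then show ?case by (simp add: Let_def)
next
  case (All \<sigma> \<Phi>)
  then show ?case using list_all2_tlift1[of \<Gamma>' xs] list_all2_tlift1[of \<Gamma>' ys]
    by (auto intro: All.IH subst_ty_up)
next
  case (ExSt \<sigma> \<Phi>)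
  then show ?case by (auto simp: list_all2_Cons2 intro!: ExSt.IH[of "\<sigma> # \<Gamma>"] subst_ty_case_nat)
next
  case (AllSt \<sigma> \<Phi>)
  then obtain ys' z where y: "ys = ys' @ [z]" "list_all2 (has_ty \<Gamma>') ys' (Uall \<Phi>)" "has_ty \<Gamma>' z \<sigma>"
    by (auto simp: list_all2_append2 list_all2_Cons2)
  have "list_all2 (has_ty \<Gamma>') (map (\<lambda>X. X \<^bold>\<cdot> z) xs) (Uex \<Phi>)"
    using has_ty_map_apps[of \<Gamma>' xs "[\<sigma>]" "Uex \<Phi>" "[z]"] AllSt.prems y
    by (simp add: arrs_def[abs_def])
  then show ?case using AllSt y by (auto simp: Let_def intro!: AllSt.IH[of "\<sigma> # \<Gamma>"] subst_ty_case_nat)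
qed simp

context ha_theory
begin

section \<open>Forcing of the matrix\<close>

lemma wff_ext2: "W \<sqsubseteq> W' \<Longrightarrow> wff (\<Gamma> @ fst W) \<phi> \<Longrightarrow> wff (\<Gamma> @ fst W') \<phi>"
  using wff_mono[of "\<Gamma> @ fst W" \<phi>] by (auto simp: ext_def)

lemma finst_BAll:
  assumes "length ss = length \<tau>s"
  shows "finst t (Imp (Mem \<tau> (Var 0) (tlift 1 s)) (BAlls \<tau>s (map (tlift 1) ss) \<phi>)) =
    Imp (Mem \<tau> t s) (BAlls \<tau>s ss (fsubst ((up ^^ length \<tau>s) (case_nat t Var)) \<phi>))"
  using assms by (simp add: finst_def fsubst_BAlls o_def)

text \<open>Each quantifier and each membership premise costs one passage to a larger world. Forcing
  is monotone, so all of them can be gathered in a single extension.\<close>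

lemma forces_BAlls:
  assumes "world W" "wff (rev \<tau>s @ fst W) \<phi>" "htys W ss (map Seq \<tau>s)"
  shows "W \<tturnstile> BAlls \<tau>s ss \<phi> \<longleftrightarrow>
    (\<forall>W' ys. W \<sqsubseteq> W' \<longrightarrow> htys W' ys \<tau>s \<longrightarrow> mems W' \<tau>s ys ss \<longrightarrow> W' \<tturnstile> fsubst (blk ys) \<phi>)"
  using assms
proof (induction \<tau>s arbitrary: W ss \<phi>)
  case Nil
  have [simp]: "blk [] = Var" by (auto simp: blk_def)
  show ?case using Nil by (auto intro: forces_mono ext_refl)
next
  case (Cons \<tau> \<tau>s)
  then obtain s ss' where s: "ss = s # ss'" "hty W s (Seq \<tau>)" "htys W ss' (map Seq \<tau>s)"
    by (auto simp: list_all2_Cons2)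
  have l: "length ss' = length \<tau>s" using list_all2_lengthD[OF s(3)] by simp
  let ?\<phi> = "\<lambda>y. fsubst ((up ^^ length \<tau>s) (case_nat y Var)) \<phi>"
  have wf: "wff (rev \<tau>s @ fst W') (?\<phi> y)" if "W \<sqsubseteq> W'" "hty W' y \<tau>" for W' y
  proof -
    have "subst_ty (fst W') (case_nat y Var) (\<tau> # fst W')"
      using that by (intro subst_ty_case_nat) auto
    moreover have "wff (rev \<tau>s @ \<tau> # fst W') \<phi>"
      using wff_ext2[of W W' "rev \<tau>s @ [\<tau>]"] that Cons.prems(2) by simp
    ultimately show ?thesis by (intro wff_fsubst[OF _ subst_ty_ups]) auto
  qed
  have bl: "fsubst (blk ys) (?\<phi> y) = fsubst (blk (y # ys)) \<phi>" if "htys W' ys \<tau>s" for W' y ys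
    using list_all2_lengthD[OF that] by (simp add: fsubst_fsubst blk_Cons)
  have IH: "W' \<tturnstile> BAlls \<tau>s ss' (?\<phi> y) \<longleftrightarrow>
    (\<forall>W'' ys. W' \<sqsubseteq> W'' \<longrightarrow> htys W'' ys \<tau>s \<longrightarrow> mems W'' \<tau>s ys ss' \<longrightarrow> W'' \<tturnstile> fsubst (blk (y # ys)) \<phi>)"
    if "W \<sqsubseteq> W'" "hty W' y \<tau>" for W' y
    using Cons.IH[OF ext_world[OF that(1)] wf[OF that] htys_ext[OF that(1) s(3)]]
    by (auto simp: bl)
  show ?case
  proof (intro iffI HOL.allI HOL.impI)
    fix W' ys assume B: "W \<tturnstile> BAlls (\<tau> # \<tau>s) ss \<phi>" and W': "W \<sqsubseteq> W'"
      and ys: "htys W' ys (\<tau> # \<tau>s)" "mems W' (\<tau> # \<tau>s) ys ss"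
    obtain y ys' where y: "ys = y # ys'" "hty W' y \<tau>" "htys W' ys' \<tau>s"
      using ys by (auto simp: list_all2_Cons2)
    have "W' \<tturnstile> Imp (Mem \<tau> y s) (BAlls \<tau>s ss' (?\<phi> y))"
      using forces_allE[OF forces_mono[OF W' B[unfolded s(1) BAlls.simps]] y(2)] finst_BAll[OF l] by simp
    then have "W' \<tturnstile> BAlls \<tau>s ss' (?\<phi> y)" by (rule forces_mp) (use ys y s in auto)
    then show "W' \<tturnstile> fsubst (blk ys) \<phi>"
      using IH[OF W' y(2)] y ys s ext_refl[OF ext_world[OF W']] by auto
  next
    assume R: "\<forall>W' ys. W \<sqsubseteq> W' \<longrightarrow> htys W' ys (\<tau> # \<tau>s) \<longrightarrow> mems W' (\<tau> # \<tau>s) ys ss \<longrightarrow> W' \<tturnstile> fsubst (blk ys) \<phi>"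
    show "W \<tturnstile> BAlls (\<tau> # \<tau>s) ss \<phi>" unfolding s(1) BAlls.simps
    proof (rule forces_allI[OF Cons.prems(1)])
      show "wff (\<tau> # fst W) (Imp (Mem \<tau> (Var 0) (tlift 1 s)) (BAlls \<tau>s (map (tlift 1) ss') \<phi>))"
        using wff_BAlls[OF Cons.prems(3,2)] unfolding s(1) by simp
      fix W1 y assume W1: "W \<sqsubseteq> W1" "hty W1 y \<tau>"
      show "W1 \<tturnstile> finst y (Imp (Mem \<tau> (Var 0) (tlift 1 s)) (BAlls \<tau>s (map (tlift 1) ss') \<phi>))"
        unfolding finst_BAll[OF l]
      proof (rule forces_impI[OF ext_world[OF W1(1)]])
        show "wff (fst W1) (Mem \<tau> y s)" by (rule wff_Mem[OF W1(2) hty_ext[OF W1(1) s(2)]])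
        fix W2 assume W2: "W1 \<sqsubseteq> W2" "W2 \<tturnstile> Mem \<tau> y s"
        have e: "W \<sqsubseteq> W2" by (rule ext_trans[OF W1(1) W2(1)])
        have y2: "hty W2 y \<tau>" by (rule hty_ext[OF W2(1) W1(2)])
        show "W2 \<tturnstile> BAlls \<tau>s ss' (?\<phi> y)" unfolding IH[OF e y2]
        proof (intro HOL.allI HOL.impI)
          fix W3 ys assume W3: "W2 \<sqsubseteq> W3" "htys W3 ys \<tau>s" "mems W3 \<tau>s ys ss'"
          show "W3 \<tturnstile> fsubst (blk (y # ys)) \<phi>"
            by (rule R[rule_format]) (use W3 s y2 ext_trans[OF e W3(1)] hty_ext[OF W3(1) y2] forces_mono[OF W3(1) W2(2)] in auto)
        qed
      qed simp
    qed
  qed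
qed

text \<open>Semantic form of the bounded block in the clauses for \<longrightarrow> and \<exists>.
  It speaks about terms of the world itself, so the lifted tuples and the bound variables of the
  matrix disappear from later arguments.\<close>

definition ball :: "world \<Rightarrow> fm \<Rightarrow> (nat \<Rightarrow> tm) \<Rightarrow> tm list \<Rightarrow> tm list \<Rightarrow> bool" where
  "ball W \<Phi> as xs Ss \<longleftrightarrow> (\<forall>W' ys. W \<sqsubseteq> W' \<longrightarrow> htys W' ys (Uall \<Phi>) \<longrightarrow> mems W' (Uall \<Phi>) ys Ss \<longrightarrow>
    W' \<tturnstile> Umat \<Phi> as xs ys)"

lemma ball_ext: "W \<sqsubseteq> W' \<Longrightarrow> ball W \<Phi> as xs Ss \<Longrightarrow> ball W' \<Phi> as xs Ss"
  unfolding ball_def using ext_trans by blast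

lemma forces_ball:
  assumes "world W" "wff \<Gamma> \<Phi>" "subst_ty (fst W) as \<Gamma>" "htys W xs (Uex \<Phi>)" "htys W Ss (map Seq (Uall \<Phi>))"
    and n: "n = length (Uall \<Phi>)"
  shows "W \<tturnstile> BAlls (Uall \<Phi>) Ss (Umat \<Phi> (tlift n \<circ> as) (map (tlift n) xs) (vars n)) \<longleftrightarrow> ball W \<Phi> as xs Ss"
proof -
  have wf: "wff (rev (Uall \<Phi>) @ fst W) (Umat \<Phi> (tlift n \<circ> as) (map (tlift n) xs) (vars n))"
    unfolding n by (intro wff_Umat[OF assms(2)] subst_ty_lift list_all2_tlift has_ty_vars assms) auto
  have l: "length xs = length (Uex \<Phi>)" using assms(4) by (rule list_all2_lengthD)
  have "fsubst (blk ys) (Umat \<Phi> (tlift n \<circ> as) (map (tlift n) xs) (vars n)) = Umat \<Phi> as xs ys"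
    if "htys W' ys (Uall \<Phi>)" for W' ys
    using list_all2_lengthD[OF that] l by (subst fsubst_Umat) (auto simp: n tsubst_blk_tlift tsubst_blk_vars o_def)
  then show ?thesis
    unfolding forces_BAlls[OF assms(1) wf assms(5)] ball_def by auto
qed

lemma forces_Imp:
  assumes "world W" "wff \<Gamma> \<Phi>" "subst_ty (fst W) as \<Gamma>"
    and "htys W Us (map (arrs (Uex \<Phi>)) (Uex \<Psi>))"
    and Y: "htys W Ys (map (\<lambda>\<tau>. arrs (Uex \<Phi> @ Uall \<Psi>) (Seq \<tau>)) (Uall \<Phi>))"
    and "htys W xs (Uex \<Phi>)" "htys W vs (Uall \<Psi>)"
  shows "W \<tturnstile> Umat (Imp \<Phi> \<Psi>) as (Us @ Ys) (xs @ vs) \<longleftrightarrow>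
    (\<forall>W'. W \<sqsubseteq> W' \<longrightarrow> ball W' \<Phi> as xs (map (\<lambda>Y. apps Y (xs @ vs)) Ys) \<longrightarrow>
      W' \<tturnstile> Umat \<Psi> as (map (\<lambda>U. apps U xs) Us) vs)"
proof -
  let ?n = "length (Uall \<Phi>)"
  let ?S = "map (\<lambda>Y. apps Y (xs @ vs)) Ys"
  let ?B = "BAlls (Uall \<Phi>) ?S (Umat \<Phi> (tlift ?n \<circ> as) (map (tlift ?n) xs) (vars ?n))"
  have l: "length Us = length (Uex \<Psi>)" "length xs = length (Uex \<Phi>)"
    using assms by (auto dest: list_all2_lengthD)
  then have eq: "Umat (Imp \<Phi> \<Psi>) as (Us @ Ys) (xs @ vs) = Imp ?B (Umat \<Psi> as (map (\<lambda>U. apps U xs) Us) vs)"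
    by (simp add: Let_def)
  have S: "htys W ?S (map Seq (Uall \<Phi>))"
    by (rule has_ty_map_apps[of _ _ "Uex \<Phi> @ Uall \<Psi>"]) (use assms in \<open>auto simp: o_def intro: list_all2_appendI\<close>)
  have iff: "W' \<tturnstile> ?B \<longleftrightarrow> ball W' \<Phi> as xs ?S" if e: "W \<sqsubseteq> W'" for W'
    by (rule forces_ball[OF ext_world[OF e] assms(2) subst_ty_world[OF e assms(3)] htys_ext[OF e assms(6)] htys_ext[OF e S] refl])
  have wf: "wff (fst W) ?B"
    by (intro wff_BAlls S wff_Umat[OF assms(2)] subst_ty_lift list_all2_tlift has_ty_vars assms) auto
  show ?thesis unfolding eq
  proof (intro iffI HOL.allI HOL.impI)
    fix W' assume "W \<tturnstile> Imp ?B (Umat \<Psi> as (map (\<lambda>U. apps U xs) Us) vs)" "W \<sqsubseteq> W'" "ball W' \<Phi> as xs ?S"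
    then show "W' \<tturnstile> Umat \<Psi> as (map (\<lambda>U. apps U xs) Us) vs"
      using iff forces_mono forces_mp by blast
  next
    assume R: "\<forall>W'. W \<sqsubseteq> W' \<longrightarrow> ball W' \<Phi> as xs ?S \<longrightarrow> W' \<tturnstile> Umat \<Psi> as (map (\<lambda>U. apps U xs) Us) vs"
    show "W \<tturnstile> Imp ?B (Umat \<Psi> as (map (\<lambda>U. apps U xs) Us) vs)"
      by (rule forces_impI[OF assms(1) _ wf]) (use R iff in simp_all)
  qed
qed

lemma forces_All:
  assumes "world W" "wff (\<sigma> # \<Gamma>) \<Phi>" "subst_ty (fst W) as \<Gamma>" "htys W xs (Uex \<Phi>)" "htys W ys (Uall \<Phi>)"
  shows "W \<tturnstile> Umat (All \<sigma> \<Phi>) as xs ys \<longleftrightarrow>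
    (\<forall>W' t. W \<sqsubseteq> W' \<longrightarrow> hty W' t \<sigma> \<longrightarrow> W' \<tturnstile> Umat \<Phi> (case_nat t as) xs ys)"
proof -
  let ?B = "Umat \<Phi> (up as) (map (tlift 1) xs) (map (tlift 1) ys)"
  have l: "length xs = length (Uex \<Phi>)" "length ys = length (Uall \<Phi>)"
    using assms by (auto dest: list_all2_lengthD)
  have "(\<lambda>i. tsubst (case_nat t Var) (up as i)) = case_nat t as" for t
    by (simp add: tsubst_case_nat_up)
  then have fi: "finst t ?B = Umat \<Phi> (case_nat t as) xs ys" for t
    using l by (simp add: finst_def fsubst_Umat o_def)
  have wf: "wff (\<sigma> # fst W) ?B"
    using wff_Umat[of \<Gamma> "All \<sigma> \<Phi>" "fst W" as xs ys] assms by simp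
  show ?thesis unfolding Umat.simps
  proof (intro iffI HOL.allI HOL.impI)
    fix W' t assume "W \<tturnstile> All \<sigma> ?B" "W \<sqsubseteq> W'" "hty W' t \<sigma>"
    then have "W' \<tturnstile> finst t ?B" using forces_allE forces_mono by blast
    then show "W' \<tturnstile> Umat \<Phi> (case_nat t as) xs ys" unfolding fi .
  next
    assume R: "\<forall>W' t. W \<sqsubseteq> W' \<longrightarrow> hty W' t \<sigma> \<longrightarrow> W' \<tturnstile> Umat \<Phi> (case_nat t as) xs ys"
    show "W \<tturnstile> All \<sigma> ?B"
      by (rule forces_allI[OF assms(1) wf]) (unfold fi, rule R[rule_format])
  qed
qed

lemma
  assumes "world W" "wff (\<sigma> # \<Gamma>) \<Phi>" "subst_ty (fst W) as \<Gamma>" "htys W xs (Uex \<Phi>)"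
    "htys W Ss (map Seq (Uall \<Phi>))"
  shows forces_ExI: "hty W t \<sigma> \<Longrightarrow> ball W \<Phi> (case_nat t as) xs Ss \<Longrightarrow> W \<tturnstile> Umat (Ex \<sigma> \<Phi>) as xs Ss"
    and forces_ExE: "W \<tturnstile> Umat (Ex \<sigma> \<Phi>) as xs Ss \<Longrightarrow> wff (fst W) \<chi> \<Longrightarrow>
      (\<And>W' t. W \<sqsubseteq> W' \<Longrightarrow> hty W' t \<sigma> \<Longrightarrow> ball W' \<Phi> (case_nat t as) xs Ss \<Longrightarrow> W' \<tturnstile> \<chi>) \<Longrightarrow> W \<tturnstile> \<chi>"
proof -
  let ?n = "length (Uall \<Phi>)"
  let ?B = "BAlls (Uall \<Phi>) (map (tlift 1) Ss) (Umat \<Phi> (tlift ?n \<circ> up as) (map (tlift (?n + 1)) xs) (vars ?n))"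
  have eq: "Umat (Ex \<sigma> \<Phi>) as xs Ss = Ex \<sigma> ?B" by (simp add: Let_def)
  have l: "length xs = length (Uex \<Phi>)" "length Ss = length (Uall \<Phi>)"
    using assms by (auto dest: list_all2_lengthD)
  have fi: "finst t ?B = BAlls (Uall \<Phi>) Ss (Umat \<Phi> (tlift ?n \<circ> case_nat t as) (map (tlift ?n) xs) (vars ?n))" for t
  proof -
    have 1: "tsubst ((up ^^ ?n) (case_nat t Var)) (tlift (Suc ?n) u) = tlift ?n u" for u
      using tsubst_ups_tlift[of ?n "case_nat t Var" "tlift 1 u"] by simp
    show ?thesis using l
      by (simp add: finst_def fsubst_BAlls fsubst_Umat o_def 1 tsubst_ups_tlift tsubst_case_nat_up tsubst_ups_vars)
  qed
  have wf: "wff (\<sigma> # fst W) ?B"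
    using wff_Umat[of \<Gamma> "Ex \<sigma> \<Phi>" "fst W" as xs Ss] assms by (simp add: Let_def)
  have iff: "W' \<tturnstile> finst t ?B \<longleftrightarrow> ball W' \<Phi> (case_nat t as) xs Ss" if "W \<sqsubseteq> W'" "hty W' t \<sigma>" for W' t
    unfolding fi
    by (rule forces_ball[OF ext_world[OF that(1)] assms(2) subst_ty_case_nat[OF that(2) subst_ty_world[OF that(1) assms(3)]]
        htys_ext[OF that(1) assms(4)] htys_ext[OF that(1) assms(5)] refl])
  show "hty W t \<sigma> \<Longrightarrow> ball W \<Phi> (case_nat t as) xs Ss \<Longrightarrow> W \<tturnstile> Umat (Ex \<sigma> \<Phi>) as xs Ss"
    unfolding eq by (rule forces_exI[of _ t]) (use wf iff[OF ext_refl[OF assms(1)]] in auto)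
  show "W \<tturnstile> Umat (Ex \<sigma> \<Phi>) as xs Ss \<Longrightarrow> wff (fst W) \<chi> \<Longrightarrow>
      (\<And>W' t. W \<sqsubseteq> W' \<Longrightarrow> hty W' t \<sigma> \<Longrightarrow> ball W' \<Phi> (case_nat t as) xs Ss \<Longrightarrow> W' \<tturnstile> \<chi>) \<Longrightarrow> W \<tturnstile> \<chi>"
    unfolding eq by (erule forces_exE) (use assms(1) iff in auto)
qed

text \<open>Realizers obtained by abstraction or recursion equal the intended ones only provably;
  this lemma exchanges them inside the matrix.\<close>

lemma Umat_cong:
  assumes "world W" "wff \<Gamma> \<Phi>" "eq_subst W \<Gamma> as bs" "eqs W (Uex \<Phi>) xs us" "eqs W (Uall \<Phi>) ys vs"
    and "W \<tturnstile> Umat \<Phi> as xs ys"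
  shows "W \<tturnstile> Umat \<Phi> bs us vs"
proof -
  let ?m = "length (Uex \<Phi>)" and ?n = "length (Uall \<Phi>)"
  \<comment> \<open>The matrix is taken with distinct variables for realizers, challenges and
    parameters, in this order. Both concrete matrices are substitution instances of it, so
    replacement for formulae applies.\<close>
  let ?C = "Uex \<Phi> @ Uall \<Phi> @ \<Gamma>"
  let ?\<theta> = "\<lambda>cs zs ws i. if i < ?m then zs ! i else if i < ?m + ?n then ws ! (i - ?m) else cs (i - ?m - ?n) :: tm"
  let ?g = "Umat \<Phi> (\<lambda>i. Var (i + ?m + ?n)) (map Var [0..<?m]) (map Var [?m..<?m+?n])"
  have sub: "fsubst (?\<theta> cs zs ws) ?g = Umat \<Phi> cs zs ws" if "length zs = ?m" "length ws = ?n" for cs zs ws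
  proof -
    have "map (\<lambda>i. zs ! i) [0..<?m] = zs" using that map_nth by metis
    moreover have "map (?\<theta> cs zs ws) [0..<?m] = map (\<lambda>i. zs ! i) [0..<?m]" by auto
    moreover have "map (?\<theta> cs zs ws) [?m..<?m + ?n] = ws"
      by (rule nth_equalityI) (use that in auto)
    ultimately show ?thesis by (simp add: fsubst_Umat o_def)
  qed
  have l: "length xs = ?m" "length us = ?m" "length ys = ?n" "length vs = ?n"
    using assms by (auto dest: rel3_length)
  have "wff ?C ?g"
    by (rule wff_Umat[OF assms(2)])
      (auto simp: subst_ty_def list_all2_conv_all_nth nth_append intro!: has_ty_VarI)
  moreover have "eq_subst W ?C (?\<theta> as xs ys) (?\<theta> bs us vs)"
    unfolding eq_subst_def
  proof (intro HOL.allI HOL.impI)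
    fix i assume "i < length ?C"
    then consider "i < ?m" | "i \<ge> ?m" "i - ?m < ?n" | "i \<ge> ?m + ?n" "i - ?m - ?n < length \<Gamma>" by fastforce
    then show "W \<tturnstile> Eq (?C ! i) (?\<theta> as xs ys i) (?\<theta> bs us vs i)"
      using assms(3-5) by cases (auto simp: nth_append rel3_conv_nth eq_subst_def less_diff_conv2)
  qed
  ultimately show ?thesis
    using leibniz[of W ?C "?\<theta> as xs ys" "?\<theta> bs us vs" ?g] assms(1,6) l by (simp add: sub)
qed

lemma eq_subst_refl: "subst_ty (fst W) as \<Gamma> \<Longrightarrow> eq_subst W \<Gamma> as as"
  by (auto simp: eq_subst_def subst_ty_def intro: eq_reflI)

lemma mems_cong:
  assumes "world W" "htys W ys \<sigma>s" "eqs W (map Seq \<sigma>s) Ss Ts" "mems W \<sigma>s ys Ss"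
  shows "mems W \<sigma>s ys Ts"
  unfolding rel3_conv_nth
proof (intro conjI HOL.allI HOL.impI)
  fix i assume i: "i < length \<sigma>s"
  have "hty W (ys ! i) (\<sigma>s ! i)" "W \<tturnstile> Eq (Seq (\<sigma>s ! i)) (Ss ! i) (Ts ! i)" "W \<tturnstile> Mem (\<sigma>s ! i) (ys ! i) (Ss ! i)"
    using assms(2-4) i by (auto simp: rel3_conv_nth list_all2_conv_all_nth)
  then show "W \<tturnstile> Mem (\<sigma>s ! i) (ys ! i) (Ts ! i)"
    using Mem_cong[OF assms(1) eq_reflI] by blast
qed (use assms(3,4) in \<open>auto dest: rel3_length\<close>)

lemma ball_cong:
  assumes "world W" "wff \<Gamma> \<Phi>" "eq_subst W \<Gamma> as bs" "eqs W (Uex \<Phi>) xs us" "eqs W (map Seq (Uall \<Phi>)) Ss Ts"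
    and "ball W \<Phi> as xs Ss"
  shows "ball W \<Phi> bs us Ts"
  unfolding ball_def
proof (intro HOL.allI HOL.impI)
  fix W' ys assume W': "W \<sqsubseteq> W'" "htys W' ys (Uall \<Phi>)" "mems W' (Uall \<Phi>) ys Ts"
  have w: "world W'" using W' ext_world by blast
  have "mems W' (Uall \<Phi>) ys Ss"
    by (rule mems_cong[OF w W'(2) eqs_ext[OF W'(1) eqs_sym[OF assms(1,5)]] W'(3)])
  then have "W' \<tturnstile> Umat \<Phi> as xs ys" using assms(6) W' by (auto simp: ball_def)
  then show "W' \<tturnstile> Umat \<Phi> bs us ys"
    by (rule Umat_cong[OF w assms(2) eq_subst_ext[OF W'(1) assms(3)] eqs_ext[OF W'(1) assms(4)] eqs_refl[OF W'(2)]])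
qed

end

section \<open>Definable tuples of terms\<close>

text \<open>Operations on tuples given by open terms over \<open>\<Gamma>\<close>. The equation is syntactic, so that such
  operations compose without any conversion; combinators are needed only in \<open>defn_lam\<close>.\<close>

definition defn :: "ty list \<Rightarrow> (tm list \<Rightarrow> tm list) \<Rightarrow> ty list \<Rightarrow> bool" where
  "defn \<Gamma> f \<tau>s \<longleftrightarrow> (\<exists>ts. list_all2 (has_ty \<Gamma>) ts \<tau>s \<and> (\<forall>xs. length xs = length \<Gamma> \<longrightarrow> f xs = map (inst xs) ts))"

lemma defnI:
  assumes "\<And>xs. length xs = length \<Gamma> \<Longrightarrow> length (f xs) = length \<tau>s"
    and "\<And>i. i < length \<tau>s \<Longrightarrow> \<exists>t. has_ty \<Gamma> t (\<tau>s ! i) \<and> (\<forall>xs. length xs = length \<Gamma> \<longrightarrow> f xs ! i = inst xs t)"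
  shows "defn \<Gamma> f \<tau>s"
proof -
  obtain t where t: "\<And>i. i < length \<tau>s \<Longrightarrow> has_ty \<Gamma> (t i) (\<tau>s ! i)"
    "\<And>i xs. i < length \<tau>s \<Longrightarrow> length xs = length \<Gamma> \<Longrightarrow> f xs ! i = inst xs (t i)"
    using assms(2) by metis
  show ?thesis unfolding defn_def
    by (rule HOL.exI[of _ "map t [0..<length \<tau>s]"])
      (auto simp: list_all2_conv_all_nth t assms(1) intro!: nth_equalityI)
qed

lemma defnD:
  assumes "defn \<Gamma> f \<tau>s" "i < length \<tau>s"
  shows "\<exists>t. has_ty \<Gamma> t (\<tau>s ! i) \<and> (\<forall>xs. length xs = length \<Gamma> \<longrightarrow> f xs ! i = inst xs t)"
  using assms by (fastforce simp: defn_def list_all2_conv_all_nth)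

lemma defn_length: "defn \<Gamma> f \<tau>s \<Longrightarrow> length xs = length \<Gamma> \<Longrightarrow> length (f xs) = length \<tau>s"
  by (auto simp: defn_def dest: list_all2_lengthD)

lemma defn_has_ty: "defn \<Gamma> f \<tau>s \<Longrightarrow> list_all2 (has_ty \<Delta>) xs \<Gamma> \<Longrightarrow> list_all2 (has_ty \<Delta>) (f xs) \<tau>s"
  by (auto simp: defn_def list_all2_conv_all_nth dest!: spec[of _ xs] intro!: has_ty_inst[of \<Gamma>])

lemma defn_id: "defn \<Gamma> (\<lambda>x. x) \<Gamma>"
  by (rule defnI) (auto intro!: HOL.exI[of _ "Var i" for i] has_ty_VarI)

lemma defn_append: "defn \<Gamma> f \<sigma>s \<Longrightarrow> defn \<Gamma> g \<tau>s \<Longrightarrow> defn \<Gamma> (\<lambda>x. f x @ g x) (\<sigma>s @ \<tau>s)"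
  unfolding defn_def by (elim HOL.exE conjE, rule_tac x = "ts @ tsa" in HOL.exI) (auto intro: list_all2_appendI)

lemma defn_take:
  assumes "defn \<Gamma> f (\<sigma>s @ \<tau>s)" "n = length \<sigma>s"
  shows "defn \<Gamma> (\<lambda>x. take n (f x)) \<sigma>s"
proof -
  obtain ts where ts: "list_all2 (has_ty \<Gamma>) ts (\<sigma>s @ \<tau>s)" "\<And>xs. length xs = length \<Gamma> \<Longrightarrow> f xs = map (inst xs) ts"
    using assms(1) by (auto simp: defn_def)
  show ?thesis unfolding defn_def
  proof (intro HOL.exI[of _ "take n ts"] conjI HOL.allI HOL.impI)
    show "list_all2 (has_ty \<Gamma>) (take n ts) \<sigma>s" using list_all2_split(1)[OF ts(1)] assms(2) by simp
  qed (simp add: ts(2) take_map)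
qed

lemma defn_drop:
  assumes "defn \<Gamma> f (\<sigma>s @ \<tau>s)" "n = length \<sigma>s"
  shows "defn \<Gamma> (\<lambda>x. drop n (f x)) \<tau>s"
proof -
  obtain ts where ts: "list_all2 (has_ty \<Gamma>) ts (\<sigma>s @ \<tau>s)" "\<And>xs. length xs = length \<Gamma> \<Longrightarrow> f xs = map (inst xs) ts"
    using assms(1) by (auto simp: defn_def)
  show ?thesis unfolding defn_def
  proof (intro HOL.exI[of _ "drop n ts"] conjI HOL.allI HOL.impI)
    show "list_all2 (has_ty \<Gamma>) (drop n ts) \<tau>s" using list_all2_split(2)[OF ts(1)] assms(2) by simp
  qed (simp add: ts(2) drop_map)
qed

lemma defn_const:
  assumes "list_all2 (has_ty []) ts \<tau>s"
  shows "defn \<Gamma> (\<lambda>x. ts) \<tau>s"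
  unfolding defn_def
proof (intro HOL.exI[of _ ts] conjI HOL.allI HOL.impI)
  show "list_all2 (has_ty \<Gamma>) ts \<tau>s" using assms by (rule list_all2_mono) (rule has_ty_closed)
  show "ts = map (inst xs) ts" for xs
    using assms by (auto simp: list_all2_conv_all_nth inst_closed intro!: nth_equalityI)
qed

lemma defn_nil [simp]: "defn \<Gamma> (\<lambda>x. []) []"
  by (rule defn_const) simp

lemma inst_map_inst:
  assumes "has_ty \<sigma>s t \<tau>" "length ss = length \<sigma>s"
  shows "inst (map (inst xs) ss) t = inst xs (inst ss t)"
  unfolding inst_def tsubst_tsubst by (rule tsubst_cong[OF assms(1)]) (simp add: assms(2))

lemma defn_comp: 
  assumes "defn \<Gamma> f \<sigma>s" "defn \<sigma>s g \<tau>s"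
  shows "defn \<Gamma> (\<lambda>x. g (f x)) \<tau>s"
proof (rule defnI)
  fix xs :: "tm list" assume l: "length xs = length \<Gamma>"
  show "length (g (f xs)) = length \<tau>s"
    using defn_length[OF assms(2)] defn_length[OF assms(1) l] by simp
next
  fix i assume i: "i < length \<tau>s"
  obtain t where t: "has_ty \<sigma>s t (\<tau>s ! i)" "\<And>xs. length xs = length \<sigma>s \<Longrightarrow> g xs ! i = inst xs t"
    using defnD[OF assms(2) i] by blast
  obtain ss where ss: "list_all2 (has_ty \<Gamma>) ss \<sigma>s" "\<And>xs. length xs = length \<Gamma> \<Longrightarrow> f xs = map (inst xs) ss"
    using assms(1) by (auto simp: defn_def)
  have "length ss = length \<sigma>s" using ss(1) by (rule list_all2_lengthD)
  then show "\<exists>t. has_ty \<Gamma> t (\<tau>s ! i) \<and> (\<forall>xs. length xs = length \<Gamma> \<longrightarrow> g (f xs) ! i = inst xs t)"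
    by (intro HOL.exI[of _ "inst ss t"]) (auto simp: ss(2) t(2) inst_map_inst[OF t(1)] intro: has_ty_inst[OF t(1) ss(1)])
qed

lemma inst_apps: "inst xs (apps t us) = apps (inst xs t) (map (inst xs) us)"
  by (simp add: inst_def tsubst_apps)

lemma defn_apps:
  assumes "defn \<Gamma> f (map (arrs \<sigma>s) \<tau>s)" "defn \<Gamma> g \<sigma>s"
  shows "defn \<Gamma> (\<lambda>x. map (\<lambda>U. apps U (g x)) (f x)) \<tau>s"
proof (rule defnI)
  fix i assume i: "i < length \<tau>s"
  obtain t where t: "has_ty \<Gamma> t (arrs \<sigma>s (\<tau>s ! i))" "\<And>xs. length xs = length \<Gamma> \<Longrightarrow> f xs ! i = inst xs t"
    using defnD[OF assms(1), of i] i by auto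
  obtain us where us: "list_all2 (has_ty \<Gamma>) us \<sigma>s" "\<And>xs. length xs = length \<Gamma> \<Longrightarrow> g xs = map (inst xs) us"
    using assms(2) by (auto simp: defn_def)
  show "\<exists>t. has_ty \<Gamma> t (\<tau>s ! i) \<and> (\<forall>xs. length xs = length \<Gamma> \<longrightarrow> map (\<lambda>U. apps U (g xs)) (f xs) ! i = inst xs t)"
    using i defn_length[OF assms(1)]
    by (intro HOL.exI[of _ "apps t us"]) (auto simp: t us inst_apps intro: has_ty_apps[OF t(1) us(1)])
qed (use defn_length[OF assms(1)] in auto)

section \<open>Singletons, default elements and padding\<close>

definition sings :: "ty list \<Rightarrow> tm list \<Rightarrow> tm list" where
  "sings \<tau>s ts = map (\<lambda>i. Cst (Prep (\<tau>s ! i)) \<^bold>\<cdot> (ts ! i) \<^bold>\<cdot> Cst (Empty (\<tau>s ! i))) [0..<length \<tau>s]"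

definition nulls :: "ty list \<Rightarrow> tm list" where
  "nulls \<tau>s = map null_tm \<tau>s"

text \<open>A bounded quantifier over a tuple of sequences is vacuous as soon as one of them is empty.
  To recover its instances for a single component, the other sequences are made nonempty.\<close>

definition add_nulls :: "ty list \<Rightarrow> tm list \<Rightarrow> tm list" where
  "add_nulls \<tau>s ss = map (\<lambda>i. Cst (Prep (\<tau>s ! i)) \<^bold>\<cdot> null_tm (\<tau>s ! i) \<^bold>\<cdot> (ss ! i)) [0..<length \<tau>s]"

lemma has_ty_nulls: "list_all2 (has_ty \<Gamma>) (nulls \<tau>s) \<tau>s"
  by (auto simp: nulls_def list_all2_conv_all_nth has_ty_null')

lemma length_lists [simp]: "length (sings \<tau>s ts) = length \<tau>s" "length (nulls \<tau>s) = length \<tau>s"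
  "length (add_nulls \<tau>s ts) = length \<tau>s"
  by (simp_all add: sings_def nulls_def add_nulls_def)

lemma defn_nulls: "defn \<Gamma> (\<lambda>x. nulls \<tau>s) \<tau>s"
  by (rule defn_const) (rule has_ty_nulls)

lemma inst_null [simp]: "inst xs (null_tm \<tau>) = null_tm \<tau>"
  by (simp add: inst_def)

lemma defn_sings:
  assumes "defn \<Gamma> f \<tau>s"
  shows "defn \<Gamma> (\<lambda>x. sings \<tau>s (f x)) (map Seq \<tau>s)"
proof (rule defnI)
  fix i assume "i < length (map Seq \<tau>s)"
  then have i: "i < length \<tau>s" by simp
  obtain t where t: "has_ty \<Gamma> t (\<tau>s ! i)" "\<And>xs. length xs = length \<Gamma> \<Longrightarrow> f xs ! i = inst xs t"
    using defnD[OF assms i] by blast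
  show "\<exists>t. has_ty \<Gamma> t (map Seq \<tau>s ! i) \<and> (\<forall>xs. length xs = length \<Gamma> \<longrightarrow> sings \<tau>s (f xs) ! i = inst xs t)"
    using i by (intro HOL.exI[of _ "Cst (Prep (\<tau>s ! i)) \<^bold>\<cdot> t \<^bold>\<cdot> Cst (Empty (\<tau>s ! i))"])
      (auto simp: sings_def t intro: has_ty_Prep has_ty_Empty)
qed simp

lemma defn_add_nulls:
  assumes "defn \<Gamma> f (map Seq \<tau>s)"
  shows "defn \<Gamma> (\<lambda>x. add_nulls \<tau>s (f x)) (map Seq \<tau>s)"
proof (rule defnI)
  fix i assume i: "i < length (map Seq \<tau>s)"
  obtain t where t: "has_ty \<Gamma> t (map Seq \<tau>s ! i)" "\<And>xs. length xs = length \<Gamma> \<Longrightarrow> f xs ! i = inst xs t"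
    using defnD[OF assms i] by blast
  show "\<exists>t. has_ty \<Gamma> t (map Seq \<tau>s ! i) \<and> (\<forall>xs. length xs = length \<Gamma> \<longrightarrow> add_nulls \<tau>s (f xs) ! i = inst xs t)"
    using i t by (intro HOL.exI[of _ "Cst (Prep (\<tau>s ! i)) \<^bold>\<cdot> null_tm (\<tau>s ! i) \<^bold>\<cdot> t"])
      (auto simp: add_nulls_def intro: has_ty_Prep has_ty_null')
qed simp

context ha_theory
begin

definition appends :: "ty list \<Rightarrow> tm list \<Rightarrow> tm list \<Rightarrow> tm list" where
  "appends \<tau>s ss ts = map (\<lambda>i. append_tm (\<tau>s ! i) (ss ! i) (ts ! i)) [0..<length \<tau>s]"

definition conds :: "ty list \<Rightarrow> tm \<Rightarrow> tm list \<Rightarrow> tm list \<Rightarrow> tm list" where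
  "conds \<tau>s z ss ts = map (\<lambda>i. cond (\<tau>s ! i) z (ss ! i) (ts ! i)) [0..<length \<tau>s]"

lemma length_lists' [simp]: "length (appends \<tau>s ss ts) = length \<tau>s" "length (conds \<tau>s z ss ts) = length \<tau>s"
  by (simp_all add: appends_def conds_def)

lemma inst_append [simp]: "inst xs (append_tm \<sigma> s t) = append_tm \<sigma> (inst xs s) (inst xs t)"
  by (simp add: inst_def)

lemma defn_appends:
  assumes "defn \<Gamma> f (map Seq \<tau>s)" "defn \<Gamma> g (map Seq \<tau>s)"
  shows "defn \<Gamma> (\<lambda>x. appends \<tau>s (f x) (g x)) (map Seq \<tau>s)"
proof (rule defnI)
  fix i assume i: "i < length (map Seq \<tau>s)"
  obtain t where t: "has_ty \<Gamma> t (map Seq \<tau>s ! i)" "\<And>xs. length xs = length \<Gamma> \<Longrightarrow> f xs ! i = inst xs t"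
    using defnD[OF assms(1) i] by blast
  obtain u where u: "has_ty \<Gamma> u (map Seq \<tau>s ! i)" "\<And>xs. length xs = length \<Gamma> \<Longrightarrow> g xs ! i = inst xs u"
    using defnD[OF assms(2) i] by blast
  show "\<exists>t. has_ty \<Gamma> t (map Seq \<tau>s ! i) \<and> (\<forall>xs. length xs = length \<Gamma> \<longrightarrow> appends \<tau>s (f xs) (g xs) ! i = inst xs t)"
    using i t u by (intro HOL.exI[of _ "append_tm (\<tau>s ! i) t u"]) (auto simp: appends_def intro: has_ty_append)
qed simp

lemma defn_conds:
  assumes "defn \<Gamma> h [N]" "defn \<Gamma> f \<tau>s" "defn \<Gamma> g \<tau>s"
  shows "defn \<Gamma> (\<lambda>x. conds \<tau>s (hd (h x)) (f x) (g x)) \<tau>s"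
proof (rule defnI)
  fix i assume i: "i < length \<tau>s"
  obtain z where z: "has_ty \<Gamma> z N" "\<And>xs. length xs = length \<Gamma> \<Longrightarrow> h xs ! 0 = inst xs z"
    using defnD[OF assms(1), of 0] by auto
  have hd: "hd (h xs) = h xs ! 0" if "length xs = length \<Gamma>" for xs
    using defn_length[OF assms(1) that] by (cases "h xs") auto
  obtain t where t: "has_ty \<Gamma> t (\<tau>s ! i)" "\<And>xs. length xs = length \<Gamma> \<Longrightarrow> f xs ! i = inst xs t"
    using defnD[OF assms(2) i] by blast
  obtain u where u: "has_ty \<Gamma> u (\<tau>s ! i)" "\<And>xs. length xs = length \<Gamma> \<Longrightarrow> g xs ! i = inst xs u"
    using defnD[OF assms(3) i] by blast
  show "\<exists>t. has_ty \<Gamma> t (\<tau>s ! i) \<and> (\<forall>xs. length xs = length \<Gamma> \<longrightarrow> conds \<tau>s (hd (h xs)) (f xs) (g xs) ! i = inst xs t)"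
    using i z t u by (intro HOL.exI[of _ "cond (\<tau>s ! i) z t u"]) (auto simp: conds_def hd intro: has_ty_cond)
qed simp

text \<open>Source of the functional realizers of an implication. The variables of \<Gamma> stay
  open, so these functionals may depend on the realizers of side formulae.\<close>

lemma defn_lam:
  assumes "defn (\<Gamma> @ \<Gamma>') f \<tau>s"
  shows "\<exists>F. defn \<Gamma> F (map (arrs \<Gamma>') \<tau>s) \<and> (\<forall>W xs us. world W \<longrightarrow> htys W xs \<Gamma> \<longrightarrow> htys W us \<Gamma>' \<longrightarrow>
    eqs W \<tau>s (map (\<lambda>U. apps U us) (F xs)) (f (xs @ us)))"
proof -
  have "\<exists>t'. has_ty \<Gamma> t' (arrs \<Gamma>' (\<tau>s ! i)) \<and> (\<forall>W xs us. world W \<longrightarrow> htys W xs \<Gamma> \<longrightarrow> htys W us \<Gamma>' \<longrightarrow>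
    W \<tturnstile> Eq (\<tau>s ! i) (apps (inst xs t') us) (f (xs @ us) ! i))" if i: "i < length \<tau>s" for i
  proof -
    obtain t where t: "has_ty (\<Gamma> @ \<Gamma>') t (\<tau>s ! i)" "\<And>xs. length xs = length (\<Gamma> @ \<Gamma>') \<Longrightarrow> f xs ! i = inst xs t"
      using defnD[OF assms i] by blast
    obtain t' where t': "has_ty \<Gamma> t' (arrs \<Gamma>' (\<tau>s ! i))"
      "\<And>W xs us. world W \<Longrightarrow> htys W xs \<Gamma> \<Longrightarrow> htys W us \<Gamma>' \<Longrightarrow>
        W \<tturnstile> Eq (\<tau>s ! i) (apps (inst xs t') us) (inst (xs @ us) t)"
      using lam[OF t(1)] by blast
    show ?thesis
    proof (intro HOL.exI[of _ t'] conjI HOL.allI HOL.impI t'(1))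
      fix W xs us assume W: "world W" "htys W xs \<Gamma>" "htys W us \<Gamma>'"
      show "W \<tturnstile> Eq (\<tau>s ! i) (apps (inst xs t') us) (f (xs @ us) ! i)"
        using t'(2)[OF W] t(2)[of "xs @ us"] list_all2_lengthD[OF W(2)] list_all2_lengthD[OF W(3)] by simp
    qed
  qed
  then obtain t where t: "\<And>i. i < length \<tau>s \<Longrightarrow> has_ty \<Gamma> (t i) (arrs \<Gamma>' (\<tau>s ! i))"
    "\<And>i W xs us. i < length \<tau>s \<Longrightarrow> world W \<Longrightarrow> htys W xs \<Gamma> \<Longrightarrow> htys W us \<Gamma>' \<Longrightarrow>
      W \<tturnstile> Eq (\<tau>s ! i) (apps (inst xs (t i)) us) (f (xs @ us) ! i)"
    by metis
  let ?F = "\<lambda>xs. map (\<lambda>i. inst xs (t i)) [0..<length \<tau>s]"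
  show ?thesis
  proof (intro HOL.exI[of _ ?F] conjI HOL.allI HOL.impI)
    show "defn \<Gamma> ?F (map (arrs \<Gamma>') \<tau>s)"
      by (rule defnI) (auto intro!: HOL.exI[of _ "t i" for i] t(1))
    fix W xs us assume W: "world W" "htys W xs \<Gamma>" "htys W us \<Gamma>'"
    have "length (f (xs @ us)) = length \<tau>s"
      by (rule defn_length[OF assms]) (simp add: list_all2_lengthD[OF W(2)] list_all2_lengthD[OF W(3)])
    then show "eqs W \<tau>s (map (\<lambda>U. apps U us) (?F xs)) (f (xs @ us))"
      using t(2)[OF _ W] by (simp add: rel3_conv_nth)
  qed
qed

text \<open>Each component of \<open>B\<close> is a union over all index tuples from
  \<open>Z\<close>, since every component of \<open>f\<close> may depend on the whole tuple
  \<open>zs\<close>.\<close>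

lemma defn_union:
  assumes "defn (\<Gamma> @ \<tau>s) f (map Seq \<sigma>s)" "defn \<Gamma> Z (map Seq \<tau>s)"
  shows "\<exists>B. defn \<Gamma> B (map Seq \<sigma>s) \<and> (\<forall>W xs zs ys. world W \<longrightarrow> htys W xs \<Gamma> \<longrightarrow> htys W zs \<tau>s \<longrightarrow> htys W ys \<sigma>s \<longrightarrow>
    mems W \<tau>s zs (Z xs) \<longrightarrow> mems W \<sigma>s ys (f (xs @ zs)) \<longrightarrow> mems W \<sigma>s ys (B xs))"
proof -
  obtain Zs where Zs: "list_all2 (has_ty \<Gamma>) Zs (map Seq \<tau>s)" "\<And>xs. length xs = length \<Gamma> \<Longrightarrow> Z xs = map (inst xs) Zs"
    using assms(2) by (auto simp: defn_def)
  have "\<exists>b. has_ty \<Gamma> b (Seq (\<sigma>s ! i)) \<and> (\<forall>W xs zs y. world W \<longrightarrow> htys W xs \<Gamma> \<longrightarrow> htys W zs \<tau>s \<longrightarrow> hty W y (\<sigma>s ! i) \<longrightarrow>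
    mems W \<tau>s zs (Z xs) \<longrightarrow> W \<tturnstile> Mem (\<sigma>s ! i) y (f (xs @ zs) ! i) \<longrightarrow> W \<tturnstile> Mem (\<sigma>s ! i) y (inst xs b))"
    if i: "i < length \<sigma>s" for i
  proof -
    obtain t where t: "has_ty (\<Gamma> @ \<tau>s) t (Seq (\<sigma>s ! i))" "\<And>xs. length xs = length (\<Gamma> @ \<tau>s) \<Longrightarrow> f xs ! i = inst xs t"
      using defnD[OF assms(1), of i] i by auto
    obtain b where b: "has_ty \<Gamma> b (Seq (\<sigma>s ! i))"
      "\<And>W xs zs y. world W \<Longrightarrow> htys W xs \<Gamma> \<Longrightarrow> htys W zs \<tau>s \<Longrightarrow> hty W y (\<sigma>s ! i) \<Longrightarrow>
        mems W \<tau>s zs (map (inst xs) Zs) \<Longrightarrow> W \<tturnstile> Mem (\<sigma>s ! i) y (inst (xs @ zs) t) \<Longrightarrow> W \<tturnstile> Mem (\<sigma>s ! i) y (inst xs b)"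
      using union[OF t(1) Zs(1)] by blast
    show ?thesis
    proof (intro HOL.exI[of _ b] conjI HOL.allI HOL.impI b(1))
      fix W xs zs y assume W: "world W" "htys W xs \<Gamma>" "htys W zs \<tau>s" "hty W y (\<sigma>s ! i)"
        "mems W \<tau>s zs (Z xs)" "W \<tturnstile> Mem (\<sigma>s ! i) y (f (xs @ zs) ! i)"
      show "W \<tturnstile> Mem (\<sigma>s ! i) y (inst xs b)"
        using b(2)[OF W(1-4)] W(5,6) t(2)[of "xs @ zs"] Zs(2)[of xs] list_all2_lengthD[OF W(2)] list_all2_lengthD[OF W(3)]
        by simp
    qed
  qed
  then obtain b where b: "\<And>i. i < length \<sigma>s \<Longrightarrow> has_ty \<Gamma> (b i) (Seq (\<sigma>s ! i))"
    "\<And>i W xs zs y. i < length \<sigma>s \<Longrightarrow> world W \<Longrightarrow> htys W xs \<Gamma> \<Longrightarrow> htys W zs \<tau>s \<Longrightarrow> hty W y (\<sigma>s ! i) \<Longrightarrow>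
    mems W \<tau>s zs (Z xs) \<Longrightarrow> W \<tturnstile> Mem (\<sigma>s ! i) y (f (xs @ zs) ! i) \<Longrightarrow> W \<tturnstile> Mem (\<sigma>s ! i) y (inst xs (b i))"
    by metis
  let ?B = "\<lambda>xs. map (\<lambda>i. inst xs (b i)) [0..<length \<sigma>s]"
  show ?thesis
  proof (intro HOL.exI[of _ ?B] conjI HOL.allI HOL.impI)
    show "defn \<Gamma> ?B (map Seq \<sigma>s)"
      by (rule defnI) (auto intro!: HOL.exI[of _ "b i" for i] b(1))
    fix W xs zs ys assume W: "world W" "htys W xs \<Gamma>" "htys W zs \<tau>s" "htys W ys \<sigma>s"
        "mems W \<tau>s zs (Z xs)" "mems W \<sigma>s ys (f (xs @ zs))"
    show "mems W \<sigma>s ys (?B xs)"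
      using b(2)[OF _ W(1-3) _ W(5)] W(4,6) by (simp add: rel3_conv_nth list_all2_conv_all_nth)
  qed
qed

lemma mems_sings: "world W \<Longrightarrow> htys W ts \<tau>s \<Longrightarrow> mems W \<tau>s ts (sings \<tau>s ts)"
  by (auto simp: rel3_conv_nth list_all2_conv_all_nth sings_def intro!: Mem_Prep_head has_ty_Empty)

lemma mems_nulls: "world W \<Longrightarrow> htys W ss (map Seq \<tau>s) \<Longrightarrow> mems W \<tau>s (nulls \<tau>s) (add_nulls \<tau>s ss)"
  by (auto simp: rel3_conv_nth list_all2_conv_all_nth add_nulls_def nulls_def intro!: Mem_Prep_head has_ty_null')

lemma mems_add_nulls:
  "world W \<Longrightarrow> htys W ss (map Seq \<tau>s) \<Longrightarrow> htys W ts \<tau>s \<Longrightarrow> mems W \<tau>s ts ss \<Longrightarrow> mems W \<tau>s ts (add_nulls \<tau>s ss)"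
  by (auto simp: rel3_conv_nth list_all2_conv_all_nth add_nulls_def intro!: Mem_Prep_tail has_ty_null')

lemma mems_appends:
  assumes "world W" "htys W ss (map Seq \<tau>s)" "htys W us (map Seq \<tau>s)" "htys W ts \<tau>s"
    and "mems W \<tau>s ts ss \<or> mems W \<tau>s ts us"
  shows "mems W \<tau>s ts (appends \<tau>s ss us)"
  using assms(5)
proof
  assume "mems W \<tau>s ts ss"
  then show ?thesis using assms(1-4)
    by (auto simp: rel3_conv_nth list_all2_conv_all_nth appends_def intro!: Mem_append_left)
next
  assume "mems W \<tau>s ts us"
  then show ?thesis using assms(1-4)
    by (auto simp: rel3_conv_nth list_all2_conv_all_nth appends_def intro!: Mem_append_right)
qed

lemma conds_zero:
  "world W \<Longrightarrow> htys W ss \<tau>s \<Longrightarrow> htys W us \<tau>s \<Longrightarrow> W \<tturnstile> Eq N z zero \<Longrightarrow> eqs W \<tau>s (conds \<tau>s z ss us) ss"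
  by (auto simp: rel3_conv_nth list_all2_conv_all_nth conds_def intro!: cond_zero)

lemma conds_suc:
  assumes "world W" "htys W ss \<tau>s" "htys W us \<tau>s" "hty W k N" "W \<tturnstile> Eq N z (suc k)"
  shows "eqs W \<tau>s (conds \<tau>s z ss us) us"
  using assms(2,3) by (auto simp: rel3_conv_nth list_all2_conv_all_nth conds_def intro!: cond_suc[OF assms(1) _ _ assms(4,5)])

section \<open>Realizers of sequents\<close>

lemma ballD:
  "ball W \<Phi> as xs Ss \<Longrightarrow> world W \<Longrightarrow> htys W ys (Uall \<Phi>) \<Longrightarrow> mems W (Uall \<Phi>) ys Ss \<Longrightarrow> W \<tturnstile> Umat \<Phi> as xs ys"
  by (auto simp: ball_def ext_refl)

text \<open>The implication from \<open>\<Phi>\<close> to \<open>\<Psi>\<close> is realized by \<open>f\<close>, which maps realizers to realizers, and \<open>g\<close>,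
  which sends a realizer of \<open>\<Phi>\<close> and a challenge to \<open>\<Psi>\<close> to a finite set of challenges to \<open>\<Phi>\<close>. As \<open>f\<close> and \<open>g\<close>
  are open terms in the realizers only, they do not depend on the parameters \<open>as\<close>: this is the
  uniformity behind NU.\<close>

definition realizes :: "ty list \<Rightarrow> fm \<Rightarrow> fm \<Rightarrow> (tm list \<Rightarrow> tm list) \<Rightarrow> (tm list \<Rightarrow> tm list) \<Rightarrow> bool" where
  "realizes \<Gamma> \<Phi> \<Psi> f g \<longleftrightarrow> defn (Uex \<Phi>) f (Uex \<Psi>) \<and> defn (Uex \<Phi> @ Uall \<Psi>) g (map Seq (Uall \<Phi>)) \<and>
    (\<forall>W as xs vs. world W \<longrightarrow> subst_ty (fst W) as \<Gamma> \<longrightarrow> htys W xs (Uex \<Phi>) \<longrightarrow> htys W vs (Uall \<Psi>) \<longrightarrow>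
      ball W \<Phi> as xs (g (xs @ vs)) \<longrightarrow> W \<tturnstile> Umat \<Psi> as (f xs) vs)"

definition sound :: "ty list \<Rightarrow> fm \<Rightarrow> fm \<Rightarrow> bool" where
  "sound \<Gamma> \<Phi> \<Psi> \<longleftrightarrow> (\<exists>f g. realizes \<Gamma> \<Phi> \<Psi> f g)"

lemma soundI:
  assumes "defn (Uex \<Phi>) f (Uex \<Psi>)" "defn (Uex \<Phi> @ Uall \<Psi>) g (map Seq (Uall \<Phi>))"
    and "\<And>W as xs vs. world W \<Longrightarrow> subst_ty (fst W) as \<Gamma> \<Longrightarrow> htys W xs (Uex \<Phi>) \<Longrightarrow> htys W vs (Uall \<Psi>) \<Longrightarrow>
      ball W \<Phi> as xs (g (xs @ vs)) \<Longrightarrow> W \<tturnstile> Umat \<Psi> as (f xs) vs"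
  shows "sound \<Gamma> \<Phi> \<Psi>"
  unfolding sound_def realizes_def using assms by blast

lemma
  assumes "realizes \<Gamma> \<Phi> \<Psi> f g"
  shows realizes_defn: "defn (Uex \<Phi>) f (Uex \<Psi>)" "defn (Uex \<Phi> @ Uall \<Psi>) g (map Seq (Uall \<Phi>))"
    and realizesD: "\<And>W as xs vs. world W \<Longrightarrow> subst_ty (fst W) as \<Gamma> \<Longrightarrow> htys W xs (Uex \<Phi>) \<Longrightarrow> htys W vs (Uall \<Psi>) \<Longrightarrow>
      ball W \<Phi> as xs (g (xs @ vs)) \<Longrightarrow> W \<tturnstile> Umat \<Psi> as (f xs) vs"
  using assms unfolding realizes_def by blast+

text \<open>The case without branching: a single challenge to \<Phi> suffices and is passed on as a
  tuple of one-element sequences.\<close>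

lemma sound_linear:
  assumes "defn (Uex \<Phi>) f (Uex \<Psi>)" "defn (Uex \<Phi> @ Uall \<Psi>) h (Uall \<Phi>)"
    and "\<And>W as xs vs. world W \<Longrightarrow> subst_ty (fst W) as \<Gamma> \<Longrightarrow> htys W xs (Uex \<Phi>) \<Longrightarrow> htys W vs (Uall \<Psi>) \<Longrightarrow>
      W \<tturnstile> Umat \<Phi> as xs (h (xs @ vs)) \<Longrightarrow> W \<tturnstile> Umat \<Psi> as (f xs) vs"
  shows "sound \<Gamma> \<Phi> \<Psi>"
proof (rule soundI[OF assms(1) defn_sings[OF assms(2)]])
  fix W as xs vs assume W: "world W" "subst_ty (fst W) as \<Gamma>" "htys W xs (Uex \<Phi>)" "htys W vs (Uall \<Psi>)"
    "ball W \<Phi> as xs (sings (Uall \<Phi>) (h (xs @ vs)))"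
  have "htys W (h (xs @ vs)) (Uall \<Phi>)" by (rule defn_has_ty[OF assms(2) list_all2_appendI[OF W(3,4)]])
  then have "W \<tturnstile> Umat \<Phi> as xs (h (xs @ vs))" using ballD[OF W(5,1)] mems_sings[OF W(1)] by blast
  then show "W \<tturnstile> Umat \<Psi> as (f xs) vs" by (rule assms(3)[OF W(1-4)])
qed

end

section \<open>Soundness of logic\<close>

lemma Umat_And:
  "length xs = length (Uex \<Phi>) \<Longrightarrow> length ys = length (Uall \<Phi>) \<Longrightarrow>
    Umat (And \<Phi> \<Psi>) as (xs @ us) (ys @ vs) = And (Umat \<Phi> as xs ys) (Umat \<Psi> as us vs)"
  by (simp add: Let_def)

lemma Umat_Or:
  "length xs = length (Uex \<Phi>) \<Longrightarrow> length ys = length (Uall \<Phi>) \<Longrightarrow>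
    Umat (Or \<Phi> \<Psi>) as (z # xs @ us) (ys @ vs) =
      And (Imp (Eq N z zero) (Umat \<Phi> as xs ys)) (Imp (Neg (Eq N z zero)) (Umat \<Psi> as us vs))"
  by (simp add: Let_def)

lemma Umat_internal:
  "internal \<phi> \<Longrightarrow> or_free \<phi> \<Longrightarrow> Uty \<phi> = ([], []) \<and> (\<forall>as xs ys. Umat \<phi> as xs ys = fsubst as \<phi>)"
  by (induction \<phi>) (auto simp: Let_def o_def vars_def)

context ha_theory
begin

section \<open>Bounded sets of challenges\<close>

lemma ball_weaken:
  "ball W \<Phi> as xs Ts \<Longrightarrow>
    (\<And>W' ys. W \<sqsubseteq> W' \<Longrightarrow> htys W' ys (Uall \<Phi>) \<Longrightarrow> mems W' (Uall \<Phi>) ys Ss \<Longrightarrow> mems W' (Uall \<Phi>) ys Ts) \<Longrightarrow>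
    ball W \<Phi> as xs Ss"
  unfolding ball_def by blast

lemma ball_add_nullsD:
  assumes "ball W \<Phi> as xs (add_nulls (Uall \<Phi>) Ss)" "htys W Ss (map Seq (Uall \<Phi>))"
  shows "ball W \<Phi> as xs Ss"
proof (rule ball_weaken[OF assms(1)])
  fix W' ys assume W': "W \<sqsubseteq> W'" "htys W' ys (Uall \<Phi>)" "mems W' (Uall \<Phi>) ys Ss"
  show "mems W' (Uall \<Phi>) ys (add_nulls (Uall \<Phi>) Ss)"
    by (rule mems_add_nulls[OF ext_world[OF W'(1)] htys_ext[OF W'(1) assms(2)] W'(2,3)])
qed

lemma ball_appendsD:
  assumes "ball W \<Phi> as xs (appends (Uall \<Phi>) Ss Ts)" "htys W Ss (map Seq (Uall \<Phi>))" "htys W Ts (map Seq (Uall \<Phi>))"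
  shows "ball W \<Phi> as xs Ss" "ball W \<Phi> as xs Ts"
proof -
  have m: "mems W' (Uall \<Phi>) ys (appends (Uall \<Phi>) Ss Ts)"
    if "W \<sqsubseteq> W'" "htys W' ys (Uall \<Phi>)" "mems W' (Uall \<Phi>) ys Ss \<or> mems W' (Uall \<Phi>) ys Ts" for W' ys
    by (rule mems_appends[OF ext_world[OF that(1)] htys_ext[OF that(1) assms(2)] htys_ext[OF that(1) assms(3)] that(2,3)])
  show "ball W \<Phi> as xs Ss" by (rule ball_weaken[OF assms(1)]) (rule m; simp)
  show "ball W \<Phi> as xs Ts" by (rule ball_weaken[OF assms(1)]) (rule m; simp)
qed

lemma ball_AndI:
  assumes "ball W \<Phi> as xs Ss" "ball W \<Psi> as us Ts" "length xs = length (Uex \<Phi>)" "length Ss = length (Uall \<Phi>)"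
  shows "ball W (And \<Phi> \<Psi>) as (xs @ us) (Ss @ Ts)"
  unfolding ball_def
proof (intro HOL.allI HOL.impI)
  fix W' ys assume W': "W \<sqsubseteq> W'" "htys W' ys (Uall (And \<Phi> \<Psi>))" "mems W' (Uall (And \<Phi> \<Psi>)) ys (Ss @ Ts)"
  then obtain y v where y: "ys = y @ v" "htys W' y (Uall \<Phi>)" "htys W' v (Uall \<Psi>)"
    by (auto simp: list_all2_append2)
  have l: "length y = length (Uall \<Phi>)" using y(2) by (rule list_all2_lengthD)
  then have "mems W' (Uall \<Phi>) y Ss" "mems W' (Uall \<Psi>) v Ts" using W'(3) y(1) assms(4) by (simp_all add: rel3_append)
  then show "W' \<tturnstile> Umat (And \<Phi> \<Psi>) as (xs @ us) ys"
    using assms W' y l by (simp only: y(1) Umat_And forces_And) (simp add: ball_def)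
qed

text \<open>The challenges to \<Psi> are filled with defaults; their membership in \<open>Ts\<close>
  keeps the joint bounded block from being vacuous.\<close>

lemma ball_AndD1:
  assumes "ball W (And \<Phi> \<Psi>) as (xs @ us) (Ss @ Ts)" "length xs = length (Uex \<Phi>)" "length Ss = length (Uall \<Phi>)"
    and "mems W (Uall \<Psi>) (nulls (Uall \<Psi>)) Ts"
  shows "ball W \<Phi> as xs Ss"
  unfolding ball_def
proof (intro HOL.allI HOL.impI)
  fix W' y assume W': "W \<sqsubseteq> W'" "htys W' y (Uall \<Phi>)" "mems W' (Uall \<Phi>) y Ss"
  have l: "length y = length (Uall \<Phi>)" using W'(2) by (rule list_all2_lengthD)
  have "W' \<tturnstile> Umat (And \<Phi> \<Psi>) as (xs @ us) (y @ nulls (Uall \<Psi>))"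
    by (rule ballD[OF ball_ext[OF W'(1) assms(1)] ext_world[OF W'(1)]])
      (use W' l assms(3) mems_ext[OF W'(1) assms(4)] in \<open>auto simp: rel3_append intro: list_all2_appendI has_ty_nulls\<close>)
  then show "W' \<tturnstile> Umat \<Phi> as xs y" using assms(2) l by (simp only: Umat_And forces_And)
qed

lemma ball_AndD2:
  assumes "ball W (And \<Phi> \<Psi>) as (xs @ us) (Ss @ Ts)" "length xs = length (Uex \<Phi>)" "length Ss = length (Uall \<Phi>)"
    and "mems W (Uall \<Phi>) (nulls (Uall \<Phi>)) Ss"
  shows "ball W \<Psi> as us Ts"
  unfolding ball_def
proof (intro HOL.allI HOL.impI)
  fix W' y assume W': "W \<sqsubseteq> W'" "htys W' y (Uall \<Psi>)" "mems W' (Uall \<Psi>) y Ts"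
  have "W' \<tturnstile> Umat (And \<Phi> \<Psi>) as (xs @ us) (nulls (Uall \<Phi>) @ y)"
    by (rule ballD[OF ball_ext[OF W'(1) assms(1)] ext_world[OF W'(1)]])
      (use W' assms(3) mems_ext[OF W'(1) assms(4)] in \<open>auto simp: rel3_append intro: list_all2_appendI has_ty_nulls\<close>)
  then show "W' \<tturnstile> Umat \<Psi> as us y" using assms(2) by (simp only: Umat_And forces_And length_lists)
qed

section \<open>Structural and propositional rules\<close>

lemma sound_id: "sound \<Gamma> \<Phi> \<Phi>"
  by (rule sound_linear[OF defn_id defn_drop[OF defn_id refl]]) (auto dest: list_all2_lengthD)

lemma sound_comp:
  assumes "sound \<Gamma> A B" "sound \<Gamma> B C"
  shows "sound \<Gamma> A C"
proof -
  obtain f1 g1 where r1: "realizes \<Gamma> A B f1 g1" using assms(1) unfolding sound_def by blast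
  note d1 = realizes_defn[OF r1] and s1 = realizesD[OF r1]
  obtain f2 g2 where r2: "realizes \<Gamma> B C f2 g2" using assms(2) unfolding sound_def by blast
  note d2 = realizes_defn[OF r2] and s2 = realizesD[OF r2]
  let ?m = "length (Uex A)" and ?p = "length (Uall C)"
  \<comment> \<open>From a realizer of \<open>A\<close> and a challenge to \<open>C\<close>: the
    sequences of challenges to \<open>B\<close> that the second sequent asks for.\<close>
  let ?Z = "\<lambda>z. g2 (f1 (take ?m z) @ drop ?m z)"
  \<comment> \<open>The arguments are a realizer of \<open>A\<close>, a challenge to
    \<open>C\<close> and one challenge to \<open>B\<close>; the middle block is skipped.\<close>
  let ?h = "\<lambda>z. g1 (take ?m z @ drop (?m + ?p) z)"
  have Z: "defn (Uex A @ Uall C) ?Z (map Seq (Uall B))"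
    by (rule defn_comp[OF defn_append[OF defn_comp[OF defn_take[OF defn_id refl] d1(1)] defn_drop[OF defn_id refl]] d2(2)])
  have "defn (Uex A @ Uall C @ Uall B) (take ?m) (Uex A)" by (rule defn_take[OF defn_id refl])
  moreover have "defn ((Uex A @ Uall C) @ Uall B) (drop (?m + ?p)) (Uall B)" by (rule defn_drop[OF defn_id]) simp
  ultimately have h: "defn ((Uex A @ Uall C) @ Uall B) ?h (map Seq (Uall A))"
    by (intro defn_comp[OF defn_append d1(2)]) auto
  obtain D where D: "defn (Uex A @ Uall C) D (map Seq (Uall A))"
    and mD: "\<And>W xs zs ys. world W \<Longrightarrow> htys W xs (Uex A @ Uall C) \<Longrightarrow> htys W zs (Uall B) \<Longrightarrow> htys W ys (Uall A) \<Longrightarrow>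
    mems W (Uall B) zs (?Z xs) \<Longrightarrow> mems W (Uall A) ys (?h (xs @ zs)) \<Longrightarrow> mems W (Uall A) ys (D xs)"
    using defn_union[OF h Z] by blast
  show ?thesis
  proof (rule soundI[OF defn_comp[OF d1(1) d2(1)] D])
    fix W as xs vs assume W: "world W" "subst_ty (fst W) as \<Gamma>" "htys W xs (Uex A)" "htys W vs (Uall C)"
      "ball W A as xs (D (xs @ vs))"
    have l: "length xs = ?m" "length vs = ?p" using W(3,4) by (auto dest: list_all2_lengthD)
    show "W \<tturnstile> Umat C as (f2 (f1 xs)) vs"
    proof (rule s2[OF W(1,2) defn_has_ty[OF d1(1) W(3)] W(4)])
      \<comment> \<open>Whatever member of \<open>?Z\<close> is tested, the challenges it raises
        against \<open>A\<close> lie in the union \<open>D\<close>, on which the matrix of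
        \<open>A\<close> is known to hold.\<close>
      show "ball W B as (f1 xs) (g2 (f1 xs @ vs))" unfolding ball_def
      proof (intro HOL.allI HOL.impI)
        fix W1 zs assume W1: "W \<sqsubseteq> W1" "htys W1 zs (Uall B)" "mems W1 (Uall B) zs (g2 (f1 xs @ vs))"
        show "W1 \<tturnstile> Umat B as (f1 xs) zs"
        proof (rule s1[OF ext_world[OF W1(1)] subst_ty_world[OF W1(1) W(2)] htys_ext[OF W1(1) W(3)] W1(2)])
          show "ball W1 A as xs (g1 (xs @ zs))"
          proof (rule ball_weaken[OF ball_ext[OF W1(1) W(5)]])
            fix W2 ys assume W2: "W1 \<sqsubseteq> W2" "htys W2 ys (Uall A)" "mems W2 (Uall A) ys (g1 (xs @ zs))"
            have e: "W \<sqsubseteq> W2" by (rule ext_trans[OF W1(1) W2(1)])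
            show "mems W2 (Uall A) ys (D (xs @ vs))"
              by (rule mD[OF ext_world[OF e] list_all2_appendI[OF htys_ext[OF e W(3)] htys_ext[OF e W(4)]]
                    htys_ext[OF W2(1) W1(2)] W2(2)])
                (use l W2(3) mems_ext[OF W2(1) W1(3)] in auto)
          qed
        qed
      qed
    qed
  qed
qed

lemma sound_pair:
  assumes "sound \<Gamma> G A" "sound \<Gamma> G B"
  shows "sound \<Gamma> G (And A B)"
proof -
  obtain f1 g1 where r1: "realizes \<Gamma> G A f1 g1" using assms(1) unfolding sound_def by blast
  note d1 = realizes_defn[OF r1] and s1 = realizesD[OF r1]
  obtain f2 g2 where r2: "realizes \<Gamma> G B f2 g2" using assms(2) unfolding sound_def by blast
  note d2 = realizes_defn[OF r2] and s2 = realizesD[OF r2]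
  let ?m = "length (Uex G)" and ?n = "length (Uall A)"
  let ?g1 = "\<lambda>z. g1 (take ?m z @ take ?n (drop ?m z))" and ?g2 = "\<lambda>z. g2 (take ?m z @ drop ?n (drop ?m z))"
  have g: "defn (Uex G @ Uall A @ Uall B) (\<lambda>z. appends (Uall G) (?g1 z) (?g2 z)) (map Seq (Uall G))"
    by (intro defn_appends defn_comp[OF defn_append d1(2)] defn_comp[OF defn_append d2(2)]
        defn_take[OF defn_id refl] defn_take[OF defn_drop[OF defn_id refl] refl] defn_drop[OF defn_drop[OF defn_id refl] refl])
  show ?thesis
  proof (rule soundI[where g = "\<lambda>z. appends (Uall G) (?g1 z) (?g2 z)"])
    show "defn (Uex G) (\<lambda>x. f1 x @ f2 x) (Uex (And A B))" using defn_append[OF d1(1) d2(1)] by simp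
    show "defn (Uex G @ Uall (And A B)) (\<lambda>z. appends (Uall G) (?g1 z) (?g2 z)) (map Seq (Uall G))" using g by simp
    fix W as xs vs assume W: "world W" "subst_ty (fst W) as \<Gamma>" "htys W xs (Uex G)" "htys W vs (Uall (And A B))"
      "ball W G as xs (appends (Uall G) (?g1 (xs @ vs)) (?g2 (xs @ vs)))"
    obtain v1 v2 where v: "vs = v1 @ v2" "htys W v1 (Uall A)" "htys W v2 (Uall B)"
      using W(4) by (auto simp: list_all2_append2)
    have l: "length xs = ?m" "length v1 = ?n" using W(3) v(2) by (auto dest: list_all2_lengthD)
    have b: "ball W G as xs (appends (Uall G) (g1 (xs @ v1)) (g2 (xs @ v2)))" using W(5) l v(1) by simp
    have ty: "htys W (g1 (xs @ v1)) (map Seq (Uall G))" "htys W (g2 (xs @ v2)) (map Seq (Uall G))"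
      by (rule defn_has_ty[OF d1(2) list_all2_appendI[OF W(3) v(2)]] defn_has_ty[OF d2(2) list_all2_appendI[OF W(3) v(3)]])+
    have "ball W G as xs (g1 (xs @ v1))" "ball W G as xs (g2 (xs @ v2))"
      by (rule ball_appendsD[OF b ty])+
    moreover have "length (f1 xs) = length (Uex A)" by (rule defn_length[OF d1(1) l(1)])
    ultimately show "W \<tturnstile> Umat (And A B) as (f1 xs @ f2 xs) vs"
      unfolding v(1) using l W v s1 s2 by (simp only: Umat_And forces_And)
  qed
qed

text \<open>A challenge to the conjunction has to address both conjuncts; the forgotten one receives
  a default challenge.\<close>

lemma sound_proj1: "sound \<Gamma> (And A B) A"
proof (rule sound_linear)
  let ?m = "length (Uex A) + length (Uex B)"
  have "defn ((Uex A @ Uex B) @ Uall A) (\<lambda>z. drop ?m z @ nulls (Uall B)) (Uall A @ Uall B)"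
    by (intro defn_append defn_nulls defn_drop[OF defn_id]) simp
  then show "defn (Uex (And A B) @ Uall A) (\<lambda>z. drop ?m z @ nulls (Uall B)) (Uall (And A B))" by simp
  show "defn (Uex (And A B)) (take (length (Uex A))) (Uex A)" using defn_take[OF defn_id refl] by simp
  fix W as xs vs assume W: "htys W xs (Uex (And A B))" "htys W vs (Uall A)"
    "W \<tturnstile> Umat (And A B) as xs (drop ?m (xs @ vs) @ nulls (Uall B))"
  obtain x u where x: "xs = x @ u" "htys W x (Uex A)" "htys W u (Uex B)" using W(1) by (auto simp: list_all2_append2)
  have l: "length x = length (Uex A)" "length u = length (Uex B)" "length vs = length (Uall A)"
    using x W by (auto dest: list_all2_lengthD)
  then have "W \<tturnstile> Umat (And A B) as (x @ u) (vs @ nulls (Uall B))" using W(3) x(1) by simp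
  then show "W \<tturnstile> Umat A as (take (length (Uex A)) xs) vs"
    using l x(1) by (simp only: Umat_And forces_And append_eq_conv_conj) simp
qed

lemma sound_proj2: "sound \<Gamma> (And A B) B"
proof (rule sound_linear)
  let ?m = "length (Uex A) + length (Uex B)"
  have "defn ((Uex A @ Uex B) @ Uall B) (\<lambda>z. nulls (Uall A) @ drop ?m z) (Uall A @ Uall B)"
    by (intro defn_append defn_nulls defn_drop[OF defn_id]) simp
  then show "defn (Uex (And A B) @ Uall B) (\<lambda>z. nulls (Uall A) @ drop ?m z) (Uall (And A B))" by simp
  show "defn (Uex (And A B)) (drop (length (Uex A))) (Uex B)" using defn_drop[OF defn_id refl] by simp
  fix W as xs vs assume W: "htys W xs (Uex (And A B))" "htys W vs (Uall B)"
    "W \<tturnstile> Umat (And A B) as xs (nulls (Uall A) @ drop ?m (xs @ vs))"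
  obtain x u where x: "xs = x @ u" "htys W x (Uex A)" "htys W u (Uex B)" using W(1) by (auto simp: list_all2_append2)
  have l: "length x = length (Uex A)" "length u = length (Uex B)"
    using x by (auto dest: list_all2_lengthD)
  then have "W \<tturnstile> Umat (And A B) as (x @ u) (nulls (Uall A) @ vs)" using W(3) x(1) by simp
  then show "W \<tturnstile> Umat B as (drop (length (Uex A)) xs) vs"
    using l x(1) by (simp only: Umat_And forces_And length_lists) simp
qed

text \<open>The output of \<open>g\<close> splits. Challenges to \<open>G\<close> remain open terms,
  while those to \<open>A\<close> belong to the realizer of the implication and are abstracted to
  the functionals \<open>Y\<close>; likewise \<open>f\<close> is abstracted over the realizers of
  \<open>A\<close>.\<close>

lemma sound_curry:
  assumes "sound \<Gamma> (And G A) B" "wff \<Gamma> A" "wff \<Gamma> B"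
  shows "sound \<Gamma> G (Imp A B)"
proof -
  obtain f g where r: "realizes \<Gamma> (And G A) B f g" using assms(1) unfolding sound_def by blast
  note d = realizes_defn[OF r, unfolded Uty.simps fst_conv snd_conv append_assoc map_append] and s = realizesD[OF r, unfolded Uty.simps fst_conv snd_conv append_assoc map_append]
  let ?n = "length (Uall G)"
  have dG: "defn (Uex G @ Uex A @ Uall B) (\<lambda>z. take ?n (g z)) (map Seq (Uall G))"
    and dA: "defn (Uex G @ Uex A @ Uall B) (\<lambda>z. drop ?n (g z)) (map Seq (Uall A))"
    by (rule defn_take[OF d(2)] defn_drop[OF d(2)]; simp)+
  obtain F where F: "defn (Uex G) F (map (arrs (Uex A)) (Uex B))"
    and Feq: "\<And>W xs us. world W \<Longrightarrow> htys W xs (Uex G) \<Longrightarrow> htys W us (Uex A) \<Longrightarrow>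
      eqs W (Uex B) (map (\<lambda>U. apps U us) (F xs)) (f (xs @ us))"
    using defn_lam[OF d(1)] by blast
  obtain Y where Y: "defn (Uex G) Y (map (arrs (Uex A @ Uall B)) (map Seq (Uall A)))"
    and Yeq: "\<And>W xs us. world W \<Longrightarrow> htys W xs (Uex G) \<Longrightarrow> htys W us (Uex A @ Uall B) \<Longrightarrow>
      eqs W (map Seq (Uall A)) (map (\<lambda>U. apps U us) (Y xs)) (drop ?n (g (xs @ us)))"
    using defn_lam[OF dA] by blast
  have Y': "defn (Uex G) Y (map (\<lambda>\<tau>. arrs (Uex A @ Uall B) (Seq \<tau>)) (Uall A))" using Y by (simp add: o_def)
  show ?thesis
  proof (rule soundI[where g = "\<lambda>z. take ?n (g z)"])
    show "defn (Uex G) (\<lambda>x. F x @ Y x) (Uex (Imp A B))" using defn_append[OF F Y'] by simp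
    show "defn (Uex G @ Uall (Imp A B)) (\<lambda>z. take ?n (g z)) (map Seq (Uall G))" using dG by simp
    fix W as xs xv assume W: "world W" "subst_ty (fst W) as \<Gamma>" "htys W xs (Uex G)" "htys W xv (Uall (Imp A B))"
      and b: "ball W G as xs (take ?n (g (xs @ xv)))"
    obtain x v where x: "xv = x @ v" "htys W x (Uex A)" "htys W v (Uall B)"
      using W(4) by (auto simp: list_all2_append2)
    have l: "length xs = length (Uex G)" "length xv = length (Uex A) + length (Uall B)"
      using W(3,4) by (auto dest: list_all2_lengthD)
    have lg: "length (g (xs @ xv)) = ?n + length (Uall A)" using defn_length[OF d(2), of "xs @ xv"] l by simp
    show "W \<tturnstile> Umat (Imp A B) as (F xs @ Y xs) xv"
      unfolding x(1) forces_Imp[OF W(1) assms(2) W(2) defn_has_ty[OF F W(3)] defn_has_ty[OF Y' W(3)] x(2,3)]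
    proof (intro HOL.allI HOL.impI)
      fix W' assume e: "W \<sqsubseteq> W'" and bA: "ball W' A as x (map (\<lambda>Y. apps Y (x @ v)) (Y xs))"
      note w = ext_world[OF e] and sub = subst_ty_world[OF e W(2)] and tx = htys_ext[OF e W(3)]
        and tx' = htys_ext[OF e x(2)] and tv = htys_ext[OF e x(3)]
      have "ball W' A as x (drop ?n (g (xs @ x @ v)))"
        by (rule ball_cong[OF w assms(2) eq_subst_refl[OF sub] eqs_refl[OF tx'] Yeq[OF w tx list_all2_appendI[OF tx' tv]] bA])
      then have "ball W' (And G A) as (xs @ x) (take ?n (g (xs @ xv)) @ drop ?n (g (xs @ xv)))"
        by (intro ball_AndI[OF ball_ext[OF e b]]) (use x l lg in auto)
      then have "W' \<tturnstile> Umat B as (f (xs @ x)) v"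
        using s[OF w sub list_all2_appendI[OF tx tx'] tv] x(1) by simp
      then show "W' \<tturnstile> Umat B as (map (\<lambda>U. apps U x) (F xs)) v"
        by (rule Umat_cong[OF w assms(3) eq_subst_refl[OF sub] eqs_sym[OF w Feq[OF w tx tx']] eqs_refl[OF tv]])
    qed
  qed
qed

text \<open>The functionals in the realizer of the implication are applied to the realizers of
  \<open>A\<close>. The sequences for \<open>G\<close> and for \<open>A\<close> are padded, since
  the bounded block of the conjunction ranges over both at once.\<close>

lemma sound_uncurry:
  assumes "sound \<Gamma> G (Imp A B)" "wff \<Gamma> A"
  shows "sound \<Gamma> (And G A) B"
proof -
  obtain f g where r: "realizes \<Gamma> G (Imp A B) f g" using assms(1) unfolding sound_def by blast
  note d = realizes_defn[OF r, unfolded Uty.simps fst_conv snd_conv] and s = realizesD[OF r, unfolded Uty.simps fst_conv snd_conv]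
  let ?m = "length (Uex G)" and ?p = "length (Uex B)"
  let ?U = "\<lambda>x. take ?p (f x)" and ?Y = "\<lambda>x. drop ?p (f x)"
  have dU: "defn (Uex G) ?U (map (arrs (Uex A)) (Uex B))" by (rule defn_take[OF d(1)]) simp
  have dY: "defn (Uex G) ?Y (map (\<lambda>\<tau>. arrs (Uex A @ Uall B) (Seq \<tau>)) (Uall A))" by (rule defn_drop[OF d(1)]) simp
  then have dY': "defn (Uex G) ?Y (map (arrs (Uex A @ Uall B)) (map Seq (Uall A)))" by (simp add: o_def)
  let ?f = "\<lambda>z. map (\<lambda>U. apps U (drop ?m z)) (?U (take ?m z))"
  let ?gA = "\<lambda>z. map (\<lambda>U. apps U (drop ?m z)) (?Y (take ?m z))"
  let ?g = "\<lambda>z. add_nulls (Uall G) (g z) @ add_nulls (Uall A) (?gA z)"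
  have df: "defn (Uex G @ Uex A) ?f (Uex B)"
    by (intro defn_apps[of _ _ "Uex A"] defn_comp[OF _ dU] defn_take[OF defn_id refl] defn_drop[OF defn_id refl])
  have dgA: "defn (Uex G @ Uex A @ Uall B) ?gA (map Seq (Uall A))"
    by (intro defn_apps[of _ _ "Uex A @ Uall B"] defn_comp[OF _ dY'] defn_take[OF defn_id refl] defn_drop[OF defn_id refl])
  have dg: "defn (Uex G @ Uex A @ Uall B) ?g (map Seq (Uall G) @ map Seq (Uall A))"
    by (intro defn_append defn_add_nulls d(2) dgA)
  show ?thesis
  proof (rule soundI[where g = ?g])
    show "defn (Uex (And G A)) ?f (Uex B)" using df by simp
    show "defn (Uex (And G A) @ Uall B) ?g (map Seq (Uall (And G A)))" using dg by simp
    fix W as xs v assume W: "world W" "subst_ty (fst W) as \<Gamma>" "htys W xs (Uex (And G A))" "htys W v (Uall B)"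
      and b: "ball W (And G A) as xs (?g (xs @ v))"
    obtain x u where x: "xs = x @ u" "htys W x (Uex G)" "htys W u (Uex A)"
      using W(3) by (auto simp: list_all2_append2)
    have l: "length x = ?m" "length u = length (Uex A)" using x by (auto dest: list_all2_lengthD)
    let ?S = "g (x @ u @ v)" and ?T = "map (\<lambda>U. apps U (u @ v)) (?Y x)"
    have b': "ball W (And G A) as (x @ u) (add_nulls (Uall G) ?S @ add_nulls (Uall A) ?T)"
      using b l x(1) by simp
    have tS: "htys W ?S (map Seq (Uall G))"
      by (rule defn_has_ty[OF d(2) list_all2_appendI[OF x(2) list_all2_appendI[OF x(3) W(4)]]])
    have tT: "htys W ?T (map Seq (Uall A))"
      using defn_has_ty[OF dgA list_all2_appendI[OF x(2) list_all2_appendI[OF x(3) W(4)]]] l by simp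
    have bG: "ball W G as x (add_nulls (Uall G) ?S)"
      by (rule ball_AndD1[OF b' l(1) _ mems_nulls[OF W(1) tT]]) simp
    have bG': "ball W G as x ?S"
      by (rule ball_add_nullsD[OF bG tS])
    have bA: "ball W A as u (add_nulls (Uall A) ?T)"
      by (rule ball_AndD2[OF b' l(1) _ mems_nulls[OF W(1) tS]]) simp
    have bA': "ball W A as u ?T"
      by (rule ball_add_nullsD[OF bA tT])
    have "W \<tturnstile> Umat (Imp A B) as (?U x @ ?Y x) (u @ v)"
      using s[OF W(1,2) x(2) list_all2_appendI[OF x(3) W(4)] bG'] by simp
    then have "W \<tturnstile> Umat B as (map (\<lambda>U. apps U u) (?U x)) v"
      unfolding forces_Imp[OF W(1) assms(2) W(2) defn_has_ty[OF dU x(2)] defn_has_ty[OF dY x(2)] x(3) W(4)]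
      using bA' ext_refl[OF W(1)] by blast
    then show "W \<tturnstile> Umat B as (?f xs) v" using l x(1) by simp
  qed
qed

text \<open>Dummy realizers will do, because the matrix of the premise is \<bottom>.\<close>

lemma sound_bot:
  assumes "wff \<Gamma> A"
  shows "sound \<Gamma> Bot A"
proof (rule sound_linear[where h = "\<lambda>z. []"])
  show "defn (Uex Bot) (\<lambda>z. nulls (Uex A)) (Uex A)" by (rule defn_nulls)
  fix W as xs vs assume W: "world W" "subst_ty (fst W) as \<Gamma>" "htys W vs (Uall A)" "W \<tturnstile> Umat Bot as xs []"
  show "W \<tturnstile> Umat A as (nulls (Uex A)) vs"
    by (rule forces_botE) (use W wff_Umat[OF assms W(2) has_ty_nulls W(3)] in auto)
qed simp

lemma has_ty_zero_list: "list_all2 (has_ty []) [zero] [N]" "list_all2 (has_ty []) [suc zero] [N]"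
  by (auto intro: has_ty_suc)

text \<open>Flag zero selects the left disjunct. The guard of the right one is the refutable
  \<open>\<not> 0 = 0\<close>, which admits dummy realizers there.\<close>

lemma sound_inl:
  assumes "wff \<Gamma> A" "wff \<Gamma> B"
  shows "sound \<Gamma> A (Or A B)"
proof (rule sound_linear)
  let ?m = "length (Uex A)" and ?n = "length (Uall A)"
  show "defn (Uex A) (\<lambda>x. [zero] @ x @ nulls (Uex B)) (Uex (Or A B))"
    using defn_append[OF defn_const[OF has_ty_zero_list(1)] defn_append[OF defn_id defn_nulls]] by simp
  show "defn (Uex A @ Uall (Or A B)) (\<lambda>z. take ?n (drop ?m z)) (Uall A)"
    using defn_take[OF defn_drop[OF defn_id refl] refl] by simp
  fix W as xs vs assume W: "world W" "subst_ty (fst W) as \<Gamma>" "htys W xs (Uex A)" "htys W vs (Uall (Or A B))"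
    "W \<tturnstile> Umat A as xs (take ?n (drop ?m (xs @ vs)))"
  obtain v u where v: "vs = v @ u" "htys W v (Uall A)" "htys W u (Uall B)" using W(4) by (auto simp: list_all2_append2)
  have l: "length xs = ?m" "length v = ?n" using W(3) v(2) by (auto dest: list_all2_lengthD)
  then have A: "W \<tturnstile> Umat A as xs v" using W(5) v(1) by simp
  have "W \<tturnstile> Imp (Eq N zero zero) (Umat A as xs v)"
    by (rule forces_impI[OF W(1)]) (use A in \<open>auto intro: forces_mono\<close>)
  moreover have "W \<tturnstile> Imp (Neg (Eq N zero zero)) (Umat B as (nulls (Uex B)) u)"
  proof (rule forces_impI[OF W(1)])
    fix W' assume W': "W \<sqsubseteq> W'" "W' \<tturnstile> Neg (Eq N zero zero)"
    show "W' \<tturnstile> Umat B as (nulls (Uex B)) u"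
      by (rule forces_botE[OF forces_mp[OF W'(2) eq_reflI[OF has_ty_zero]]])
        (use wff_Umat[OF assms(2) subst_ty_world[OF W'(1) W(2)] has_ty_nulls htys_ext[OF W'(1) v(3)]] in auto)
  qed auto
  ultimately show "W \<tturnstile> Umat (Or A B) as ([zero] @ xs @ nulls (Uex B)) vs"
    using Umat_Or[of xs A v B as zero "nulls (Uex B)" u] l v(1) by (simp add: forces_And del: Umat.simps)
qed

text \<open>Flag one selects the right disjunct; that a successor is not zero refutes the guard of
  the left one.\<close>

lemma sound_inr:
  assumes "wff \<Gamma> A" "wff \<Gamma> B"
  shows "sound \<Gamma> B (Or A B)"
proof (rule sound_linear)
  let ?m = "length (Uex B)" and ?n = "length (Uall A)"
  show "defn (Uex B) (\<lambda>x. [suc zero] @ nulls (Uex A) @ x) (Uex (Or A B))"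
    using defn_append[OF defn_const[OF has_ty_zero_list(2)] defn_append[OF defn_nulls defn_id]] by simp
  show "defn (Uex B @ Uall (Or A B)) (\<lambda>z. drop ?n (drop ?m z)) (Uall B)"
    using defn_drop[OF defn_drop[OF defn_id refl] refl] by simp
  fix W as xs vs assume W: "world W" "subst_ty (fst W) as \<Gamma>" "htys W xs (Uex B)" "htys W vs (Uall (Or A B))"
    "W \<tturnstile> Umat B as xs (drop ?n (drop ?m (xs @ vs)))"
  obtain v u where v: "vs = v @ u" "htys W v (Uall A)" "htys W u (Uall B)" using W(4) by (auto simp: list_all2_append2)
  have l: "length xs = ?m" "length v = ?n" using W(3) v(2) by (auto dest: list_all2_lengthD)
  then have B: "W \<tturnstile> Umat B as xs u" using W(5) v(1) by simp
  have ty: "hty W (suc zero) N" by (auto intro: has_ty_suc)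
  have "W \<tturnstile> Imp (Neg (Eq N (suc zero) zero)) (Umat B as xs u)"
    by (rule forces_impI[OF W(1)]) (use B ty in \<open>auto intro: forces_mono\<close>)
  moreover have "W \<tturnstile> Imp (Eq N (suc zero) zero) (Umat A as (nulls (Uex A)) v)"
  proof (rule forces_impI[OF W(1)])
    fix W' assume W': "W \<sqsubseteq> W'" "W' \<tturnstile> Eq N (suc zero) zero"
    show "W' \<tturnstile> Umat A as (nulls (Uex A)) v"
      by (rule forces_botE[OF suc_neq_zero[OF ext_world[OF W'(1)] W'(2)]])
        (use wff_Umat[OF assms(1) subst_ty_world[OF W'(1) W(2)] has_ty_nulls htys_ext[OF W'(1) v(2)]] in auto)
  qed (use ty in auto)
  ultimately show "W \<tturnstile> Umat (Or A B) as ([suc zero] @ nulls (Uex A) @ xs) vs"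
    using Umat_Or[of "nulls (Uex A)" A v B as "suc zero" xs u] l v(1) by (simp add: forces_And del: Umat.simps)
qed

text \<open>The realizer is selected by a conditional on the flag, whereas challenges to both
  disjuncts are issued whatever the flag, padded because they share one bounded block. The
  verification splits on the flag, a numerical case distinction whose goal is a matrix.\<close>

lemma sound_case:
  assumes "sound \<Gamma> A C" "sound \<Gamma> B C" "wff \<Gamma> C"
  shows "sound \<Gamma> (Or A B) C"
proof -
  obtain f1 g1 where r1: "realizes \<Gamma> A C f1 g1" using assms(1) unfolding sound_def by blast
  note d1 = realizes_defn[OF r1] and s1 = realizesD[OF r1]
  obtain f2 g2 where r2: "realizes \<Gamma> B C f2 g2" using assms(2) unfolding sound_def by blast
  note d2 = realizes_defn[OF r2] and s2 = realizesD[OF r2]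
  let ?m = "length (Uex A)" and ?p = "length (Uex B)"
  let ?C = "[N] @ Uex A @ Uex B" and ?D = "[N] @ Uex A @ Uex B @ Uall C"
  let ?f1 = "\<lambda>z. f1 (take ?m (drop 1 z))" and ?f2 = "\<lambda>z. f2 (drop ?m (drop 1 z))"
  let ?f = "\<lambda>z. conds (Uex C) (hd (take 1 z)) (?f1 z) (?f2 z)"
  let ?v = "\<lambda>z. drop ?p (drop ?m (drop 1 z))"
  let ?g1 = "\<lambda>z. g1 (take ?m (drop 1 z) @ ?v z)" and ?g2 = "\<lambda>z. g2 (take ?p (drop ?m (drop 1 z)) @ ?v z)"
  let ?g = "\<lambda>z. add_nulls (Uall A) (?g1 z) @ add_nulls (Uall B) (?g2 z)"
  have t1: "defn ([N] @ \<Gamma>') (drop 1) \<Gamma>'" "defn ([N] @ \<Gamma>') (take 1) [N]" for \<Gamma>'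
    by (rule defn_drop[OF defn_id] defn_take[OF defn_id]; simp)+
  have df: "defn ?C ?f (Uex C)"
    by (intro defn_conds defn_comp[OF _ d1(1)] defn_comp[OF _ d2(1)] t1 defn_take[OF t1(1) refl] defn_drop[OF t1(1) refl])
  have dv: "defn ?D ?v (Uall C)" by (rule defn_drop[OF defn_drop[OF t1(1) refl] refl])
  have dg: "defn ?D ?g (map Seq (Uall A) @ map Seq (Uall B))"
    by (intro defn_append defn_add_nulls defn_comp[OF defn_append d1(2)] defn_comp[OF defn_append d2(2)] dv
        defn_take[OF t1(1) refl] defn_take[OF defn_drop[OF t1(1) refl] refl])
  show ?thesis
  proof (rule soundI[where g = ?g])
    show "defn (Uex (Or A B)) ?f (Uex C)" using df by simp
    show "defn (Uex (Or A B) @ Uall C) ?g (map Seq (Uall (Or A B)))" using dg by simp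
    fix W as zs v assume W: "world W" "subst_ty (fst W) as \<Gamma>" "htys W zs (Uex (Or A B))" "htys W v (Uall C)"
      and b: "ball W (Or A B) as zs (?g (zs @ v))"
    obtain z x u where z: "zs = z # x @ u" "hty W z N" "htys W x (Uex A)" "htys W u (Uex B)"
      using W(3) by (auto simp: list_all2_append2 list_all2_Cons2)
    have l: "length x = ?m" "length u = ?p" using z by (auto dest: list_all2_lengthD)
    let ?S = "g1 (x @ v)" and ?T = "g2 (u @ v)"
    have b': "ball W (Or A B) as (z # x @ u) (add_nulls (Uall A) ?S @ add_nulls (Uall B) ?T)"
      using b l z(1) by simp
    have tS: "htys W ?S (map Seq (Uall A))" by (rule defn_has_ty[OF d1(2) list_all2_appendI[OF z(3) W(4)]])
    have tT: "htys W ?T (map Seq (Uall B))" by (rule defn_has_ty[OF d2(2) list_all2_appendI[OF z(4) W(4)]])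
    have t1: "htys W (f1 x) (Uex C)" by (rule defn_has_ty[OF d1(1) z(3)])
    have t2: "htys W (f2 u) (Uex C)" by (rule defn_has_ty[OF d2(1) z(4)])
    have fz: "?f zs = conds (Uex C) z (f1 x) (f2 u)" using z(1) l by simp
    have tf: "htys W (?f zs) (Uex C)" using defn_has_ty[OF df, of "fst W" zs] W(3) by simp
    show "W \<tturnstile> Umat C as (?f zs) v"
    proof (rule nat_cases[OF W(1) z(2)])
      show "wff (fst W) (Umat C as (?f zs) v)" by (rule wff_Umat[OF assms(3) W(2) tf W(4)])
      fix W1 assume W1: "W \<sqsubseteq> W1" "W1 \<tturnstile> Eq N z zero"
      note w = ext_world[OF W1(1)] and sub = subst_ty_world[OF W1(1) W(2)] and tv = htys_ext[OF W1(1) W(4)]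
      have "ball W1 A as x ?S" unfolding ball_def
      proof (intro HOL.allI HOL.impI)
        fix W2 ys assume W2: "W1 \<sqsubseteq> W2" "htys W2 ys (Uall A)" "mems W2 (Uall A) ys ?S"
        have e: "W \<sqsubseteq> W2" by (rule ext_trans[OF W1(1) W2(1)])
        have ly: "length ys = length (Uall A)" using W2(2) by (rule list_all2_lengthD)
        have "W2 \<tturnstile> Umat (Or A B) as (z # x @ u) (ys @ nulls (Uall B))"
          by (rule ballD[OF ball_ext[OF e b'] ext_world[OF e]])
            (use W2 ly mems_nulls[OF ext_world[OF e] htys_ext[OF e tT]] mems_add_nulls[OF ext_world[OF e] htys_ext[OF e tS] W2(2,3)]
              in \<open>auto simp: rel3_append intro: list_all2_appendI has_ty_nulls\<close>)
        then have "W2 \<tturnstile> Imp (Eq N z zero) (Umat A as x ys)" unfolding Umat_Or[OF l(1) ly] forces_And by simp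
        then show "W2 \<tturnstile> Umat A as x ys" by (rule forces_mp[OF _ forces_mono[OF W2(1) W1(2)]])
      qed
      then have "W1 \<tturnstile> Umat C as (f1 x) v" by (rule s1[OF w sub htys_ext[OF W1(1) z(3)] tv])
      then show "W1 \<tturnstile> Umat C as (?f zs) v" unfolding fz
        by (rule Umat_cong[OF w assms(3) eq_subst_refl[OF sub] eqs_sym[OF w conds_zero[OF w htys_ext[OF W1(1) t1]
            htys_ext[OF W1(1) t2] W1(2)]] eqs_refl[OF tv]])
    next
      fix W1 k assume W1: "W \<sqsubseteq> W1" "hty W1 k N" "W1 \<tturnstile> Eq N z (suc k)"
      note w = ext_world[OF W1(1)] and sub = subst_ty_world[OF W1(1) W(2)] and tv = htys_ext[OF W1(1) W(4)]
      have nz: "W1 \<tturnstile> Neg (Eq N z zero)" by (rule eq_suc_neq_zero[OF w W1(3)])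
      have "ball W1 B as u ?T" unfolding ball_def
      proof (intro HOL.allI HOL.impI)
        fix W2 ys assume W2: "W1 \<sqsubseteq> W2" "htys W2 ys (Uall B)" "mems W2 (Uall B) ys ?T"
        have e: "W \<sqsubseteq> W2" by (rule ext_trans[OF W1(1) W2(1)])
        have "W2 \<tturnstile> Umat (Or A B) as (z # x @ u) (nulls (Uall A) @ ys)"
          by (rule ballD[OF ball_ext[OF e b'] ext_world[OF e]])
            (use W2 mems_nulls[OF ext_world[OF e] htys_ext[OF e tS]] mems_add_nulls[OF ext_world[OF e] htys_ext[OF e tT] W2(2,3)]
              in \<open>auto simp: rel3_append intro: list_all2_appendI has_ty_nulls\<close>)
        then have "W2 \<tturnstile> Imp (Neg (Eq N z zero)) (Umat B as u ys)"
          unfolding Umat_Or[OF l(1) length_lists(2)] forces_And by simp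
        then show "W2 \<tturnstile> Umat B as u ys" by (rule forces_mp[OF _ forces_mono[OF W2(1) nz]])
      qed
      then have "W1 \<tturnstile> Umat C as (f2 u) v" by (rule s2[OF w sub htys_ext[OF W1(1) z(4)] tv])
      then show "W1 \<tturnstile> Umat C as (?f zs) v" unfolding fz
        by (rule Umat_cong[OF w assms(3) eq_subst_refl[OF sub] eqs_sym[OF w conds_suc[OF w htys_ext[OF W1(1) t1]
            htys_ext[OF W1(1) t2] W1(2,3)]] eqs_refl[OF tv]])
    qed auto
  qed
qed

section \<open>Internal quantifiers\<close>

lemma ball_flift: "ball W (flift \<Phi>) (case_nat t as) xs Ss = ball W \<Phi> as xs Ss"
  by (simp add: ball_def Umat_flift)

lemma ball_finst: "ball W (finst t \<Phi>) as xs Ss = ball W \<Phi> (case_nat (tsubst as t) as) xs Ss"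
  by (simp add: ball_def Umat_finst)

lemma sound_allI:
  assumes "sound (\<sigma> # \<Gamma>) (flift G) A" "wff (\<sigma> # \<Gamma>) A"
  shows "sound \<Gamma> G (All \<sigma> A)"
proof -
  obtain f g where r: "realizes (\<sigma> # \<Gamma>) (flift G) A f g" using assms(1) unfolding sound_def by blast
  note d = realizes_defn[OF r, unfolded Uty_flift] and s = realizesD[OF r, unfolded Uty_flift]
  show ?thesis
  proof (rule soundI)
    fix W as xs vs assume W: "world W" "subst_ty (fst W) as \<Gamma>" "htys W xs (Uex G)" "htys W vs (Uall (All \<sigma> A))"
      "ball W G as xs (g (xs @ vs))"
    have v: "htys W vs (Uall A)" using W(4) by simp
    show "W \<tturnstile> Umat (All \<sigma> A) as (f xs) vs"
      unfolding forces_All[OF W(1) assms(2) W(2) defn_has_ty[OF d(1) W(3)] v]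
    proof (intro HOL.allI HOL.impI)
      fix W' t assume e: "W \<sqsubseteq> W'" and t: "hty W' t \<sigma>"
      show "W' \<tturnstile> Umat A (case_nat t as) (f xs) vs"
        by (rule s[OF ext_world[OF e] subst_ty_case_nat[OF t subst_ty_world[OF e W(2)]] htys_ext[OF e W(3)] htys_ext[OF e v]])
          (use ball_ext[OF e W(5)] in \<open>simp add: ball_flift\<close>)
    qed
  qed (use d in auto)
qed

lemma sound_allE:
  assumes "has_ty \<Gamma> t \<sigma>" "wff (\<sigma> # \<Gamma>) A"
  shows "sound \<Gamma> (All \<sigma> A) (finst t A)"
proof (rule sound_linear)
  show "defn (Uex (All \<sigma> A)) (\<lambda>x. x) (Uex (finst t A))" using defn_id by simp
  show "defn (Uex (All \<sigma> A) @ Uall (finst t A)) (drop (length (Uex A))) (Uall (All \<sigma> A))"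
    using defn_drop[OF defn_id refl] by simp
  fix W as xs vs assume W: "world W" "subst_ty (fst W) as \<Gamma>" "htys W xs (Uex (All \<sigma> A))" "htys W vs (Uall (finst t A))"
    "W \<tturnstile> Umat (All \<sigma> A) as xs (drop (length (Uex A)) (xs @ vs))"
  have ty: "htys W xs (Uex A)" "htys W vs (Uall A)" using W(3,4) by auto
  have "W \<tturnstile> Umat (All \<sigma> A) as xs vs" using W(5) list_all2_lengthD[OF ty(1)] by (simp del: Umat.simps)
  then show "W \<tturnstile> Umat (finst t A) as xs vs"
    unfolding forces_All[OF W(1) assms(2) W(2) ty] Umat_finst
    using ext_refl[OF W(1)] has_ty_tsubst[OF assms(1) W(2)] by blast
qed

text \<open>A challenge to the existential statement is already a tuple of sequences of challenges
  to its instance, and is handed on unchanged.\<close>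

lemma sound_exI:
  assumes "has_ty \<Gamma> t \<sigma>" "wff (\<sigma> # \<Gamma>) A"
  shows "sound \<Gamma> (finst t A) (Ex \<sigma> A)"
proof (rule soundI)
  show "defn (Uex (finst t A)) (\<lambda>x. x) (Uex (Ex \<sigma> A))" using defn_id by simp
  show "defn (Uex (finst t A) @ Uall (Ex \<sigma> A)) (drop (length (Uex A))) (map Seq (Uall (finst t A)))"
    using defn_drop[OF defn_id refl] by simp
  fix W as xs vs assume W: "world W" "subst_ty (fst W) as \<Gamma>" "htys W xs (Uex (finst t A))" "htys W vs (Uall (Ex \<sigma> A))"
    "ball W (finst t A) as xs (drop (length (Uex A)) (xs @ vs))"
  have ty: "htys W xs (Uex A)" "htys W vs (map Seq (Uall A))" using W(3,4) by auto
  have "ball W A (case_nat (tsubst as t) as) xs vs"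
    using W(5) list_all2_lengthD[OF ty(1)] by (simp add: ball_finst)
  then show "W \<tturnstile> Umat (Ex \<sigma> A) as xs vs"
    by (rule forces_ExI[OF W(1) assms(2) W(2) ty has_ty_tsubst[OF assms(1) W(2)]])
qed

text \<open>The sequences that \<open>g\<close> raises against \<open>A\<close> form a single
  challenge to the existential statement. This works because \<open>g\<close> does not depend on the
  witness, which only appears by elimination inside the internal theory.\<close>

lemma sound_exE:
  assumes "sound (\<sigma> # \<Gamma>) A (flift C)" "wff (\<sigma> # \<Gamma>) A" "wff \<Gamma> C"
  shows "sound \<Gamma> (Ex \<sigma> A) C"
proof -
  obtain f g where r: "realizes (\<sigma> # \<Gamma>) A (flift C) f g" using assms(1) unfolding sound_def by blast
  note d = realizes_defn[OF r, unfolded Uty_flift] and s = realizesD[OF r, unfolded Uty_flift]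
  show ?thesis
  proof (rule sound_linear)
    fix W as xs vs assume W: "world W" "subst_ty (fst W) as \<Gamma>" "htys W xs (Uex (Ex \<sigma> A))" "htys W vs (Uall C)"
      "W \<tturnstile> Umat (Ex \<sigma> A) as xs (g (xs @ vs))"
    have ty: "htys W xs (Uex A)" using W(3) by simp
    show "W \<tturnstile> Umat C as (f xs) vs"
    proof (rule forces_ExE[OF W(1) assms(2) W(2) ty defn_has_ty[OF d(2) list_all2_appendI[OF ty W(4)]] W(5)])
      show "wff (fst W) (Umat C as (f xs) vs)" by (rule wff_Umat[OF assms(3) W(2) defn_has_ty[OF d(1) ty] W(4)])
      fix W' t assume e: "W \<sqsubseteq> W'" and t: "hty W' t \<sigma>" and b: "ball W' A (case_nat t as) xs (g (xs @ vs))"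
      have "W' \<tturnstile> Umat (flift C) (case_nat t as) (f xs) vs"
        by (rule s[OF ext_world[OF e] subst_ty_case_nat[OF t subst_ty_world[OF e W(2)]] htys_ext[OF e ty] htys_ext[OF e W(4)] b])
      then show "W' \<tturnstile> Umat C as (f xs) vs" by (simp add: Umat_flift)
    qed
  qed (use d in auto)
qed

text \<open>A formula with neither realizers nor challenges. It ends the conjunction of hypotheses
  and is the premise under which axioms are interpreted.\<close>

abbreviation Top :: fm where
  "Top \<equiv> Imp Bot Bot"

lemma sound_top: "sound \<Gamma> A Top"
proof (rule sound_linear)
  show "defn (Uex A) (\<lambda>x. []) (Uex Top)" by simp
  show "defn (Uex A @ Uall Top) (\<lambda>x. nulls (Uall A)) (Uall A)" by (rule defn_nulls)
  fix W as xs vs assume "world W"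
  then show "W \<tturnstile> Umat Top as [] vs" by (auto simp: vars_def intro!: forces_impI)
qed

lemma sound_ImpI: "sound \<Gamma> A B \<Longrightarrow> wff \<Gamma> A \<Longrightarrow> wff \<Gamma> B \<Longrightarrow> sound \<Gamma> G (Imp A B)"
  by (rule sound_curry[OF sound_comp[OF sound_proj2]])

section \<open>Soundness of derivations\<close>

definition conj :: "fm list \<Rightarrow> fm" where
  "conj H = foldr And H Top"

lemma conj_simps [simp]: "conj [] = Top" "conj (\<phi> # H) = And \<phi> (conj H)"
  by (simp_all add: conj_def)

lemma conj_flift: "conj (map flift H) = flift (conj H)"
  by (induction H) (simp_all add: flift_def)

lemma wff_conj: "(\<And>h. h \<in> set H \<Longrightarrow> wff \<Gamma> h) \<Longrightarrow> wff \<Gamma> (conj H)"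
  by (induction H) auto

lemma sound_hyp: "\<phi> \<in> set H \<Longrightarrow> sound \<Gamma> (conj H) \<phi>"
  by (induction H) (auto intro: sound_proj1 sound_comp[OF sound_proj2])

lemma sound_contract: "sound \<Gamma> (And G G) C \<Longrightarrow> sound \<Gamma> G C"
  by (rule sound_comp[OF sound_pair[OF sound_id sound_id]])

lemma prv_sound:
  assumes "prv UNIV Ax \<Gamma> H \<Phi>"
    and Ax: "\<And>\<Gamma> \<phi>. \<phi> \<in> Ax \<Longrightarrow> wff \<Gamma> \<phi> \<Longrightarrow> sound \<Gamma> Top \<phi>"
    and "\<And>h. h \<in> set H \<Longrightarrow> wff \<Gamma> h"
  shows "sound \<Gamma> (conj H) \<Phi>"
  using assms(1,3)
proof (induction rule: prv.induct)
  case (ax \<phi> \<Gamma> H)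
  then show ?case using sound_comp[OF sound_top Ax] by blast
next
  case (hyp \<phi> H \<Gamma>)
  then show ?case by (simp add: sound_hyp)
next
  case (botE \<Gamma> H \<phi>)
  then show ?case using sound_comp[OF _ sound_bot] by blast
next
  case (andI \<Gamma> H \<phi> \<psi>)
  then show ?case using sound_pair by blast
next
  case (andE1 \<Gamma> H \<phi> \<psi>)
  then show ?case using sound_comp[OF _ sound_proj1] by blast
next
  case (andE2 \<Gamma> H \<phi> \<psi>)
  then show ?case using sound_comp[OF _ sound_proj2] by blast
next
  case (orI1 \<Gamma> H \<phi> \<psi>)
  have "wff \<Gamma> \<phi>" by (rule prv_wff[OF orI1.hyps(1) orI1.prems])
  then show ?case using sound_comp[OF orI1.IH sound_inl] orI1 by blast
next
  case (orI2 \<Gamma> H \<psi> \<phi>)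
  have "wff \<Gamma> \<psi>" by (rule prv_wff[OF orI2.hyps(1) orI2.prems])
  then show ?case using sound_comp[OF orI2.IH sound_inr] orI2 by blast
next
  case (orE \<Gamma> H \<phi> \<psi> \<chi>)
  have wf: "wff \<Gamma> (Or \<phi> \<psi>)" by (rule prv_wff[OF orE.hyps(1) orE.prems])
  have wfH: "wff \<Gamma> h" if "h \<in> set (\<phi> # H)" for h using that wf orE.prems by auto
  have wfH': "wff \<Gamma> h" if "h \<in> set (\<psi> # H)" for h using that wf orE.prems by auto
  have wc: "wff \<Gamma> \<chi>" by (rule prv_wff[OF orE.hyps(2) wfH])
  have wH: "wff \<Gamma> (conj H)" by (rule wff_conj[OF orE.prems])
  \<comment> \<open>The case rule has no side formulae, so the hypotheses move into the conclusion
    as the premise of an implication. Afterwards this implication is applied to the hypotheses, and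
    the two copies of them are contracted.\<close>
  have "sound \<Gamma> (Or \<phi> \<psi>) (Imp (conj H) \<chi>)"
    by (rule sound_case[OF sound_curry[OF _ wH wc] sound_curry[OF _ wH wc]])
      (use orE.IH(2)[OF wfH] orE.IH(3)[OF wfH'] wc wH in auto)
  then have "sound \<Gamma> (conj H) (Imp (conj H) \<chi>)" using sound_comp orE.IH(1)[OF orE.prems] by blast
  then show ?case using sound_contract sound_uncurry wH by blast
next
  case (impI \<phi> \<Gamma> H \<psi>)
  have wfH: "wff \<Gamma> h" if "h \<in> set (\<phi> # H)" for h using that impI by auto
  have wc: "wff \<Gamma> \<psi>" by (rule prv_wff[OF impI.hyps(3) wfH])
  \<comment> \<open>A new hypothesis stands at the front of the list, while currying discharges the
    right conjunct; hence the exchange.\<close>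
  have "sound \<Gamma> (And (conj H) \<phi>) \<psi>"
    using sound_comp[OF sound_pair[OF sound_proj2 sound_proj1]] impI.IH[OF wfH] by simp
  then show ?case using sound_curry wc impI.hyps by blast
next
  case (impE \<Gamma> H \<phi> \<psi>)
  have wf: "wff \<Gamma> \<phi>" by (rule prv_wff[OF impE.hyps(2) impE.prems])
  show ?case
    using sound_comp[OF sound_pair[OF sound_id impE.IH(2)] sound_uncurry[OF impE.IH(1) wf]] impE.prems by blast
next
  case (allI \<sigma> \<Gamma> H \<phi>)
  have wfH: "wff (\<sigma> # \<Gamma>) h" if "h \<in> set (map flift H)" for h using that allI.prems by (auto intro: wff_flift)
  have "wff (\<sigma> # \<Gamma>) \<phi>" by (rule prv_wff[OF allI.hyps wfH])
  then show ?case using allI.IH[OF wfH] by (auto simp: conj_flift intro: sound_allI)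
next
  case (allE \<Gamma> H \<sigma> \<phi> t)
  have "wff \<Gamma> (All \<sigma> \<phi>)" by (rule prv_wff[OF allE.hyps(1) allE.prems])
  then show ?case using sound_comp[OF allE.IH sound_allE] allE by simp
next
  case (exI \<sigma> \<phi> \<Gamma> t H)
  then show ?case using sound_comp[OF exI.IH sound_exI] by simp
next
  case (exE \<Gamma> H \<sigma> \<phi> \<chi>)
  have wf: "wff (\<sigma> # \<Gamma>) \<phi>" using prv_wff[OF exE.hyps(1) exE.prems] by simp
  have wfH: "wff (\<sigma> # \<Gamma>) h" if "h \<in> set (\<phi> # map flift H)" for h
    using that wf exE.prems by (auto intro: wff_flift)
  have wc: "wff \<Gamma> \<chi>" by (rule wff_fliftD[OF prv_wff[OF exE.hyps(2) wfH]])
  have wH: "wff \<Gamma> (conj H)" by (rule wff_conj[OF exE.prems])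
  \<comment> \<open>As for disjunction, the side formulae pass into the conclusion. They do not
    contain the eigenvariable, so the resulting implication is a lifted formula as the rule
    demands.\<close>
  have "sound (\<sigma> # \<Gamma>) (And \<phi> (flift (conj H))) (flift \<chi>)"
    using exE.IH(2)[OF wfH] by (simp add: conj_flift)
  then have "sound (\<sigma> # \<Gamma>) \<phi> (flift (Imp (conj H) \<chi>))"
    using sound_curry wff_flift[OF wH] wff_flift[OF wc] by (simp add: flift_def)
  then have "sound \<Gamma> (Ex \<sigma> \<phi>) (Imp (conj H) \<chi>)"
    by (rule sound_exE) (use wf wc wH in auto)
  then have "sound \<Gamma> (conj H) (Imp (conj H) \<chi>)" using sound_comp exE.IH(1)[OF exE.prems] by blast
  then show ?case using sound_contract sound_uncurry wH by blast
qed

end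

section \<open>Soundness of the axioms\<close>

lemma arrs_single [simp]: "arrs [\<sigma>] = Fn \<sigma>" and arrs_nil [simp]: "arrs [] = (\<lambda>\<tau>. \<tau>)"
  by (rule ext, simp)+

lemma fsubst_Alls: "fsubst \<theta> (Alls \<tau>s \<phi>) = Alls \<tau>s (fsubst ((up ^^ length \<tau>s) \<theta>) \<phi>)"
  by (induction \<tau>s arbitrary: \<theta>) (simp_all add: Alls_def funpow_swap1)

lemma Alls_simps [simp]: "Alls [] \<phi> = \<phi>" "Alls (\<tau> # \<tau>s) \<phi> = All \<tau> (Alls \<tau>s \<phi>)"
  by (simp_all add: Alls_def)

lemma internal_Alls [simp]: "internal (Alls \<tau>s \<phi>) = internal \<phi>" and or_free_Alls [simp]: "or_free (Alls \<tau>s \<phi>) = or_free \<phi>"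
  by (induction \<tau>s) auto

lemma wff_Alls: "wff \<Gamma> (Alls \<tau>s \<phi>) = wff (rev \<tau>s @ \<Gamma>) \<phi>"
  by (induction \<tau>s arbitrary: \<Gamma>) auto

lemma prv_Alls: "prv L Ax (rev \<tau>s @ \<Gamma>) [] \<phi> \<Longrightarrow> prv L Ax \<Gamma> [] (Alls \<tau>s \<phi>)"
proof (induction \<tau>s arbitrary: \<Gamma>)
  case (Cons \<tau> \<tau>s)
  then have "prv L Ax (\<tau> # \<Gamma>) [] (Alls \<tau>s \<phi>)" by simp
  then show ?case using prv.allI[of L Ax \<tau> \<Gamma> "[]"] by simp
qed simp

lemma Umat_fsucc: "Umat (fsucc \<Phi>) (case_nat t as) xs ys = Umat \<Phi> (case_nat (suc t) as) xs ys"
proof -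
  have "(\<lambda>i. tsubst (case_nat t as) (case_nat (suc (Var 0)) (\<lambda>i. Var (Suc i)) i)) = case_nat (suc t) as"
    by (auto simp: fun_eq_iff split: nat.split)
  then show ?thesis by (simp add: fsucc_def Umat_fsubst_fm)
qed

lemma EHA_or_ax_internal: "\<phi> \<in> EHA_or_ax \<Longrightarrow> internal \<phi> \<and> or_free \<phi>"
  by (induction rule: EHA_or_ax.induct) auto

context ha_theory
begin

text \<open>An internal \<or>-free formula has no realizers, and its matrix is the formula itself
  with the parameters substituted. The axioms are closed under substitution, so the matrix is again
  an axiom of the internal theory.\<close>

lemma sound_internal:
  assumes "\<phi> \<in> EHA_or_ax \<union> \<Delta>" "wff \<Gamma> \<phi>"
  shows "sound \<Gamma> Top \<phi>"
proof -
  have int: "internal \<phi>" "or_free \<phi>" using assms(1) EHA_or_ax_internal Delta by blast+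
  then have U: "Uty \<phi> = ([], [])" "Umat \<phi> as xs ys = fsubst as \<phi>" for as xs ys using Umat_internal by auto
  show ?thesis
  proof (rule sound_linear[where f = "\<lambda>x. []" and h = "\<lambda>x. []"])
    fix W :: world and as xs vs assume "subst_ty (fst W) as \<Gamma>"
    then show "W \<tturnstile> Umat \<phi> as [] vs"
      unfolding U by (intro forces_ax ax_fsubst assms wff_fsubst[OF assms(2)]) (use int in auto)
  qed (simp_all add: U)
qed

text \<open>For formulae with the same interpretation: the identity is a realizer, and a challenge
  is returned as it came. Uniformity, choice and independence of premise are of this kind.\<close>

lemma sound_same:
  assumes "Uty A = Uty B"
    and "\<And>as xs ys. length xs = length (Uex A) \<Longrightarrow> length ys = length (Uall A) \<Longrightarrow> Umat A as xs ys = Umat B as xs ys"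
  shows "sound \<Gamma> A B"
proof (rule sound_linear)
  show "defn (Uex A) (\<lambda>x. x) (Uex B)" using defn_id assms(1) by simp
  show "defn (Uex A @ Uall B) (drop (length (Uex A))) (Uall A)" using defn_drop[OF defn_id refl] assms(1) by simp
  fix W as xs vs assume "htys W xs (Uex A)" "htys W vs (Uall B)" "W \<tturnstile> Umat A as xs (drop (length (Uex A)) (xs @ vs))"
  then show "W \<tturnstile> Umat B as xs vs" using assms by (auto dest!: list_all2_lengthD)
qed

section \<open>Standardness axioms\<close>

lemma sound_allst1:
  assumes wf: "wff (\<sigma> # \<Gamma>) A"
  shows "sound \<Gamma> (AllSt \<sigma> A) (All \<sigma> (Imp (St \<sigma> (Var 0)) A))" (is "sound \<Gamma> ?A (All \<sigma> ?I)")
proof (rule sound_linear)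
  let ?m = "length (Uex A)"
  show "defn (Uex ?A) (\<lambda>x. x) (Uex (All \<sigma> ?I))" using defn_id by simp
  \<comment> \<open>The two translations list the standard parameter at opposite ends of the
    challenges: last for the external quantifier, first for the implication.\<close>
  let ?h = "\<lambda>z. drop 1 (drop ?m z) @ take 1 (drop ?m z)"
  have "defn (map (Fn \<sigma>) (Uex A) @ [\<sigma>] @ Uall A) ?h (Uall A @ [\<sigma>])"
    by (intro defn_append defn_drop[OF defn_drop[OF defn_id]] defn_take[OF defn_drop[OF defn_id]]) auto
  then show "defn (Uex ?A @ Uall (All \<sigma> ?I)) ?h (Uall ?A)" by simp
  fix W as Xs vs assume W: "world W" "subst_ty (fst W) as \<Gamma>" "htys W Xs (Uex ?A)" "htys W vs (Uall (All \<sigma> ?I))"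
    "W \<tturnstile> Umat ?A as Xs (?h (Xs @ vs))"
  obtain u ys where u: "vs = [u] @ ys" "hty W u \<sigma>" "htys W ys (Uall A)"
    using W(4) by (auto simp: list_all2_Cons2)
  have X: "htys W Xs (map (arrs [\<sigma>]) (Uex A))" and U: "htys W [u] (Uex (St \<sigma> (Var 0)))" using W(3) u by auto
  have A: "W \<tturnstile> Umat A (case_nat u as) (map (\<lambda>X. X \<^bold>\<cdot> u) Xs) ys"
    using W(5) u(1) list_all2_lengthD[OF X] by simp
  have tX: "htys W (map (\<lambda>X. X \<^bold>\<cdot> u) Xs) (Uex A)" using has_ty_map_apps[OF X, of "[u]"] u by simp
  have wfI: "wff (\<sigma> # \<Gamma>) ?I" "wff (\<sigma> # \<Gamma>) (St \<sigma> (Var 0))" using wf by (auto intro: has_ty_VarI)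
  have tv: "htys W vs (Uall ?I)" "htys W Xs (Uex ?I)" using W(3,4) by simp_all
  show "W \<tturnstile> Umat (All \<sigma> ?I) as Xs vs"
    unfolding forces_All[OF W(1) wfI(1) W(2) tv(2) tv(1)]
  proof (intro HOL.allI HOL.impI)
    fix W1 t assume e: "W \<sqsubseteq> W1" and t: "hty W1 t \<sigma>"
    note sub = subst_ty_case_nat[OF t subst_ty_world[OF e W(2)]]
    have "W1 \<tturnstile> Umat ?I (case_nat t as) (Xs @ []) ([u] @ ys)"
    proof (subst forces_Imp[OF ext_world[OF e] wfI(2) sub])
      show "\<forall>W2. W1 \<sqsubseteq> W2 \<longrightarrow> ball W2 (St \<sigma> (Var 0)) (case_nat t as) [u] (map (\<lambda>Y. apps Y ([u] @ ys)) []) \<longrightarrow>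
          W2 \<tturnstile> Umat A (case_nat t as) (map (\<lambda>U. apps U [u]) Xs) ys"
      proof (intro HOL.allI HOL.impI)
        fix W2 assume e2: "W1 \<sqsubseteq> W2" and b: "ball W2 (St \<sigma> (Var 0)) (case_nat t as) [u] (map (\<lambda>Y. apps Y ([u] @ ys)) [])"
        have e': "W \<sqsubseteq> W2" by (rule ext_trans[OF e e2])
        note w = ext_world[OF e2]
        \<comment> \<open>The matrix of the standardness premise says that the arbitrary
          \<open>t\<close> equals its realizer \<open>u\<close>, so the matrix known at
          \<open>u\<close> carries over to \<open>t\<close>.\<close>
        have eq: "W2 \<tturnstile> Eq \<sigma> u t" using ballD[OF b w, of "[]"] by simp
        show "W2 \<tturnstile> Umat A (case_nat t as) (map (\<lambda>U. apps U [u]) Xs) ys"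
          using Umat_cong[OF w wf eq_subst_case_nat[OF eq_subst_refl[OF subst_ty_world[OF e' W(2)]] eq]
              eqs_refl[OF htys_ext[OF e' tX]] eqs_refl[OF htys_ext[OF e' u(3)]] forces_mono[OF e' A]] by simp
      qed
    qed (use htys_ext[OF e X] hty_ext[OF e u(2)] htys_ext[OF e u(3)] in auto)
    then show "W1 \<tturnstile> Umat ?I (case_nat t as) Xs vs" using u(1) by (simp del: Umat.simps)
  qed
qed

lemma sound_allst2:
  assumes wf: "wff (\<sigma> # \<Gamma>) A"
  shows "sound \<Gamma> (All \<sigma> (Imp (St \<sigma> (Var 0)) A)) (AllSt \<sigma> A)" (is "sound \<Gamma> (All \<sigma> ?I) ?A")
proof (rule sound_linear)
  let ?m = "length (Uex A)" and ?n = "length (Uall A)"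
  show "defn (Uex (All \<sigma> ?I)) (\<lambda>x. x) (Uex ?A)" using defn_id by simp
  let ?h = "\<lambda>z. drop ?n (drop ?m z) @ take ?n (drop ?m z)"
  have "defn (map (Fn \<sigma>) (Uex A) @ Uall A @ [\<sigma>]) ?h ([\<sigma>] @ Uall A)"
    by (intro defn_append defn_drop[OF defn_drop[OF defn_id]] defn_take[OF defn_drop[OF defn_id]]) auto
  then show "defn (Uex (All \<sigma> ?I) @ Uall ?A) ?h (Uall (All \<sigma> ?I))" by simp
  fix W as Xs vs assume W: "world W" "subst_ty (fst W) as \<Gamma>" "htys W Xs (Uex (All \<sigma> ?I))" "htys W vs (Uall ?A)"
    "W \<tturnstile> Umat (All \<sigma> ?I) as Xs (?h (Xs @ vs))"
  obtain z ys where z: "vs = ys @ [z]" "hty W z \<sigma>" "htys W ys (Uall A)"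
    using W(4) by (auto simp: list_all2_Cons2 list_all2_append2)
  have X: "htys W Xs (map (arrs [\<sigma>]) (Uex A))" using W(3) by auto
  have I: "W \<tturnstile> Umat (All \<sigma> ?I) as Xs ([z] @ ys)"
    using W(5) z(1) list_all2_lengthD[OF X] list_all2_lengthD[OF z(3)] by (simp del: Umat.simps)
  have wfI: "wff (\<sigma> # \<Gamma>) ?I" "wff (\<sigma> # \<Gamma>) (St \<sigma> (Var 0))" using wf by (auto intro: has_ty_VarI)
  have tv: "htys W ([z] @ ys) (Uall ?I)" "htys W Xs (Uex ?I)" using W(3) z(2,3) by simp_all
  note sub = subst_ty_case_nat[OF z(2) W(2)]
  have "W \<tturnstile> Umat ?I (case_nat z as) (Xs @ []) ([z] @ ys)"
    using I[unfolded forces_All[OF W(1) wfI(1) W(2) tv(2) tv(1)]] ext_refl[OF W(1)] z(2) by (simp del: Umat.simps)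
  moreover have "W \<tturnstile> Umat ?I (case_nat z as) (Xs @ []) ([z] @ ys) \<longleftrightarrow>
    (\<forall>W'. W \<sqsubseteq> W' \<longrightarrow> ball W' (St \<sigma> (Var 0)) (case_nat z as) [z] (map (\<lambda>Y. apps Y ([z] @ ys)) []) \<longrightarrow>
      W' \<tturnstile> Umat A (case_nat z as) (map (\<lambda>U. apps U [z]) Xs) ys)"
    by (rule forces_Imp[OF W(1) wfI(2) sub]) (use X z in auto)
  \<comment> \<open>With \<open>z\<close> both as realizer and as value of the internal quantifier,
    the standardness premise reads \<open>z = z\<close>.\<close>
  moreover have "ball W (St \<sigma> (Var 0)) (case_nat z as) [z] (map (\<lambda>Y. apps Y ([z] @ ys)) [])"
    unfolding ball_def using z(2) by (auto intro: eq_reflI hty_ext)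
  ultimately have "W \<tturnstile> Umat A (case_nat z as) (map (\<lambda>U. apps U [z]) Xs) ys"
    using ext_refl[OF W(1)] by blast
  then show "W \<tturnstile> Umat ?A as Xs vs" using z(1) by simp
qed

lemma wff_St0: "wff (\<sigma> # \<Gamma>) (St \<sigma> (Var 0))"
  by (auto intro: has_ty_VarI)

text \<open>The realizer of the external quantifier serves as the internal witness and as the
  realizer of its standardness. A challenge to the conclusion is a tuple of sequences, just what may
  be asked of the premise.\<close>

lemma sound_exst1:
  assumes wf: "wff (\<sigma> # \<Gamma>) A"
  shows "sound \<Gamma> (ExSt \<sigma> A) (Ex \<sigma> (And (St \<sigma> (Var 0)) A))" (is "sound \<Gamma> ?A (Ex \<sigma> ?I)")
proof (rule soundI)
  let ?m = "length (Uex ?A)"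
  show "defn (Uex ?A) (\<lambda>x. x) (Uex (Ex \<sigma> ?I))" using defn_id by simp
  show "defn (Uex ?A @ Uall (Ex \<sigma> ?I)) (drop ?m) (map Seq (Uall ?A))"
    using defn_drop[OF defn_id refl, of "Uex ?A"] by simp
  fix W as zs Ss assume W: "world W" "subst_ty (fst W) as \<Gamma>" "htys W zs (Uex ?A)" "htys W Ss (Uall (Ex \<sigma> ?I))"
    "ball W ?A as zs (drop ?m (zs @ Ss))"
  obtain z xs where z: "zs = [z] @ xs" "hty W z \<sigma>" "htys W xs (Uex A)" using W(3) by (auto simp: list_all2_Cons2)
  have b: "ball W A (case_nat z as) xs Ss"
    using W(5) z(1) list_all2_lengthD[OF W(3)] by (simp add: ball_def)
  have wfI: "wff (\<sigma> # \<Gamma>) ?I" using wf wff_St0 by simp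
  show "W \<tturnstile> Umat (Ex \<sigma> ?I) as zs Ss"
  proof (rule forces_ExI[OF W(1) wfI W(2) _ _ z(2)])
    have "ball W (St \<sigma> (Var 0)) (case_nat z as) [z] []"
      unfolding ball_def using z(2) by (auto intro: eq_reflI hty_ext)
    then have "ball W ?I (case_nat z as) ([z] @ xs) ([] @ Ss)" by (rule ball_AndI[OF _ b]) auto
    then show "ball W ?I (case_nat z as) zs Ss" using z(1) by simp
  qed (use W in auto)
qed

text \<open>The witness \<open>t\<close> obtained in the internal theory is provably equal to the
  realizer \<open>z\<close>, which takes its place.\<close>

lemma sound_exst2:
  assumes wf: "wff (\<sigma> # \<Gamma>) A"
  shows "sound \<Gamma> (Ex \<sigma> (And (St \<sigma> (Var 0)) A)) (ExSt \<sigma> A)" (is "sound \<Gamma> (Ex \<sigma> ?I) ?A")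
proof (rule sound_linear)
  let ?m = "length (Uex ?A)"
  let ?h = "\<lambda>z. sings (Uall A) (drop ?m z)"
  show "defn (Uex (Ex \<sigma> ?I)) (\<lambda>x. x) (Uex ?A)" using defn_id by simp
  show "defn (Uex (Ex \<sigma> ?I) @ Uall ?A) ?h (Uall (Ex \<sigma> ?I))"
    using defn_sings[OF defn_drop[OF defn_id refl, of "Uex ?A" "Uall A"]] by simp
  fix W as zs vs assume W: "world W" "subst_ty (fst W) as \<Gamma>" "htys W zs (Uex (Ex \<sigma> ?I))" "htys W vs (Uall ?A)"
    "W \<tturnstile> Umat (Ex \<sigma> ?I) as zs (?h (zs @ vs))"
  obtain z xs where z: "zs = [z] @ xs" "hty W z \<sigma>" "htys W xs (Uex A)" using W(3) by (auto simp: list_all2_Cons2)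
  have v: "htys W vs (Uall A)" using W(4) by simp
  have E: "W \<tturnstile> Umat (Ex \<sigma> ?I) as zs (sings (Uall A) vs)"
    using W(5) list_all2_lengthD[OF W(3)] by (simp del: Umat.simps)
  have wfI: "wff (\<sigma> # \<Gamma>) ?I" using wf wff_St0 by simp
  have tS: "htys W (sings (Uall A) vs) (map Seq (Uall ?I))"
    using v by (auto simp: sings_def list_all2_conv_all_nth intro!: has_ty_Prep has_ty_Empty)
  have tz: "htys W zs (Uex ?I)" using W(3) by simp
  have goal: "Umat ?A as zs vs = Umat A (case_nat z as) xs vs" using z(1) by simp
  show "W \<tturnstile> Umat ?A as zs vs" unfolding goal
  proof (rule forces_ExE[OF W(1) wfI W(2) tz tS E])
    show "wff (fst W) (Umat A (case_nat z as) xs vs)"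
      by (rule wff_Umat[OF wf subst_ty_case_nat[OF z(2) W(2)] z(3) v])
    fix W1 t assume W1: "W \<sqsubseteq> W1" "hty W1 t \<sigma>" and b: "ball W1 ?I (case_nat t as) zs (sings (Uall A) vs)"
    note w = ext_world[OF W1(1)] and v1 = htys_ext[OF W1(1) v]
    have "W1 \<tturnstile> Umat ?I (case_nat t as) ([z] @ xs) ([] @ vs)"
      using ballD[OF b w, of vs] v1 mems_sings[OF w v1] z(1) by simp
    then have eq: "W1 \<tturnstile> Eq \<sigma> z t" and A: "W1 \<tturnstile> Umat A (case_nat t as) xs vs" by (simp_all add: forces_And)
    show "W1 \<tturnstile> Umat A (case_nat z as) xs vs"
      by (rule Umat_cong[OF w wf eq_subst_case_nat[OF eq_subst_refl[OF subst_ty_world[OF W1(1) W(2)]] eq_symI[OF w eq]]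
              eqs_refl[OF htys_ext[OF W1(1) z(3)]] eqs_refl[OF v1] A])
  qed
qed

lemma sound_st_eq: "sound \<Gamma> (And (St \<sigma> t) (Eq \<sigma> t u)) (St \<sigma> u)"
proof (rule sound_linear[where f = "\<lambda>x. x" and h = "\<lambda>x. []"])
  fix W as xs vs assume W: "world W" "htys W xs (Uex (And (St \<sigma> t) (Eq \<sigma> t u)))"
    "W \<tturnstile> Umat (And (St \<sigma> t) (Eq \<sigma> t u)) as xs []"
  obtain x where "xs = [x]" using W(2) by (auto simp: list_all2_Cons2)
  then show "W \<tturnstile> Umat (St \<sigma> u) as xs vs"
    using W eq_transI[OF W(1), of \<sigma> x "tsubst as t" "tsubst as u"] by (simp add: forces_And)
qed (use defn_id in auto)

lemma sound_st_closed: "has_ty [] t \<sigma> \<Longrightarrow> sound \<Gamma> Top (St \<sigma> t)"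
  by (rule sound_linear[where f = "\<lambda>x. [t]" and h = "\<lambda>x. []"])
    (auto simp: tsubst_closed intro!: defn_const eq_reflI intro: has_ty_closed)

lemma sound_st_app: "sound \<Gamma> (And (St (\<sigma> \<^bold>\<rightarrow> \<tau>) f) (St \<sigma> t)) (St \<tau> (f \<^bold>\<cdot> t))" (is "sound \<Gamma> ?A ?B")
proof (rule sound_linear[where h = "\<lambda>x. []"])
  show "defn (Uex ?A) (\<lambda>x. [x ! 0 \<^bold>\<cdot> x ! 1]) (Uex ?B)"
  proof (rule defnI)
    fix i assume "i < length (Uex ?B)"
    moreover have "has_ty [\<sigma> \<^bold>\<rightarrow> \<tau>, \<sigma>] (Var 0 \<^bold>\<cdot> Var 1) \<tau>"
      by (rule has_ty.intros(3)[of _ _ \<sigma>]) (auto intro!: has_ty_VarI)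
    ultimately show "\<exists>t. has_ty (Uex ?A) t (Uex ?B ! i) \<and> (\<forall>xs. length xs = length (Uex ?A) \<longrightarrow> [xs ! 0 \<^bold>\<cdot> xs ! 1] ! i = inst xs t)"
      by (intro HOL.exI[of _ "Var 0 \<^bold>\<cdot> Var 1"]) auto
  qed simp
  fix W as xs vs assume W: "world W" "htys W xs (Uex ?A)" "W \<tturnstile> Umat ?A as xs []"
  obtain x y where "xs = [x, y]" using W(2) by (auto simp: list_all2_Cons2)
  then show "W \<tturnstile> Umat ?B as [xs ! 0 \<^bold>\<cdot> xs ! 1] vs"
    using W eq_appI[OF W(1), of \<sigma> \<tau>] by (simp add: forces_And)
qed simp

section \<open>Characteristic principles\<close>

lemma Umat_hyper: "Umat (hyper \<sigma> (Var 0)) (case_nat v as) xs [y] = Mem \<sigma> y v"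
  using Umat_internal[of "Mem \<sigma> (Var 0) (tlift 1 (Var 0))"] by (simp add: hyper_def)

lemma Uty_hyper [simp]: "Uty (hyper \<sigma> s) = ([], [\<sigma>])"
  using Umat_internal[of "Mem \<sigma> (Var 0) (tlift 1 s)"] by (simp add: hyper_def)

lemma wff_hyper0: "wff (Seq \<sigma> # \<Gamma>) (hyper \<sigma> (Var 0))"
  by (auto simp: hyper_def intro!: wff_Mem has_ty_VarI)

text \<open>A challenge to the conclusion is a sequence \<open>v\<close> of elements at which
  \<open>hyper\<close> will be tested. With \<open>v\<close> itself as the internal witness these
  tests succeed trivially, and \<phi> holds at \<open>v\<close> because \<open>v\<close> is put as a
  challenge to the premise.\<close>

lemma sound_OS:
  assumes \<phi>: "internal \<phi>" "or_free \<phi>" "wff (Seq \<sigma> # \<Gamma>) \<phi>"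
  shows "sound \<Gamma> (AllSt (Seq \<sigma>) \<phi>) (Ex (Seq \<sigma>) (And (hyper \<sigma> (Var 0)) \<phi>))" (is "sound \<Gamma> ?A (Ex _ ?I)")
proof -
  have U: "Uty \<phi> = ([], [])" "Umat \<phi> as xs ys = fsubst as \<phi>" for as xs ys using Umat_internal \<phi> by auto
  show ?thesis
  proof (rule sound_linear[where f = "\<lambda>x. x" and h = "\<lambda>x. x"])
    fix W as xs vs assume W: "world W" "subst_ty (fst W) as \<Gamma>" "htys W xs (Uex ?A)" "htys W vs (Uall (Ex (Seq \<sigma>) ?I))"
      "W \<tturnstile> Umat ?A as xs (xs @ vs)"
    obtain v where v: "vs = [v]" "hty W v (Seq \<sigma>)" "xs = []" using W(3,4) by (auto simp: U list_all2_Cons2)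
    have p: "W \<tturnstile> fsubst (case_nat v as) \<phi>" using W(5) v by (simp add: U)
    have wfI: "wff (Seq \<sigma> # \<Gamma>) ?I" using \<phi> wff_hyper0 by simp
    show "W \<tturnstile> Umat (Ex (Seq \<sigma>) ?I) as xs vs"
    proof (rule forces_ExI[OF W(1) wfI W(2) _ _ v(2)])
      show "ball W ?I (case_nat v as) xs vs" unfolding ball_def
      proof (intro HOL.allI HOL.impI)
        fix W' ys assume W': "W \<sqsubseteq> W'" "htys W' ys (Uall ?I)" "mems W' (Uall ?I) ys vs"
        obtain y where y: "ys = [y]" "W' \<tturnstile> Mem \<sigma> y v" using W'(2,3) v(1) by (auto simp: U list_all2_Cons2)
        show "W' \<tturnstile> Umat ?I (case_nat v as) xs ys"
          using y forces_mono[OF W'(1) p] by (simp add: U Umat_hyper forces_And)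
      qed
    qed (use W in \<open>auto simp: U\<close>)
  qed (use defn_id in \<open>auto simp: U\<close>)
qed

text \<open>The realizer of the premise lists the finitely many elements at which
  \<open>hyper\<close> is tested. At that very list the tests succeed, so it is the standard
  sequence sought.\<close>

lemma sound_US:
  assumes \<phi>: "internal \<phi>" "or_free \<phi>" "wff (Seq \<sigma> # \<Gamma>) \<phi>"
  shows "sound \<Gamma> (All (Seq \<sigma>) (Imp (hyper \<sigma> (Var 0)) \<phi>)) (ExSt (Seq \<sigma>) \<phi>)" (is "sound \<Gamma> (All _ ?I) ?A")
proof -
  have U: "Uty \<phi> = ([], [])" "Umat \<phi> as xs ys = fsubst as \<phi>" for as xs ys using Umat_internal \<phi> by auto
  show ?thesis
  proof (rule sound_linear[where f = "\<lambda>x. x" and h = "\<lambda>x. []"])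
    fix W as xs vs assume W: "world W" "subst_ty (fst W) as \<Gamma>" "htys W xs (Uex (All (Seq \<sigma>) ?I))" "htys W vs (Uall ?A)"
      "W \<tturnstile> Umat (All (Seq \<sigma>) ?I) as xs []"
    obtain s where s: "xs = [s]" "hty W s (Seq \<sigma>)" "vs = []" using W(3,4) by (auto simp: U list_all2_Cons2)
    have wfI: "wff (Seq \<sigma> # \<Gamma>) ?I" using \<phi> wff_hyper0 by simp
    have ty: "htys W xs (Uex ?I)" "htys W [] (Uall ?I)" using W by (auto simp: U)
    have "W \<tturnstile> Umat ?I (case_nat s as) ([] @ [s]) ([] @ [])"
      using W(5)[unfolded forces_All[OF W(1) wfI W(2) ty]] ext_refl[OF W(1)] s by (simp del: Umat.simps)
    moreover have "W \<tturnstile> Umat ?I (case_nat s as) ([] @ [s]) ([] @ []) \<longleftrightarrow>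
      (\<forall>W'. W \<sqsubseteq> W' \<longrightarrow> ball W' (hyper \<sigma> (Var 0)) (case_nat s as) [] (map (\<lambda>Y. apps Y ([] @ [])) [s]) \<longrightarrow>
        W' \<tturnstile> Umat \<phi> (case_nat s as) (map (\<lambda>U. apps U []) []) [])"
      by (rule forces_Imp[OF W(1) wff_hyper0 subst_ty_case_nat[OF s(2) W(2)]]) (use s in \<open>auto simp: U\<close>)
    moreover have "ball W (hyper \<sigma> (Var 0)) (case_nat s as) [] (map (\<lambda>Y. apps Y ([] @ [])) [s])"
      unfolding ball_def
    proof (intro HOL.allI HOL.impI)
      fix W' ys assume W': "W \<sqsubseteq> W'" "htys W' ys (Uall (hyper \<sigma> (Var 0)))"
        "mems W' (Uall (hyper \<sigma> (Var 0))) ys (map (\<lambda>Y. apps Y ([] @ [])) [s])"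
      obtain y where "ys = [y]" "W' \<tturnstile> Mem \<sigma> y s" using W'(2,3) by (auto simp: list_all2_Cons2)
      then show "W' \<tturnstile> Umat (hyper \<sigma> (Var 0)) (case_nat s as) [] ys" by (simp add: Umat_hyper)
    qed
    ultimately have "W \<tturnstile> Umat \<phi> (case_nat s as) [] []" using ext_refl[OF W(1)] by auto
    then show "W \<tturnstile> Umat ?A as xs vs" using s by simp
  qed (use defn_id in \<open>auto simp: U\<close>)
qed

text \<open>Realizers never depend on internally quantified variables, so moving the external
  quantifier outwards changes neither the types nor the matrix.\<close>

lemma sound_NU:
  "sound \<Gamma> (All \<tau> (ExSt \<sigma> \<Phi>))
    (ExSt \<sigma> (All \<tau> (fsubst (case_nat (Var 1) (case_nat (Var 0) (\<lambda>i. Var (i + 2)))) \<Phi>)))"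
  (is "sound \<Gamma> ?A ?B")
proof (rule sound_same)
  fix as :: "nat \<Rightarrow> tm" and xs ys :: "tm list" assume "length xs = length (Uex ?A)"
  then obtain x xs' where x: "xs = x # xs'" by (cases xs) auto
  have "tsubst (up (case_nat x as)) (case_nat (Var (Suc 0)) (case_nat (Var 0) (\<lambda>i. Var (Suc (Suc i)))) i) =
      case_nat (tlift (Suc 0) x) (up as) i" for i
    by (auto split: nat.split simp: up_def)
  then show "Umat ?A as xs ys = Umat ?B as xs ys" by (simp add: x Umat_fsubst_fm)
qed simp

text \<open>The clause for the external universal quantifier already makes every realizer a function
  of the quantified variable; the first of these functions is the choice function.\<close>

lemma sound_AC:
  "sound \<Gamma> (AllSt \<sigma> (ExSt \<tau> \<Phi>))
    (ExSt (\<sigma> \<^bold>\<rightarrow> \<tau>) (AllSt \<sigma>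
         (fsubst (case_nat (Var 1 \<^bold>\<cdot> Var 0) (case_nat (Var 0) (\<lambda>i. Var (i + 2)))) \<Phi>)))"
  (is "sound \<Gamma> ?A ?B")
proof (rule sound_same)
  fix as :: "nat \<Rightarrow> tm" and xs ys :: "tm list" assume "length xs = length (Uex ?A)"
  then obtain x xs' where x: "xs = x # xs'" by (cases xs) auto
  have "tsubst (case_nat z (case_nat x as)) (case_nat (Var (Suc 0) \<^bold>\<cdot> Var 0) (case_nat (Var 0) (\<lambda>i. Var (Suc (Suc i)))) i) =
      case_nat (x \<^bold>\<cdot> z) (case_nat z as) i" for i z
    by (auto split: nat.split)
  then show "Umat ?A as xs ys = Umat ?B as xs ys" by (simp add: x Umat_fsubst_fm Let_def)
qed simp

text \<open>The premise has no realizers because \<phi> is internal and \<or>-free. The witness for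
  the external quantifier therefore takes no arguments on either side, and types and matrix
  coincide.\<close>

lemma sound_IP:
  assumes \<phi>: "internal \<phi>" "or_free \<phi>"
  shows "sound \<Gamma> (Imp (AllSt \<sigma> \<phi>) (ExSt \<tau> \<Psi>)) (ExSt \<tau> (Imp (flift (AllSt \<sigma> \<phi>)) \<Psi>))"
  (is "sound \<Gamma> ?A ?B")
proof (rule sound_same)
  have U: "Uty \<phi> = ([], [])" using Umat_internal \<phi> by auto
  then show "Uty ?A = Uty ?B" by (simp del: fsubst.simps)
  fix as :: "nat \<Rightarrow> tm" and xs ys :: "tm list" assume "length xs = length (Uex ?A)"
  then obtain x xs' where x: "xs = x # xs'" by (cases xs) auto
  have "Umat (flift (AllSt \<sigma> \<phi>)) (tlift n \<circ> case_nat x as) us vs = Umat (AllSt \<sigma> \<phi>) (tlift n \<circ> as) us vs" for n us vs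
    unfolding Umat_flift by (simp add: o_def)
  then show "Umat ?A as xs ys = Umat ?B as xs ys"
    unfolding Umat.simps(6,9) Uty_flift by (simp add: x Let_def U del: Umat.simps)
qed

section \<open>External induction\<close>

lemma forces_Alls:
  assumes "world W" "wff (rev \<tau>s @ fst W) \<phi>"
  shows "W \<tturnstile> Alls \<tau>s \<phi> \<longleftrightarrow> (\<forall>W' ys. W \<sqsubseteq> W' \<longrightarrow> htys W' ys \<tau>s \<longrightarrow> W' \<tturnstile> fsubst (blk ys) \<phi>)"
  using assms
proof (induction \<tau>s arbitrary: W \<phi>)
  case Nil
  have [simp]: "blk [] = Var" by (auto simp: blk_def)
  show ?case using Nil by (auto intro: forces_mono ext_refl)
next
  case (Cons \<tau> \<tau>s)
  let ?\<phi> = "\<lambda>y. fsubst ((up ^^ length \<tau>s) (case_nat y Var)) \<phi>"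
  have wf: "wff (rev \<tau>s @ fst W') (?\<phi> y)" if "W \<sqsubseteq> W'" "hty W' y \<tau>" for W' y
  proof -
    have "subst_ty (fst W') (case_nat y Var) (\<tau> # fst W')"
      using that by (intro subst_ty_case_nat) auto
    moreover have "wff (rev \<tau>s @ \<tau> # fst W') \<phi>"
      using wff_ext2[of W W' "rev \<tau>s @ [\<tau>]"] that Cons.prems(2) by simp
    ultimately show ?thesis by (intro wff_fsubst[OF _ subst_ty_ups]) auto
  qed
  have bl: "fsubst (blk ys) (?\<phi> y) = fsubst (blk (y # ys)) \<phi>" if "htys W' ys \<tau>s" for W' y ys
    using list_all2_lengthD[OF that] by (simp add: fsubst_fsubst blk_Cons)
  have IH: "W' \<tturnstile> Alls \<tau>s (?\<phi> y) \<longleftrightarrow>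
    (\<forall>W'' ys. W' \<sqsubseteq> W'' \<longrightarrow> htys W'' ys \<tau>s \<longrightarrow> W'' \<tturnstile> fsubst (blk (y # ys)) \<phi>)"
    if "W \<sqsubseteq> W'" "hty W' y \<tau>" for W' y
    using Cons.IH[OF ext_world[OF that(1)] wf[OF that]] by (auto simp: bl)
  have fi: "finst y (Alls \<tau>s \<phi>) = Alls \<tau>s (?\<phi> y)" for y by (simp add: finst_def fsubst_Alls)
  show ?case
  proof (intro iffI HOL.allI HOL.impI)
    fix W' ys assume B: "W \<tturnstile> Alls (\<tau> # \<tau>s) \<phi>" and W': "W \<sqsubseteq> W'" and ys: "htys W' ys (\<tau> # \<tau>s)"
    obtain y ys' where y: "ys = y # ys'" "hty W' y \<tau>" "htys W' ys' \<tau>s"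
      using ys by (auto simp: list_all2_Cons2)
    have "W' \<tturnstile> Alls \<tau>s (?\<phi> y)"
      using forces_allE[OF forces_mono[OF W' B[unfolded Alls_simps]] y(2)] fi by simp
    then show "W' \<tturnstile> fsubst (blk ys) \<phi>"
      using IH[OF W' y(2)] y ext_refl[OF ext_world[OF W']] by auto
  next
    assume R: "\<forall>W' ys. W \<sqsubseteq> W' \<longrightarrow> htys W' ys (\<tau> # \<tau>s) \<longrightarrow> W' \<tturnstile> fsubst (blk ys) \<phi>"
    show "W \<tturnstile> Alls (\<tau> # \<tau>s) \<phi>" unfolding Alls_simps
    proof (rule forces_allI[OF Cons.prems(1)])
      show "wff (\<tau> # fst W) (Alls \<tau>s \<phi>)" using Cons.prems(2) by (simp add: wff_Alls)
      fix W1 y assume W1: "W \<sqsubseteq> W1" "hty W1 y \<tau>"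
      show "W1 \<tturnstile> finst y (Alls \<tau>s \<phi>)" unfolding fi IH[OF W1]
      proof (intro HOL.allI HOL.impI)
        fix W2 ys assume W2: "W1 \<sqsubseteq> W2" "htys W2 ys \<tau>s"
        show "W2 \<tturnstile> fsubst (blk (y # ys)) \<phi>"
          by (rule R[rule_format, OF ext_trans[OF W1(1) W2(1)]]) (use W2 hty_ext[OF W2(1) W1(2)] in auto)
      qed
    qed
  qed
qed

lemma ball_Top: "world W \<Longrightarrow> ball W Top as xs Ss"
  unfolding ball_def by (auto simp: vars_def dest: ext_world intro!: forces_impI)

lemma defn_closed: "defn [] f \<tau>s \<Longrightarrow> list_all2 (has_ty []) (f []) \<tau>s"
  by (rule defn_has_ty) auto

text \<open>The realizer is defined by simultaneous recursion from those of base and step.\<close>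

lemma sound_induct:
  assumes wf: "wff (N # \<Gamma>) \<Psi>" and base: "sound \<Gamma> Top (finst zero \<Psi>)"
    and step: "sound (N # \<Gamma>) (And (St N (Var 0)) \<Psi>) (fsucc \<Psi>)"
  shows "sound \<Gamma> Top (AllSt N \<Psi>)"
proof -
  let ?\<sigma>s = "Uex \<Psi>" and ?\<tau>s = "Uall \<Psi>"
  let ?p = "length ?\<tau>s" and ?k = "length ?\<sigma>s"
  obtain f0 g0 where r0: "realizes \<Gamma> Top (finst zero \<Psi>) f0 g0" using base unfolding sound_def by blast
  obtain f1 g1 where r1: "realizes (N # \<Gamma>) (And (St N (Var 0)) \<Psi>) (fsucc \<Psi>) f1 g1"
    using step unfolding sound_def by blast
  have d0: "defn [] f0 ?\<sigma>s" using realizes_defn(1)[OF r0] by simp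
  have d1: "defn (N # ?\<sigma>s) f1 ?\<sigma>s" using realizes_defn(1)[OF r1] by simp
  have "defn ([] @ N # ?\<sigma>s) f1 ?\<sigma>s" using d1 by simp
  \<comment> \<open>All arguments of the step are abstracted, which gives closed functionals of the
    types that the simultaneous recursor expects.\<close>
  from defn_lam[OF this] obtain F where F: "defn [] F (map (arrs (N # ?\<sigma>s)) ?\<sigma>s)"
    and Feq: "\<And>W us. world W \<Longrightarrow> htys W us (N # ?\<sigma>s) \<Longrightarrow> eqs W ?\<sigma>s (map (\<lambda>U. apps U us) (F [])) (f1 us)"
    by (metis append_Nil list_all2_Nil)
  define u where "u = f0 []"
  define st where "st = F []"
  have u: "list_all2 (has_ty []) u ?\<sigma>s" unfolding u_def by (rule defn_closed[OF d0])
  have st: "list_all2 (has_ty []) st (map (\<lambda>\<tau>. N \<^bold>\<rightarrow> arrs ?\<sigma>s \<tau>) ?\<sigma>s)"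
    using defn_closed[OF F] by (simp add: st_def o_def arrs_def[abs_def])
  have lu: "length u = ?k" "length st = ?k" using u st by (auto dest: list_all2_lengthD)
  \<comment> \<open>\<open>R i\<close> is the \<open>i\<close>-th component of the recursor, applied
    to the realizers of the base and to the step functionals; \<open>X\<close> collects the
    components and \<open>at t\<close> their values at \<open>t\<close>.\<close>
  define R where "R i = apps (Cst (Rec ?\<sigma>s i)) (u @ st)" for i
  define X where "X = map R [0..<?k]"
  have R: "has_ty [] (R i) (N \<^bold>\<rightarrow> ?\<sigma>s ! i)" if "i < ?k" for i
    unfolding R_def
    by (rule has_ty_apps[OF has_ty.intros(2)[OF cst_ty.intros(5)[OF that]] list_all2_appendI[OF u st]])
  have X: "list_all2 (has_ty []) X (map (Fn N) ?\<sigma>s)" by (auto simp: X_def list_all2_conv_all_nth R)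
  define at where "at t = map (\<lambda>X. X \<^bold>\<cdot> t) X" for t
  have tat: "list_all2 (has_ty \<Gamma>') (at t) ?\<sigma>s" if "has_ty \<Gamma>' t N" for \<Gamma>' t
    using has_ty.intros(3)[OF has_ty_closed[OF R] that] by (simp add: at_def X_def list_all2_conv_all_nth)
  have at_subst: "map (tsubst \<theta>) (at t) = at (tsubst \<theta> t)" for \<theta> t
    using tsubst_closed[OF R] by (simp add: at_def X_def)
  have uW: "htys W u ?\<sigma>s" "htys W st (map (\<lambda>\<tau>. N \<^bold>\<rightarrow> arrs ?\<sigma>s \<tau>) ?\<sigma>s)" for W
    by (rule list_all2_mono[OF u has_ty_closed] list_all2_mono[OF st has_ty_closed]; assumption)+
  have at0: "eqs W ?\<sigma>s u (at zero)" if "world W" for W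
    unfolding rel3_conv_nth
  proof (intro conjI HOL.allI HOL.impI)
    fix i assume i: "i < ?k"
    have "W \<tturnstile> Eq (?\<sigma>s ! i) (R i \<^bold>\<cdot> zero) (u ! i)"
      unfolding R_def
    proof (rule forces_ax)
      show "Eq (?\<sigma>s ! i) (apps (Cst (Rec ?\<sigma>s i)) (u @ st) \<^bold>\<cdot> zero) (u ! i) \<in> EHA_or_ax \<union> \<Delta>"
        using EHA_or_ax.rec_zero[OF lu i] by simp
      show "wff (fst W) (Eq (?\<sigma>s ! i) (apps (Cst (Rec ?\<sigma>s i)) (u @ st) \<^bold>\<cdot> zero) (u ! i))"
        using has_ty.intros(3)[OF has_ty_closed[OF R[OF i, unfolded R_def]] has_ty_zero] uW(1)[of W] i
        by (auto simp: list_all2_conv_all_nth)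
    qed simp
    then show "W \<tturnstile> Eq (?\<sigma>s ! i) (u ! i) (at zero ! i)"
      using eq_symI[OF that] i by (simp add: at_def X_def)
  qed (simp_all add: lu at_def X_def)
  have atS: "eqs W ?\<sigma>s (f1 (t # at t)) (at (suc t))" if w: "world W" and t: "hty W t N" for W t
    unfolding rel3_conv_nth
  proof (intro conjI HOL.allI HOL.impI)
    have ty: "htys W (t # at t) (N # ?\<sigma>s)" using t tat by simp
    show "length (f1 (t # at t)) = ?k" by (rule defn_length[OF d1]) (simp add: at_def X_def)
    fix i assume i: "i < ?k"
    have "W \<tturnstile> Eq (?\<sigma>s ! i) (R i \<^bold>\<cdot> suc t) (apps (st ! i \<^bold>\<cdot> t) (at t))"
    proof (rule forces_ax)
      have "at t = map (\<lambda>j. apps (Cst (Rec ?\<sigma>s j)) (u @ st) \<^bold>\<cdot> t) [0..<?k]" by (simp add: at_def X_def R_def)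
      then show "Eq (?\<sigma>s ! i) (R i \<^bold>\<cdot> suc t) (apps (st ! i \<^bold>\<cdot> t) (at t)) \<in> EHA_or_ax \<union> \<Delta>"
        using EHA_or_ax.rec_suc[OF lu i, of t] unfolding R_def by simp
      have "hty W (st ! i \<^bold>\<cdot> t) (arrs ?\<sigma>s (?\<sigma>s ! i))"
        by (rule has_ty.intros(3)[OF _ t]) (use uW(2)[of W] i in \<open>auto simp: list_all2_conv_all_nth\<close>)
      then show "wff (fst W) (Eq (?\<sigma>s ! i) (R i \<^bold>\<cdot> suc t) (apps (st ! i \<^bold>\<cdot> t) (at t)))"
        using has_ty.intros(3)[OF has_ty_closed[OF R[OF i]] has_ty_suc[OF t]] has_ty_apps tat[OF t] by auto
    qed simp
    moreover have "W \<tturnstile> Eq (?\<sigma>s ! i) (apps (st ! i \<^bold>\<cdot> t) (at t)) (f1 (t # at t) ! i)"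
      using Feq[OF w ty] i lu by (auto simp: rel3_conv_nth st_def)
    ultimately have "W \<tturnstile> Eq (?\<sigma>s ! i) (R i \<^bold>\<cdot> suc t) (f1 (t # at t) ! i)" by (rule eq_transI[OF w])
    then show "W \<tturnstile> Eq (?\<sigma>s ! i) (f1 (t # at t) ! i) (at (suc t) ! i)"
      using eq_symI[OF w] i by (simp add: at_def X_def)
  qed (simp_all add: at_def X_def)
  show ?thesis
  proof (rule sound_linear[where f = "\<lambda>x. X" and h = "\<lambda>x. []"])
    show "defn (Uex Top) (\<lambda>x. X) (Uex (AllSt N \<Psi>))" using defn_const[OF X] by simp
    fix W as xs vs assume W: "world W" "subst_ty (fst W) as \<Gamma>" "htys W vs (Uall (AllSt N \<Psi>))"
    obtain ys n where v: "vs = ys @ [n]" "htys W ys ?\<tau>s" "hty W n N"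
      using W(3) by (auto simp: list_all2_append2 list_all2_Cons2)
    \<comment> \<open>The induction formula says that the values at \<open>n\<close> meet all
      challenges. Under the \<open>?p\<close> quantified challenges the number has index
      \<open>?p\<close>.\<close>
    let ?B = "Umat \<Psi> (tlift ?p \<circ> up as) (at (Var ?p)) (vars ?p)"
    let ?\<phi> = "Alls ?\<tau>s ?B"
    have wfB: "wff (rev ?\<tau>s @ N # fst W) ?B"
      by (intro wff_Umat[OF wf] subst_ty_lift subst_ty_up W(2) tat has_ty_vars) (auto intro!: has_ty_VarI simp: nth_append)
    have iff: "W' \<tturnstile> finst t ?\<phi> \<longleftrightarrow>
      (\<forall>W'' ys. W' \<sqsubseteq> W'' \<longrightarrow> htys W'' ys ?\<tau>s \<longrightarrow> W'' \<tturnstile> Umat \<Psi> (case_nat t as) (at t) ys)"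
      if e: "W \<sqsubseteq> W'" and t: "hty W' t N" for W' t
    proof -
      let ?C = "Umat \<Psi> (tlift ?p \<circ> case_nat t as) (at (tlift ?p t)) (vars ?p)"
      have la: "length (at s) = ?k" for s by (simp add: at_def X_def)
      have fi: "finst t ?\<phi> = Alls ?\<tau>s ?C"
        by (simp add: finst_def fsubst_Alls fsubst_Umat la at_subst ups tsubst_ups_vars tsubst_ups_tlift tsubst_case_nat_up o_def)
      have wfC: "wff (rev ?\<tau>s @ fst W') ?C"
        by (intro wff_Umat[OF wf] subst_ty_lift subst_ty_case_nat t subst_ty_world[OF e W(2)] tat has_ty_vars has_ty_tlift) auto
      have "fsubst (blk ys) ?C = Umat \<Psi> (case_nat t as) (at t) ys" if "htys W'' ys ?\<tau>s" for W'' ys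
        using list_all2_lengthD[OF that]
        by (simp add: fsubst_Umat la at_subst tsubst_blk_tlift tsubst_blk_vars)
      then show ?thesis unfolding fi forces_Alls[OF ext_world[OF e] wfC] by auto
    qed
    have "W \<tturnstile> finst n ?\<phi>"
    proof (rule nat_induct[OF W(1)])
      show "wff (N # fst W) ?\<phi>" using wfB by (simp add: wff_Alls)
      show "W \<tturnstile> finst zero ?\<phi>" unfolding iff[OF ext_refl[OF W(1)] has_ty_zero]
      proof (intro HOL.allI HOL.impI)
        fix W' ys assume W': "W \<sqsubseteq> W'" "htys W' ys ?\<tau>s"
        note w = ext_world[OF W'(1)] and sub = subst_ty_world[OF W'(1) W(2)]
        have "W' \<tturnstile> Umat (finst zero \<Psi>) as u ys" unfolding u_def
          by (rule realizesD[OF r0 w sub _ _ ball_Top[OF w]]) (use W'(2) in auto)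
        then have "W' \<tturnstile> Umat \<Psi> (case_nat zero as) u ys" by (simp add: Umat_finst)
        then show "W' \<tturnstile> Umat \<Psi> (case_nat zero as) (at zero) ys"
          by (rule Umat_cong[OF w wf eq_subst_refl[OF subst_ty_case_nat[OF has_ty_zero sub]] at0[OF w] eqs_refl[OF W'(2)]])
      qed
      fix W1 t assume W1: "W \<sqsubseteq> W1" "hty W1 t N" and IH: "W1 \<tturnstile> finst t ?\<phi>"
      show "W1 \<tturnstile> finst (suc t) ?\<phi>" unfolding iff[OF W1(1) has_ty_suc[OF W1(2)]]
      proof (intro HOL.allI HOL.impI)
        fix W2 ys assume W2: "W1 \<sqsubseteq> W2" "htys W2 ys ?\<tau>s"
        have e: "W \<sqsubseteq> W2" by (rule ext_trans[OF W1(1) W2(1)])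
        note w = ext_world[OF W2(1)] and sub = subst_ty_world[OF e W(2)] and t = hty_ext[OF W2(1) W1(2)]
        have ty: "htys W2 (t # at t) (N # ?\<sigma>s)" using t tat by simp
        have "ball W2 (St N (Var 0)) (case_nat t as) [t] []"
          unfolding ball_def using t by (auto intro: eq_reflI hty_ext)
        \<comment> \<open>The induction hypothesis covers all challenges, in particular those that
          the step asks for.\<close>
        moreover have "ball W2 \<Psi> (case_nat t as) (at t) (g1 ((t # at t) @ ys))"
          unfolding ball_def using IH[unfolded iff[OF W1]] ext_trans[OF W2(1)] by blast
        ultimately have "ball W2 (And (St N (Var 0)) \<Psi>) (case_nat t as) ([t] @ at t) ([] @ g1 ((t # at t) @ ys))"
          by (rule ball_AndI) auto
        then have "W2 \<tturnstile> Umat (fsucc \<Psi>) (case_nat t as) (f1 (t # at t)) ys"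
          by (intro realizesD[OF r1 w subst_ty_case_nat[OF t sub]]) (use ty W2(2) in auto)
        then have "W2 \<tturnstile> Umat \<Psi> (case_nat (suc t) as) (f1 (t # at t)) ys" by (simp add: Umat_fsucc)
        then show "W2 \<tturnstile> Umat \<Psi> (case_nat (suc t) as) (at (suc t)) ys"
          by (rule Umat_cong[OF w wf eq_subst_refl[OF subst_ty_case_nat[OF has_ty_suc[OF t] sub]] atS[OF w t] eqs_refl[OF W2(2)]])
      qed
    qed (use v in auto)
    then have "W \<tturnstile> Umat \<Psi> (case_nat n as) (at n) ys"
      using iff[OF ext_refl[OF W(1)] v(3)] v(2) ext_refl[OF W(1)] by blast
    then show "W \<tturnstile> Umat (AllSt N \<Psi>) as X vs" using v(1) by (simp add: at_def)
  qed simp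
qed

lemma sound_weaken:
  assumes "sound \<Gamma> A B"
  shows "sound (\<sigma> # \<Gamma>) (flift A) (flift B)"
proof -
  obtain f g where r: "realizes \<Gamma> A B f g" using assms unfolding sound_def by blast
  note d = realizes_defn[OF r] and s = realizesD[OF r]
  show ?thesis
  proof (rule soundI)
    fix W as xs vs assume W: "world W" "subst_ty (fst W) as (\<sigma> # \<Gamma>)" "htys W xs (Uex (flift A))" "htys W vs (Uall (flift B))"
      "ball W (flift A) as xs (g (xs @ vs))"
    have "subst_ty (fst W) (\<lambda>i. as (Suc i)) \<Gamma>" using W(2) by (fastforce simp: subst_ty_def)
    then show "W \<tturnstile> Umat (flift B) as (f xs) vs"
      unfolding Umat_flift by (rule s[OF W(1)]) (use W in \<open>auto simp: ball_def Umat_flift\<close>)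
  qed (use d in auto)
qed

lemma sound_mp: "sound \<Gamma> G (Imp A B) \<Longrightarrow> sound \<Gamma> G A \<Longrightarrow> wff \<Gamma> A \<Longrightarrow> sound \<Gamma> G B"
  by (rule sound_comp[OF sound_pair[OF sound_id] sound_uncurry])

text \<open>Opening a lifted quantified formula at the fresh variable gives back the original
  body.\<close>

lemma fsubst_up_Suc: "finst (Var 0) (fsubst (up (\<lambda>i. Var (Suc i))) \<phi>) = \<phi>"
proof -
  have "case_nat (Var 0) (\<lambda>i. Var (Suc i)) = Var" by (auto simp: case_nat_eq)
  then show ?thesis by simp
qed

lemma fsucc_flift: "fsucc (flift \<phi>) = flift \<phi>"
  by (simp add: fsucc_def fsubst_flift) (simp add: flift_def)

text \<open>With \<open>P\<close> the premise of the axiom, the induction rule is applied to \<open>P \<longrightarrow> \<Phi>(n)\<close>: its base and step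
  are derivable, hence have realizers that work for all challenges, and the collection of the
  challenges to \<open>P\<close> along the recursion is left to the logical rules.\<close>

lemma sound_ext_induction:
  assumes wf: "wff (N # \<Gamma>) \<Phi>"
  shows "sound \<Gamma> (And (finst zero \<Phi>) (AllSt N (Imp \<Phi> (fsucc \<Phi>)))) (AllSt N \<Phi>)"
proof -
  let ?I = "Imp \<Phi> (fsucc \<Phi>)" and ?S = "St N (Var 0)"
  let ?P = "And (finst zero \<Phi>) (AllSt N ?I)"
  let ?P' = "flift ?P" and ?\<Gamma> = "N # \<Gamma>"
  let ?\<Psi> = "Imp ?P' \<Phi>"
  have wI: "wff ?\<Gamma> ?I" using wf wff_fsucc by simp
  have wP: "wff \<Gamma> ?P" using wf wI wff_finst[OF wf has_ty_zero] by simp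
  have wP': "wff ?\<Gamma> ?P'" by (rule wff_flift[OF wP])
  have wPsi: "wff ?\<Gamma> ?\<Psi>" using wP' wf by simp
  have ty0: "has_ty ?\<Gamma> (Var 0) N" by (rule has_ty_VarI) auto
  \<comment> \<open>Lifting for the body of a quantifier: the bound variable 0 is kept and the
    parameters move up.\<close>
  define up1 where "up1 = fsubst (up (\<lambda>i. Var (Suc i)))"
  have wup: "wff (N # ?\<Gamma>) (up1 \<phi>)" if "wff ?\<Gamma> \<phi>" for \<phi>
    unfolding up1_def by (rule wff_fsubst[OF that subst_ty_up]) (auto simp: subst_ty_def intro!: has_ty_VarI)
  have inst0: "finst (Var 0) (up1 \<phi>) = \<phi>" for \<phi> unfolding up1_def by (rule fsubst_up_Suc)
  have st0: "finst (Var 0) (Imp ?S (up1 \<phi>)) = Imp ?S \<phi>" for \<phi>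
    by (simp add: inst0) (simp add: finst_def)
  \<comment> \<open>The base of the induction on \<open>P \<longrightarrow> \<Phi>(n)\<close> is a
    projection from \<open>P\<close>.\<close>
  have base: "sound \<Gamma> Top (finst zero ?\<Psi>)"
    using sound_ImpI[OF sound_proj1 wP wff_finst[OF wf has_ty_zero]] by (simp add: finst_flift)
  have step: "sound ?\<Gamma> (And ?S ?\<Psi>) (fsucc ?\<Psi>)"
  proof -
    let ?G = "And (And ?S ?\<Psi>) ?P'"
    have S: "sound ?\<Gamma> ?G ?S" by (rule sound_comp[OF sound_proj1 sound_proj1])
    have Psi: "sound ?\<Gamma> ?G ?\<Psi>" by (rule sound_comp[OF sound_proj1 sound_proj2])
    have Phi: "sound ?\<Gamma> ?G \<Phi>" by (rule sound_mp[OF Psi sound_proj2 wP'])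
    have "?P' = And (flift (finst zero \<Phi>)) (AllSt N (up1 ?I))" by (simp add: flift_def up1_def)
    \<comment> \<open>The external step formula contained in \<open>?P'\<close> is specialised to
      the current number, whose standardness is part of \<open>?G\<close>.\<close>
    then have "sound ?\<Gamma> ?G (AllSt N (up1 ?I))" using sound_comp[OF sound_proj2 sound_proj2] by metis
    from sound_comp[OF this sound_allst1[OF wup[OF wI]]]
    have "sound ?\<Gamma> ?G (All N (Imp ?S (up1 ?I)))" .
    from sound_comp[OF this sound_allE[OF ty0]]
    have "sound ?\<Gamma> ?G (Imp ?S ?I)" using wup[OF wI] wff_St0[of N "?\<Gamma>"] unfolding st0 by simp
    from sound_mp[OF sound_mp[OF this S] Phi] have "sound ?\<Gamma> ?G (fsucc \<Phi>)" using wf wff_St0 by simp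
    then have "sound ?\<Gamma> (And ?S ?\<Psi>) (Imp ?P' (fsucc \<Phi>))" by (rule sound_curry[OF _ wP' wff_fsucc[OF wf]])
    moreover have "fsucc ?\<Psi> = Imp ?P' (fsucc \<Phi>)" using fsucc_flift[of ?P] by (simp add: fsucc_def)
    ultimately show ?thesis by simp
  qed
  have "sound \<Gamma> ?P (AllSt N ?\<Psi>)" by (rule sound_comp[OF sound_top sound_induct[OF wPsi base step]])
  from sound_comp[OF this sound_allst1[OF wPsi]] have "sound \<Gamma> ?P (All N (Imp ?S ?\<Psi>))" .
  \<comment> \<open>The result \<open>P \<longrightarrow> \<Phi>(n)\<close> is opened at a fresh
    standard \<open>n\<close> over the weakened premise, against which \<open>P\<close> is then
    discharged.\<close>
  from sound_weaken[OF this] have "sound ?\<Gamma> ?P' (All N (Imp ?S (up1 ?\<Psi>)))"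
    by (simp add: flift_def up1_def)
  from sound_comp[OF this sound_allE[OF ty0]] have *: "sound ?\<Gamma> ?P' (Imp ?S ?\<Psi>)"
    using wup[OF wPsi] wff_St0[of N "?\<Gamma>"] unfolding st0 by simp
  let ?G = "And ?P' ?S"
  have "sound ?\<Gamma> ?G \<Phi>"
    by (rule sound_mp[OF sound_mp[OF sound_comp[OF sound_proj1 *] sound_proj2 wff_St0] sound_proj1 wP'])
  then have "sound ?\<Gamma> ?P' (Imp ?S \<Phi>)" by (rule sound_curry[OF _ wff_St0 wf])
  then have "sound \<Gamma> ?P (All N (Imp ?S \<Phi>))" by (rule sound_allI) (use wf wff_St0 in simp)
  then show ?thesis by (rule sound_comp[OF _ sound_allst2[OF wf]])
qed

section \<open>Soundness of the theory and extraction of terms\<close>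

lemma sound_axiom:
  assumes "\<phi> \<in> EHA_or_ax \<union> st_ax \<union> (OS_or \<union> US_or \<union> NU \<union> AC_st \<union> IP_or \<union> \<Delta>)" "wff \<Gamma> \<phi>"
  shows "sound \<Gamma> Top \<phi>"
proof -
  have imp: "sound \<Gamma> Top (Imp A B)" if "wff \<Gamma> (Imp A B)" "wff \<Gamma> A \<Longrightarrow> wff \<Gamma> B \<Longrightarrow> sound \<Gamma> A B" for A B
    using that by (intro sound_ImpI) auto
  consider "\<phi> \<in> EHA_or_ax \<union> \<Delta>" | "\<phi> \<in> st_ax" | "\<phi> \<in> OS_or" | "\<phi> \<in> US_or" | "\<phi> \<in> NU" | "\<phi> \<in> AC_st" | "\<phi> \<in> IP_or"
    using assms(1) by blast
  then show ?thesis
  proof cases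
    case 1
    then show ?thesis using assms(2) by (rule sound_internal)
  next
    case 2
    then show ?thesis using assms(2)
    proof cases
      case (allst1 \<sigma> \<Phi>)
      show ?thesis unfolding allst1 by (rule imp[OF assms(2)[unfolded allst1]], rule sound_allst1) simp
    next
      case (allst2 \<sigma> \<Phi>)
      show ?thesis unfolding allst2 by (rule imp[OF assms(2)[unfolded allst2]], rule sound_allst2) simp
    next
      case (exst1 \<sigma> \<Phi>)
      show ?thesis unfolding exst1 by (rule imp[OF assms(2)[unfolded exst1]], rule sound_exst1) simp
    next
      case (exst2 \<sigma> \<Phi>)
      show ?thesis unfolding exst2 by (rule imp[OF assms(2)[unfolded exst2]], rule sound_exst2) simp
    next
      case (st_eq \<sigma> t u)
      show ?thesis unfolding st_eq by (rule imp[OF assms(2)[unfolded st_eq] sound_st_eq])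
    next
      case (st_closed t \<sigma>)
      show ?thesis unfolding st_closed(1) by (rule sound_st_closed[OF st_closed(2)])
    next
      case (st_app \<sigma> \<tau> f t)
      show ?thesis unfolding st_app by (rule imp[OF assms(2)[unfolded st_app] sound_st_app])
    next
      case (ext_induction \<Phi>)
      show ?thesis unfolding ext_induction
        by (rule imp[OF assms(2)[unfolded ext_induction]], rule sound_ext_induction) simp
    qed
  next
    case 3
    then obtain \<psi> \<sigma> where "internal \<psi>" "or_free \<psi>"
      and eq: "\<phi> = Imp (AllSt (Seq \<sigma>) \<psi>) (Ex (Seq \<sigma>) (And (hyper \<sigma> (Var 0)) \<psi>))"
      by (auto elim: OS_or.cases)
    then show ?thesis unfolding eq by (intro imp[OF assms(2)[unfolded eq]] sound_OS) auto
  next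
    case 4
    then obtain \<psi> \<sigma> where "internal \<psi>" "or_free \<psi>"
      and eq: "\<phi> = Imp (All (Seq \<sigma>) (Imp (hyper \<sigma> (Var 0)) \<psi>)) (ExSt (Seq \<sigma>) \<psi>)"
      by (auto elim: US_or.cases)
    then show ?thesis unfolding eq by (intro imp[OF assms(2)[unfolded eq]] sound_US) auto
  next
    case 5
    then show ?thesis
    proof cases
      case (1 \<tau> \<sigma> \<Phi>)
      show ?thesis unfolding 1 by (rule imp[OF assms(2)[unfolded 1] sound_NU])
    qed
  next
    case 6
    then show ?thesis
    proof cases
      case (1 \<sigma> \<tau> \<Phi>)
      show ?thesis unfolding 1 by (rule imp[OF assms(2)[unfolded 1] sound_AC])
    qed
  next
    case 7
    then show ?thesis
    proof cases
      case (1 \<psi> \<sigma> \<tau> \<Psi>)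
      show ?thesis unfolding 1(1) by (rule imp[OF assms(2)[unfolded 1(1)] sound_IP[OF 1(2,3)]])
    qed
  qed
qed

text \<open>The premise \<open>Top\<close> supplies no arguments, so \<open>f []\<close> consists of
  closed terms. Verifying them against variables as challenges yields the universally quantified
  statement.\<close>

theorem extract_realizers:
  assumes "EHA_st_or (OS_or \<union> US_or \<union> NU \<union> AC_st \<union> IP_or \<union> \<Delta>) \<Gamma> \<Phi>"
  shows "\<exists>ts. list_all2 (has_ty []) ts (Uex \<Phi>) \<and>
    EHA_or \<Delta> \<Gamma>
      (Alls (Uall \<Phi>)
        (Umat \<Phi> (\<lambda>i. Var (i + length (Uall \<Phi>))) ts (vars (length (Uall \<Phi>)))))"
proof -
  have "sound \<Gamma> (conj []) \<Phi>"
    by (rule prv_sound[OF assms[unfolded EHA_st_or_def] sound_axiom]) auto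
  then obtain f g where r: "realizes \<Gamma> Top \<Phi> f g" unfolding sound_def conj_simps by blast
  have f: "defn [] f (Uex \<Phi>)" using realizes_defn(1)[OF r] by simp
  \<comment> \<open>The world has no hypotheses, and its first variables are the generic challenges.
    Their types are reversed because the last challenge is bound innermost; the parameters of \<Phi>
    are shifted by \<open>?n\<close>.\<close>
  let ?n = "length (Uall \<Phi>)" and ?W = "(rev (Uall \<Phi>) @ \<Gamma>, [] :: fm list)"
  have w: "world ?W" by (simp add: world_def)
  have "?W \<tturnstile> Umat \<Phi> (\<lambda>i. Var (i + ?n)) (f []) (vars ?n)"
    by (rule realizesD[OF r w _ _ _ ball_Top[OF w]])
      (auto simp: subst_ty_def nth_append has_ty_vars intro!: has_ty_VarI)
  then have "EHA_or \<Delta> \<Gamma> (Alls (Uall \<Phi>) (Umat \<Phi> (\<lambda>i. Var (i + ?n)) (f []) (vars ?n)))"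
    unfolding EHA_or_def forces_def by (intro prv_Alls) simp
  then show ?thesis using defn_closed[OF f] by blast
qed

end

theorem mainTheorem13:
  fixes \<Delta> :: "fm set" and \<Gamma> :: "ty list" and \<Phi> :: fm
  assumes "\<forall>\<delta>\<in>\<Delta>. sentence \<delta> \<and> internal \<delta> \<and> or_free \<delta>"
    and "EHA_st_or (OS_or \<union> US_or \<union> NU \<union> AC_st \<union> IP_or \<union> \<Delta>) \<Gamma> \<Phi>"
  shows "\<exists>ts. list_all2 (has_ty []) ts (Uex \<Phi>) \<and>
    EHA_or \<Delta> \<Gamma>
      (Alls (Uall \<Phi>)
        (Umat \<Phi> (\<lambda>i. Var (i + length (Uall \<Phi>))) ts (vars (length (Uall \<Phi>)))))"
proof -
  interpret ha_theory \<Delta> by unfold_locales (use assms(1) in blast)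
  show ?thesis by (rule extract_realizers[OF assms(2)])
qed

end
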